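(* Let $n\ge1$ and $t>0$. For every Schwartz function $f\in\mathcal S(\mathbb H)$ the family $\mathcal J_t(f):=\big((\mathcal H_t f)^\lambda\big)_{\lambda\in\mathbb{R}\setminus\{0\}}$ lies in the direct integral $\mathfrak B_t$, and $\mathcal J_t$ extends to a unitary operator $\mathcal J_t:L^2(\mathbb H)\to\mathfrak B_t$ satisfying $\mathcal J_t\circ\tau(h)=\Sigma(h)\circ\mathcal J_t$ for all $h\in\mathbb H$.
   Context: $\mathbb H=\mathbb{R}^n\times\mathbb{R}^n\times\mathbb{R}$ with product $(\mathbf x,\mathbf u,\xi)(\mathbf x',\mathbf u',\xi')=(\mathbf x+\mathbf x',\mathbf u+\mathbf u',\xi+\xi'+\frac12(\mathbf u\cdot\mathbf x'-\mathbf x\cdot\mathbf u'))$ and Haar measure $d\mathbf x\,d\mathbf u\,d\xi$; $\mathbb H_{\mathbb C}=\mathbb{C}^n\times\mathbb{C}^n\times\mathbb{C}$ with the same formula ($\mathbf a\cdot\mathbf b=\sum a_jb_j$ complex bilinear). Heat kernel: $k_t(\mathbf x,\mathbf u,\xi)=(2\pi)^{-1}(4\pi)^{-n}\int_{\mathbb{R}}e^{-i\lambda\xi}e^{-t\lambda^2}\big(\frac{\lambda}{\sinh t\lambda}\big)^n e^{-\frac{\lambda}{4}\coth(t\lambda)(\mathbf x\cdot\mathbf x+\mathbf u\cdot\mathbf u)}d\lambda$, with holomorphic extension $k_t^\sim$ to $\mathbb H_{\mathbb C}$ given by the same formula in $(\mathbf z,\mathbf w,\zeta)$. Heat kernel transform: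 $\mathcal H_t f(g)=\int_{\mathbb H}f(h)k_t^\sim(h^{-1}g)\,dh$ ($g\in\mathbb H_{\mathbb C}$), holomorphic on $\mathbb H_{\mathbb C}$. For $f\in\mathcal S(\mathbb H)$ and $\lambda\neq0$ put $(\mathcal H_tf)^\lambda(\mathbf z,\mathbf w)=\int_{\mathbb{R}}e^{i\lambda\xi}\mathcal H_tf(\mathbf z,\mathbf w,\xi)\,d\xi$ ($\xi$ real). For $\lambda\ne0$: $p_t^\lambda(\mathbf z,\mathbf w)=(4\pi)^{-n}(\frac{\lambda}{\sinh t\lambda})^n e^{-\frac{\lambda}{4}\coth(t\lambda)(\mathbf z\cdot\mathbf z+\mathbf w\cdot\mathbf w)}$; $W_t^\lambda(\mathbf x+i\mathbf y,\mathbf u+i\mathbf v)=4^ne^{\lambda(\mathbf u\cdot\mathbf y-\mathbf v\cdot\mathbf x)}p_{2t}^\lambda(2\mathbf y,2\mathbf v)$; $\mathcal B_t^\lambda(\mathbb{C}^{2n})$ is the Hilbert space of entire $F$ on $\mathbb{C}^{2n}$ with $\|F\|_\lambda^2=\int|F|^2W_t^\lambda<\infty$. The direct integral $\mathfrak B_t$ consists of (classes modulo null sets of) families $s=(s_\lambda)_{\lambda\ne0}$ with $s_\lambda\in\mathcal B_t^\lambda(\mathbb{C}^{2n})$, $\lambda\mapsto s_\lambda(\mathbf z,\mathbf w)$ measurable for each $(\mathbf z,\mathbf w)$, and $\|s\|^2=\frac{1}{2\pi}\int_{\mathbb{R}\setminus\{0\}}\|s_\lambda\|_\lambda^2e^{2t\lambda^2}d\lambda<\infty$.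 Actions: $(\tau(h)f)(x)=f(h^{-1}x)$ on $L^2(\mathbb H)$, and for $h=(\mathbf a,\mathbf b,c)\in\mathbb H$, $(\Sigma(h)s)_\lambda(\mathbf z,\mathbf w)=e^{i\lambda c}e^{-\frac{i\lambda}{2}(\mathbf a\cdot\mathbf w-\mathbf b\cdot\mathbf z)}s_\lambda(\mathbf z-\mathbf a,\mathbf w-\mathbf b)$. *)

theory Defs
  imports "HOL-Analysis.Analysis"
begin

type_synonym 'n heis = "(real^'n) \<times> (real^'n) \<times> real"
type_synonym 'n cpair = "(complex^'n) \<times> (complex^'n)"
type_synonym 'n heisC = "(complex^'n) \<times> (complex^'n) \<times> complex"

definition cdot :: "complex^'n::finite \<Rightarrow> complex^'n \<Rightarrow> complex" where
  "cdot a b = (\<Sum>i\<in>UNIV. a$i * b$i)"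

definition vof_real :: "real^'n::finite \<Rightarrow> complex^'n" where
  "vof_real x = (\<chi> i. complex_of_real (x$i))"

definition vRe :: "complex^'n::finite \<Rightarrow> real^'n" where
  "vRe z = (\<chi> i. Re (z$i))"

definition vIm :: "complex^'n::finite \<Rightarrow> real^'n" where
  "vIm z = (\<chi> i. Im (z$i))"

definition hmul :: "'n::finite heis \<Rightarrow> 'n heis \<Rightarrow> 'n heis" where
  "hmul g g' = (case g of (x, u, \<xi>) \<Rightarrow> case g' of (x', u', \<xi>') \<Rightarrow>
     (x + x', u + u', \<xi> + \<xi>' + (1/2) * (u \<bullet> x' - x \<bullet> u')))"

definition hinv :: "'n::finite heis \<Rightarrow> 'n heis" where
  "hinv g = (case g of (x, u, \<xi>) \<Rightarrow> (- x, - u, - \<xi>))"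

definition hmulC :: "'n::finite heisC \<Rightarrow> 'n heisC \<Rightarrow> 'n heisC" where
  "hmulC g g' = (case g of (z, w, \<zeta>) \<Rightarrow> case g' of (z', w', \<zeta>') \<Rightarrow>
     (z + z', w + w', \<zeta> + \<zeta>' + (1/2) * (cdot w z' - cdot z w')))"

definition hembed :: "'n::finite heis \<Rightarrow> 'n heisC" where
  "hembed g = (case g of (x, u, \<xi>) \<Rightarrow> (vof_real x, vof_real u, complex_of_real \<xi>))"

definition coth :: "real \<Rightarrow> real" where
  "coth x = cosh x / sinh x"

text \<open>holomorphic extension of the heat kernel to the complexification
  (restricted to real points it is the heat kernel itself)\<close>
definition heat_kernelC :: "real \<Rightarrow> 'n::finite heisC \<Rightarrow> complex" where
  "heat_kernelC t g = (case g of (z, w, \<zeta>) \<Rightarrow>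
     complex_of_real (inverse (2*pi) * inverse ((4*pi) ^ CARD('n))) *
     (LINT l|lborel. exp (- \<i> * complex_of_real l * \<zeta>) * complex_of_real (exp (- t * l^2))
        * complex_of_real ((l / sinh (t * l)) ^ CARD('n))
        * exp (- complex_of_real (l / 4 * coth (t * l)) * (cdot z z + cdot w w))))"

definition heat_transform :: "real \<Rightarrow> ('n::finite heis \<Rightarrow> complex) \<Rightarrow> 'n heisC \<Rightarrow> complex" where
  "heat_transform t f g = (LINT h|lborel. f h * heat_kernelC t (hmulC (hembed (hinv h)) g))"

definition Jt :: "real \<Rightarrow> ('n::finite heis \<Rightarrow> complex) \<Rightarrow> real \<Rightarrow> 'n cpair \<Rightarrow> complex" where
  "Jt t f l p = (case p of (z, w) \<Rightarrow>
     (LINT \<xi>|lborel. exp (\<i> * complex_of_real (l * \<xi>)) * heat_transform t f (z, w, complex_of_real \<xi>)))"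

fun iter_pd :: "'a::real_normed_vector list \<Rightarrow> ('a \<Rightarrow> 'b::real_normed_vector) \<Rightarrow> 'a \<Rightarrow> 'b" where
  "iter_pd [] f = f"
| "iter_pd (v # vs) f = (\<lambda>x. frechet_derivative (iter_pd vs f) (at x) v)"

definition schwartz :: "('a::euclidean_space \<Rightarrow> complex) \<Rightarrow> bool" where
  "schwartz f \<longleftrightarrow>
     (\<forall>vs. set vs \<subseteq> Basis \<longrightarrow> iter_pd vs f differentiable_on UNIV) \<and>
     (\<forall>(k::nat) vs. set vs \<subseteq> Basis \<longrightarrow>
        bounded (range (\<lambda>x. (1 + norm x) ^ k * norm (iter_pd vs f x))))"

definition L2 :: "('a::euclidean_space \<Rightarrow> complex) \<Rightarrow> bool" where
  "L2 f \<longleftrightarrow> f \<in> borel_measurable lborel \<and> (\<integral>\<^sup>+ x. ennreal ((cmod (f x))^2) \<partial>lborel) < \<infinity>"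

definition L2norm2 :: "('a::euclidean_space \<Rightarrow> complex) \<Rightarrow> ennreal" where
  "L2norm2 f = (\<integral>\<^sup>+ x. ennreal ((cmod (f x))^2) \<partial>lborel)"

definition entireC :: "('n::finite cpair \<Rightarrow> complex) \<Rightarrow> bool" where
  "entireC F \<longleftrightarrow> (\<forall>p. \<exists>L. (F has_derivative L) (at p) \<and>
      (\<forall>c z w. L (c *s z, c *s w) = c * L (z, w)))"

definition pker :: "real \<Rightarrow> real \<Rightarrow> real^'n::finite \<Rightarrow> real^'n \<Rightarrow> real" where
  "pker t l y v = inverse ((4*pi) ^ CARD('n)) * (l / sinh (t * l)) ^ CARD('n)
      * exp (- (l / 4) * coth (t * l) * (y \<bullet> y + v \<bullet> v))"

definition Wt :: "real \<Rightarrow> real \<Rightarrow> 'n::finite cpair \<Rightarrow> real" where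
  "Wt t l p = (case p of (z, w) \<Rightarrow>
     4 ^ CARD('n) * exp (l * (vRe w \<bullet> vIm z - vIm w \<bullet> vRe z))
       * pker (2*t) l (2 *\<^sub>R vIm z) (2 *\<^sub>R vIm w))"

definition bnorm2 :: "real \<Rightarrow> real \<Rightarrow> ('n::finite cpair \<Rightarrow> complex) \<Rightarrow> ennreal" where
  "bnorm2 t l F = (\<integral>\<^sup>+ p. ennreal ((cmod (F p))^2 * Wt t l p) \<partial>lborel)"

definition Bnorm2 :: "real \<Rightarrow> (real \<Rightarrow> 'n::finite cpair \<Rightarrow> complex) \<Rightarrow> ennreal" where
  "Bnorm2 t s = (\<integral>\<^sup>+ l. indicator (- {0}) l * ennreal (1 / (2*pi)) * bnorm2 t l (s l)
      * ennreal (exp (2 * t * l^2)) \<partial>lborel)"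

text \<open>membership of a representative family in the direct integral \<open>\<frak>B_t\<close>\<close>
definition Bt :: "real \<Rightarrow> (real \<Rightarrow> 'n::finite cpair \<Rightarrow> complex) \<Rightarrow> bool" where
  "Bt t s \<longleftrightarrow> (\<forall>l. l \<noteq> 0 \<longrightarrow> entireC (s l) \<and> bnorm2 t l (s l) < \<infinity>) \<and>
     (\<forall>p. (\<lambda>l. s l p) \<in> borel_measurable lborel) \<and> Bnorm2 t s < \<infinity>"

text \<open>equality in \<open>\<frak>B_t\<close> (i.e. of classes)\<close>
definition B_equiv :: "real \<Rightarrow> (real \<Rightarrow> 'n::finite cpair \<Rightarrow> complex)
    \<Rightarrow> (real \<Rightarrow> 'n cpair \<Rightarrow> complex) \<Rightarrow> bool" where
  "B_equiv t s s' \<longleftrightarrow> Bnorm2 t (\<lambda>l p. s l p - s' l p) = 0"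

definition tau :: "'n::finite heis \<Rightarrow> ('n heis \<Rightarrow> complex) \<Rightarrow> 'n heis \<Rightarrow> complex" where
  "tau h f x = f (hmul (hinv h) x)"

definition Sigma_act :: "'n::finite heis \<Rightarrow> (real \<Rightarrow> 'n cpair \<Rightarrow> complex)
    \<Rightarrow> real \<Rightarrow> 'n cpair \<Rightarrow> complex" where
  "Sigma_act h s l p = (case h of (a, b, c) \<Rightarrow> case p of (z, w) \<Rightarrow>
     exp (\<i> * complex_of_real (l * c))
     * exp (- (\<i> * complex_of_real (l / 2)) * (cdot (vof_real a) w - cdot (vof_real b) z))
     * s l (z - vof_real a, w - vof_real b))"

end

theory Submission
  imports Defs "HOL-Probability.Probability" "HOL-Complex_Analysis.Complex_Analysis"
begin

text \<open>
  The partial Fourier transform in the central variable is, by Plancherel, \<open>\<surd>(2\<pi>)\<close> times an isometry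
  of \<open>L\<^sup>2(\<real>\<^sup>2\<^sup>n \<times> \<real>)\<close>. It turns the heat kernel transform, at frequency \<open>\<lambda>\<close>, into \<open>e\<^bsup>-t\<lambda>\<^sup>2\<^esup>\<close> times the
  integral operator \<open>T\<^sub>\<lambda>\<close> with kernel the holomorphically extended \<open>p\<^sub>t\<^sup>\<lambda>\<close> twisted by a symplectic phase.
  With the symplectic map \<open>J\<close> and suitable constants, \<open>P = \<alpha>x + \<gamma>Jy\<close> and \<open>R = \<gamma>Jx - \<alpha>y\<close> are linear coordinates
  on the points \<open>x + iy\<close> of \<open>\<complex>\<^sup>2\<^sup>n\<close>; for fixed \<open>P\<close>, the function \<open>R \<mapsto> T\<^sub>\<lambda>g\<close> is, up to an explicit factor, the
  Fourier transform of \<open>g\<close> times a Gaussian. Plancherel in \<open>R\<close> and a Gaussian integration in \<open>P\<close> show that \<open>T\<^sub>\<lambda>\<close>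
  is an isometry from \<open>L\<^sup>2(\<real>\<^sup>2\<^sup>n)\<close> into \<open>\<B>\<^sub>t\<^sup>\<lambda>\<close>. Its reproducing kernel has the mean value property for
  entire functions, so \<open>T\<^sub>\<lambda>T\<^sub>\<lambda>\<^sup>*F = F\<close> for every \<open>F\<close> in \<open>\<B>\<^sub>t\<^sup>\<lambda>\<close>, which gives surjectivity. Truncating \<open>F\<close> to balls
  before applying \<open>T\<^sub>\<lambda>\<^sup>*\<close> keeps the preimages jointly measurable in \<open>\<lambda>\<close>, so that the fibres can be glued.
\<close>

section \<open>Square-integrable functions\<close>

text \<open>The parameters are \<alpha>^2 = (\<lambda>/2) coth(t \<lambda>), twice the Gaussian rate
  of the kernel, and \<gamma> = \<lambda>/(2 \<alpha>), forced by 2 \<alpha> \<gamma> = \<lambda>,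
  the strength of the symplectic phase. The double-argument formulas give \<alpha>^2 + \<gamma>^2 =
  \<lambda> coth(2 t \<lambda>) and \<alpha>^2 - \<gamma>^2 = \<lambda> / sinh(2 t \<lambda>). The
  sum turns the prescribed weight into the one that leaves only exp(-|P|^2) in the coordinates (P,
  R); the difference governs their Jacobian, and with it the normalisation. On Schwartz functions
  the operator is an iterated integral over a kernel that is itself a Fourier integral in the
  frequency. Exchanging the integrals needs the kernel to be absolutely integrable along the central
  direction, with controlled growth in the real point s. A Sobolev-type bound supplies this with
  growth (1 + |s|)^2, which rapid decay absorbs. All functions are representatives, so identities
  between families hold modulo null sets of frequencies.\<close>

lemma borel_measurable_cnj [measurable (raw)]:
  "f \<in> borel_measurable M \<Longrightarrow> (\<lambda>x. cnj (f x)) \<in> borel_measurable M"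
  by (rule borel_measurable_continuous_on[of cnj f M]) (auto intro: continuous_intros)

text \<open>A predicate on representatives rather than a quotient: fibres over single frequencies
  have to be formed, and an almost-everywhere class does not determine them.\<close>

definition sqint :: "'a measure \<Rightarrow> ('a \<Rightarrow> complex) \<Rightarrow> bool" where
  "sqint M f \<longleftrightarrow> f \<in> borel_measurable M \<and> integrable M (\<lambda>x. (cmod (f x))\<^sup>2)"

definition l2n :: "'a measure \<Rightarrow> ('a \<Rightarrow> complex) \<Rightarrow> real" where
  "l2n M f = sqrt (LINT x|M. (cmod (f x))\<^sup>2)"

lemma sqint_integrable: "sqint M f \<Longrightarrow> integrable M (\<lambda>x. (cmod (f x))\<^sup>2)"
  by (simp add: sqint_def)

lemma sqint_iff_nn: "sqint M f \<longleftrightarrow> f \<in> borel_measurable M \<and> (\<integral>\<^sup>+x. ennreal ((cmod (f x))\<^sup>2) \<partial>M) < \<infinity>"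
  unfolding sqint_def by (auto simp: integrable_iff_bounded)

lemma l2n_nonneg: "0 \<le> l2n M f"
  by (simp add: l2n_def)

lemma l2n_square: "(l2n M f)\<^sup>2 = (LINT x|M. (cmod (f x))\<^sup>2)"
  by (simp add: l2n_def)

lemma sqint_nn_eq: "sqint M f \<Longrightarrow> (\<integral>\<^sup>+x. ennreal ((cmod (f x))\<^sup>2) \<partial>M) = ennreal ((l2n M f)\<^sup>2)"
  unfolding l2n_square by (rule nn_integral_eq_integral) (auto simp: sqint_def)

lemma sqint_mult:
  assumes "sqint M f" "sqint M g"
  shows "integrable M (\<lambda>x. f x * g x)"
proof (rule Bochner_Integration.integrable_bound)
  show "integrable M (\<lambda>x. (cmod (f x))\<^sup>2 + (cmod (g x))\<^sup>2)"
    using assms by (auto simp: sqint_def)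
  show "(\<lambda>x. f x * g x) \<in> borel_measurable M"
    using assms by (auto simp: sqint_def)
  show "AE x in M. norm (f x * g x) \<le> norm ((cmod (f x))\<^sup>2 + (cmod (g x))\<^sup>2)"
  proof (rule AE_I2)
    fix x
    have "2 * (cmod (f x) * cmod (g x)) \<le> (cmod (f x))\<^sup>2 + (cmod (g x))\<^sup>2"
      using sum_squares_bound[of "cmod (f x)" "cmod (g x)"] by (simp add: mult.assoc)
    moreover have "0 \<le> cmod (f x) * cmod (g x)" by simp
    ultimately have "cmod (f x) * cmod (g x) \<le> (cmod (f x))\<^sup>2 + (cmod (g x))\<^sup>2" by linarith
    then show "norm (f x * g x) \<le> norm ((cmod (f x))\<^sup>2 + (cmod (g x))\<^sup>2)"
      by (simp add: norm_mult)
  qed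
qed

lemma sqint_cnj: "sqint M f \<Longrightarrow> sqint M (\<lambda>x. cnj (f x))"
  by (auto simp: sqint_def)

lemma l2n_cnj: "l2n M (\<lambda>x. cnj (f x)) = l2n M f"
  by (simp add: l2n_def)

lemma sqint_cmult: "sqint M f \<Longrightarrow> sqint M (\<lambda>x. c * f x)"
  by (auto simp: sqint_def norm_mult power_mult_distrib)

lemma l2n_cmult: "l2n M (\<lambda>x. c * f x) = cmod c * l2n M f"
  by (simp add: l2n_def norm_mult power_mult_distrib real_sqrt_mult)

lemma sqint_bound:
  assumes "sqint M g" "f \<in> borel_measurable M" "\<And>x. x \<in> space M \<Longrightarrow> cmod (f x) \<le> cmod (g x)"
  shows "sqint M f"
  unfolding sqint_def
proof
  show "integrable M (\<lambda>x. (cmod (f x))\<^sup>2)"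
    by (rule Bochner_Integration.integrable_bound[OF sqint_integrable[OF assms(1)]])
       (use assms(2,3) in \<open>auto intro!: power_mono AE_I2\<close>)
qed fact

lemma sqint_add:
  assumes "sqint M f" "sqint M g"
  shows "sqint M (\<lambda>x. f x + g x)"
  unfolding sqint_def
proof
  show "(\<lambda>x. f x + g x) \<in> borel_measurable M" using assms by (auto simp: sqint_def)
  then show "integrable M (\<lambda>x. (cmod (f x + g x))\<^sup>2)"
  proof (rule_tac Bochner_Integration.integrable_bound)
    show "integrable M (\<lambda>x. 2 * (cmod (f x))\<^sup>2 + 2 * (cmod (g x))\<^sup>2)"
      using assms by (auto simp: sqint_def)
    show "AE x in M. norm ((cmod (f x + g x))\<^sup>2) \<le> norm (2 * (cmod (f x))\<^sup>2 + 2 * (cmod (g x))\<^sup>2)"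
    proof (rule AE_I2)
      fix x
      have "(cmod (f x + g x))\<^sup>2 \<le> (cmod (f x) + cmod (g x))\<^sup>2"
        by (intro power_mono norm_triangle_ineq) auto
      also have "\<dots> \<le> 2 * (cmod (f x))\<^sup>2 + 2 * (cmod (g x))\<^sup>2"
        using sum_squares_bound[of "cmod (f x)" "cmod (g x)"] by (simp add: power2_sum)
      finally show "norm ((cmod (f x + g x))\<^sup>2) \<le> norm (2 * (cmod (f x))\<^sup>2 + 2 * (cmod (g x))\<^sup>2)"
        by simp
    qed
  qed auto
qed

lemma sqint_diff:
  assumes "sqint M f" "sqint M g"
  shows "sqint M (\<lambda>x. f x - g x)"
  using sqint_add[OF assms(1) sqint_cmult[OF assms(2), of "-1"]] by simp

lemma l2_Cauchy_Schwarz_abs: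
  assumes "sqint M f" "sqint M g"
  shows "(LINT x|M. cmod (f x) * cmod (g x)) \<le> l2n M f * l2n M g"
proof -
  have m[measurable]: "f \<in> borel_measurable M" "g \<in> borel_measurable M"
    using assms by (auto simp: sqint_def)
  have i: "integrable M (\<lambda>x. cmod (f x) * cmod (g x))"
    using integrable_norm[OF sqint_mult[OF assms]] by (simp add: norm_mult)
  have "(\<integral>\<^sup>+x. ennreal (cmod (f x)) * ennreal (cmod (g x)) \<partial>M)\<^sup>2 \<le>
     (\<integral>\<^sup>+x. (ennreal (cmod (f x)))\<^sup>2 \<partial>M) * (\<integral>\<^sup>+x. (ennreal (cmod (g x)))\<^sup>2 \<partial>M)"
    by (rule Cauchy_Schwarz_nn_integral) auto
  also have "\<dots> = ennreal ((l2n M f)\<^sup>2) * ennreal ((l2n M g)\<^sup>2)"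
    by (simp add: ennreal_power sqint_nn_eq assms)
  also have "(\<integral>\<^sup>+x. ennreal (cmod (f x)) * ennreal (cmod (g x)) \<partial>M) = ennreal (LINT x|M. cmod (f x) * cmod (g x))"
    by (subst nn_integral_eq_integral[OF i, symmetric]) (auto simp: ennreal_mult)
  finally have "ennreal ((LINT x|M. cmod (f x) * cmod (g x))\<^sup>2) \<le> ennreal ((l2n M f * l2n M g)\<^sup>2)"
    by (simp add: ennreal_power ennreal_mult[symmetric] power_mult_distrib)
  then have "(LINT x|M. cmod (f x) * cmod (g x))\<^sup>2 \<le> (l2n M f * l2n M g)\<^sup>2"
    by (simp add: ennreal_le_iff)
  then show ?thesis
    by (rule power2_le_imp_le) (simp add: l2n_nonneg)
qed

lemma l2_Cauchy_Schwarz: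
  assumes "sqint M f" "sqint M g"
  shows "cmod (LINT x|M. f x * g x) \<le> l2n M f * l2n M g"
proof -
  have "cmod (LINT x|M. f x * g x) \<le> (LINT x|M. cmod (f x * g x))"
    by (rule integral_norm_bound)
  also have "\<dots> = (LINT x|M. cmod (f x) * cmod (g x))" by (simp add: norm_mult)
  also have "\<dots> \<le> l2n M f * l2n M g" by (rule l2_Cauchy_Schwarz_abs[OF assms])
  finally show ?thesis .
qed

lemma l2n_square_add:
  assumes "sqint M f" "sqint M g"
  shows "(l2n M (\<lambda>x. f x + g x))\<^sup>2 = (l2n M f)\<^sup>2 + (l2n M g)\<^sup>2 + 2 * Re (LINT x|M. f x * cnj (g x))"
proof -
  have i: "integrable M (\<lambda>x. f x * cnj (g x))"
    by (intro sqint_mult sqint_cnj assms)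
  have "(cmod (f x + g x))\<^sup>2 = (cmod (f x))\<^sup>2 + (cmod (g x))\<^sup>2 + 2 * Re (f x * cnj (g x))" for x
    unfolding cmod_power2 by (simp add: power2_eq_square algebra_simps)
  then have "(LINT x|M. (cmod (f x + g x))\<^sup>2) =
      (LINT x|M. (cmod (f x))\<^sup>2 + (cmod (g x))\<^sup>2 + 2 * Re (f x * cnj (g x)))"
    by presburger
  also have "\<dots> = (LINT x|M. (cmod (f x))\<^sup>2) + (LINT x|M. (cmod (g x))\<^sup>2) + 2 * (LINT x|M. Re (f x * cnj (g x)))"
    using integrable_Re[OF i] sqint_integrable[OF assms(1)] sqint_integrable[OF assms(2)]
    by (simp del: complex_cnj_mult times_complex.sel)
  also have "(LINT x|M. Re (f x * cnj (g x))) = Re (LINT x|M. f x * cnj (g x))"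
    by (rule integral_Re[OF i])
  finally show ?thesis unfolding l2n_square .
qed

lemma l2n_triangle:
  assumes "sqint M f" "sqint M g"
  shows "l2n M (\<lambda>x. f x + g x) \<le> l2n M f + l2n M g"
proof (rule power2_le_imp_le)
  have "Re (LINT x|M. f x * cnj (g x)) \<le> l2n M f * l2n M g"
    using l2_Cauchy_Schwarz[OF assms(1) sqint_cnj[OF assms(2)]] complex_Re_le_cmod[of "LINT x|M. f x * cnj (g x)"]
    by (simp add: l2n_cnj)
  then show "(l2n M (\<lambda>x. f x + g x))\<^sup>2 \<le> (l2n M f + l2n M g)\<^sup>2"
    unfolding l2n_square_add[OF assms] by (simp add: power2_sum)
qed (simp add: l2n_nonneg)

lemma l2n_minus: "l2n M (\<lambda>x. g x - f x) = l2n M (\<lambda>x. f x - g x)"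
  by (simp add: l2n_def norm_minus_commute)

lemma l2n_triangle_diff:
  assumes "sqint M f" "sqint M g" "sqint M h"
  shows "l2n M (\<lambda>x. f x - h x) \<le> l2n M (\<lambda>x. f x - g x) + l2n M (\<lambda>x. g x - h x)"
  using l2n_triangle[OF sqint_diff[OF assms(1,2)] sqint_diff[OF assms(2,3)]] by simp

lemma l2n_diff_le:
  assumes "sqint M f" "sqint M g"
  shows "\<bar>l2n M f - l2n M g\<bar> \<le> l2n M (\<lambda>x. f x - g x)"
  using l2n_triangle[OF sqint_diff[OF assms] assms(2)] l2n_triangle[OF sqint_diff[OF assms(2,1)] assms(1)]
    l2n_minus[of M f g] by simp

lemma l2n_eq_0_iff:
  assumes "sqint M f"
  shows "l2n M f = 0 \<longleftrightarrow> (AE x in M. f x = 0)"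
  using integral_nonneg_eq_0_iff_AE[OF sqint_integrable[OF assms]] by (simp add: l2n_def)

lemma l2n_cong_AE:
  assumes "f \<in> borel_measurable M" "g \<in> borel_measurable M" "AE x in M. f x = g x"
  shows "l2n M f = l2n M g"
  unfolding l2n_def by (intro arg_cong[where f=sqrt] integral_cong_AE) (use assms in auto)

lemma l2n_tendsto:
  assumes "\<And>n. sqint M (F n)" "sqint M f" "(\<lambda>n. l2n M (\<lambda>x. F n x - f x)) \<longlonglongrightarrow> 0"
  shows "(\<lambda>n. l2n M (F n)) \<longlonglongrightarrow> l2n M f"
proof -
  have "(\<lambda>n. l2n M (F n) - l2n M f) \<longlonglongrightarrow> 0"
    by (rule Lim_null_comparison[OF _ assms(3)]) (auto intro!: always_eventually l2n_diff_le assms)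
  then show ?thesis by (simp add: LIM_zero_iff)
qed

text \<open>Along a subsequence with \<open>\<parallel>d\<^sub>j\<parallel>\<^sup>2 \<le> 4\<^sup>-\<^sup>j\<close> the weighted sum of the \<open>2\<^sup>j |d\<^sub>j|\<^sup>2\<close> is integrable,
  so \<open>|d\<^sub>j|\<close> is almost everywhere summable.\<close>
lemma l2_complete:
  assumes F: "\<And>n. sqint M (F n)"
    and C: "\<And>e. e > 0 \<Longrightarrow> \<exists>N. \<forall>m\<ge>N. \<forall>n\<ge>N. l2n M (\<lambda>x. F m x - F n x) < e"
  obtains f where "sqint M f" "(\<lambda>n. l2n M (\<lambda>x. F n x - f x)) \<longlonglongrightarrow> 0"
proof -
  have [measurable]: "F n \<in> borel_measurable M" for n using F by (simp add: sqint_def)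
  have "\<exists>N. \<forall>j. \<forall>m\<ge>N j. \<forall>n\<ge>N j. l2n M (\<lambda>x. F m x - F n x) < (1/2)^j"
    by (intro choice allI C) auto
  then obtain N where N: "\<And>j m n. m \<ge> N j \<Longrightarrow> n \<ge> N j \<Longrightarrow> l2n M (\<lambda>x. F m x - F n x) < (1/2)^j" by blast
  \<comment> \<open>Partial sums of \<open>N\<close> keep \<open>r j \<ge> N j\<close> and make
    \<open>r\<close> monotone.\<close>
  define r where "r j = (\<Sum>i\<le>j. N i)" for j
  have rN: "r j \<ge> N j" for j unfolding r_def by (rule member_le_sum) auto
  have rm: "r j \<le> r (Suc j)" for j unfolding r_def by simp
  define d where "d j x = F (r (Suc j)) x - F (r j) x" for j x
  have sd: "sqint M (d j)" for j unfolding d_def by (intro sqint_diff F)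
  have dj: "l2n M (d j) \<le> (1/2)^j" for j
    unfolding d_def using N[of j "r (Suc j)" "r j"] rN[of j] rm[of j] by simp
  have md[measurable]: "d j \<in> borel_measurable M" for j unfolding d_def by measurable
  have "(\<integral>\<^sup>+x. (\<Sum>j. ennreal (2^j * (cmod (d j x))\<^sup>2)) \<partial>M) = (\<Sum>j. \<integral>\<^sup>+x. ennreal (2^j * (cmod (d j x))\<^sup>2) \<partial>M)"
    by (rule nn_integral_suminf) auto
  also have "\<dots> \<le> (\<Sum>j. ennreal ((1/2)^j))"
  proof (intro suminf_le allI summableI)
    fix j
    have "(\<integral>\<^sup>+x. ennreal (2^j * (cmod (d j x))\<^sup>2) \<partial>M) = ennreal (2^j * (l2n M (d j))\<^sup>2)"
      by (simp add: ennreal_mult nn_integral_cmult sqint_nn_eq sd)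
    also have "2^j * (l2n M (d j))\<^sup>2 \<le> 2^j * ((1/2)^j)\<^sup>2"
      by (intro mult_left_mono power_mono dj l2n_nonneg) auto
    also have "\<dots> = (1/2)^j" by (simp add: power2_eq_square power_divide)
    finally show "(\<integral>\<^sup>+x. ennreal (2^j * (cmod (d j x))\<^sup>2) \<partial>M) \<le> ennreal ((1/2)^j)"
      by (simp add: ennreal_leI)
  qed
  also have "\<dots> = ennreal (\<Sum>j. (1/2)^j)"
    by (rule suminf_ennreal2) (auto intro: summable_geometric)
  also have "\<dots> < \<infinity>" by simp
  finally have "AE x in M. (\<Sum>j. ennreal (2^j * (cmod (d j x))\<^sup>2)) < \<infinity>"
    by (intro finite_nn_integral_imp_ae_finite) auto
  then have conv: "AE x in M. convergent (\<lambda>j. F (r j) x)"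
  proof eventually_elim
    case (elim x)
    then have sm: "summable (\<lambda>j. 2^j * (cmod (d j x))\<^sup>2)"
      by (intro summable_suminf_not_top) (auto simp: less_top)
    then have "(\<lambda>j. 2^j * (cmod (d j x))\<^sup>2) \<longlonglongrightarrow> 0" by (rule summable_LIMSEQ_zero)
    then obtain C where C: "\<And>j. 2^j * (cmod (d j x))\<^sup>2 \<le> C"
      using convergent_imp_bounded by (force simp: bounded_iff)
    have "summable (\<lambda>j. d j x)"
    proof (rule summable_comparison_test')
      show "summable (\<lambda>j. sqrt C * (sqrt (1/2))^j)"
        by (intro summable_mult summable_geometric) (simp add: real_less_lsqrt)
      fix j :: nat
      have "(cmod (d j x))\<^sup>2 \<le> C * (1/2)^j" using C[of j] by (simp add: power_divide field_simps)
      then have "cmod (d j x) \<le> sqrt (C * (1/2)^j)" by (rule real_le_rsqrt)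
      then show "norm (d j x) \<le> sqrt C * (sqrt (1/2))^j" by (simp add: real_sqrt_mult real_sqrt_power)
    qed
    then have "convergent (\<lambda>n. \<Sum>j<n. d j x)" by (simp add: summable_iff_convergent)
    moreover have "(\<Sum>j<n. d j x) = F (r n) x - F (r 0) x" for n
      unfolding d_def by (rule sum_lessThan_telescope)
    ultimately have "convergent (\<lambda>n. F (r n) x - F (r 0) x)" by simp
    from convergent_add[OF this convergent_const[of "F (r 0) x"]] show ?case by simp
  qed
  define f where "f x = lim (\<lambda>j. F (r j) x)" for x
  have fm[measurable]: "f \<in> borel_measurable M" unfolding f_def by (rule borel_measurable_lim_metric) simp
  have flim: "AE x in M. (\<lambda>j. F (r j) x) \<longlonglongrightarrow> f x"
    using conv by eventually_elim (auto simp: f_def convergent_LIMSEQ_iff)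
  \<comment> \<open>Fatou along the pointwise convergent subsequence carries the Cauchy bound over
    to the limit, for every index beyond \<open>N j\<close> and not only along the
    subsequence.\<close>
  have est: "(\<integral>\<^sup>+x. ennreal ((cmod (F n x - f x))\<^sup>2) \<partial>M) \<le> ennreal (((1/2)^j)\<^sup>2)" if n: "n \<ge> N j" for n j
  proof -
    have "(\<integral>\<^sup>+x. ennreal ((cmod (F n x - f x))\<^sup>2) \<partial>M) = (\<integral>\<^sup>+x. liminf (\<lambda>k. ennreal ((cmod (F n x - F (r k) x))\<^sup>2)) \<partial>M)"
    proof (rule nn_integral_cong_AE)
      show "AE x in M. ennreal ((cmod (F n x - f x))\<^sup>2) = liminf (\<lambda>k. ennreal ((cmod (F n x - F (r k) x))\<^sup>2))"
        using flim
      proof eventually_elim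
        case (elim x)
        then have "(\<lambda>k. ennreal ((cmod (F n x - F (r k) x))\<^sup>2)) \<longlonglongrightarrow> ennreal ((cmod (F n x - f x))\<^sup>2)"
          by (intro tendsto_intros)
        then show ?case by (intro lim_imp_Liminf[symmetric]) auto
      qed
    qed
    also have "\<dots> \<le> liminf (\<lambda>k. \<integral>\<^sup>+x. ennreal ((cmod (F n x - F (r k) x))\<^sup>2) \<partial>M)"
      by (rule nn_integral_liminf) auto
    also have "\<dots> \<le> liminf (\<lambda>k. ennreal (((1/2)^j)\<^sup>2))"
    proof (rule Liminf_mono)
      show "\<forall>\<^sub>F k in sequentially. (\<integral>\<^sup>+x. ennreal ((cmod (F n x - F (r k) x))\<^sup>2) \<partial>M) \<le> ennreal (((1/2)^j)\<^sup>2)"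
        using eventually_ge_at_top[of j]
      proof eventually_elim
        case (elim k)
        have "N j \<le> r k" unfolding r_def by (rule member_le_sum) (use elim in auto)
        then have "l2n M (\<lambda>x. F n x - F (r k) x) \<le> (1/2)^j" using N[OF n] less_imp_le by blast
        then show ?case
          by (subst sqint_nn_eq[OF sqint_diff[OF F F]]) (auto intro!: ennreal_leI power_mono l2n_nonneg)
      qed
    qed
    finally show ?thesis by (simp add: Liminf_const)
  qed
  have sq1: "sqint M (\<lambda>x. F (N 0) x - f x)"
    unfolding sqint_iff_nn using est[of 0 "N 0"] by (auto intro: le_less_trans)
  have sf: "sqint M f" using sqint_diff[OF F[of "N 0"] sq1] by simp
  have "(\<lambda>n. l2n M (\<lambda>x. F n x - f x)) \<longlonglongrightarrow> 0"
  proof (rule LIMSEQ_I)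
    fix e :: real assume "e > 0"
    then obtain j where j: "(1/2::real)^j < e" using one_less_inverse real_arch_pow_inv[of e "1/2"] by auto
    have "norm (l2n M (\<lambda>x. F n x - f x) - 0) < e" if "n \<ge> N j" for n
    proof -
      have "(l2n M (\<lambda>x. F n x - f x))\<^sup>2 \<le> ((1/2)^j)\<^sup>2"
        using est[OF that] sqint_nn_eq[OF sqint_diff[OF F[of n] sf]] by simp
      then have "l2n M (\<lambda>x. F n x - f x) \<le> (1/2)^j" by (rule power2_le_imp_le) simp
      then show ?thesis using j by (simp add: l2n_nonneg)
    qed
    then show "\<exists>no. \<forall>n\<ge>no. norm (l2n M (\<lambda>x. F n x - f x) - 0) < e" by blast
  qed
  then show ?thesis using that sf by blast
qed

lemma l2_lim_unique:
  assumes "\<And>n. sqint M (F n)" "sqint M f" "sqint M g"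
    "(\<lambda>n. l2n M (\<lambda>x. F n x - f x)) \<longlonglongrightarrow> 0" "(\<lambda>n. l2n M (\<lambda>x. F n x - g x)) \<longlonglongrightarrow> 0"
  shows "AE x in M. f x = g x"
proof -
  have "l2n M (\<lambda>x. f x - g x) \<le> l2n M (\<lambda>x. F n x - f x) + l2n M (\<lambda>x. F n x - g x)" for n
    using l2n_triangle_diff[OF assms(2) assms(1)[of n] assms(3)] l2n_minus[of M f "F n"] by simp
  then have "l2n M (\<lambda>x. f x - g x) \<le> 0 + 0"
    by (intro LIMSEQ_le_const[OF tendsto_add[OF assms(4,5)]]) auto
  then have "l2n M (\<lambda>x. f x - g x) = 0" using l2n_nonneg[of M "\<lambda>x. f x - g x"] by simp
  then show ?thesis using l2n_eq_0_iff[OF sqint_diff[OF assms(2,3)]] by simp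
qed

section \<open>Fourier inversion\<close>

lemma lborel_integrable_affine:
  fixes f :: "'a::euclidean_space \<Rightarrow> 'b::{banach,second_countable_topology}"
  assumes f: "integrable lborel f" and c: "c \<noteq> 0"
  shows "integrable lborel (\<lambda>x. f (t + c *\<^sub>R x))"
proof -
  have [measurable]: "f \<in> borel_measurable borel" using f by auto
  have "integrable (density (distr lborel borel (\<lambda>x. t + c *\<^sub>R x)) (\<lambda>_. ennreal (\<bar>c\<bar>^DIM('a)))) f"
    using f lborel_affine[OF c, of t] by simp
  then have "integrable lborel (\<lambda>x. \<bar>c\<bar>^DIM('a) *\<^sub>R f (t + c *\<^sub>R x))"
    by (subst (asm) integrable_density) (auto simp: integrable_distr_eq)
  then have "integrable lborel (\<lambda>x. inverse (\<bar>c\<bar>^DIM('a)) *\<^sub>R \<bar>c\<bar>^DIM('a) *\<^sub>R f (t + c *\<^sub>R x))"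
    by (rule integrable_scaleR_right)
  then show ?thesis using c by simp
qed

lemma lborel_integral_affine:
  fixes f :: "'a::euclidean_space \<Rightarrow> 'b::{banach,second_countable_topology}"
  assumes [measurable]: "f \<in> borel_measurable borel" and c: "c \<noteq> 0"
  shows "(LINT x|lborel. f x) = \<bar>c\<bar>^DIM('a) *\<^sub>R (LINT x|lborel. f (t + c *\<^sub>R x))"
  by (subst lborel_affine[OF c, of t]) (simp add: integral_density integral_distr)

lemma lborel_nn_integral_affine:
  fixes f :: "'a::euclidean_space \<Rightarrow> ennreal"
  assumes [measurable]: "f \<in> borel_measurable borel" and c: "c \<noteq> 0"
  shows "(\<integral>\<^sup>+x. f x \<partial>lborel) = ennreal (\<bar>c\<bar>^DIM('a)) * (\<integral>\<^sup>+x. f (t + c *\<^sub>R x) \<partial>lborel)"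
  by (subst lborel_affine[OF c, of t]) (simp add: nn_integral_density nn_integral_distr nn_integral_cmult)

lemma integrable_pair_mult:
  fixes f :: "'a \<Rightarrow> complex" and g :: "'b \<Rightarrow> complex"
  assumes "sigma_finite_measure M" "sigma_finite_measure N"
    and f: "integrable M f" and g: "integrable N g"
  shows "integrable (M \<Otimes>\<^sub>M N) (\<lambda>p. f (fst p) * g (snd p))"
proof -
  interpret pair_sigma_finite M N using assms(1,2) by (simp add: pair_sigma_finite_def)
  have [measurable]: "f \<in> borel_measurable M" "g \<in> borel_measurable N" using f g by auto
  show ?thesis
  proof (rule Fubini_integrable)
    show "AE x in M. integrable N (\<lambda>y. f (fst (x, y)) * g (snd (x, y)))"
      using g by (intro AE_I2) simp
    have "integrable M (\<lambda>x. cmod (f x) * (LINT y|N. cmod (g y)))"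
      using f by simp
    then show "integrable M (\<lambda>x. LINT y|N. norm (f (fst (x, y)) * g (snd (x, y))))"
      by (simp add: norm_mult)
  qed measurable
qed

text \<open>The characteristic function of the standard normal distribution, with the factor
  \<open>1 / sqrt (2 * pi)\<close> of the density moved to the other side.\<close>

lemma gauss_fourier_std_1:
  fixes y :: real
  shows "has_bochner_integral lborel (\<lambda>x. exp (complex_of_real (- x\<^sup>2 / 2) + \<i> * complex_of_real (y * x)))
     (complex_of_real (sqrt (2 * pi) * exp (- y\<^sup>2 / 2)))"
proof -
  have eq: "std_normal_density x *\<^sub>R iexp (y * x) =
     complex_of_real (1 / sqrt (2 * pi)) * exp (complex_of_real (- x\<^sup>2 / 2) + \<i> * complex_of_real (y * x))" for x
    by (simp add: std_normal_density_def scaleR_conv_of_real exp_add[symmetric] exp_of_real[symmetric])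
  have "integrable std_normal_distribution (\<lambda>x. iexp (y * x))"
    by (rule finite_measure.integrable_const_bound[where B=1])
       (auto simp: prob_space.finite_measure[OF prob_space_normal_density])
  then have "integrable lborel (\<lambda>x. std_normal_density x *\<^sub>R iexp (y * x))"
    by (subst (asm) integrable_density) auto
  then have "integrable lborel (\<lambda>x. complex_of_real (sqrt (2 * pi)) * (std_normal_density x *\<^sub>R iexp (y * x)))"
    by (rule integrable_mult_right)
  then have i: "integrable lborel (\<lambda>x. exp (complex_of_real (- x\<^sup>2 / 2) + \<i> * complex_of_real (y * x)))"
    unfolding eq by (simp flip: mult.assoc of_real_mult)
  have "(LINT x|lborel. std_normal_density x *\<^sub>R iexp (y * x)) = exp (- (y^2) / 2)"
    using fun_cong[OF char_std_normal_distribution, of y] unfolding char_def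
    by (subst (asm) integral_density) auto
  then have "complex_of_real (1 / sqrt (2 * pi)) *
      (LINT x|lborel. exp (complex_of_real (- x\<^sup>2 / 2) + \<i> * complex_of_real (y * x))) = exp (- (y^2) / 2)"
    unfolding eq using i by simp
  then have "(LINT x|lborel. exp (complex_of_real (- x\<^sup>2 / 2) + \<i> * complex_of_real (y * x)))
     = complex_of_real (sqrt (2 * pi) * exp (- y\<^sup>2 / 2))"
    by (simp add: field_simps)
  with i show ?thesis by (simp add: has_bochner_integral_iff)
qed

text \<open>Integrand and Lebesgue measure both factor over \<open>Basis\<close>, so the
  one-dimensional integrals multiply.\<close>

lemma gauss_fourier_std:
  fixes y :: "'a::euclidean_space"
  shows "has_bochner_integral lborel (\<lambda>s. exp (complex_of_real (- (s \<bullet> s) / 2) + \<i> * complex_of_real (y \<bullet> s)))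
     (complex_of_real (sqrt (2 * pi) ^ DIM('a) * exp (- (y \<bullet> y) / 2)))"
proof -
  define f where "f b x = exp (complex_of_real (- x\<^sup>2 / 2) + \<i> * complex_of_real ((y \<bullet> b) * x))" for b :: 'a and x :: real
  interpret product_sigma_finite "\<lambda>_::'a. lborel :: real measure" by standard
  have fi: "integrable lborel (f b)" and fv: "integral\<^sup>L lborel (f b) = complex_of_real (sqrt (2 * pi) * exp (- (y \<bullet> b)\<^sup>2 / 2))" for b
    using gauss_fourier_std_1[of "y \<bullet> b"] unfolding f_def by (auto simp: has_bochner_integral_iff)
  have [measurable]: "f b \<in> borel_measurable borel" for b using fi by auto
  have eq: "exp (complex_of_real (- (s \<bullet> s) / 2) + \<i> * complex_of_real (y \<bullet> s)) = (\<Prod>b\<in>Basis. f b (s \<bullet> b))" for s :: 'a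
    unfolding f_def by (subst euclidean_inner[of s s], subst euclidean_inner[of y s])
      (simp add: exp_sum[symmetric] sum_subtractf sum_distrib_left sum_negf sum_divide_distrib power2_eq_square)
  have "integrable (\<Pi>\<^sub>M b\<in>Basis. lborel) (\<lambda>x. \<Prod>b\<in>Basis. f b (x b))"
    by (rule product_integrable_prod) (auto simp: fi)
  then have i: "integrable lborel (\<lambda>s::'a. \<Prod>b\<in>Basis. f b (s \<bullet> b))"
    by (subst lborel_eq) (simp add: integrable_distr_eq inner_sum_left_Basis cong: prod.cong)
  have "(LINT s|lborel. (\<Prod>b\<in>Basis. f b (s \<bullet> b))) = (LINT x|(\<Pi>\<^sub>M b\<in>Basis. lborel). (\<Prod>b\<in>Basis. f b (x b)))"
    by (subst lborel_eq) (simp add: integral_distr inner_sum_left_Basis cong: prod.cong)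
  also have "\<dots> = (\<Prod>b\<in>Basis. integral\<^sup>L lborel (f b))"
    by (rule product_integral_prod) (auto simp: fi)
  also have "\<dots> = complex_of_real (sqrt (2 * pi) ^ DIM('a) * exp (- (y \<bullet> y) / 2))"
    unfolding fv euclidean_inner[of y y]
    by (simp add: prod.distrib exp_sum[symmetric] sum_negf sum_divide_distrib power2_eq_square flip: of_real_prod)
  finally show ?thesis using i unfolding eq by (simp add: has_bochner_integral_iff)
qed

text \<open>Completing the square by the real substitution \<open>t + c *\<^sub>R s\<close> with
  \<open>c = sqrt (2 * \<kappa>)\<close> and \<open>t = - ((1/c) *\<^sub>R x)\<close>. Only
  \<open>x\<close> is absorbed by the shift, so no contour has to be moved; the shift leaves the
  phase \<open>(x \<bullet> y) / (2 * \<kappa>)\<close> behind.\<close>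

lemma gauss_fourier:
  fixes x y :: "'a::euclidean_space"
  assumes \<kappa>: "\<kappa> > 0"
  shows "has_bochner_integral lborel (\<lambda>s. exp (complex_of_real (x \<bullet> s - \<kappa> * (s \<bullet> s)) + \<i> * complex_of_real (y \<bullet> s)))
     (complex_of_real (sqrt (pi / \<kappa>) ^ DIM('a)) *
        exp (complex_of_real ((x \<bullet> x - y \<bullet> y) / (4 * \<kappa>)) + \<i> * complex_of_real ((x \<bullet> y) / (2 * \<kappa>))))"
proof -
  define c where "c = sqrt (2 * \<kappa>)"
  have c: "c > 0" "c * c = 2 * \<kappa>" using \<kappa> by (auto simp: c_def)
  define G where "G r = exp (complex_of_real (- (r \<bullet> r) / 2) + \<i> * complex_of_real (((1/c) *\<^sub>R y) \<bullet> r))" for r :: 'a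
  define C where "C = exp (complex_of_real ((x \<bullet> x) / (4 * \<kappa>)) + \<i> * complex_of_real ((x \<bullet> y) / (2 * \<kappa>)))"
  have Gi: "integrable lborel G" and Gv: "integral\<^sup>L lborel G = complex_of_real (sqrt (2 * pi) ^ DIM('a) * exp (- (y \<bullet> y) / (4 * \<kappa>)))"
    using gauss_fourier_std[of "(1/c) *\<^sub>R y"] c unfolding G_def by (auto simp: has_bochner_integral_iff field_simps)
  define t where "t = - ((1/c) *\<^sub>R x)"
  have eq: "exp (complex_of_real (x \<bullet> s - \<kappa> * (s \<bullet> s)) + \<i> * complex_of_real (y \<bullet> s)) = C * G (t + c *\<^sub>R s)" for s
  proof -
    have "x \<bullet> s - \<kappa> * (s \<bullet> s) = (x \<bullet> x) / (4 * \<kappa>) - ((t + c *\<^sub>R s) \<bullet> (t + c *\<^sub>R s)) / 2"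
    proof -
      have "(t + c *\<^sub>R s) \<bullet> (t + c *\<^sub>R s) = (x \<bullet> x) / (c * c) - 2 * (x \<bullet> s) + c * c * (s \<bullet> s)"
        unfolding t_def using c(1) by (simp add: inner_simps inner_commute field_simps)
      then show ?thesis unfolding c(2) using \<kappa> by (simp add: field_simps)
    qed
    moreover have "y \<bullet> s = (x \<bullet> y) / (2 * \<kappa>) + ((1/c) *\<^sub>R y) \<bullet> (t + c *\<^sub>R s)"
      unfolding t_def c(2)[symmetric] using c(1) by (simp add: inner_simps inner_commute field_simps)
    ultimately have "complex_of_real (x \<bullet> s - \<kappa> * (s \<bullet> s)) + \<i> * complex_of_real (y \<bullet> s)
      = complex_of_real ((x \<bullet> x) / (4 * \<kappa>) - ((t + c *\<^sub>R s) \<bullet> (t + c *\<^sub>R s)) / 2)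
       + \<i> * complex_of_real ((x \<bullet> y) / (2 * \<kappa>) + ((1/c) *\<^sub>R y) \<bullet> (t + c *\<^sub>R s))"
      by presburger
    then show ?thesis
      unfolding C_def G_def exp_add[symmetric] by (simp add: ring_distribs add.commute add.left_commute add_diff_eq)
  qed
  have i: "integrable lborel (\<lambda>s. C * G (t + c *\<^sub>R s))"
    using lborel_integrable_affine[OF Gi, of c t] c by simp
  have "integral\<^sup>L lborel G = \<bar>c\<bar>^DIM('a) *\<^sub>R (LINT s|lborel. G (t + c *\<^sub>R s))"
    using Gi c by (intro lborel_integral_affine) auto
  then have "(LINT s|lborel. G (t + c *\<^sub>R s)) = integral\<^sup>L lborel G / complex_of_real (c ^ DIM('a))"
    using c by (simp add: scaleR_conv_of_real field_simps)
  then have "(LINT s|lborel. C * G (t + c *\<^sub>R s)) = C * (integral\<^sup>L lborel G / complex_of_real (c ^ DIM('a)))"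
    using lborel_integrable_affine[OF Gi, of c t] c by simp
  also have "\<dots> = complex_of_real ((sqrt (2 * pi) / c) ^ DIM('a)) * (C * exp (complex_of_real (- (y \<bullet> y) / (4 * \<kappa>))))"
    unfolding Gv exp_of_real by (simp add: power_divide)
  also have "sqrt (2 * pi) / c = sqrt (pi / \<kappa>)"
    unfolding c_def by (simp add: real_sqrt_divide[symmetric])
  also have "C * exp (complex_of_real (- (y \<bullet> y) / (4 * \<kappa>))) = exp (complex_of_real ((x \<bullet> x - y \<bullet> y) / (4 * \<kappa>)) + \<i> * complex_of_real ((x \<bullet> y) / (2 * \<kappa>)))"
    unfolding C_def exp_add[symmetric] by (simp add: diff_divide_distrib add.commute add_diff_eq)
  finally show ?thesis using i unfolding eq by (simp add: has_bochner_integral_iff)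
qed

lemma gauss_real:
  fixes x :: "'a::euclidean_space"
  assumes \<kappa>: "\<kappa> > 0"
  shows "has_bochner_integral lborel (\<lambda>s. exp (x \<bullet> s - \<kappa> * (s \<bullet> s)))
     (sqrt (pi / \<kappa>) ^ DIM('a) * exp ((x \<bullet> x) / (4 * \<kappa>)))"
proof -
  have "has_bochner_integral lborel (\<lambda>s. complex_of_real (exp (x \<bullet> s - \<kappa> * (s \<bullet> s))))
     (complex_of_real (sqrt (pi / \<kappa>) ^ DIM('a) * exp ((x \<bullet> x) / (4 * \<kappa>))))"
    using gauss_fourier[OF \<kappa>, of x "0::'a"] by (simp add: exp_of_real[symmetric])
  from has_bochner_integral_Re[OF this] show ?thesis by simp
qed

lemma integrable_gauss_norm:
  assumes "\<kappa> > 0"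
  shows "integrable lborel (\<lambda>s::'a::euclidean_space. exp (- \<kappa> * (norm s)\<^sup>2))"
  using gauss_real[OF assms, of "0::'a"] by (simp add: has_bochner_integral_iff power2_norm_eq_inner)

definition ft :: "('a::euclidean_space \<Rightarrow> complex) \<Rightarrow> 'a \<Rightarrow> complex" where
  "ft g k = (LINT s|lborel. exp (- (\<i> * complex_of_real (k \<bullet> s))) * g s)"

lemma ft_integrand_integrable:
  assumes "integrable lborel g"
  shows "integrable lborel (\<lambda>s. exp (- (\<i> * complex_of_real (k \<bullet> s))) * g s)"
  by (rule Bochner_Integration.integrable_bound[OF assms])
     (use assms in \<open>auto simp: norm_mult\<close>)

lemma ft_measurable [measurable]:
  assumes [measurable]: "g \<in> borel_measurable lborel"
  shows "ft g \<in> borel_measurable borel"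
  unfolding ft_def[abs_def] by measurable

lemma norm_ft_le:
  assumes "integrable lborel g"
  shows "cmod (ft g k) \<le> (LINT s|lborel. cmod (g s))"
proof -
  have "cmod (ft g k) \<le> (LINT s|lborel. cmod (exp (- (\<i> * complex_of_real (k \<bullet> s))) * g s))"
    unfolding ft_def by (rule integral_norm_bound)
  then show ?thesis by (simp add: norm_mult)
qed

text \<open>Fubini, with the Gaussian integral carried out in \<open>k\<close>: the damped inversion
  integral at \<open>y\<close> is an average of \<open>c\<close> against a Gaussian of width
  \<open>e\<close> around \<open>y\<close>. Inversion and Plancherel both arise by letting
  \<open>e\<close> tend to 0.\<close>

lemma ft_gauss_mult:
  fixes c :: "'a::euclidean_space \<Rightarrow> complex"
  assumes c: "integrable lborel c" and e: "e > 0"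
  shows "(LINT k|lborel. ft c k * (exp (\<i> * complex_of_real (k \<bullet> y)) * complex_of_real (exp (- (e\<^sup>2 / 2) * (k \<bullet> k)))))
    = complex_of_real (sqrt (2 * pi) ^ DIM('a)) * (LINT r|lborel. c (y + e *\<^sub>R r) * complex_of_real (exp (- (r \<bullet> r) / 2)))"
proof -
  have [measurable]: "c \<in> borel_measurable borel" using c by auto
  define E where "E k = complex_of_real (exp (- (e\<^sup>2 / 2) * (k \<bullet> k)))" for k :: 'a
  have Ei: "integrable lborel E"
    using gauss_real[of "e\<^sup>2 / 2" "0::'a"] e unfolding E_def
    by (simp add: has_bochner_integral_iff)
  have [measurable]: "E \<in> borel_measurable borel" using Ei by auto
  have I: "integrable (lborel \<Otimes>\<^sub>M lborel) (\<lambda>(s, k). exp (\<i> * complex_of_real ((y - s) \<bullet> k)) * c s * E k)"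
    by (rule Bochner_Integration.integrable_bound[OF integrable_pair_mult[OF sigma_finite_lborel sigma_finite_lborel c Ei]])
       (auto simp: norm_mult)
  have inner: "(LINT k|lborel. exp (\<i> * complex_of_real ((y - s) \<bullet> k)) * c s * E k)
     = c s * complex_of_real ((sqrt (2 * pi) / e) ^ DIM('a) * exp (- ((s - y) \<bullet> (s - y)) / (2 * e\<^sup>2)))" for s
  proof -
    have *: "exp (\<i> * complex_of_real ((y - s) \<bullet> k)) * c s * E k =
       c s * exp (complex_of_real (0 \<bullet> k - (e\<^sup>2 / 2) * (k \<bullet> k)) + \<i> * complex_of_real ((y - s) \<bullet> k))" for k
      unfolding E_def by (simp add: exp_of_real[symmetric] exp_add[symmetric] mult_ac)
    have "(LINT k|lborel. exp (\<i> * complex_of_real ((y - s) \<bullet> k)) * c s * E k) = c s *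
        (complex_of_real (sqrt (pi / (e\<^sup>2 / 2)) ^ DIM('a)) *
        exp (complex_of_real (- ((y - s) \<bullet> (y - s)) / (4 * (e\<^sup>2 / 2)))))"
      unfolding * using gauss_fourier[of "e\<^sup>2 / 2" "0::'a" "y - s"] e
      by (simp add: has_bochner_integral_iff)
    also have "sqrt (pi / (e\<^sup>2 / 2)) = sqrt (2 * pi) / e"
      using e by (simp add: real_sqrt_divide real_sqrt_mult field_simps)
    also have "(y - s) \<bullet> (y - s) = (s - y) \<bullet> (s - y)"
      by (simp add: inner_diff_left inner_diff_right inner_commute)
    finally show ?thesis unfolding exp_of_real by (simp add: exp_of_real mult_ac power2_eq_square)
  qed
  have "(LINT k|lborel. ft c k * (exp (\<i> * complex_of_real (k \<bullet> y)) * E k)) =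
     (LINT k|lborel. (LINT s|lborel. exp (\<i> * complex_of_real ((y - s) \<bullet> k)) * c s * E k))"
  proof (intro Bochner_Integration.integral_cong refl)
    fix k
    have "ft c k * (exp (\<i> * complex_of_real (k \<bullet> y)) * E k) =
       (LINT s|lborel. (exp (- (\<i> * complex_of_real (k \<bullet> s))) * c s) * (exp (\<i> * complex_of_real (k \<bullet> y)) * E k))"
      unfolding ft_def by (simp add: ft_integrand_integrable[OF c])
    also have "\<dots> = (LINT s|lborel. exp (\<i> * complex_of_real ((y - s) \<bullet> k)) * c s * E k)"
    proof (intro Bochner_Integration.integral_cong refl)
      fix s
      have "exp (\<i> * complex_of_real ((y - s) \<bullet> k)) = exp (- (\<i> * complex_of_real (k \<bullet> s))) * exp (\<i> * complex_of_real (k \<bullet> y))"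
        unfolding exp_add[symmetric] by (simp add: inner_diff_left inner_commute algebra_simps)
      then show "exp (- (\<i> * complex_of_real (k \<bullet> s))) * c s * (exp (\<i> * complex_of_real (k \<bullet> y)) * E k)
        = exp (\<i> * complex_of_real ((y - s) \<bullet> k)) * c s * E k" by (simp add: mult_ac)
    qed
    finally show "ft c k * (exp (\<i> * complex_of_real (k \<bullet> y)) * E k) = (LINT s|lborel. exp (\<i> * complex_of_real ((y - s) \<bullet> k)) * c s * E k)" .
  qed
  also have "\<dots> = (LINT s|lborel. (LINT k|lborel. exp (\<i> * complex_of_real ((y - s) \<bullet> k)) * c s * E k))"
    by (rule lborel_pair.Fubini_integral[OF I])
  also have "\<dots> = (LINT s|lborel. c s * complex_of_real ((sqrt (2 * pi) / e) ^ DIM('a) * exp (- ((s - y) \<bullet> (s - y)) / (2 * e\<^sup>2))))"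
    unfolding inner ..
  also have "\<dots> = \<bar>e\<bar>^DIM('a) *\<^sub>R (LINT r|lborel. c (y + e *\<^sub>R r) * complex_of_real ((sqrt (2 * pi) / e) ^ DIM('a) * exp (- ((y + e *\<^sub>R r - y) \<bullet> (y + e *\<^sub>R r - y)) / (2 * e\<^sup>2))))"
    using e by (intro lborel_integral_affine) auto
  also have "\<dots> = (LINT r|lborel. complex_of_real (sqrt (2 * pi) ^ DIM('a)) * (c (y + e *\<^sub>R r) * complex_of_real (exp (- (r \<bullet> r) / 2))))"
    unfolding integral_scaleR_right[symmetric] using e
    by (intro Bochner_Integration.integral_cong refl)
       (simp add: scaleR_conv_of_real power_divide power2_eq_square field_simps)
  also have "\<dots> = complex_of_real (sqrt (2 * pi) ^ DIM('a)) * (LINT r|lborel. c (y + e *\<^sub>R r) * complex_of_real (exp (- (r \<bullet> r) / 2)))"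
    by simp
  finally show ?thesis unfolding E_def .
qed

text \<open>An approximate identity, by dominated convergence. Continuity is asked at the single
  point \<open>y\<close> because the autocorrelation to which this is applied is shown continuous
  only at 0.\<close>

lemma gauss_limit:
  fixes c :: "'a::euclidean_space \<Rightarrow> complex"
  assumes [measurable]: "c \<in> borel_measurable borel" and B: "\<And>x. cmod (c x) \<le> B" and cont: "isCont c y"
    and e: "e \<longlonglongrightarrow> 0"
  shows "(\<lambda>n. LINT r|lborel. c (y + e n *\<^sub>R r) * complex_of_real (exp (- (r \<bullet> r) / 2)))
     \<longlonglongrightarrow> complex_of_real (sqrt (2 * pi) ^ DIM('a)) * c y"
proof -
  have g: "has_bochner_integral lborel (\<lambda>r::'a. exp (- (r \<bullet> r) / 2)) (sqrt (2 * pi) ^ DIM('a))"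
    using gauss_real[of "1/2" "0::'a"] by (simp add: mult.commute)
  have "(\<lambda>n. LINT r|lborel. c (y + e n *\<^sub>R r) * complex_of_real (exp (- (r \<bullet> r) / 2)))
     \<longlonglongrightarrow> (LINT r::'a|lborel. c y * complex_of_real (exp (- (r \<bullet> r) / 2)))"
  proof (rule integral_dominated_convergence)
    show "integrable lborel (\<lambda>r::'a. B * exp (- (r \<bullet> r) / 2))"
      using g by (simp add: has_bochner_integral_iff)
    show "AE r in lborel. (\<lambda>n. c (y + e n *\<^sub>R r) * complex_of_real (exp (- (r \<bullet> r) / 2))) \<longlonglongrightarrow> c y * complex_of_real (exp (- (r \<bullet> r) / 2))"
    proof (rule AE_I2, rule tendsto_mult_right)
      fix r :: 'a
      have "(\<lambda>n. y + e n *\<^sub>R r) \<longlonglongrightarrow> y + 0 *\<^sub>R r" by (intro tendsto_intros e)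
      then show "(\<lambda>n. c (y + e n *\<^sub>R r)) \<longlonglongrightarrow> c y"
        using isCont_tendsto_compose[OF cont] by simp
    qed
    show "AE r in lborel. norm (c (y + e n *\<^sub>R r) * complex_of_real (exp (- (r \<bullet> r) / 2))) \<le> B * exp (- (r \<bullet> r) / 2)" for n
      using B by (intro AE_I2) (auto simp: norm_mult intro!: mult_right_mono)
  qed auto
  also have "(LINT r::'a|lborel. c y * complex_of_real (exp (- (r \<bullet> r) / 2))) = complex_of_real (sqrt (2 * pi) ^ DIM('a)) * c y"
    using g by (simp add: has_bochner_integral_iff)
  finally show ?thesis .
qed

text \<open>The Gaussian-damped inversion integral has two limits that must agree: integrability of
  \<open>ft c\<close> lets the damping be removed by dominated convergence, while
  \<open>ft_gauss_mult\<close> and \<open>gauss_limit\<close> produce the value of \<open>c\<close>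
  at \<open>y\<close>.\<close>

lemma fourier_inversion:
  fixes c :: "'a::euclidean_space \<Rightarrow> complex"
  assumes c: "integrable lborel c" and B: "\<And>x. cmod (c x) \<le> B" and cont: "isCont c y"
    and fc: "integrable lborel (ft c)"
  shows "(LINT k|lborel. exp (\<i> * complex_of_real (k \<bullet> y)) * ft c k) = complex_of_real ((2 * pi) ^ DIM('a)) * c y"
proof (rule LIMSEQ_unique)
  have [measurable]: "c \<in> borel_measurable borel" using c by auto
  define e where "e n = 1 / real (Suc n)" for n
  have e: "e \<longlonglongrightarrow> 0" "\<And>n. e n > 0" unfolding e_def by (real_asymp, simp)
  define I where "I n = (LINT k|lborel. ft c k * (exp (\<i> * complex_of_real (k \<bullet> y)) * complex_of_real (exp (- ((e n)\<^sup>2 / 2) * (k \<bullet> k)))))" for n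
  show "I \<longlonglongrightarrow> (LINT k|lborel. exp (\<i> * complex_of_real (k \<bullet> y)) * ft c k)"
    unfolding I_def
  proof (rule integral_dominated_convergence)
    show "integrable lborel (\<lambda>k. cmod (ft c k))" using fc by simp
    show "AE k in lborel. (\<lambda>n. ft c k * (exp (\<i> * complex_of_real (k \<bullet> y)) * complex_of_real (exp (- ((e n)\<^sup>2 / 2) * (k \<bullet> k))))) \<longlonglongrightarrow> exp (\<i> * complex_of_real (k \<bullet> y)) * ft c k"
    proof (rule AE_I2)
      fix k
      have "(\<lambda>n. ft c k * (exp (\<i> * complex_of_real (k \<bullet> y)) * complex_of_real (exp (- ((e n)\<^sup>2 / 2) * (k \<bullet> k)))))
        \<longlonglongrightarrow> ft c k * (exp (\<i> * complex_of_real (k \<bullet> y)) * complex_of_real (exp (- (0\<^sup>2 / 2) * (k \<bullet> k))))"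
        by (intro tendsto_intros e) auto
      then show "(\<lambda>n. ft c k * (exp (\<i> * complex_of_real (k \<bullet> y)) * complex_of_real (exp (- ((e n)\<^sup>2 / 2) * (k \<bullet> k))))) \<longlonglongrightarrow> exp (\<i> * complex_of_real (k \<bullet> y)) * ft c k"
        by (simp add: mult.commute)
    qed
    show "AE k in lborel. norm (ft c k * (exp (\<i> * complex_of_real (k \<bullet> y)) * complex_of_real (exp (- ((e n)\<^sup>2 / 2) * (k \<bullet> k))))) \<le> cmod (ft c k)" for n
      by (intro AE_I2) (auto simp: norm_mult intro!: mult_left_le)
  qed auto
  have "I = (\<lambda>n. complex_of_real (sqrt (2 * pi) ^ DIM('a)) * (LINT r|lborel. c (y + e n *\<^sub>R r) * complex_of_real (exp (- (r \<bullet> r) / 2))))"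
    unfolding I_def using ft_gauss_mult[OF c e(2)] by (intro ext) blast
  moreover have "\<dots> \<longlonglongrightarrow> complex_of_real (sqrt (2 * pi) ^ DIM('a)) * (complex_of_real (sqrt (2 * pi) ^ DIM('a)) * c y)"
    by (intro tendsto_mult_left gauss_limit[where B=B] e B cont) auto
  moreover have "complex_of_real (sqrt (2 * pi) ^ DIM('a)) * (complex_of_real (sqrt (2 * pi) ^ DIM('a)) * c y) = complex_of_real ((2 * pi) ^ DIM('a)) * c y"
    unfolding mult.assoc[symmetric] of_real_mult[symmetric] power_mult_distrib[symmetric] by simp
  ultimately show "I \<longlonglongrightarrow> complex_of_real ((2 * pi) ^ DIM('a)) * c y" by (simp only:)
qed

section \<open>Plancherel\<close>

lemma integrable_translate:
  fixes f :: "'a::euclidean_space \<Rightarrow> 'b::{banach,second_countable_topology}"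
  assumes "integrable lborel f"
  shows "integrable lborel (\<lambda>x. f (x + h))"
  using lborel_integrable_affine[OF assms, of 1 h] by (simp add: add.commute)

lemma integral_translate:
  fixes f :: "'a::euclidean_space \<Rightarrow> 'b::{banach,second_countable_topology}"
  assumes "f \<in> borel_measurable borel"
  shows "(LINT x|lborel. f (x + h)) = (LINT x|lborel. f x)"
  using lborel_integral_affine[OF assms, of 1 h] by (simp add: add.commute)

text \<open>For an open set this is dominated convergence, since \<open>s + h n\<close> eventually
  lies in the set whenever \<open>s\<close> does. Outer regularity passes to a measurable
  \<open>A\<close> inside an open \<open>U\<close>, at the price of the measure of
  \<open>U - A\<close>, paid once at \<open>s\<close> and once at \<open>s + h n\<close>.\<close>

lemma indicator_translate_tendsto:
  fixes A :: "'a::euclidean_space set"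
  assumes A: "A \<in> sets lborel" "emeasure lborel A < \<infinity>" and h: "h \<longlonglongrightarrow> 0"
  shows "(\<lambda>n. LINT s|lborel. \<bar>indicat_real A (s + h n) - indicat_real A s\<bar>) \<longlonglongrightarrow> 0"
proof (rule LIMSEQ_I)
  fix e :: real assume e: "e > 0"
  obtain U where U: "open U" "A \<subseteq> U" "emeasure lborel (U - A) < ennreal (e/4)"
    using outer_regular_lborel[of A "e/4"] A e by auto
  have "emeasure lborel U \<le> emeasure lborel (U - A) + emeasure lborel A"
  proof -
    have "emeasure lborel ((U - A) \<union> A) \<le> emeasure lborel (U - A) + emeasure lborel A"
      by (rule emeasure_subadditive) (use A U in auto)
    then show ?thesis using U by (simp add: Un_absorb1 Un_commute)
  qed
  also have "\<dots> < \<infinity>" using U(3) A(2) by (auto intro: less_trans)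
  finally have Uf: "emeasure lborel U < \<infinity>" .
  have [measurable]: "U \<in> sets borel" "A \<in> sets borel" using U A by auto
  have iU: "integrable lborel (indicat_real U)" using Uf by (simp add: integrable_indicator_iff)
  have iD: "integrable lborel (indicat_real (U - A))"
    by (rule integrable_real_indicator) (use U(3) in \<open>auto intro: less_trans\<close>)
  have D: "(LINT s|lborel. indicat_real (U - A) s) < e / 4"
  proof -
    have "emeasure lborel (U - A) \<noteq> \<infinity>" using U(3) by (auto simp: top_unique)
    then have "ennreal (measure lborel (U - A)) < ennreal (e / 4)"
      using U(3) by (simp add: emeasure_eq_ennreal_measure)
    then show ?thesis using e by (simp add: ennreal_less_iff)
  qed
  have "(\<lambda>n. LINT s|lborel. indicat_real U s * indicat_real U (s + h n)) \<longlonglongrightarrow> (LINT s|lborel. indicat_real U s)"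
  proof (rule integral_dominated_convergence[OF _ _ iU])
    show "AE s in lborel. (\<lambda>n. indicat_real U s * indicat_real U (s + h n)) \<longlonglongrightarrow> indicat_real U s"
    proof (rule AE_I2)
      fix s :: 'a
      show "(\<lambda>n. indicat_real U s * indicat_real U (s + h n)) \<longlonglongrightarrow> indicat_real U s"
      proof (cases "s \<in> U")
        case True
        have "(\<lambda>n. s + h n) \<longlonglongrightarrow> s + 0" by (intro tendsto_intros h)
        then have "\<forall>\<^sub>F n in sequentially. s + h n \<in> U" using U(1) True by (intro topological_tendstoD) auto
        then have "\<forall>\<^sub>F n in sequentially. indicat_real U s * indicat_real U (s + h n) = indicat_real U s"
          by eventually_elim (use True in auto)
        then show ?thesis by (rule tendsto_eventually)
      qed simp
    qed
    show "AE s in lborel. norm (indicat_real U s * indicat_real U (s + h n)) \<le> indicat_real U s" for n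
      by (intro AE_I2) (auto simp: indicator_def)
  qed measurable
  then have "\<forall>\<^sub>F n in sequentially. dist (LINT s|lborel. indicat_real U s * indicat_real U (s + h n)) (LINT s|lborel. indicat_real U s) < e / 8"
    using e by (intro tendstoD) auto
  then obtain N where N: "\<And>n. n \<ge> N \<Longrightarrow> \<bar>(LINT s|lborel. indicat_real U s * indicat_real U (s + h n)) - (LINT s|lborel. indicat_real U s)\<bar> < e / 8"
    by (auto simp: eventually_sequentially dist_real_def)
  have "norm ((LINT s|lborel. \<bar>indicat_real A (s + h n) - indicat_real A s\<bar>) - 0) < e" if n: "n \<ge> N" for n
  proof -
    have iUU: "integrable lborel (\<lambda>s. indicat_real U s * indicat_real U (s + h n))"
      by (rule Bochner_Integration.integrable_bound[OF iU]) (auto simp: indicator_def)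
    have iUt: "integrable lborel (\<lambda>s. indicat_real U (s + h n))" and iDt: "integrable lborel (\<lambda>s. indicat_real (U - A) (s + h n))"
      by (intro integrable_translate iU iD)+
    \<comment> \<open>The first three terms are the squared, hence also the absolute, difference of
      the two indicators of \<open>U\<close>; the last two pay for replacing \<open>A\<close> by
      \<open>U\<close>.\<close>
    have "(LINT s|lborel. \<bar>indicat_real A (s + h n) - indicat_real A s\<bar>) \<le>
       (LINT s|lborel. indicat_real U (s + h n) + indicat_real U s - 2 * (indicat_real U s * indicat_real U (s + h n))
         + indicat_real (U - A) (s + h n) + indicat_real (U - A) s)"
    proof (rule integral_mono_AE)
      have "integrable lborel (indicat_real A)" using A by (simp add: integrable_indicator_iff)
      then show "integrable lborel (\<lambda>s. \<bar>indicat_real A (s + h n) - indicat_real A s\<bar>)"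
        by (intro integrable_abs Bochner_Integration.integrable_diff integrable_translate)
      show "AE s in lborel. \<bar>indicat_real A (s + h n) - indicat_real A s\<bar> \<le> indicat_real U (s + h n) + indicat_real U s - 2 * (indicat_real U s * indicat_real U (s + h n))
         + indicat_real (U - A) (s + h n) + indicat_real (U - A) s"
        using U(2) by (intro AE_I2) (auto simp: indicator_def)
    qed (intro Bochner_Integration.integrable_add Bochner_Integration.integrable_diff integrable_mult_right iUU iUt iU iDt iD)
    also have "\<dots> = 2 * ((LINT s|lborel. indicat_real U s) - (LINT s|lborel. indicat_real U s * indicat_real U (s + h n)))
        + 2 * (LINT s|lborel. indicat_real (U - A) s)"
      using iUU iUt iU iDt iD integral_translate[of "indicat_real U" "h n"] integral_translate[of "indicat_real (U-A)" "h n"]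
      by simp
    also have "\<dots> < 2 * (e / 8) + 2 * (e / 4)"
      using N[OF n] D by (intro add_strict_mono mult_strict_left_mono) linarith+
    also have "\<dots> < e" using e by simp
    finally show ?thesis by (simp add: abs_of_nonneg integral_nonneg)
  qed
  then show "\<exists>no. \<forall>n\<ge>no. norm ((LINT s|lborel. \<bar>indicat_real A (s + h n) - indicat_real A s\<bar>) - 0) < e" by blast
qed

text \<open>Density of simple functions, in the form of the induction rule for integrable functions.
  The limit case is a three-epsilon argument in which the translated approximation error has the
  same integral as the untranslated one.\<close>

lemma L1_translate_tendsto:
  fixes f :: "'a::euclidean_space \<Rightarrow> complex"
  assumes "integrable lborel f" and h: "h \<longlonglongrightarrow> 0"
  shows "(\<lambda>n. LINT s|lborel. cmod (f (s + h n) - f s)) \<longlonglongrightarrow> 0"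
  using assms(1)
proof (induction rule: integrable_induct)
  case (base A c)
  have "(LINT s|lborel. cmod (indicat_real A (s + h n) *\<^sub>R c - indicat_real A s *\<^sub>R c))
     = (LINT s|lborel. \<bar>indicat_real A (s + h n) - indicat_real A s\<bar> * cmod c)" for n
    by (simp add: scaleR_diff_left[symmetric])
  then have eq: "(\<lambda>n. LINT s|lborel. cmod (indicat_real A (s + h n) *\<^sub>R c - indicat_real A s *\<^sub>R c))
    = (\<lambda>n. (LINT s|lborel. \<bar>indicat_real A (s + h n) - indicat_real A s\<bar>) * cmod c)"
    by simp
  show ?case unfolding eq
    using tendsto_mult_right[OF indicator_translate_tendsto[OF base h], of "cmod c"] by simp
next
  case (add f g)
  have "(\<lambda>n. (LINT s|lborel. cmod (f (s + h n) - f s)) + (LINT s|lborel. cmod (g (s + h n) - g s))) \<longlonglongrightarrow> 0 + 0"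
    by (intro tendsto_add add)
  then show ?case
  proof (rule Lim_null_comparison[rotated, OF tendsto_eq_rhs])
    show "\<forall>\<^sub>F n in sequentially. norm (LINT s|lborel. cmod (f (s + h n) + g (s + h n) - (f s + g s))) \<le> (LINT s|lborel. cmod (f (s + h n) - f s)) + (LINT s|lborel. cmod (g (s + h n) - g s))"
    proof (rule always_eventually, rule allI)
      fix n
      have i: "integrable lborel (\<lambda>s. cmod (f (s + h n) - f s))" "integrable lborel (\<lambda>s. cmod (g (s + h n) - g s))"
        by (intro integrable_norm Bochner_Integration.integrable_diff integrable_translate add)+
      have "(LINT s|lborel. cmod (f (s + h n) + g (s + h n) - (f s + g s))) \<le> (LINT s|lborel. cmod (f (s + h n) - f s) + cmod (g (s + h n) - g s))"
      proof (rule integral_mono)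
        show "integrable lborel (\<lambda>s. cmod (f (s + h n) + g (s + h n) - (f s + g s)))"
          by (intro integrable_norm Bochner_Integration.integrable_diff Bochner_Integration.integrable_add integrable_translate add)
        show "cmod (f (s + h n) + g (s + h n) - (f s + g s)) \<le> cmod (f (s + h n) - f s) + cmod (g (s + h n) - g s)" for s
          using norm_triangle_ineq[of "f (s + h n) - f s" "g (s + h n) - g s"] by (simp add: algebra_simps)
      qed (use i in auto)
      then show "norm (LINT s|lborel. cmod (f (s + h n) + g (s + h n) - (f s + g s))) \<le> (LINT s|lborel. cmod (f (s + h n) - f s)) + (LINT s|lborel. cmod (g (s + h n) - g s))"
        using i by (simp add: integral_nonneg)
    qed
  qed simp
next
  case (lim f s)
  have [measurable]: "f \<in> borel_measurable borel" "\<And>i. s i \<in> borel_measurable borel" using lim by auto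
  have fi: "integrable lborel f" and si: "integrable lborel (s i)" for i using lim by auto
  have L: "(\<lambda>i. LINT x|lborel. cmod (s i x - f x)) \<longlonglongrightarrow> (LINT x::'a|lborel. 0)"
  proof (rule integral_dominated_convergence)
    \<comment> \<open>The approximants in the induction rule satisfy
      \<open>cmod (s i x) \<le> 2 * cmod (f x)\<close>, hence the factor 3.\<close>
    show "integrable lborel (\<lambda>x. 3 * cmod (f x))" using fi by simp
    show "AE x in lborel. (\<lambda>i. cmod (s i x - f x)) \<longlonglongrightarrow> 0"
      using lim(2) by (intro AE_I2) (auto intro!: tendsto_norm_zero simp: LIM_zero_iff)
    show "AE x in lborel. norm (cmod (s i x - f x)) \<le> 3 * cmod (f x)" for i
    proof (rule AE_I2)
      fix x
      show "norm (cmod (s i x - f x)) \<le> 3 * cmod (f x)"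
        using norm_triangle_ineq4[of "s i x" "f x"] lim(3)[of x i] by simp
    qed
  qed auto
  show ?case
  proof (rule LIMSEQ_I)
    fix e :: real assume e: "e > 0"
    obtain i where i: "(LINT x|lborel. cmod (s i x - f x)) < e / 4"
      using LIMSEQ_D[OF L, of "e/4"] e by (auto simp: integral_nonneg)
    obtain N where N: "\<And>n. n \<ge> N \<Longrightarrow> (LINT x|lborel. cmod (s i (x + h n) - s i x)) < e / 4"
      using LIMSEQ_D[OF lim(5)[of i], of "e/4"] e by (auto simp: integral_nonneg)
    have "norm ((LINT x|lborel. cmod (f (x + h n) - f x)) - 0) < e" if "n \<ge> N" for n
    proof -
      have id: "integrable lborel (\<lambda>x. cmod (s i x - f x))" using fi si by simp
      have id2: "integrable lborel (\<lambda>x. cmod (s i (x + h n) - f (x + h n)))" by (rule integrable_translate[OF id])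
      have id3: "integrable lborel (\<lambda>x. cmod (s i (x + h n) - s i x))"
        by (intro integrable_norm Bochner_Integration.integrable_diff integrable_translate si)
      have "(LINT x|lborel. cmod (f (x + h n) - f x)) \<le>
         (LINT x|lborel. cmod (s i (x + h n) - f (x + h n)) + cmod (s i (x + h n) - s i x) + cmod (s i x - f x))"
      proof (rule integral_mono)
        show "integrable lborel (\<lambda>x. cmod (f (x + h n) - f x))"
          by (intro integrable_norm Bochner_Integration.integrable_diff integrable_translate fi)
        show "cmod (f (x + h n) - f x) \<le> cmod (s i (x + h n) - f (x + h n)) + cmod (s i (x + h n) - s i x) + cmod (s i x - f x)" for x
          by norm
      qed (use id id2 id3 in auto)
      also have "\<dots> = (LINT x|lborel. cmod (s i x - f x)) + (LINT x|lborel. cmod (s i (x + h n) - s i x)) + (LINT x|lborel. cmod (s i x - f x))"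
        using id id2 id3 integral_translate[of "\<lambda>x. cmod (s i x - f x)" "h n"] by simp
      also have "\<dots> < e" using i N[OF that] e by simp
      finally show ?thesis by (simp add: integral_nonneg)
    qed
    then show "\<exists>no. \<forall>n\<ge>no. norm ((LINT x|lborel. cmod (f (x + h n) - f x)) - 0) < e" by blast
  qed
qed

lemma sqint_translate:
  fixes f :: "'a::euclidean_space \<Rightarrow> complex"
  assumes "sqint lborel f"
  shows "sqint lborel (\<lambda>x. f (x + h))" "l2n lborel (\<lambda>x. f (x + h)) = l2n lborel f"
proof -
  have [measurable]: "f \<in> borel_measurable borel" using assms by (simp add: sqint_def)
  show "sqint lborel (\<lambda>x. f (x + h))"
    using integrable_translate[OF sqint_integrable[OF assms], of h] by (simp add: sqint_def)
  show "l2n lborel (\<lambda>x. f (x + h)) = l2n lborel f"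
    unfolding l2n_def using integral_translate[of "\<lambda>x. (cmod (f x))\<^sup>2" h] by simp
qed

text \<open>The convolution of \<open>g\<close> with its reflected conjugate: its Fourier transform
  is the power spectrum of \<open>g\<close>, and its value at 0 is the squared norm.\<close>

definition autocorr :: "('a::euclidean_space \<Rightarrow> complex) \<Rightarrow> 'a \<Rightarrow> complex" where
  "autocorr g h = (LINT s|lborel. g (s + h) * cnj (g s))"

text \<open>For bounded \<open>g\<close> this is continuity of translations in mean. In general
  \<open>g\<close> is cut off at height \<open>M\<close>: what is removed is small in mean square,
  hence contributes little by Cauchy-Schwarz uniformly in the translation, and what remains costs a
  factor \<open>M\<close> on the mean translation error.\<close>

lemma autocorr_isCont_0:
  fixes g :: "'a::euclidean_space \<Rightarrow> complex"
  assumes gi: "integrable lborel g" and g2: "sqint lborel g"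
  shows "isCont (autocorr g) 0"
  unfolding continuous_at_sequentially comp_def
proof (intro allI impI, goal_cases)
  case (1 h)
  have [measurable]: "g \<in> borel_measurable borel" using gi by auto
  define gM where "gM M s = (if cmod (g s) \<le> real M then g s else 0)" for M s
  have [measurable]: "gM M \<in> borel_measurable borel" for M unfolding gM_def[abs_def] by measurable
  have gM2: "sqint lborel (gM M)" for M
    by (rule sqint_bound[OF g2]) (auto simp: gM_def)
  have lim: "(\<lambda>M. l2n lborel (\<lambda>s. g s - gM M s)) \<longlonglongrightarrow> 0"
  proof -
    have "(\<lambda>M. LINT s|lborel. (cmod (g s - gM M s))\<^sup>2) \<longlonglongrightarrow> (LINT s::'a|lborel. 0)"
    proof (rule integral_dominated_convergence[OF _ _ sqint_integrable[OF g2]])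
      show "AE s in lborel. (\<lambda>M. (cmod (g s - gM M s))\<^sup>2) \<longlonglongrightarrow> 0"
      proof (rule AE_I2)
        fix s :: 'a
        obtain N where "cmod (g s) \<le> real N" using real_arch_simple by blast
        then have "\<forall>\<^sub>F M in sequentially. (cmod (g s - gM M s))\<^sup>2 = 0"
          by (intro eventually_sequentiallyI[of N]) (auto simp: gM_def)
        then show "(\<lambda>M. (cmod (g s - gM M s))\<^sup>2) \<longlonglongrightarrow> 0" by (rule tendsto_eventually)
      qed
      show "AE s in lborel. norm ((cmod (g s - gM M s))\<^sup>2) \<le> (cmod (g s))\<^sup>2" for M
        by (intro AE_I2) (auto simp: gM_def)
    qed auto
    then have "(\<lambda>M. sqrt (LINT s|lborel. (cmod (g s - gM M s))\<^sup>2)) \<longlonglongrightarrow> sqrt 0"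
      by (intro tendsto_real_sqrt) simp
    then show ?thesis by (simp add: l2n_def)
  qed
  have bound: "cmod (autocorr g (h n) - autocorr g 0) \<le> 2 * l2n lborel g * l2n lborel (\<lambda>s. g s - gM M s)
      + real M * (LINT s|lborel. cmod (g (s + h n) - g s))" for n M
  proof -
    have t2: "sqint lborel (\<lambda>s. g (s + h n))" by (rule sqint_translate[OF g2])
    have d2: "sqint lborel (\<lambda>s. g (s + h n) - g s)" by (rule sqint_diff[OF t2 g2])
    have m2: "sqint lborel (\<lambda>s. g s - gM M s)" by (rule sqint_diff[OF g2 gM2])
    have "autocorr g (h n) - autocorr g 0 = (LINT s|lborel. (g (s + h n) - g s) * cnj (g s))"
      unfolding autocorr_def using sqint_mult[OF t2 sqint_cnj[OF g2]] sqint_mult[OF g2 sqint_cnj[OF g2]]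
      by (simp add: left_diff_distrib)
    also have "\<dots> = (LINT s|lborel. (g (s + h n) - g s) * cnj (g s - gM M s) + (g (s + h n) - g s) * cnj (gM M s))"
      by (intro Bochner_Integration.integral_cong refl) (simp add: algebra_simps)
    also have "\<dots> = (LINT s|lborel. (g (s + h n) - g s) * cnj (g s - gM M s)) + (LINT s|lborel. (g (s + h n) - g s) * cnj (gM M s))"
      by (intro Bochner_Integration.integral_add sqint_mult sqint_cnj d2 m2 gM2)
    finally have "cmod (autocorr g (h n) - autocorr g 0) \<le> cmod (LINT s|lborel. (g (s + h n) - g s) * cnj (g s - gM M s))
       + cmod (LINT s|lborel. (g (s + h n) - g s) * cnj (gM M s))"
      by (simp only: norm_triangle_ineq)
    moreover have "cmod (LINT s|lborel. (g (s + h n) - g s) * cnj (g s - gM M s)) \<le> 2 * l2n lborel g * l2n lborel (\<lambda>s. g s - gM M s)"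
    proof -
      have "cmod (LINT s|lborel. (g (s + h n) - g s) * cnj (g s - gM M s)) \<le> l2n lborel (\<lambda>s. g (s + h n) - g s) * l2n lborel (\<lambda>s. cnj (g s - gM M s))"
        by (rule l2_Cauchy_Schwarz[OF d2 sqint_cnj[OF m2]])
      also have "\<dots> \<le> (2 * l2n lborel g) * l2n lborel (\<lambda>s. g s - gM M s)"
        using l2n_triangle[OF t2 sqint_cmult[OF g2, of "-1"]] sqint_translate(2)[OF g2, of "h n"] l2n_cmult[of lborel "-1" g]
        unfolding l2n_cnj by (intro mult_right_mono l2n_nonneg) auto
      finally show ?thesis .
    qed
    moreover have "cmod (LINT s|lborel. (g (s + h n) - g s) * cnj (gM M s)) \<le> real M * (LINT s|lborel. cmod (g (s + h n) - g s))"
    proof -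
      have "cmod (LINT s|lborel. (g (s + h n) - g s) * cnj (gM M s)) \<le> (LINT s|lborel. cmod ((g (s + h n) - g s) * cnj (gM M s)))"
        by (rule integral_norm_bound)
      also have "\<dots> \<le> (LINT s|lborel. real M * cmod (g (s + h n) - g s))"
      proof (rule integral_mono)
        show "integrable lborel (\<lambda>s. cmod ((g (s + h n) - g s) * cnj (gM M s)))"
          by (intro integrable_norm sqint_mult d2 sqint_cnj gM2)
        show "integrable lborel (\<lambda>s. real M * cmod (g (s + h n) - g s))"
          by (intro integrable_mult_right integrable_norm Bochner_Integration.integrable_diff integrable_translate gi)
        show "cmod ((g (s + h n) - g s) * cnj (gM M s)) \<le> real M * cmod (g (s + h n) - g s)" for s
          unfolding norm_mult complex_mod_cnj mult.commute[of "real M"] by (intro mult_left_mono) (auto simp: gM_def)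
      qed
      finally show ?thesis by simp
    qed
    ultimately show ?thesis by linarith
  qed
  show ?case
  proof (rule LIMSEQ_I)
    fix e :: real assume e: "e > 0"
    have "(\<lambda>M. 2 * l2n lborel g * l2n lborel (\<lambda>s. g s - gM M s)) \<longlonglongrightarrow> 2 * l2n lborel g * 0"
      by (intro tendsto_mult_left lim)
    then have "\<forall>\<^sub>F M in sequentially. 2 * l2n lborel g * l2n lborel (\<lambda>s. g s - gM M s) < e/2"
      using e by (intro order_tendstoD(2)) auto
    then obtain M where M: "2 * l2n lborel g * l2n lborel (\<lambda>s. g s - gM M s) < e/2"
      unfolding eventually_sequentially by blast
    have "(\<lambda>n. real M * (LINT s|lborel. cmod (g (s + h n) - g s))) \<longlonglongrightarrow> real M * 0"
      using 1 by (intro tendsto_mult_left L1_translate_tendsto gi)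
    then have "\<forall>\<^sub>F n in sequentially. real M * (LINT s|lborel. cmod (g (s + h n) - g s)) < e/2"
      using e by (intro order_tendstoD(2)) auto
    then obtain N where N: "\<And>n. n \<ge> N \<Longrightarrow> real M * (LINT s|lborel. cmod (g (s + h n) - g s)) < e/2"
      unfolding eventually_sequentially by blast
    have "norm (autocorr g (h n) - autocorr g 0) < e" if "n \<ge> N" for n
      using bound[of n M] M N[OF that] by simp
    then show "\<exists>no. \<forall>n\<ge>no. norm (autocorr g (h n) - autocorr g 0) < e" by blast
  qed
qed

lemma autocorr_integrable_ft:
  fixes g :: "'a::euclidean_space \<Rightarrow> complex"
  assumes gi: "integrable lborel g"
  shows "integrable lborel (autocorr g)" "ft (autocorr g) k = complex_of_real ((cmod (ft g k))\<^sup>2)"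
proof -
  have [measurable]: "g \<in> borel_measurable borel" using gi by auto
  have I: "integrable (lborel \<Otimes>\<^sub>M lborel) (\<lambda>(s, h). g (s + h) * cnj (g s))"
  proof (rule lborel_pair.Fubini_integrable)
    show "AE s in lborel. integrable lborel (\<lambda>h. case (s, h) of (s, h) \<Rightarrow> g (s + h) * cnj (g s))"
      using integrable_translate[OF gi] by (intro AE_I2) (simp add: add.commute)
    have "(LINT h|lborel. norm (case (s, h) of (s, h) \<Rightarrow> g (s + h) * cnj (g s))) = (LINT h|lborel. cmod (g h)) * cmod (g s)" for s
      using integral_translate[of "\<lambda>h. cmod (g h)" s] by (simp add: norm_mult add.commute)
    then show "integrable lborel (\<lambda>s. LINT h|lborel. norm (case (s, h) of (s, h) \<Rightarrow> g (s + h) * cnj (g s)))"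
      using gi by simp
  qed measurable
  show "integrable lborel (autocorr g)"
    unfolding autocorr_def[abs_def] by (rule lborel_pair.integrable_snd[OF I])
  have I2: "integrable (lborel \<Otimes>\<^sub>M lborel) (\<lambda>(s, h). exp (- (\<i> * complex_of_real (k \<bullet> h))) * (g (s + h) * cnj (g s)))"
    by (rule Bochner_Integration.integrable_bound[OF I]) (auto simp: norm_mult)
  have "ft (autocorr g) k = (LINT h|lborel. (LINT s|lborel. exp (- (\<i> * complex_of_real (k \<bullet> h))) * (g (s + h) * cnj (g s))))"
    unfolding ft_def autocorr_def by simp
  also have "\<dots> = (LINT s|lborel. (LINT h|lborel. exp (- (\<i> * complex_of_real (k \<bullet> h))) * (g (s + h) * cnj (g s))))"
    by (rule lborel_pair.Fubini_integral[OF I2])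
  also have "\<dots> = (LINT s|lborel. ft g k * cnj (exp (- (\<i> * complex_of_real (k \<bullet> s))) * g s))"
  proof (intro Bochner_Integration.integral_cong refl)
    fix s
    have "(LINT h|lborel. exp (- (\<i> * complex_of_real (k \<bullet> h))) * (g (s + h) * cnj (g s))) =
      (LINT h|lborel. (exp (- (\<i> * complex_of_real (k \<bullet> (h + s)))) * g (h + s)) * cnj (exp (- (\<i> * complex_of_real (k \<bullet> s))) * g s))"
    proof (intro Bochner_Integration.integral_cong refl)
      fix h
      have "exp (- (\<i> * complex_of_real (k \<bullet> h))) = exp (- (\<i> * complex_of_real (k \<bullet> (h + s)))) * cnj (exp (- (\<i> * complex_of_real (k \<bullet> s))))"
        unfolding exp_cnj exp_add[symmetric] by (simp add: inner_add_right ring_distribs)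
      then show "exp (- (\<i> * complex_of_real (k \<bullet> h))) * (g (s + h) * cnj (g s)) =
        (exp (- (\<i> * complex_of_real (k \<bullet> (h + s)))) * g (h + s)) * cnj (exp (- (\<i> * complex_of_real (k \<bullet> s))) * g s)"
        by (simp add: add.commute)
    qed
    also have "\<dots> = (LINT h|lborel. exp (- (\<i> * complex_of_real (k \<bullet> (h + s)))) * g (h + s)) * cnj (exp (- (\<i> * complex_of_real (k \<bullet> s))) * g s)"
      using integrable_translate[OF ft_integrand_integrable[OF gi], of k s] by simp
    also have "(LINT h|lborel. exp (- (\<i> * complex_of_real (k \<bullet> (h + s)))) * g (h + s)) = ft g k"
      unfolding ft_def by (rule integral_translate[of "\<lambda>h. exp (- (\<i> * complex_of_real (k \<bullet> h))) * g h" s]) simp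
    finally show "(LINT h|lborel. exp (- (\<i> * complex_of_real (k \<bullet> h))) * (g (s + h) * cnj (g s))) = ft g k * cnj (exp (- (\<i> * complex_of_real (k \<bullet> s))) * g s)" .
  qed
  also have "\<dots> = ft g k * (LINT s|lborel. cnj (exp (- (\<i> * complex_of_real (k \<bullet> s))) * g s))"
    by (simp add: ft_integrand_integrable[OF gi] del: complex_cnj_mult)
  also have "\<dots> = ft g k * cnj (ft g k)"
    unfolding ft_def by (subst integral_bounded_linear[OF bounded_linear_cnj ft_integrand_integrable[OF gi]]) simp
  finally show "ft (autocorr g) k = complex_of_real ((cmod (ft g k))\<^sup>2)"
    by (simp add: complex_norm_square[symmetric])
qed

text \<open>\<open>ft_gauss_mult\<close> is applied to the autocorrelation at the point 0. The
  damped integrals of \<open>(cmod (ft g k))\<^sup>2\<close> increase to the left side by monotone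
  convergence, which presupposes no integrability of the limit, and tend to
  \<open>(2 * pi) ^ DIM('a)\<close> times \<open>autocorr g 0\<close> by the approximate
  identity.\<close>

theorem plancherel:
  fixes g :: "'a::euclidean_space \<Rightarrow> complex"
  assumes gi: "integrable lborel g" and g2: "sqint lborel g"
  shows "(\<integral>\<^sup>+k. ennreal ((cmod (ft g k))\<^sup>2) \<partial>lborel) = ennreal ((2 * pi) ^ DIM('a)) * (\<integral>\<^sup>+s. ennreal ((cmod (g s))\<^sup>2) \<partial>lborel)"
proof (rule LIMSEQ_unique)
  have [measurable]: "g \<in> borel_measurable borel" using gi by auto
  define e where "e n = 1 / real (Suc n)" for n
  have e: "e \<longlonglongrightarrow> 0" "\<And>n. e n > 0" unfolding e_def by (real_asymp, simp)
  define E where "E n k = exp (- ((e n)\<^sup>2 / 2) * (k \<bullet> k))" for n and k :: 'a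
  have [measurable]: "E n \<in> borel_measurable borel" for n unfolding E_def[abs_def] by measurable
  define I where "I n = (\<integral>\<^sup>+k. ennreal ((cmod (ft g k))\<^sup>2 * E n k) \<partial>lborel)" for n
  have inc: "incseq (\<lambda>n k. ennreal ((cmod (ft g k))\<^sup>2 * E n k))"
  proof (intro incseq_SucI le_funI ennreal_leI mult_left_mono)
    fix n and k :: 'a
    have "(e (Suc n))\<^sup>2 \<le> (e n)\<^sup>2" by (intro power_mono) (auto simp: e_def frac_le)
    then have "((e (Suc n))\<^sup>2 / 2) * (k \<bullet> k) \<le> ((e n)\<^sup>2 / 2) * (k \<bullet> k)" by (intro mult_right_mono) auto
    then show "E n k \<le> E (Suc n) k" unfolding E_def by simp
  qed simp
  have sup: "(\<lambda>n. ennreal ((cmod (ft g k))\<^sup>2 * E n k)) \<longlonglongrightarrow> ennreal ((cmod (ft g k))\<^sup>2)" for k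
  proof -
    have "(\<lambda>n. ennreal ((cmod (ft g k))\<^sup>2 * E n k)) \<longlonglongrightarrow> ennreal ((cmod (ft g k))\<^sup>2 * exp (- (0\<^sup>2 / 2) * (k \<bullet> k)))"
      unfolding E_def by (intro tendsto_intros e) auto
    then show ?thesis by simp
  qed
  show "I \<longlonglongrightarrow> (\<integral>\<^sup>+k. ennreal ((cmod (ft g k))\<^sup>2) \<partial>lborel)"
    unfolding I_def by (rule nn_integral_LIMSEQ[OF inc _ sup]) auto
  have Ei: "integrable lborel (E n)" for n
    using gauss_real[of "(e n)\<^sup>2 / 2" "0::'a"] e(2)[of n] unfolding E_def by (simp add: has_bochner_integral_iff)
  have Ii: "integrable lborel (\<lambda>k. (cmod (ft g k))\<^sup>2 * E n k)" for n
  proof (rule Bochner_Integration.integrable_bound)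
    show "integrable lborel (\<lambda>k. (LINT s|lborel. cmod (g s))\<^sup>2 * E n k)" using Ei by simp
    show "AE k in lborel. norm ((cmod (ft g k))\<^sup>2 * E n k) \<le> norm ((LINT s|lborel. cmod (g s))\<^sup>2 * E n k)"
      using norm_ft_le[OF gi] by (intro AE_I2) (auto simp: norm_mult E_def intro!: mult_right_mono power_mono)
  qed auto
  note ac = autocorr_integrable_ft[OF gi]
  have Iv: "I n = ennreal (Re (complex_of_real (sqrt (2 * pi) ^ DIM('a)) * (LINT r|lborel. autocorr g (0 + e n *\<^sub>R r) * complex_of_real (exp (- (r \<bullet> r) / 2)))))" for n
  proof -
    have "I n = ennreal (LINT k|lborel. (cmod (ft g k))\<^sup>2 * E n k)"
      unfolding I_def using Ii by (intro nn_integral_eq_integral) (auto simp: E_def)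
    also have "(LINT k|lborel. (cmod (ft g k))\<^sup>2 * E n k) = Re (LINT k|lborel. complex_of_real ((cmod (ft g k))\<^sup>2 * E n k))"
      by (simp only: integral_complex_of_real Re_complex_of_real)
    also have "(LINT k|lborel. complex_of_real ((cmod (ft g k))\<^sup>2 * E n k)) =
      (LINT k|lborel. ft (autocorr g) k * (exp (\<i> * complex_of_real (k \<bullet> 0)) * complex_of_real (exp (- ((e n)\<^sup>2 / 2) * (k \<bullet> k)))))"
      unfolding ac(2) E_def by simp
    finally show ?thesis unfolding ft_gauss_mult[OF ac(1) e(2)] .
  qed
  have a0: "autocorr g 0 = complex_of_real (LINT s|lborel. (cmod (g s))\<^sup>2)"
    unfolding autocorr_def by (simp add: complex_norm_square[symmetric] flip: integral_complex_of_real)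
  have bd: "cmod (autocorr g h) \<le> (l2n lborel g)\<^sup>2" for h
    using l2_Cauchy_Schwarz[OF sqint_translate(1)[OF g2, of h] sqint_cnj[OF g2]]
    unfolding autocorr_def l2n_cnj sqint_translate(2)[OF g2] by (simp add: power2_eq_square)
  have "(\<lambda>n. Re (complex_of_real (sqrt (2 * pi) ^ DIM('a)) * (LINT r|lborel. autocorr g (0 + e n *\<^sub>R r) * complex_of_real (exp (- (r \<bullet> r) / 2)))))
    \<longlonglongrightarrow> Re (complex_of_real (sqrt (2 * pi) ^ DIM('a)) * (complex_of_real (sqrt (2 * pi) ^ DIM('a)) * autocorr g 0))"
    using ac(1) by (intro tendsto_Re tendsto_mult_left gauss_limit[where B="(l2n lborel g)\<^sup>2"] e bd autocorr_isCont_0[OF gi g2]) auto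
  also have "complex_of_real (sqrt (2 * pi) ^ DIM('a)) * (complex_of_real (sqrt (2 * pi) ^ DIM('a)) * autocorr g 0) = complex_of_real ((2 * pi) ^ DIM('a)) * autocorr g 0"
    unfolding mult.assoc[symmetric] of_real_mult[symmetric] power_mult_distrib[symmetric] by simp
  finally have "I \<longlonglongrightarrow> ennreal (Re (complex_of_real ((2 * pi) ^ DIM('a)) * autocorr g 0))"
    unfolding Iv by (rule tendsto_ennrealI)
  also have "Re (complex_of_real ((2 * pi) ^ DIM('a)) * autocorr g 0) = (2 * pi) ^ DIM('a) * (l2n lborel g)\<^sup>2"
    unfolding a0 l2n_square by (simp only: of_real_mult[symmetric] Re_complex_of_real)
  also have "ennreal \<dots> = ennreal ((2 * pi) ^ DIM('a)) * (\<integral>\<^sup>+s. ennreal ((cmod (g s))\<^sup>2) \<partial>lborel)"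
    unfolding sqint_nn_eq[OF g2] by (simp add: ennreal_mult)
  finally show "I \<longlonglongrightarrow> ennreal ((2 * pi) ^ DIM('a)) * (\<integral>\<^sup>+s. ennreal ((cmod (g s))\<^sup>2) \<partial>lborel)" .
qed

section \<open>Partial Fourier transform\<close>

lemma nn_integral_lborel_pair:
  fixes h :: "'a::euclidean_space \<times> 'b::euclidean_space \<Rightarrow> ennreal"
  assumes [measurable]: "h \<in> borel_measurable borel"
  shows "(\<integral>\<^sup>+p. h p \<partial>lborel) = (\<integral>\<^sup>+x. \<integral>\<^sup>+y. h (x, y) \<partial>lborel \<partial>lborel)"
    and "(\<integral>\<^sup>+p. h p \<partial>lborel) = (\<integral>\<^sup>+y. \<integral>\<^sup>+x. h (x, y) \<partial>lborel \<partial>lborel)"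
proof -
  have [measurable]: "h \<in> borel_measurable (lborel \<Otimes>\<^sub>M lborel)" by (simp add: lborel_prod)
  show "(\<integral>\<^sup>+p. h p \<partial>lborel) = (\<integral>\<^sup>+x. \<integral>\<^sup>+y. h (x, y) \<partial>lborel \<partial>lborel)"
    unfolding lborel_prod[symmetric] by (rule lborel.nn_integral_fst[symmetric]) simp
  show "(\<integral>\<^sup>+p. h p \<partial>lborel) = (\<integral>\<^sup>+y. \<integral>\<^sup>+x. h (x, y) \<partial>lborel \<partial>lborel)"
    unfolding lborel_prod[symmetric] by (rule lborel_pair.nn_integral_snd[symmetric]) simp
qed

lemma integral_lborel_pair:
  fixes h :: "'a::euclidean_space \<times> 'b::euclidean_space \<Rightarrow> 'c::{banach,second_countable_topology}"
  assumes "integrable lborel h"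
  shows "(LINT p|lborel. h p) = (LINT x|lborel. (LINT y|lborel. h (x, y)))"
    and "(LINT p|lborel. h p) = (LINT y|lborel. (LINT x|lborel. h (x, y)))"
    and "AE x in lborel. integrable lborel (\<lambda>y. h (x, y))"
    and "AE y in lborel. integrable lborel (\<lambda>x. h (x, y))"
proof -
  have i: "integrable (lborel \<Otimes>\<^sub>M lborel) h" using assms by (simp add: lborel_prod)
  then have i2: "integrable (lborel \<Otimes>\<^sub>M lborel) (\<lambda>(x, y). h (x, y))" by (simp add: case_prod_unfold)
  show "(LINT p|lborel. h p) = (LINT x|lborel. (LINT y|lborel. h (x, y)))"
    unfolding lborel_prod[symmetric] using lborel_pair.integral_fst[OF i2] by (simp add: case_prod_unfold)
  show "(LINT p|lborel. h p) = (LINT y|lborel. (LINT x|lborel. h (x, y)))"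
    unfolding lborel_prod[symmetric] using lborel_pair.integral_snd[OF i2] by (simp add: case_prod_unfold)
  show "AE x in lborel. integrable lborel (\<lambda>y. h (x, y))" by (rule lborel_pair.AE_integrable_fst[OF i2])
  show "AE y in lborel. integrable lborel (\<lambda>x. h (x, y))" by (rule lborel_pair.AE_integrable_snd[OF i2])
qed

lemma sqint_fibre:
  fixes f :: "'a::euclidean_space \<times> 'b::euclidean_space \<Rightarrow> complex"
  assumes "sqint lborel f"
  shows "AE x in lborel. sqint lborel (\<lambda>y. f (x, y))" "AE y in lborel. sqint lborel (\<lambda>x. f (x, y))"
proof -
  have [measurable]: "f \<in> borel_measurable borel" using assms by (simp add: sqint_def)
  have [measurable]: "f \<in> borel_measurable (lborel \<Otimes>\<^sub>M lborel)" by (simp add: lborel_prod)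
  note i = integral_lborel_pair(3,4)[OF sqint_integrable[OF assms]]
  show "AE x in lborel. sqint lborel (\<lambda>y. f (x, y))"
    using i(1) by eventually_elim (simp add: sqint_def)
  show "AE y in lborel. sqint lborel (\<lambda>x. f (x, y))"
    using i(2) by eventually_elim (simp add: sqint_def)
qed

lemma lborel_real_reflect_nn:
  assumes [measurable]: "h \<in> borel_measurable borel" and s: "\<sigma> = 1 \<or> \<sigma> = (-1::real)"
  shows "(\<integral>\<^sup>+l. h (\<sigma> * l) \<partial>lborel) = (\<integral>\<^sup>+l. h l \<partial>lborel)"
  using s nn_integral_real_affine[of h "-1" 0] by auto

text \<open>The sign \<open>\<sigma>\<close> is 1 for the transform in the statement and -1 for its
  adjoint, so that both share one development.\<close>

definition pft :: "real \<Rightarrow> ('v::euclidean_space \<times> real \<Rightarrow> complex) \<Rightarrow> 'v \<times> real \<Rightarrow> complex" where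
  "pft \<sigma> f p = (LINT \<xi>|lborel. exp (\<i> * complex_of_real (\<sigma> * snd p * \<xi>)) * f (fst p, \<xi>))"

text \<open>The condition under which the integral in \<open>pft\<close> is a genuine one, and not
  the default value 0, on almost every fibre.\<close>

definition fibre_integrable :: "('v::euclidean_space \<times> real \<Rightarrow> complex) \<Rightarrow> bool" where
  "fibre_integrable f \<longleftrightarrow> (AE v in lborel. integrable lborel (\<lambda>\<xi>. f (v, \<xi>)))"

lemma pft_eq_ft: "pft \<sigma> f (v, l) = ft (\<lambda>\<xi>. f (v, \<xi>)) (- (\<sigma> * l))"
  by (simp add: pft_def ft_def)

lemma pft_integrand_integrable:
  assumes "integrable lborel (\<lambda>\<xi>. f (v, \<xi>))"
  shows "integrable lborel (\<lambda>\<xi>. exp (\<i> * complex_of_real (\<sigma> * l * \<xi>)) * f (v, \<xi>))"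
  using ft_integrand_integrable[OF assms, of "- (\<sigma> * l)"] by simp

lemma pft_measurable [measurable]:
  assumes [measurable]: "f \<in> borel_measurable borel"
  shows "pft \<sigma> f \<in> borel_measurable borel"
proof -
  have [measurable]: "f \<in> borel_measurable (lborel \<Otimes>\<^sub>M lborel)" by (simp add: lborel_prod)
  have "(\<lambda>p. LINT \<xi>|lborel. exp (\<i> * complex_of_real (\<sigma> * snd p * \<xi>)) * f (fst p, \<xi>)) \<in> borel_measurable (lborel \<Otimes>\<^sub>M lborel)"
    by measurable
  then show ?thesis unfolding pft_def[abs_def] by (simp add: lborel_prod)
qed

text \<open>Tonelli reduces this to one-dimensional Plancherel on almost every fibre, so the
  constant is \<open>2 * pi\<close> whatever the dimension of the remaining variables.\<close>

lemma pft_nn_norm: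
  fixes f :: "'v::euclidean_space \<times> real \<Rightarrow> complex"
  assumes f: "sqint lborel f" "fibre_integrable f" and s: "\<sigma> = 1 \<or> \<sigma> = -1"
  shows "(\<integral>\<^sup>+p. ennreal ((cmod (pft \<sigma> f p))\<^sup>2) \<partial>lborel) = ennreal (2 * pi) * (\<integral>\<^sup>+p. ennreal ((cmod (f p))\<^sup>2) \<partial>lborel)"
proof -
  have [measurable]: "f \<in> borel_measurable borel" using f by (simp add: sqint_def)
  have [measurable]: "f \<in> borel_measurable (lborel \<Otimes>\<^sub>M lborel)" by (simp add: lborel_prod)
  have "(\<integral>\<^sup>+p. ennreal ((cmod (pft \<sigma> f p))\<^sup>2) \<partial>lborel) = (\<integral>\<^sup>+v. \<integral>\<^sup>+l. ennreal ((cmod (pft \<sigma> f (v, l)))\<^sup>2) \<partial>lborel \<partial>lborel)"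
    by (rule nn_integral_lborel_pair) simp
  also have "\<dots> = (\<integral>\<^sup>+v. ennreal (2 * pi) * (\<integral>\<^sup>+\<xi>. ennreal ((cmod (f (v, \<xi>)))\<^sup>2) \<partial>lborel) \<partial>lborel)"
  proof (rule nn_integral_cong_AE)
    show "AE v in lborel. (\<integral>\<^sup>+l. ennreal ((cmod (pft \<sigma> f (v, l)))\<^sup>2) \<partial>lborel) = ennreal (2 * pi) * (\<integral>\<^sup>+\<xi>. ennreal ((cmod (f (v, \<xi>)))\<^sup>2) \<partial>lborel)"
      using f(2)[unfolded fibre_integrable_def] sqint_fibre(1)[OF f(1)]
    proof eventually_elim
      case (elim v)
      have s': "- \<sigma> = 1 \<or> - \<sigma> = -1" using s by auto
      have "(\<integral>\<^sup>+l. ennreal ((cmod (pft \<sigma> f (v, l)))\<^sup>2) \<partial>lborel) = (\<integral>\<^sup>+l. ennreal ((cmod (ft (\<lambda>\<xi>. f (v, \<xi>)) l))\<^sup>2) \<partial>lborel)"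
        unfolding pft_eq_ft using lborel_real_reflect_nn[OF _ s', of "\<lambda>l. ennreal ((cmod (ft (\<lambda>\<xi>. f (v, \<xi>)) l))\<^sup>2)"] by simp
      also have "\<dots> = ennreal (2 * pi) * (\<integral>\<^sup>+\<xi>. ennreal ((cmod (f (v, \<xi>)))\<^sup>2) \<partial>lborel)"
        using plancherel[OF elim] by simp
      finally show ?case .
    qed
  qed
  also have "\<dots> = ennreal (2 * pi) * (\<integral>\<^sup>+p. ennreal ((cmod (f p))\<^sup>2) \<partial>lborel)"
    by (subst nn_integral_cmult) (auto simp: nn_integral_lborel_pair(1)[of "\<lambda>p. ennreal ((cmod (f p))\<^sup>2)"])
  finally show ?thesis .
qed

lemma pft_sqint:
  fixes f :: "'v::euclidean_space \<times> real \<Rightarrow> complex"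
  assumes f: "sqint lborel f" "fibre_integrable f" and s: "\<sigma> = 1 \<or> \<sigma> = -1"
  shows "sqint lborel (pft \<sigma> f)" "l2n lborel (pft \<sigma> f) = sqrt (2 * pi) * l2n lborel f"
proof -
  have [measurable]: "f \<in> borel_measurable borel" using f by (simp add: sqint_def)
  show 1: "sqint lborel (pft \<sigma> f)"
    using f(1) unfolding sqint_iff_nn pft_nn_norm[OF assms] by (auto simp: ennreal_mult_less_top)
  have "ennreal ((l2n lborel (pft \<sigma> f))\<^sup>2) = ennreal (2 * pi * (l2n lborel f)\<^sup>2)"
    using pft_nn_norm[OF assms] unfolding sqint_nn_eq[OF 1] sqint_nn_eq[OF f(1)] by (simp add: ennreal_mult)
  then have "(l2n lborel (pft \<sigma> f))\<^sup>2 = 2 * pi * (l2n lborel f)\<^sup>2" by simp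
  then have "sqrt ((l2n lborel (pft \<sigma> f))\<^sup>2) = sqrt (2 * pi * (l2n lborel f)\<^sup>2)" by simp
  then show "l2n lborel (pft \<sigma> f) = sqrt (2 * pi) * l2n lborel f"
    by (simp add: real_sqrt_mult l2n_nonneg)
qed

lemma fibre_integrable_diff:
  "fibre_integrable f \<Longrightarrow> fibre_integrable g \<Longrightarrow> fibre_integrable (\<lambda>p. f p - g p)"
  unfolding fibre_integrable_def by (auto elim!: eventually_elim2)

lemma fibre_integrable_cmult:
  "fibre_integrable f \<Longrightarrow> fibre_integrable (\<lambda>p. c * f p)"
  unfolding fibre_integrable_def by (auto elim!: eventually_mono)

lemma AE_lborel_fstI:
  fixes P :: "'a::euclidean_space \<Rightarrow> bool"
  assumes "AE x in lborel. P x"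
  shows "AE p in (lborel :: ('a \<times> 'b::euclidean_space) measure). P (fst p)"
proof -
  obtain N where N: "{x. \<not> P x} \<subseteq> N" "emeasure lborel N = 0" "N \<in> sets lborel"
    using assms by (elim AE_E) auto
  show ?thesis
  proof (rule AE_I)
    show "{p \<in> space lborel. \<not> P (fst p)} \<subseteq> N \<times> UNIV" using N by auto
    show "N \<times> UNIV \<in> sets (lborel :: ('a \<times> 'b) measure)"
      unfolding lborel_prod[symmetric] using N by (intro pair_measureI) auto
    show "emeasure (lborel :: ('a \<times> 'b) measure) (N \<times> UNIV) = 0"
      unfolding lborel_prod[symmetric] using N by (subst lborel.emeasure_pair_measure_Times) auto
  qed
qed

lemma pft_add_AE:
  fixes f g :: "'v::euclidean_space \<times> real \<Rightarrow> complex"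
  assumes "fibre_integrable f" "fibre_integrable g"
  shows "AE p in lborel. pft \<sigma> (\<lambda>p. f p + g p) p = pft \<sigma> f p + pft \<sigma> g p"
  using AE_lborel_fstI[where 'b=real, OF assms(1)[unfolded fibre_integrable_def]]
    AE_lborel_fstI[where 'b=real, OF assms(2)[unfolded fibre_integrable_def]]
proof eventually_elim
  case (elim p)
  then show ?case
    using pft_integrand_integrable[of f "fst p" \<sigma> "snd p"] pft_integrand_integrable[of g "fst p" \<sigma> "snd p"]
    by (simp add: pft_def distrib_left)
qed

lemma pft_cmult: "pft \<sigma> (\<lambda>p. c * f p) p = c * pft \<sigma> f p"
  unfolding pft_def by (subst integral_mult_right_zero[symmetric]) (simp add: mult_ac)

lemma pft_diff_AE:
  fixes f g :: "'v::euclidean_space \<times> real \<Rightarrow> complex"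
  assumes "fibre_integrable f" "fibre_integrable g"
  shows "AE p in lborel. pft \<sigma> (\<lambda>p. f p - g p) p = pft \<sigma> f p - pft \<sigma> g p"
  using pft_add_AE[OF assms(1) fibre_integrable_cmult[OF assms(2), of "-1"], of \<sigma>] pft_cmult[of \<sigma> "-1" g] by simp

lemma l2n_pft_diff:
  fixes f g :: "'v::euclidean_space \<times> real \<Rightarrow> complex"
  assumes "sqint lborel f" "fibre_integrable f" "sqint lborel g" "fibre_integrable g" and s: "\<sigma> = 1 \<or> \<sigma> = -1"
  shows "l2n lborel (\<lambda>p. pft \<sigma> f p - pft \<sigma> g p) = sqrt (2 * pi) * l2n lborel (\<lambda>p. f p - g p)"
proof -
  have [measurable]: "f \<in> borel_measurable borel" "g \<in> borel_measurable borel" using assms by (auto simp: sqint_def)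
  have "l2n lborel (\<lambda>p. pft \<sigma> f p - pft \<sigma> g p) = l2n lborel (pft \<sigma> (\<lambda>p. f p - g p))"
    using pft_diff_AE[OF assms(2,4), of \<sigma>] by (intro l2n_cong_AE) auto
  also have "\<dots> = sqrt (2 * pi) * l2n lborel (\<lambda>p. f p - g p)"
    by (intro pft_sqint sqint_diff fibre_integrable_diff assms)
  finally show ?thesis .
qed

section \<open>Extension of the partial transform to square-integrable functions\<close>

definition trunc :: "nat \<Rightarrow> ('v \<times> real \<Rightarrow> complex) \<Rightarrow> 'v \<times> real \<Rightarrow> complex" where
  "trunc n f p = f p * indicator {- real n..real n} (snd p)"

text \<open>Cutting off in the central variable alone is enough: on a bounded interval a
  square-integrable fibre is integrable, by Cauchy-Schwarz against the indicator.\<close>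

lemma trunc_sqint:
  fixes f :: "'v::euclidean_space \<times> real \<Rightarrow> complex"
  assumes f: "sqint lborel f"
  shows "sqint lborel (trunc n f)" "fibre_integrable (trunc n f)" "(\<lambda>n. l2n lborel (\<lambda>p. trunc n f p - f p)) \<longlonglongrightarrow> 0"
proof -
  have [measurable]: "f \<in> borel_measurable borel" using f by (simp add: sqint_def)
  have [measurable]: "trunc n f \<in> borel_measurable borel" for n
  proof -
    have [measurable]: "(\<lambda>p. indicator {- real n..real n} (snd p) :: complex) \<in> borel_measurable (borel :: ('v \<times> real) measure)"
      unfolding borel_prod[symmetric] by (rule measurable_compose[OF measurable_snd]) simp
    show ?thesis unfolding trunc_def[abs_def] by measurable
  qed
  show "sqint lborel (trunc n f)"
    by (rule sqint_bound[OF f]) (auto simp: trunc_def indicator_def)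
  show "fibre_integrable (trunc n f)"
    unfolding fibre_integrable_def using sqint_fibre(1)[OF f]
  proof eventually_elim
    case (elim v)
    have "sqint lborel (\<lambda>\<xi>::real. indicator {- real n..real n} \<xi> :: complex)"
    proof -
      have "(\<lambda>\<xi>. (cmod (indicator {- real n..real n} \<xi>))\<^sup>2) = indicat_real {- real n..real n}"
        by (auto simp: indicator_def)
      then show ?thesis unfolding sqint_def by (simp add: emeasure_lborel_Icc_eq)
    qed
    from sqint_mult[OF elim this] show ?case by (simp add: trunc_def)
  qed
  have "(\<lambda>n. LINT p|lborel. (cmod (trunc n f p - f p))\<^sup>2) \<longlonglongrightarrow> (LINT p::'v\<times>real|lborel. 0)"
  proof (rule integral_dominated_convergence[OF _ _ sqint_integrable[OF f]])
    show "AE p in lborel. (\<lambda>n. (cmod (trunc n f p - f p))\<^sup>2) \<longlonglongrightarrow> 0"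
    proof (rule AE_I2)
      fix p :: "'v \<times> real"
      obtain N where N: "\<bar>snd p\<bar> \<le> real N" using real_arch_simple by blast
      have "\<forall>\<^sub>F n in sequentially. (cmod (trunc n f p - f p))\<^sup>2 = 0"
        by (intro eventually_sequentiallyI[of N]) (use N in \<open>auto simp: trunc_def indicator_def\<close>)
      then show "(\<lambda>n. (cmod (trunc n f p - f p))\<^sup>2) \<longlonglongrightarrow> 0" by (rule tendsto_eventually)
    qed
    show "AE p in lborel. norm ((cmod (trunc n f p - f p))\<^sup>2) \<le> (cmod (f p))\<^sup>2" for n
      by (intro AE_I2) (auto simp: trunc_def indicator_def)
  qed auto
  from tendsto_real_sqrt[OF this] show "(\<lambda>n. l2n lborel (\<lambda>p. trunc n f p - f p)) \<longlonglongrightarrow> 0" by (simp add: l2n_def)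
qed

lemma l2n_null:
  assumes "\<And>n. l2n M (F n) \<le> g n" "g \<longlonglongrightarrow> 0"
  shows "(\<lambda>n. l2n M (F n)) \<longlonglongrightarrow> 0"
  by (rule Lim_null_comparison[OF always_eventually assms(2)]) (auto simp: abs_of_nonneg[OF l2n_nonneg] assms(1))

text \<open>The extended transform is a relation, since its value is determined only almost
  everywhere; this leaves room to adjust a representative on a null set of frequencies
  later.\<close>

definition isft :: "real \<Rightarrow> ('v::euclidean_space \<times> real \<Rightarrow> complex) \<Rightarrow> ('v \<times> real \<Rightarrow> complex) \<Rightarrow> bool" where
  "isft \<sigma> f G \<longleftrightarrow> sqint lborel f \<and> sqint lborel G \<and> (\<lambda>n. l2n lborel (\<lambda>p. pft \<sigma> (trunc n f) p - G p)) \<longlonglongrightarrow> 0"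

lemma l2_Cauchy_of_convergent:
  assumes "\<And>n. sqint M (F n)" "sqint M f" "(\<lambda>n. l2n M (\<lambda>x. F n x - f x)) \<longlonglongrightarrow> 0" "e > 0"
  shows "\<exists>N. \<forall>m\<ge>N. \<forall>n\<ge>N. l2n M (\<lambda>x. F m x - F n x) < e"
proof -
  obtain N where N: "\<And>n. n \<ge> N \<Longrightarrow> l2n M (\<lambda>x. F n x - f x) < e/2"
    using LIMSEQ_D[OF assms(3), of "e/2"] assms(4) by (auto simp: l2n_nonneg)
  have "l2n M (\<lambda>x. F m x - F n x) < e" if "m \<ge> N" "n \<ge> N" for m n
    using l2n_triangle_diff[OF assms(1)[of m] assms(2) assms(1)[of n]] l2n_minus[of M f "F n"] N[OF that(1)] N[OF that(2)]
    by simp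
  then show ?thesis by blast
qed

lemma isft_exists:
  fixes f :: "'v::euclidean_space \<times> real \<Rightarrow> complex"
  assumes f: "sqint lborel f" and s: "\<sigma> = 1 \<or> \<sigma> = -1"
  obtains G where "isft \<sigma> f G"
proof -
  note t = trunc_sqint[OF f]
  have "\<exists>N. \<forall>m\<ge>N. \<forall>n\<ge>N. l2n lborel (\<lambda>x. pft \<sigma> (trunc m f) x - pft \<sigma> (trunc n f) x) < e" if "e > 0" for e
  proof -
    have "e / sqrt (2 * pi) > 0" using that by simp
    from l2_Cauchy_of_convergent[OF t(1) f t(3) this]
    obtain N where N: "\<forall>m\<ge>N. \<forall>n\<ge>N. l2n lborel (\<lambda>x. trunc m f x - trunc n f x) < e / sqrt (2 * pi)" by blast
    have "l2n lborel (\<lambda>x. pft \<sigma> (trunc m f) x - pft \<sigma> (trunc n f) x) < e" if "m \<ge> N" "n \<ge> N" for m n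
    proof -
      have "l2n lborel (\<lambda>x. trunc m f x - trunc n f x) < e / sqrt (2 * pi)" using N that by blast
      then show ?thesis unfolding l2n_pft_diff[OF t(1,2) t(1,2) s] by (simp add: field_simps)
    qed
    then show ?thesis by blast
  qed
  from l2_complete[OF pft_sqint(1)[OF t(1,2) s] this]
  obtain G where "sqint lborel G" "(\<lambda>n. l2n lborel (\<lambda>x. pft \<sigma> (trunc n f) x - G x)) \<longlonglongrightarrow> 0" by blast
  then show ?thesis using that f by (auto simp: isft_def)
qed

text \<open>Since \<open>pft\<close> multiplies distances by \<open>sqrt (2 * pi)\<close>, any
  approximating sequence with integrable fibres may replace the truncations in the
  definition.\<close>

lemma isft_limI:
  fixes f :: "'v::euclidean_space \<times> real \<Rightarrow> complex"
  assumes f: "sqint lborel f" and F: "\<And>n. sqint lborel (F n)" "\<And>n. fibre_integrable (F n)"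
    and Ff: "(\<lambda>n. l2n lborel (\<lambda>p. F n p - f p)) \<longlonglongrightarrow> 0"
    and G: "sqint lborel G" and FG: "(\<lambda>n. l2n lborel (\<lambda>p. pft \<sigma> (F n) p - G p)) \<longlonglongrightarrow> 0"
    and s: "\<sigma> = 1 \<or> \<sigma> = -1"
  shows "isft \<sigma> f G"
proof -
  note t = trunc_sqint[OF f]
  have le: "l2n lborel (\<lambda>p. pft \<sigma> (trunc n f) p - G p) \<le>
     sqrt (2 * pi) * (l2n lborel (\<lambda>p. trunc n f p - f p) + l2n lborel (\<lambda>p. F n p - f p)) + l2n lborel (\<lambda>p. pft \<sigma> (F n) p - G p)" for n
  proof -
    have "l2n lborel (\<lambda>p. pft \<sigma> (trunc n f) p - G p) \<le> l2n lborel (\<lambda>p. pft \<sigma> (trunc n f) p - pft \<sigma> (F n) p) + l2n lborel (\<lambda>p. pft \<sigma> (F n) p - G p)"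
      by (intro l2n_triangle_diff pft_sqint t F G s)
    also have "l2n lborel (\<lambda>p. pft \<sigma> (trunc n f) p - pft \<sigma> (F n) p) = sqrt (2 * pi) * l2n lborel (\<lambda>p. trunc n f p - F n p)"
      by (intro l2n_pft_diff t F s)
    also have "l2n lborel (\<lambda>p. trunc n f p - F n p) \<le> l2n lborel (\<lambda>p. trunc n f p - f p) + l2n lborel (\<lambda>p. F n p - f p)"
      using l2n_triangle_diff[OF t(1)[of n] f F(1)[of n]] l2n_minus[of lborel f "F n"] by simp
    finally show ?thesis by simp
  qed
  have "(\<lambda>n. sqrt (2 * pi) * (l2n lborel (\<lambda>p. trunc n f p - f p) + l2n lborel (\<lambda>p. F n p - f p)) + l2n lborel (\<lambda>p. pft \<sigma> (F n) p - G p)) \<longlonglongrightarrow> sqrt (2 * pi) * (0 + 0) + 0"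
    by (intro tendsto_intros t Ff FG)
  then have "(\<lambda>n. l2n lborel (\<lambda>p. pft \<sigma> (trunc n f) p - G p)) \<longlonglongrightarrow> 0"
    by (intro l2n_null[OF le]) simp
  then show ?thesis using f G by (simp add: isft_def)
qed

lemma isft_pft:
  fixes f :: "'v::euclidean_space \<times> real \<Rightarrow> complex"
  assumes "sqint lborel f" "fibre_integrable f" "\<sigma> = 1 \<or> \<sigma> = -1"
  shows "isft \<sigma> f (pft \<sigma> f)"
  by (rule isft_limI[where F="\<lambda>_. f", OF assms(1) _ _ _ pft_sqint(1)[OF assms] _ assms(3)])
     (simp_all add: assms l2n_def)

lemma isft_norm:
  fixes f :: "'v::euclidean_space \<times> real \<Rightarrow> complex"
  assumes "isft \<sigma> f G" and s: "\<sigma> = 1 \<or> \<sigma> = -1"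
  shows "l2n lborel G = sqrt (2 * pi) * l2n lborel f"
proof (rule LIMSEQ_unique)
  have f: "sqint lborel f" and G: "sqint lborel G" using assms by (auto simp: isft_def)
  note t = trunc_sqint[OF f]
  show "(\<lambda>n. l2n lborel (pft \<sigma> (trunc n f))) \<longlonglongrightarrow> l2n lborel G"
    using assms(1) by (intro l2n_tendsto pft_sqint t s G) (simp add: isft_def)
  show "(\<lambda>n. l2n lborel (pft \<sigma> (trunc n f))) \<longlonglongrightarrow> sqrt (2 * pi) * l2n lborel f"
    unfolding pft_sqint(2)[OF t(1,2) s] by (intro tendsto_mult_left l2n_tendsto t f)
qed

lemma isft_add:
  fixes f g :: "'v::euclidean_space \<times> real \<Rightarrow> complex"
  assumes "isft \<sigma> f F" "isft \<sigma> g G" and s: "\<sigma> = 1 \<or> \<sigma> = -1"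
  shows "isft \<sigma> (\<lambda>p. f p + g p) (\<lambda>p. F p + G p)"
proof -
  have f: "sqint lborel f" "sqint lborel F" and g: "sqint lborel g" "sqint lborel G" using assms by (auto simp: isft_def)
  note tf = trunc_sqint[OF f(1)] and tg = trunc_sqint[OF g(1)]
  have m[measurable]: "trunc n f \<in> borel_measurable borel" "trunc n g \<in> borel_measurable borel" "F \<in> borel_measurable borel" "G \<in> borel_measurable borel" for n
    using tf(1)[of n] tg(1)[of n] f g by (auto simp: sqint_def)
  have eq: "trunc n (\<lambda>p. f p + g p) = (\<lambda>p. trunc n f p + trunc n g p)" for n
    by (auto simp: trunc_def distrib_right)
  have le: "l2n lborel (\<lambda>p. pft \<sigma> (trunc n (\<lambda>p. f p + g p)) p - (F p + G p)) \<le>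
    l2n lborel (\<lambda>p. pft \<sigma> (trunc n f) p - F p) + l2n lborel (\<lambda>p. pft \<sigma> (trunc n g) p - G p)" for n
  proof -
    have "l2n lborel (\<lambda>p. pft \<sigma> (trunc n (\<lambda>p. f p + g p)) p - (F p + G p)) =
      l2n lborel (\<lambda>p. (pft \<sigma> (trunc n f) p - F p) + (pft \<sigma> (trunc n g) p - G p))"
    proof (rule l2n_cong_AE)
      show "AE p in lborel. pft \<sigma> (trunc n (\<lambda>p. f p + g p)) p - (F p + G p) = (pft \<sigma> (trunc n f) p - F p) + (pft \<sigma> (trunc n g) p - G p)"
        using pft_add_AE[OF tf(2)[of n] tg(2)[of n], of \<sigma>] unfolding eq by eventually_elim simp
    qed (simp_all add: eq)
    also have "\<dots> \<le> l2n lborel (\<lambda>p. pft \<sigma> (trunc n f) p - F p) + l2n lborel (\<lambda>p. pft \<sigma> (trunc n g) p - G p)"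
      by (intro l2n_triangle sqint_diff pft_sqint tf tg f g s)
    finally show ?thesis .
  qed
  have "(\<lambda>n. l2n lborel (\<lambda>p. pft \<sigma> (trunc n f) p - F p) + l2n lborel (\<lambda>p. pft \<sigma> (trunc n g) p - G p)) \<longlonglongrightarrow> 0 + 0"
    using assms(1,2) by (intro tendsto_add) (simp_all add: isft_def)
  then have "(\<lambda>n. l2n lborel (\<lambda>p. pft \<sigma> (trunc n (\<lambda>p. f p + g p)) p - (F p + G p))) \<longlonglongrightarrow> 0"
    by (intro l2n_null[OF le]) simp
  then show ?thesis using sqint_add[OF f(1) g(1)] sqint_add[OF f(2) g(2)] by (simp add: isft_def)
qed

lemma isft_cmult:
  fixes f :: "'v::euclidean_space \<times> real \<Rightarrow> complex"
  assumes "isft \<sigma> f F"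
  shows "isft \<sigma> (\<lambda>p. c * f p) (\<lambda>p. c * F p)"
proof -
  have eq: "pft \<sigma> (trunc n (\<lambda>p. c * f p)) p - c * F p = c * (pft \<sigma> (trunc n f) p - F p)" for n p
    using pft_cmult[of \<sigma> c "trunc n f" p] by (simp add: trunc_def[abs_def] mult.assoc right_diff_distrib)
  have "(\<lambda>n. cmod c * l2n lborel (\<lambda>p. pft \<sigma> (trunc n f) p - F p)) \<longlonglongrightarrow> cmod c * 0"
    using assms by (intro tendsto_mult_left) (simp add: isft_def)
  then show ?thesis using assms sqint_cmult[of lborel f c] sqint_cmult[of lborel F c] unfolding isft_def eq l2n_cmult by simp
qed

lemma isft_unique:
  fixes f :: "'v::euclidean_space \<times> real \<Rightarrow> complex"
  assumes "isft \<sigma> f F" "isft \<sigma> f G" and s: "\<sigma> = 1 \<or> \<sigma> = -1"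
  shows "AE p in lborel. F p = G p"
proof -
  have f: "sqint lborel f" using assms by (auto simp: isft_def)
  show ?thesis
    by (rule l2_lim_unique[where F="\<lambda>n. pft \<sigma> (trunc n f)", OF pft_sqint(1)[OF trunc_sqint(1,2)[OF f] s]])
       (use assms(1,2) in \<open>simp_all add: isft_def\<close>)
qed

lemma isft_cong_AE:
  fixes f :: "'v::euclidean_space \<times> real \<Rightarrow> complex"
  assumes "isft \<sigma> f F" "sqint lborel G" "AE p in lborel. F p = G p" and s: "\<sigma> = 1 \<or> \<sigma> = -1"
  shows "isft \<sigma> f G"
proof -
  have f: "sqint lborel f" "sqint lborel F" using assms by (auto simp: isft_def)
  have [measurable]: "trunc n f \<in> borel_measurable borel" "F \<in> borel_measurable borel" "G \<in> borel_measurable borel" for n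
    using trunc_sqint(1)[OF f(1)] f assms(2) by (auto simp: sqint_def)
  have "l2n lborel (\<lambda>p. pft \<sigma> (trunc n f) p - F p) = l2n lborel (\<lambda>p. pft \<sigma> (trunc n f) p - G p)" for n
  proof (rule l2n_cong_AE)
    show "AE p in lborel. pft \<sigma> (trunc n f) p - F p = pft \<sigma> (trunc n f) p - G p"
      using assms(3) by eventually_elim simp
  qed simp_all
  then show ?thesis using assms(1,2) by (simp add: isft_def)
qed

lemma l2_inner_tendsto:
  assumes F: "\<And>n. sqint M (F n)" "sqint M f" "(\<lambda>n. l2n M (\<lambda>x. F n x - f x)) \<longlonglongrightarrow> 0"
    and G: "\<And>n. sqint M (G n)" "sqint M g" "(\<lambda>n. l2n M (\<lambda>x. G n x - g x)) \<longlonglongrightarrow> 0"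
  shows "(\<lambda>n. LINT x|M. F n x * cnj (G n x)) \<longlonglongrightarrow> (LINT x|M. f x * cnj (g x))"
proof -
  have "cmod ((LINT x|M. F n x * cnj (G n x)) - (LINT x|M. f x * cnj (g x))) \<le>
     l2n M (\<lambda>x. F n x - f x) * l2n M (G n) + l2n M f * l2n M (\<lambda>x. G n x - g x)" for n
  proof -
    have "(LINT x|M. F n x * cnj (G n x)) - (LINT x|M. f x * cnj (g x)) =
      (LINT x|M. F n x * cnj (G n x) - f x * cnj (g x))"
      by (intro Bochner_Integration.integral_diff[symmetric] sqint_mult sqint_cnj F G)
    also have "\<dots> = (LINT x|M. (F n x - f x) * cnj (G n x) + f x * cnj (G n x - g x))"
      by (intro Bochner_Integration.integral_cong refl) (simp add: algebra_simps)
    also have "\<dots> = (LINT x|M. (F n x - f x) * cnj (G n x)) + (LINT x|M. f x * cnj (G n x - g x))"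
      by (intro Bochner_Integration.integral_add sqint_mult sqint_cnj sqint_diff F G)
    finally have "cmod ((LINT x|M. F n x * cnj (G n x)) - (LINT x|M. f x * cnj (g x))) \<le>
       cmod (LINT x|M. (F n x - f x) * cnj (G n x)) + cmod (LINT x|M. f x * cnj (G n x - g x))"
      by (simp only: norm_triangle_ineq)
    then show ?thesis
      using l2_Cauchy_Schwarz[OF sqint_diff[OF F(1)[of n] F(2)] sqint_cnj[OF G(1)[of n]]]
        l2_Cauchy_Schwarz[OF F(2) sqint_cnj[OF sqint_diff[OF G(1)[of n] G(2)]]]
      unfolding l2n_cnj by linarith
  qed
  moreover have "(\<lambda>n. l2n M (\<lambda>x. F n x - f x) * l2n M (G n) + l2n M f * l2n M (\<lambda>x. G n x - g x)) \<longlonglongrightarrow> 0 * l2n M g + l2n M f * 0"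
    by (intro tendsto_intros F G l2n_tendsto)
  ultimately have "(\<lambda>n. (LINT x|M. F n x * cnj (G n x)) - (LINT x|M. f x * cnj (g x))) \<longlonglongrightarrow> 0"
    by (rule_tac Lim_null_comparison[OF always_eventually]) simp_all
  then show ?thesis by (simp add: LIM_zero_iff)
qed

lemma pft_adjoint:
  fixes f g :: "'v::euclidean_space \<times> real \<Rightarrow> complex"
  assumes f: "sqint lborel f" "fibre_integrable f" and g: "sqint lborel g" "fibre_integrable g"
    and s: "\<sigma> = 1 \<or> \<sigma> = -1"
  shows "(LINT p|lborel. pft \<sigma> f p * cnj (g p)) = (LINT p|lborel. f p * cnj (pft (-\<sigma>) g p))"
proof -
  have s': "-\<sigma> = 1 \<or> -\<sigma> = -1" using s by auto
  have [measurable]: "f \<in> borel_measurable borel" "g \<in> borel_measurable borel" using f g by (auto simp: sqint_def)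
  have [measurable]: "f \<in> borel_measurable (lborel \<Otimes>\<^sub>M lborel)" "g \<in> borel_measurable (lborel \<Otimes>\<^sub>M lborel)" by (auto simp: lborel_prod)
  have "(LINT p|lborel. pft \<sigma> f p * cnj (g p)) = (LINT v|lborel. (LINT l|lborel. pft \<sigma> f (v, l) * cnj (g (v, l))))"
    by (intro integral_lborel_pair sqint_mult pft_sqint f s sqint_cnj g)
  also have "\<dots> = (LINT v|lborel. (LINT \<xi>|lborel. f (v, \<xi>) * cnj (pft (-\<sigma>) g (v, \<xi>))))"
  proof (rule integral_cong_AE)
    have [measurable]: "pft \<sigma> f \<in> borel_measurable (lborel \<Otimes>\<^sub>M lborel)" "pft (-\<sigma>) g \<in> borel_measurable (lborel \<Otimes>\<^sub>M lborel)"
      by (auto simp: lborel_prod)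
    show "(\<lambda>v. LINT l|lborel. pft \<sigma> f (v, l) * cnj (g (v, l))) \<in> borel_measurable lborel"
      "(\<lambda>v. LINT l|lborel. f (v, l) * cnj (pft (-\<sigma>) g (v, l))) \<in> borel_measurable lborel" by measurable
    show "AE v in lborel. (LINT l|lborel. pft \<sigma> f (v, l) * cnj (g (v, l))) = (LINT \<xi>|lborel. f (v, \<xi>) * cnj (pft (-\<sigma>) g (v, \<xi>)))"
      using f(2)[unfolded fibre_integrable_def] g(2)[unfolded fibre_integrable_def]
    proof eventually_elim
      case (elim v)
      have ig: "integrable lborel (\<lambda>l. cnj (g (v, l)))" using elim(2) by simp
      have I: "integrable (lborel \<Otimes>\<^sub>M lborel) (\<lambda>(\<xi>, l). exp (\<i> * complex_of_real (\<sigma> * l * \<xi>)) * f (v, \<xi>) * cnj (g (v, l)))"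
        by (rule Bochner_Integration.integrable_bound[OF integrable_pair_mult[OF sigma_finite_lborel sigma_finite_lborel elim(1) ig]])
           (auto simp: norm_mult)
      have "(LINT l|lborel. pft \<sigma> f (v, l) * cnj (g (v, l))) = (LINT l|lborel. (LINT \<xi>|lborel. exp (\<i> * complex_of_real (\<sigma> * l * \<xi>)) * f (v, \<xi>) * cnj (g (v, l))))"
        unfolding pft_def using pft_integrand_integrable[OF elim(1), of \<sigma>] by simp
      also have "\<dots> = (LINT \<xi>|lborel. (LINT l|lborel. exp (\<i> * complex_of_real (\<sigma> * l * \<xi>)) * f (v, \<xi>) * cnj (g (v, l))))"
        by (rule lborel_pair.Fubini_integral[OF I])
      also have "\<dots> = (LINT \<xi>|lborel. (LINT l|lborel. f (v, \<xi>) * cnj (exp (\<i> * complex_of_real ((-\<sigma>) * \<xi> * l)) * g (v, l))))"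
        by (intro Bochner_Integration.integral_cong refl) (simp add: exp_cnj mult_ac)
      also have "\<dots> = (LINT \<xi>|lborel. f (v, \<xi>) * (LINT l|lborel. cnj (exp (\<i> * complex_of_real ((-\<sigma>) * \<xi> * l)) * g (v, l))))"
        using pft_integrand_integrable[OF elim(2), of "-\<sigma>"] by (simp del: complex_cnj_mult)
      also have "\<dots> = (LINT \<xi>|lborel. f (v, \<xi>) * cnj (pft (-\<sigma>) g (v, \<xi>)))"
        unfolding pft_def fst_conv snd_conv
        by (subst integral_bounded_linear[OF bounded_linear_cnj pft_integrand_integrable[OF elim(2)]]) simp
      finally show ?case .
    qed
  qed
  also have "\<dots> = (LINT p|lborel. f p * cnj (pft (-\<sigma>) g p))"
    by (intro integral_lborel_pair(1)[symmetric] sqint_mult sqint_cnj pft_sqint f g s')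
  finally show ?thesis .
qed

lemma isft_adjoint:
  fixes f g :: "'v::euclidean_space \<times> real \<Rightarrow> complex"
  assumes F: "isft \<sigma> f F" and G: "isft (-\<sigma>) g G" and s: "\<sigma> = 1 \<or> \<sigma> = -1"
  shows "(LINT p|lborel. F p * cnj (g p)) = (LINT p|lborel. f p * cnj (G p))"
proof (rule LIMSEQ_unique)
  have s': "-\<sigma> = 1 \<or> -\<sigma> = -1" using s by auto
  have f: "sqint lborel f" "sqint lborel F" "(\<lambda>n. l2n lborel (\<lambda>p. pft \<sigma> (trunc n f) p - F p)) \<longlonglongrightarrow> 0"
    and g: "sqint lborel g" "sqint lborel G" "(\<lambda>n. l2n lborel (\<lambda>p. pft (-\<sigma>) (trunc n g) p - G p)) \<longlonglongrightarrow> 0"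
    using assms by (auto simp: isft_def)
  note tf = trunc_sqint[OF f(1)] and tg = trunc_sqint[OF g(1)]
  show "(\<lambda>n. LINT p|lborel. pft \<sigma> (trunc n f) p * cnj (trunc n g p)) \<longlonglongrightarrow> (LINT p|lborel. F p * cnj (g p))"
    by (intro l2_inner_tendsto pft_sqint tf tg f g s)
  show "(\<lambda>n. LINT p|lborel. pft \<sigma> (trunc n f) p * cnj (trunc n g p)) \<longlonglongrightarrow> (LINT p|lborel. f p * cnj (G p))"
    unfolding pft_adjoint[OF tf(1,2) tg(1,2) s] by (intro l2_inner_tendsto pft_sqint tf tg f g s')
qed

text \<open>The preimage is \<open>1 / (2 * pi)\<close> times the transform of \<open>G\<close> with
  the opposite sign. That its transform \<open>F\<close> equals \<open>G\<close> needs no inversion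
  formula: \<open>F\<close> and \<open>G\<close> have the same norm, and by adjointness their inner
  product is the squared norm of \<open>G\<close>, so the squared distance expands to 0.\<close>

lemma isft_onto:
  fixes G :: "'v::euclidean_space \<times> real \<Rightarrow> complex"
  assumes G: "sqint lborel G" and s: "\<sigma> = 1 \<or> \<sigma> = -1"
  obtains f where "isft \<sigma> f G"
proof -
  have s': "-\<sigma> = 1 \<or> -\<sigma> = -1" using s by auto
  obtain H where H: "isft (-\<sigma>) G H" using isft_exists[OF G s'] .
  then have Hs: "sqint lborel H" by (simp add: isft_def)
  define f where "f p = complex_of_real (1 / (2 * pi)) * H p" for p
  have fs: "sqint lborel f" unfolding f_def by (rule sqint_cmult[OF Hs])
  obtain F where F: "isft \<sigma> f F" using isft_exists[OF fs s] .
  then have Fs: "sqint lborel F" by (simp add: isft_def)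
  have nH: "l2n lborel H = sqrt (2 * pi) * l2n lborel G" by (rule isft_norm[OF H s'])
  have nF: "l2n lborel F = l2n lborel G"
  proof -
    have "l2n lborel F = sqrt (2 * pi) * (cmod (complex_of_real (1 / (2 * pi))) * l2n lborel H)"
      using isft_norm[OF F s] unfolding f_def l2n_cmult by simp
    also have "\<dots> = (sqrt (2 * pi) * sqrt (2 * pi)) / (2 * pi) * l2n lborel G"
      unfolding nH norm_of_real by (simp del: real_sqrt_mult_self)
    finally show ?thesis by simp
  qed
  have ip: "(LINT p|lborel. F p * cnj (G p)) = complex_of_real ((l2n lborel G)\<^sup>2)"
  proof -
    have "(LINT p|lborel. F p * cnj (G p)) = (LINT p|lborel. f p * cnj (H p))"
      by (rule isft_adjoint[OF F H s])
    also have "\<dots> = (LINT p|lborel. complex_of_real ((1 / (2 * pi)) * (cmod (H p))\<^sup>2))"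
      unfolding f_def by (intro Bochner_Integration.integral_cong refl) (simp add: complex_norm_square mult.assoc del: of_real_power)
    also have "\<dots> = complex_of_real ((1 / (2 * pi)) * (l2n lborel H)\<^sup>2)"
      unfolding l2n_square integral_complex_of_real by simp
    also have "(1 / (2 * pi)) * (l2n lborel H)\<^sup>2 = (l2n lborel G)\<^sup>2"
      unfolding nH by (simp add: power_mult_distrib)
    finally show ?thesis .
  qed
  have Gm: "sqint lborel (\<lambda>p. -1 * G p)" by (rule sqint_cmult[OF G])
  have "(l2n lborel (\<lambda>p. F p + -1 * G p))\<^sup>2 = (l2n lborel F)\<^sup>2 + (l2n lborel (\<lambda>p. -1 * G p))\<^sup>2 + 2 * Re (LINT p|lborel. F p * cnj (-1 * G p))"
    by (rule l2n_square_add[OF Fs Gm])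
  also have "(LINT p|lborel. F p * cnj (-1 * G p)) = - complex_of_real ((l2n lborel G)\<^sup>2)"
    using ip by simp
  also have "l2n lborel (\<lambda>p. -1 * G p) = l2n lborel G"
    unfolding l2n_cmult by simp
  finally have "l2n lborel (\<lambda>p. F p - G p) = 0" unfolding nF by simp
  then have "AE p in lborel. F p = G p" using l2n_eq_0_iff[OF sqint_diff[OF Fs G]] by simp
  then have "isft \<sigma> f G" by (rule isft_cong_AE[OF F G _ s])
  then show ?thesis using that by blast
qed

section \<open>Shears of the central variable\<close>

lemma lborel_shear:
  fixes v0 :: "'v::euclidean_space" and \<theta> :: "'v \<Rightarrow> real"
  assumes [measurable]: "\<theta> \<in> borel_measurable borel"
  shows "distr lborel borel (\<lambda>p. (fst p - v0, snd p - \<theta> (fst p))) = (lborel :: ('v \<times> real) measure)"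
proof (rule measure_eqI)
  have [measurable]: "(\<lambda>p::'v\<times>real. (fst p - v0, snd p - \<theta> (fst p))) \<in> borel \<rightarrow>\<^sub>M borel"
    unfolding borel_prod[symmetric] by measurable
  fix A assume "A \<in> sets (distr lborel borel (\<lambda>p::'v\<times>real. (fst p - v0, snd p - \<theta> (fst p))))"
  then have A[measurable]: "A \<in> sets borel" by simp
  have [measurable]: "A \<in> sets (borel \<Otimes>\<^sub>M borel)" unfolding borel_prod by (rule A)
  have "emeasure (distr lborel borel (\<lambda>p::'v\<times>real. (fst p - v0, snd p - \<theta> (fst p)))) A =
    (\<integral>\<^sup>+p. indicator A p \<partial>(distr lborel borel (\<lambda>p::'v\<times>real. (fst p - v0, snd p - \<theta> (fst p)))))"
    by simp
  also have "\<dots> = (\<integral>\<^sup>+p. indicator A (fst p - v0, snd p - \<theta> (fst p)) \<partial>lborel)"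
    by (subst nn_integral_distr) auto
  also have "\<dots> = (\<integral>\<^sup>+v. \<integral>\<^sup>+\<xi>. indicator A (v - v0, \<xi> - \<theta> v) \<partial>lborel \<partial>lborel)"
    by (subst nn_integral_lborel_pair(1)) auto
  also have "\<dots> = (\<integral>\<^sup>+v. \<integral>\<^sup>+\<xi>. indicator A (v - v0, \<xi>) \<partial>lborel \<partial>lborel)"
  proof (rule nn_integral_cong)
    fix v :: 'v
    show "(\<integral>\<^sup>+\<xi>. indicator A (v - v0, \<xi> - \<theta> v) \<partial>lborel) = (\<integral>\<^sup>+\<xi>. indicator A (v - v0, \<xi>) \<partial>lborel)"
      using lborel_nn_integral_affine[of "\<lambda>\<xi>. indicator A (v - v0, \<xi>)" 1 "- \<theta> v"] by simp
  qed
  also have "\<dots> = (\<integral>\<^sup>+v. \<integral>\<^sup>+\<xi>. indicator A (v, \<xi>) \<partial>lborel \<partial>lborel)"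
    using lborel_nn_integral_affine[of "\<lambda>v. \<integral>\<^sup>+\<xi>. indicator A (v, \<xi>) \<partial>lborel" 1 "- v0"] by simp
  also have "\<dots> = (\<integral>\<^sup>+p. indicator A p \<partial>lborel)"
    by (subst nn_integral_lborel_pair(1)) auto
  finally show "emeasure (distr lborel borel (\<lambda>p::'v\<times>real. (fst p - v0, snd p - \<theta> (fst p)))) A = emeasure lborel A"
    by simp
qed simp

lemma sqint_shear:
  fixes v0 :: "'v::euclidean_space" and \<theta> :: "'v \<Rightarrow> real"
  assumes [measurable]: "\<theta> \<in> borel_measurable borel" and f: "sqint lborel f"
  shows "sqint lborel (\<lambda>p. f (fst p - v0, snd p - \<theta> (fst p)))"
    "l2n lborel (\<lambda>p. f (fst p - v0, snd p - \<theta> (fst p))) = l2n lborel f"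
proof -
  have [measurable]: "(\<lambda>p::'v\<times>real. (fst p - v0, snd p - \<theta> (fst p))) \<in> borel \<rightarrow>\<^sub>M borel"
    unfolding borel_prod[symmetric] by measurable
  have [measurable]: "f \<in> borel_measurable borel" using f by (simp add: sqint_def)
  note d = lborel_shear[OF assms(1), of v0]
  have "sqint (distr lborel borel (\<lambda>p::'v\<times>real. (fst p - v0, snd p - \<theta> (fst p)))) f" using f d by simp
  then show "sqint lborel (\<lambda>p. f (fst p - v0, snd p - \<theta> (fst p)))"
    by (simp add: sqint_def integrable_distr_eq)
  have "l2n lborel f = l2n (distr lborel borel (\<lambda>p::'v\<times>real. (fst p - v0, snd p - \<theta> (fst p)))) f" using d by simp
  also have "\<dots> = l2n lborel (\<lambda>p. f (fst p - v0, snd p - \<theta> (fst p)))"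
    unfolding l2n_def by (subst integral_distr) auto
  finally show "l2n lborel (\<lambda>p. f (fst p - v0, snd p - \<theta> (fst p))) = l2n lborel f" ..
qed

text \<open>Left translation in the Heisenberg group moves the non-central coordinates by a constant
  and the central one by an amount depending on them. The substitution in the central integral turns
  that second motion into a phase linear in the frequency.\<close>

lemma isft_shear:
  fixes f :: "'v::euclidean_space \<times> real \<Rightarrow> complex" and \<theta> :: "'v \<Rightarrow> real"
  assumes G: "isft \<sigma> f G" and [measurable]: "\<theta> \<in> borel_measurable borel" and s: "\<sigma> = 1 \<or> \<sigma> = -1"
  shows "isft \<sigma> (\<lambda>p. f (fst p - v0, snd p - \<theta> (fst p)))
    (\<lambda>p. exp (\<i> * complex_of_real (\<sigma> * snd p * \<theta> (fst p))) * G (fst p - v0, snd p))"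
proof -
  have f: "sqint lborel f" "sqint lborel G" "(\<lambda>n. l2n lborel (\<lambda>p. pft \<sigma> (trunc n f) p - G p)) \<longlonglongrightarrow> 0"
    using assms by (auto simp: isft_def)
  note t = trunc_sqint[OF f(1)]
  define S where "S f = (\<lambda>p::'v\<times>real. f (fst p - v0, snd p - \<theta> (fst p)) :: complex)" for f
  define T where "T G = (\<lambda>p::'v\<times>real. exp (\<i> * complex_of_real (\<sigma> * snd p * \<theta> (fst p))) * G (fst p - v0, snd p) :: complex)" for G
  have Ts: "sqint lborel (T G)" "l2n lborel (T G) = l2n lborel G" if "sqint lborel G" for G
  proof -
    have 0: "sqint lborel (\<lambda>p. G (fst p - v0, snd p))" "l2n lborel (\<lambda>p. G (fst p - v0, snd p)) = l2n lborel G"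
      using sqint_shear[OF _ that, of "\<lambda>_. 0" v0] by auto
    have e: "(\<lambda>p::'v\<times>real. exp (\<i> * complex_of_real (\<sigma> * snd p * \<theta> (fst p)))) \<in> borel_measurable borel"
      unfolding borel_prod[symmetric] by measurable
    show "sqint lborel (T G)"
      using 0(1) e unfolding sqint_def T_def by (auto simp: norm_mult)
    show "l2n lborel (T G) = l2n lborel G"
      unfolding 0(2)[symmetric] unfolding l2n_def T_def by (simp add: norm_mult)
  qed
  have fi: "fibre_integrable (S (trunc n f))" for n
  proof -
    have "AE v in distr lborel borel ((+) (- v0)). integrable lborel (\<lambda>\<xi>. trunc n f (v, \<xi>))"
      unfolding lborel_distr_plus using t(2)[of n] by (simp add: fibre_integrable_def)
    then have "AE v in lborel. integrable lborel (\<lambda>\<xi>. trunc n f (v - v0, \<xi>))"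
      using AE_distrD[of "(+) (- v0)" lborel borel] by simp
    then show ?thesis
      unfolding fibre_integrable_def S_def
    proof eventually_elim
      case (elim v)
      then show ?case using integrable_translate[OF elim, of "- \<theta> v"] by simp
    qed
  qed
  have pS: "pft \<sigma> (S (trunc n f)) = T (pft \<sigma> (trunc n f))" for n
  proof
    fix p :: "'v \<times> real"
    have m: "trunc n f \<in> borel_measurable borel" using t(1)[of n] by (simp add: sqint_def)
    have [measurable]: "(\<lambda>\<xi>. trunc n f (fst p - v0, \<xi>)) \<in> borel_measurable borel"
      using m by (intro measurable_compose[OF _ m]) (simp add: borel_prod[symmetric])
    have "pft \<sigma> (S (trunc n f)) p = (LINT \<xi>|lborel. exp (\<i> * complex_of_real (\<sigma> * snd p * \<theta> (fst p))) *
      (exp (\<i> * complex_of_real (\<sigma> * snd p * (\<xi> + - \<theta> (fst p)))) * trunc n f (fst p - v0, \<xi> + - \<theta> (fst p))))"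
      unfolding pft_def S_def
    proof (intro Bochner_Integration.integral_cong refl)
      fix \<xi>
      have "exp (\<i> * complex_of_real (\<sigma> * snd p * \<xi>)) = exp (\<i> * complex_of_real (\<sigma> * snd p * \<theta> (fst p))) * exp (\<i> * complex_of_real (\<sigma> * snd p * (\<xi> + - \<theta> (fst p))))"
        unfolding exp_add[symmetric] by (simp add: algebra_simps)
      then show "exp (\<i> * complex_of_real (\<sigma> * snd p * \<xi>)) * trunc n f (fst (fst p, \<xi>) - v0, snd (fst p, \<xi>) - \<theta> (fst (fst p, \<xi>))) =
         exp (\<i> * complex_of_real (\<sigma> * snd p * \<theta> (fst p))) *
        (exp (\<i> * complex_of_real (\<sigma> * snd p * (\<xi> + - \<theta> (fst p)))) * trunc n f (fst p - v0, \<xi> + - \<theta> (fst p)))"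
        by simp
    qed
    also have "\<dots> = exp (\<i> * complex_of_real (\<sigma> * snd p * \<theta> (fst p))) *
      (LINT \<xi>|lborel. exp (\<i> * complex_of_real (\<sigma> * snd p * (\<xi> + - \<theta> (fst p)))) * trunc n f (fst p - v0, \<xi> + - \<theta> (fst p)))"
      by (rule integral_mult_right_zero)
    also have "(LINT \<xi>|lborel. exp (\<i> * complex_of_real (\<sigma> * snd p * (\<xi> + - \<theta> (fst p)))) * trunc n f (fst p - v0, \<xi> + - \<theta> (fst p)))
      = (LINT \<xi>|lborel. exp (\<i> * complex_of_real (\<sigma> * snd p * \<xi>)) * trunc n f (fst p - v0, \<xi>))"
      by (rule integral_translate[of "\<lambda>\<xi>. exp (\<i> * complex_of_real (\<sigma> * snd p * \<xi>)) * trunc n f (fst p - v0, \<xi>)"]) measurable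
    finally show "pft \<sigma> (S (trunc n f)) p = T (pft \<sigma> (trunc n f)) p"
      by (simp add: T_def pft_def)
  qed
  have "isft \<sigma> (S f) (T G)"
  \<comment> \<open>The sheared truncations are not truncations of the sheared function, because the
    cut-off interval moves with the fibre; hence the freedom in the choice of approximants is
    needed.\<close>
  proof (rule isft_limI[where F="\<lambda>n. S (trunc n f)"])
    show "sqint lborel (S f)" "\<And>n. sqint lborel (S (trunc n f))"
      unfolding S_def by (intro sqint_shear f t assms(2))+
    show "sqint lborel (T G)" by (rule Ts[OF f(2)])
    have "l2n lborel (\<lambda>p. S (trunc n f) p - S f p) = l2n lborel (\<lambda>p. trunc n f p - f p)" for n
      using sqint_shear(2)[OF assms(2) sqint_diff[OF t(1)[of n] f(1)], of v0] by (simp add: S_def)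
    then show "(\<lambda>n. l2n lborel (\<lambda>p. S (trunc n f) p - S f p)) \<longlonglongrightarrow> 0" using t(3) by simp
    have "l2n lborel (\<lambda>p. pft \<sigma> (S (trunc n f)) p - T G p) = l2n lborel (\<lambda>p. pft \<sigma> (trunc n f) p - G p)" for n
      using Ts(2)[OF sqint_diff[OF pft_sqint(1)[OF t(1,2) s] f(2)], of n] unfolding pS by (simp add: T_def right_diff_distrib)
    then show "(\<lambda>n. l2n lborel (\<lambda>p. pft \<sigma> (S (trunc n f)) p - T G p)) \<longlonglongrightarrow> 0" using f(3) by simp
  qed (use fi s in auto)
  then show ?thesis by (simp add: S_def T_def)
qed

section \<open>Gaussian kernels twisted by a skew map\<close>

text \<open>The map is a composition of two steps, each changing one variable by an affine map while
  the other is held fixed. Tonelli and the one-block scaling rule then suffice, and no determinant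
  appears.\<close>

lemma nn_integral_triangular:
  fixes h :: "'v::euclidean_space \<times> 'v \<Rightarrow> ennreal" and L M :: "'v \<Rightarrow> 'v"
  assumes [measurable]: "h \<in> borel_measurable borel" "L \<in> borel_measurable borel" "M \<in> borel_measurable borel"
    and a: "a \<noteq> 0" "d \<noteq> 0"
  shows "ennreal (\<bar>a * d\<bar> ^ DIM('v)) * (\<integral>\<^sup>+z. h (a *\<^sub>R fst z + L (snd z), M (a *\<^sub>R fst z + L (snd z)) + d *\<^sub>R snd z) \<partial>lborel)
    = (\<integral>\<^sup>+z. h z \<partial>lborel)"
proof -
  have [measurable]: "h \<in> borel_measurable (borel \<Otimes>\<^sub>M borel)" by (simp add: borel_prod)
  have m: "(\<lambda>z. h (a *\<^sub>R fst z + L (snd z), M (a *\<^sub>R fst z + L (snd z)) + d *\<^sub>R snd z)) \<in> borel_measurable borel"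
    unfolding borel_prod[symmetric] by measurable
  have "ennreal (\<bar>a * d\<bar> ^ DIM('v)) * (\<integral>\<^sup>+z. h (a *\<^sub>R fst z + L (snd z), M (a *\<^sub>R fst z + L (snd z)) + d *\<^sub>R snd z) \<partial>lborel)
    = ennreal (\<bar>d\<bar> ^ DIM('v)) * (ennreal (\<bar>a\<bar> ^ DIM('v)) * (\<integral>\<^sup>+q. \<integral>\<^sup>+p. h (a *\<^sub>R p + L q, M (a *\<^sub>R p + L q) + d *\<^sub>R q) \<partial>lborel \<partial>lborel))"
    by (subst nn_integral_lborel_pair(2)[OF m]) (simp add: abs_mult power_mult_distrib ennreal_mult mult_ac)
  also have "ennreal (\<bar>a\<bar> ^ DIM('v)) * (\<integral>\<^sup>+q. \<integral>\<^sup>+p. h (a *\<^sub>R p + L q, M (a *\<^sub>R p + L q) + d *\<^sub>R q) \<partial>lborel \<partial>lborel)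
    = (\<integral>\<^sup>+q. ennreal (\<bar>a\<bar> ^ DIM('v)) * (\<integral>\<^sup>+p. h (L q + a *\<^sub>R p, M (L q + a *\<^sub>R p) + d *\<^sub>R q) \<partial>lborel) \<partial>lborel)"
    by (subst nn_integral_cmult) (auto simp: add.commute)
  also have "\<dots> = (\<integral>\<^sup>+q. \<integral>\<^sup>+x. h (x, M x + d *\<^sub>R q) \<partial>lborel \<partial>lborel)"
    by (rule nn_integral_cong) (subst lborel_nn_integral_affine[OF _ a(1)], auto)
  also have "\<dots> = (\<integral>\<^sup>+x. \<integral>\<^sup>+q. h (x, M x + d *\<^sub>R q) \<partial>lborel \<partial>lborel)"
    by (rule lborel_pair.Fubini'[symmetric]) measurable
  also have "ennreal (\<bar>d\<bar> ^ DIM('v)) * \<dots> = (\<integral>\<^sup>+x. ennreal (\<bar>d\<bar> ^ DIM('v)) * (\<integral>\<^sup>+q. h (x, M x + d *\<^sub>R q) \<partial>lborel) \<partial>lborel)"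
    by (rule nn_integral_cmult[symmetric]) measurable
  also have "\<dots> = (\<integral>\<^sup>+x. \<integral>\<^sup>+y. h (x, y) \<partial>lborel \<partial>lborel)"
    by (rule nn_integral_cong) (subst lborel_nn_integral_affine[OF _ a(2)], auto)
  also have "\<dots> = (\<integral>\<^sup>+z. h z \<partial>lborel)"
    by (rule nn_integral_lborel_pair(1)[symmetric]) simp
  finally show ?thesis .
qed

text \<open>A pair \<open>(x, y)\<close> stands for x + iy in the complexification, and this is
  multiplication by a complex scalar there.\<close>

definition csc :: "complex \<Rightarrow> 'v::real_vector \<times> 'v \<Rightarrow> 'v \<times> 'v" where
  "csc c z = (Re c *\<^sub>R fst z - Im c *\<^sub>R snd z, Re c *\<^sub>R snd z + Im c *\<^sub>R fst z)"

text \<open>The complex bilinear, not sesquilinear, extension of the inner product to the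
  complexification.\<close>

definition bil :: "'v::real_inner \<times> 'v \<Rightarrow> 'v \<times> 'v \<Rightarrow> complex" where
  "bil z z' = Complex (fst z \<bullet> fst z' - snd z \<bullet> snd z') (fst z \<bullet> snd z' + snd z \<bullet> fst z')"

lemma bil_csc: "bil z (csc c z') = c * bil z z'" "bil (csc c z) z' = c * bil z z'"
  by (auto simp: bil_def csc_def complex_eq_iff inner_simps algebra_simps)

lemma csc_inner: "csc c z \<bullet> csc c z = (cmod c)\<^sup>2 * (z \<bullet> z)"
  unfolding cmod_power2 by (simp add: csc_def inner_prod_def inner_simps inner_commute algebra_simps power2_eq_square)

text \<open>A rotation factors into triangular steps with scalings \<open>cos \<theta>\<close> and
  \<open>1 / cos \<theta>\<close>, whose product is 1. This is where the angles with vanishing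
  cosine drop out.\<close>

lemma lborel_rotate:
  fixes \<theta> :: real
  assumes c: "cos \<theta> \<noteq> 0"
  shows "distr lborel borel (csc (cis \<theta>)) = (lborel :: ('v::euclidean_space \<times> 'v) measure)"
proof (rule measure_eqI)
  have [measurable]: "(csc (cis \<theta>) :: 'v \<times> 'v \<Rightarrow> 'v \<times> 'v) \<in> borel \<rightarrow>\<^sub>M borel"
    unfolding csc_def[abs_def] borel_prod[symmetric] by measurable
  fix A :: "('v \<times> 'v) set" assume "A \<in> sets (distr lborel borel (csc (cis \<theta>)))"
  then have A[measurable]: "A \<in> sets borel" by simp
  have eq: "csc (cis \<theta>) z = (cos \<theta> *\<^sub>R fst z + - sin \<theta> *\<^sub>R snd z, tan \<theta> *\<^sub>R (cos \<theta> *\<^sub>R fst z + - sin \<theta> *\<^sub>R snd z) + (1 / cos \<theta>) *\<^sub>R snd z)" for z :: "'v \<times> 'v"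
  proof -
    have "cos \<theta> = (1 - (sin \<theta>)\<^sup>2) / cos \<theta>" using c sin_squared_eq[of \<theta>] by (simp add: power2_eq_square)
    then have "cos \<theta> = 1 / cos \<theta> - tan \<theta> * sin \<theta>" by (simp add: tan_def diff_divide_distrib power2_eq_square)
    then have "cos \<theta> *\<^sub>R snd z = (1 / cos \<theta>) *\<^sub>R snd z - (tan \<theta> * sin \<theta>) *\<^sub>R snd z"
      by (metis scaleR_left.diff)
    moreover have "sin \<theta> = tan \<theta> * cos \<theta>" using c by (simp add: tan_def)
    ultimately show ?thesis by (simp add: csc_def scaleR_right_diff_distrib algebra_simps)
  qed
  have "emeasure (distr lborel borel (csc (cis \<theta>))) A = (\<integral>\<^sup>+z. indicator A z \<partial>(distr lborel borel (csc (cis \<theta>))))"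
    by simp
  also have "\<dots> = (\<integral>\<^sup>+z. indicator A (csc (cis \<theta>) z) \<partial>lborel)"
    by (subst nn_integral_distr) auto
  also have "\<dots> = (\<integral>\<^sup>+z. indicator A z \<partial>lborel)"
    unfolding eq using nn_integral_triangular[of "indicator A" "\<lambda>q. - sin \<theta> *\<^sub>R q" "\<lambda>x. tan \<theta> *\<^sub>R x" "cos \<theta>" "1 / cos \<theta>"] c
    by simp
  finally show "emeasure (distr lborel borel (csc (cis \<theta>))) A = emeasure lborel A" by simp
qed simp

text \<open>Cauchy's integral formula for the unit circle; the parameter runs over the unit interval
  to match \<open>circlepath\<close>.\<close>

lemma circle_mean_value:
  fixes h :: "complex \<Rightarrow> complex"
  assumes "h holomorphic_on UNIV"
  shows "(LINT x|lborel. indicator {0..1} x *\<^sub>R h (cis (2 * pi * x))) = h 0"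
proof -
  have cont: "continuous_on UNIV h" using assms by (rule holomorphic_on_imp_continuous_on)
  have "((\<lambda>u. h u / (u - 0)) has_contour_integral (2 * of_real pi * \<i> * h 0)) (circlepath 0 1)"
    using assms by (intro Cauchy_integral_circlepath_simple) (auto intro: holomorphic_on_subset)
  then have "((\<lambda>x. h (circlepath 0 1 x) / circlepath 0 1 x * vector_derivative (circlepath 0 1) (at x)) has_integral 2 * of_real pi * \<i> * h 0) {0..1}"
    unfolding has_contour_integral by (simp add: has_contour_integral)
  moreover have "h (circlepath 0 1 x) / circlepath 0 1 x * vector_derivative (circlepath 0 1) (at x) = 2 * of_real pi * \<i> * h (cis (2 * pi * x))" for x
  proof -
    have "circlepath 0 1 x = cis (2 * pi * x)" by (simp add: circlepath cis_conv_exp mult_ac)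
    moreover have "vector_derivative (circlepath 0 1) (at x) = 2 * pi * \<i> * cis (2 * pi * x)"
      by (simp add: vector_derivative_circlepath cis_conv_exp mult_ac)
    ultimately show ?thesis by simp
  qed
  ultimately have "((\<lambda>x. 2 * of_real pi * \<i> * h (cis (2 * pi * x))) has_integral 2 * of_real pi * \<i> * h 0) {0..1}" by simp
  from has_integral_mult_right[OF this, of "1 / (2 * of_real pi * \<i>)"]
  have hi: "((\<lambda>x. h (cis (2 * pi * x))) has_integral h 0) {0..1}" by simp
  have "continuous_on {0..1} (\<lambda>x. h (cis (2 * pi * x)))"
    by (intro continuous_on_compose2[OF cont] continuous_intros) auto
  then have "set_integrable lborel {0..1} (\<lambda>x. h (cis (2 * pi * x)))"
    by (rule borel_integrable_atLeastAtMost')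
  from set_borel_integral_eq_integral(2)[OF this] show ?thesis
    using integral_unique[OF hi] by (simp add: set_lebesgue_integral_def)
qed

text \<open>Everything that happens at one frequency depends only on an orthogonal complex structure
  \<open>J\<close> and the two numbers \<alpha> and \<gamma>, so the hyperbolic functions can be
  kept out. The inequality between the squares makes the passage to the coordinates (P, R)
  invertible and the norm constant positive.\<close>

locale skew =
  fixes J :: "'v::euclidean_space \<Rightarrow> 'v" and \<alpha> \<gamma> :: real
  assumes J_linear: "bounded_linear J" and J_skew: "p \<bullet> J q = - (J p \<bullet> q)" and J_square: "J (J p) = - p"
    and \<alpha>_pos: "\<alpha> > 0" and \<gamma>_less: "\<gamma>\<^sup>2 < \<alpha>\<^sup>2"
begin

section \<open>Coordinates, kernel, weight and isometry\<close>

lemma J_measurable [measurable]: "J \<in> borel_measurable borel"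
  by (intro borel_measurable_continuous_onI linear_continuous_on J_linear)

lemma J_continuous [continuous_intros]: "continuous_on S f \<Longrightarrow> continuous_on S (\<lambda>x. J (f x))"
  by (rule bounded_linear.continuous_on[OF J_linear])

lemmas J_simps = linear_add[OF bounded_linear.linear[OF J_linear]] linear_diff[OF bounded_linear.linear[OF J_linear]]
  linear_scale[OF bounded_linear.linear[OF J_linear]]

definition Pm :: "'v \<times> 'v \<Rightarrow> 'v" where "Pm z = \<alpha> *\<^sub>R fst z + \<gamma> *\<^sub>R J (snd z)"
definition Rm :: "'v \<times> 'v \<Rightarrow> 'v" where "Rm z = \<gamma> *\<^sub>R J (fst z) - \<alpha> *\<^sub>R snd z"

text \<open>\<open>kA\<close> and \<open>kB\<close> are the real and imaginary parts of
  -(\<alpha>^2/2) (z - s).(z - s) - i \<alpha> \<gamma> (J z).s, with the dot and \<open>J\<close>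
  extended complex linearly to z = x + iy. Collecting the terms linear in \<open>s\<close> is what
  produces \<open>Pm\<close> and \<open>Rm\<close>.\<close>

definition kA :: "'v \<times> 'v \<Rightarrow> 'v \<Rightarrow> real" where
  "kA z s = - (\<alpha>\<^sup>2 / 2) * (fst z \<bullet> fst z - snd z \<bullet> snd z) + (\<alpha> * (Pm z \<bullet> s) - (\<alpha>\<^sup>2 / 2) * (s \<bullet> s))"
definition kB :: "'v \<times> 'v \<Rightarrow> 'v \<Rightarrow> real" where
  "kB z s = - (\<alpha>\<^sup>2) * (fst z \<bullet> snd z) - \<alpha> * (Rm z \<bullet> s)"
definition kern :: "'v \<times> 'v \<Rightarrow> 'v \<Rightarrow> complex" where
  "kern z s = exp (complex_of_real (kA z s) + \<i> * complex_of_real (kB z s))"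
text \<open>The first part of the exponent cancels the factor in front of the Fourier transform in
  \<open>cmod (S g z)\<close> squared; what is left is the Gaussian
  \<open>exp (- (Pm z \<bullet> Pm z))\<close>.\<close>

definition wgt :: "'v \<times> 'v \<Rightarrow> real" where
  "wgt z = exp (\<alpha>\<^sup>2 * (fst z \<bullet> fst z - snd z \<bullet> snd z) - Pm z \<bullet> Pm z)"
definition mu :: "('v \<times> 'v) measure" where
  "mu = density lborel (\<lambda>z. ennreal (wgt z))"
definition S :: "('v \<Rightarrow> complex) \<Rightarrow> 'v \<times> 'v \<Rightarrow> complex" where
  "S g z = (LINT s|lborel. kern z s * g s)"
text \<open>The squared norm of \<open>S\<close>: \<open>(2 * pi) ^ DIM('v)\<close> comes from
  Plancherel in R, the power of \<alpha> from evaluating at the frequency \<alpha> R, the power of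
  \<open>sqrt pi\<close> from the Gaussian in P, and the last power from the Jacobian of (P,
  R).\<close>

definition N :: real where
  "N = (2 * pi) ^ DIM('v) * sqrt pi ^ DIM('v) / (\<alpha> ^ DIM('v) * (\<alpha>\<^sup>2 - \<gamma>\<^sup>2) ^ DIM('v))"

lemma N_pos: "N > 0"
  using \<alpha>_pos \<gamma>_less by (simp add: N_def)

lemma cont_Pm [continuous_intros]: "continuous_on A f \<Longrightarrow> continuous_on A (\<lambda>x. Pm (f x))"
  unfolding Pm_def by (intro continuous_intros)
lemma cont_Rm [continuous_intros]: "continuous_on A f \<Longrightarrow> continuous_on A (\<lambda>x. Rm (f x))"
  unfolding Rm_def by (intro continuous_intros)
lemma cont_kern: "continuous_on UNIV (\<lambda>p. kern (fst p) (snd p))"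
  unfolding kern_def kA_def kB_def by (intro continuous_intros)
lemma cont_wgt: "continuous_on UNIV wgt"
  unfolding wgt_def by (intro continuous_intros)

lemma wgt_measurable [measurable]: "wgt \<in> borel_measurable borel"
  by (intro borel_measurable_continuous_onI cont_wgt)
lemma kern_measurable_pair: "(\<lambda>p. kern (fst p) (snd p)) \<in> borel_measurable borel"
  by (intro borel_measurable_continuous_onI cont_kern)

lemma kern_measurable [measurable (raw)]:
  assumes [measurable]: "f \<in> M \<rightarrow>\<^sub>M borel" "g \<in> M \<rightarrow>\<^sub>M borel"
  shows "(\<lambda>x. kern (f x) (g x)) \<in> borel_measurable M"
proof -
  have "(\<lambda>x. (f x, g x)) \<in> M \<rightarrow>\<^sub>M borel \<Otimes>\<^sub>M borel" by measurable
  then have "(\<lambda>x. (f x, g x)) \<in> M \<rightarrow>\<^sub>M borel" by (simp only: borel_prod)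
  from measurable_compose[OF this kern_measurable_pair] show ?thesis by simp
qed

lemma wgt_pos: "wgt z > 0" by (simp add: wgt_def)

lemma norm_kern: "cmod (kern z s) = exp (kA z s)"
  by (simp add: kern_def)

text \<open>Half of the Gaussian decay in \<open>s\<close> is spent on the linear term, by
  completing a square. The other half survives, with a constant that is bounded for \<open>z\<close>
  in a bounded set.\<close>

lemma kA_le: "kA z s \<le> (\<alpha>\<^sup>2 / 2) * (snd z \<bullet> snd z) + Pm z \<bullet> Pm z - (\<alpha>\<^sup>2 / 4) * (s \<bullet> s)"
proof -
  have "0 \<le> (Pm z - (\<alpha> / 2) *\<^sub>R s) \<bullet> (Pm z - (\<alpha> / 2) *\<^sub>R s)" by simp
  also have "\<dots> = Pm z \<bullet> Pm z - \<alpha> * (Pm z \<bullet> s) + (\<alpha>\<^sup>2 / 4) * (s \<bullet> s)"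
    by (simp add: inner_simps inner_commute power2_eq_square field_simps)
  finally have "\<alpha> * (Pm z \<bullet> s) \<le> Pm z \<bullet> Pm z + (\<alpha>\<^sup>2 / 4) * (s \<bullet> s)" by simp
  moreover have "0 \<le> (\<alpha>\<^sup>2 / 2) * (fst z \<bullet> fst z)" by simp
  ultimately show ?thesis unfolding kA_def right_diff_distrib by linarith
qed

lemma kern_bound:
  obtains D where "\<And>z s. norm z \<le> k \<Longrightarrow> cmod (kern z s) \<le> D * exp (- (\<alpha>\<^sup>2 / 4) * (s \<bullet> s))" "D > 0"
proof -
  have "compact (cball (0::'v\<times>'v) k)" by simp
  then have "compact ((\<lambda>z. (\<alpha>\<^sup>2 / 2) * (snd z \<bullet> snd z) + Pm z \<bullet> Pm z) ` cball (0::'v\<times>'v) k)"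
    by (intro compact_continuous_image continuous_intros)
  from compact_imp_bounded[OF this] obtain B where
    "\<forall>x\<in>(\<lambda>z. (\<alpha>\<^sup>2 / 2) * (snd z \<bullet> snd z) + Pm z \<bullet> Pm z) ` cball (0::'v\<times>'v) k. norm x \<le> B"
    unfolding bounded_iff by blast
  then have B: "\<bar>(\<alpha>\<^sup>2 / 2) * (snd z \<bullet> snd z) + Pm z \<bullet> Pm z\<bar> \<le> B" if "norm z \<le> k" for z
    using that by auto
  show ?thesis
  proof (rule that[of "exp B"])
    fix z :: "'v \<times> 'v" and s :: 'v assume "norm z \<le> k"
    then have "kA z s \<le> B + (- (\<alpha>\<^sup>2 / 4) * (s \<bullet> s))" using kA_le[of z s] B[of z] by simp
    then show "cmod (kern z s) \<le> exp B * exp (- (\<alpha>\<^sup>2 / 4) * (s \<bullet> s))"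
      unfolding norm_kern exp_add[symmetric] by simp
  qed simp
qed

lemma gauss_int: "integrable lborel (\<lambda>s::'v. exp (- (\<alpha>\<^sup>2 / 4) * (s \<bullet> s)))"
  using gauss_real[of "\<alpha>\<^sup>2 / 4" "0::'v"] \<alpha>_pos by (simp add: has_bochner_integral_iff)

lemma gauss_sqint: "sqint lborel (\<lambda>s::'v. complex_of_real (exp (- (\<alpha>\<^sup>2 / 4) * (s \<bullet> s))))"
proof -
  have "(\<lambda>s::'v. (cmod (complex_of_real (exp (- (\<alpha>\<^sup>2 / 4) * (s \<bullet> s)))))\<^sup>2) = (\<lambda>s. exp (0 \<bullet> s - (\<alpha>\<^sup>2 / 2) * (s \<bullet> s)))"
    by (auto simp: exp_double[symmetric])
  then show ?thesis unfolding sqint_def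
    using gauss_real[of "\<alpha>\<^sup>2 / 2" "0::'v"] \<alpha>_pos by (simp add: has_bochner_integral_iff)
qed

lemma kern_sqint: "sqint lborel (kern z)"
proof -
  obtain D where D: "\<And>z' s. norm z' \<le> norm z \<Longrightarrow> cmod (kern z' s) \<le> D * exp (- (\<alpha>\<^sup>2 / 4) * (s \<bullet> s))" "D > 0"
    using kern_bound[of "norm z"] by blast
  show ?thesis
    by (rule sqint_bound[OF sqint_cmult[OF gauss_sqint, of "complex_of_real D"]])
       (use D in \<open>auto simp: norm_mult simp del: of_real_exp\<close>)
qed

lemma S_integrable: "sqint lborel g \<Longrightarrow> integrable lborel (\<lambda>s. kern z s * g s)"
  by (intro sqint_mult kern_sqint)

lemma S_measurable [measurable]:
  assumes [measurable]: "g \<in> borel_measurable borel"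
  shows "S g \<in> borel_measurable borel"
  unfolding S_def[abs_def] by measurable

text \<open>Because \<open>J (J p) = - p\<close>, the second coordinate is \<open>(\<gamma> /
  \<alpha>) *\<^sub>R J (Pm z) + (\<gamma>\<^sup>2 / \<alpha> - \<alpha>) *\<^sub>R snd z\<close>.
  This puts the map into triangular form, and the two scalings multiply to
  \<open>\<gamma>\<^sup>2 - \<alpha>\<^sup>2\<close>.\<close>

lemma nn_integral_RP:
  assumes [measurable]: "h \<in> borel_measurable borel"
  shows "ennreal ((\<alpha>\<^sup>2 - \<gamma>\<^sup>2) ^ DIM('v)) * (\<integral>\<^sup>+z. h (Pm z, Rm z) \<partial>lborel) = (\<integral>\<^sup>+z. h z \<partial>lborel)"
proof -
  have eq: "(Pm z, Rm z) = (\<alpha> *\<^sub>R fst z + \<gamma> *\<^sub>R J (snd z), (\<gamma> / \<alpha>) *\<^sub>R J (\<alpha> *\<^sub>R fst z + \<gamma> *\<^sub>R J (snd z)) + (\<gamma>\<^sup>2 / \<alpha> - \<alpha>) *\<^sub>R snd z)" for z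
    using \<alpha>_pos by (simp add: Pm_def Rm_def J_simps J_square scaleR_diff_right scaleR_add_right scaleR_diff_left power2_eq_square)
  have ne: "\<gamma>\<^sup>2 / \<alpha> - \<alpha> \<noteq> 0" using \<alpha>_pos \<gamma>_less by (simp add: field_simps power2_eq_square)
  have "\<alpha> * (\<gamma>\<^sup>2 / \<alpha> - \<alpha>) = \<gamma>\<^sup>2 - \<alpha>\<^sup>2" using \<alpha>_pos by (simp add: field_simps power2_eq_square)
  then have "\<bar>\<alpha> * (\<gamma>\<^sup>2 / \<alpha> - \<alpha>)\<bar> = \<alpha>\<^sup>2 - \<gamma>\<^sup>2" using \<gamma>_less by simp
  then show ?thesis unfolding eq
    using nn_integral_triangular[of h "\<lambda>q. \<gamma> *\<^sub>R J q" "\<lambda>x. (\<gamma> / \<alpha>) *\<^sub>R J x" \<alpha> "\<gamma>\<^sup>2 / \<alpha> - \<alpha>"] ne \<alpha>_pos by simp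
qed

definition gP :: "('v \<Rightarrow> complex) \<Rightarrow> 'v \<Rightarrow> 'v \<Rightarrow> complex" where
  "gP g \<rho> s = complex_of_real (exp (\<alpha> * (\<rho> \<bullet> s) - (\<alpha>\<^sup>2 / 2) * (s \<bullet> s))) * g s"

lemma S_eq_ft:
  "S g z = exp (complex_of_real (- (\<alpha>\<^sup>2 / 2) * (fst z \<bullet> fst z - snd z \<bullet> snd z)) + \<i> * complex_of_real (- (\<alpha>\<^sup>2) * (fst z \<bullet> snd z)))
     * ft (gP g (Pm z)) (\<alpha> *\<^sub>R Rm z)"
proof -
  have "kern z s * g s = exp (complex_of_real (- (\<alpha>\<^sup>2 / 2) * (fst z \<bullet> fst z - snd z \<bullet> snd z)) + \<i> * complex_of_real (- (\<alpha>\<^sup>2) * (fst z \<bullet> snd z)))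
     * (exp (- (\<i> * complex_of_real ((\<alpha> *\<^sub>R Rm z) \<bullet> s))) * gP g (Pm z) s)" for s
  proof -
    have "complex_of_real (kA z s) + \<i> * complex_of_real (kB z s) =
      (complex_of_real (- (\<alpha>\<^sup>2 / 2) * (fst z \<bullet> fst z - snd z \<bullet> snd z)) + \<i> * complex_of_real (- (\<alpha>\<^sup>2) * (fst z \<bullet> snd z)))
      + (- (\<i> * complex_of_real ((\<alpha> *\<^sub>R Rm z) \<bullet> s)) + complex_of_real (\<alpha> * (Pm z \<bullet> s) - (\<alpha>\<^sup>2 / 2) * (s \<bullet> s)))"
      unfolding kA_def kB_def by (simp add: complex_eq_iff)
    then show ?thesis unfolding kern_def gP_def exp_of_real[symmetric] by (simp only: exp_add mult.assoc)
  qed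
  then show ?thesis unfolding S_def ft_def by simp
qed

lemma gP_props:
  assumes g: "sqint lborel g"
  shows "integrable lborel (gP g \<rho>)" "sqint lborel (gP g \<rho>)"
proof -
  have [measurable]: "g \<in> borel_measurable borel" using g by (simp add: sqint_def)
  have e: "\<alpha> * (\<rho> \<bullet> s) - (\<alpha>\<^sup>2 / 2) * (s \<bullet> s) \<le> \<rho> \<bullet> \<rho> + - (\<alpha>\<^sup>2 / 4) * (s \<bullet> s)" for s
  proof -
    have "0 \<le> (\<rho> - (\<alpha> / 2) *\<^sub>R s) \<bullet> (\<rho> - (\<alpha> / 2) *\<^sub>R s)" by simp
    also have "\<dots> = \<rho> \<bullet> \<rho> - \<alpha> * (\<rho> \<bullet> s) + (\<alpha>\<^sup>2 / 4) * (s \<bullet> s)"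
      by (simp add: inner_simps inner_commute power2_eq_square field_simps)
    finally show ?thesis by simp
  qed
  have b: "cmod (complex_of_real (exp (\<alpha> * (\<rho> \<bullet> s) - (\<alpha>\<^sup>2 / 2) * (s \<bullet> s)))) \<le> cmod (complex_of_real (exp (\<rho> \<bullet> \<rho>)) * complex_of_real (exp (- (\<alpha>\<^sup>2 / 4) * (s \<bullet> s))))" for s
    using e[of s] unfolding norm_mult norm_of_real abs_exp_cancel exp_add[symmetric] by simp
  have "sqint lborel (\<lambda>s. complex_of_real (exp (\<alpha> * (\<rho> \<bullet> s) - (\<alpha>\<^sup>2 / 2) * (s \<bullet> s))))"
    by (rule sqint_bound[OF sqint_cmult[OF gauss_sqint, of "complex_of_real (exp (\<rho> \<bullet> \<rho>))"]])
       (use b in auto)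
  from sqint_mult[OF this g] show "integrable lborel (gP g \<rho>)" unfolding gP_def[abs_def] .
  show "sqint lborel (gP g \<rho>)"
  proof (rule sqint_bound[OF sqint_cmult[OF g, of "complex_of_real (exp (\<rho> \<bullet> \<rho>))"]])
    show "gP g \<rho> \<in> borel_measurable lborel" unfolding gP_def by measurable
    fix s
    have "\<alpha> * (\<rho> \<bullet> s) - (\<alpha>\<^sup>2 / 2) * (s \<bullet> s) \<le> \<rho> \<bullet> \<rho>" using e[of s] by (smt (verit) inner_ge_zero mult_nonneg_nonneg zero_le_power2 divide_nonneg_nonneg mult_minus_left)
    then show "cmod (gP g \<rho> s) \<le> cmod (complex_of_real (exp (\<rho> \<bullet> \<rho>)) * g s)"
      unfolding gP_def norm_mult by (intro mult_right_mono) auto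
  qed
qed

lemma S_nn_norm:
  assumes g: "sqint lborel g"
  shows "(\<integral>\<^sup>+z. ennreal ((cmod (S g z))\<^sup>2 * wgt z) \<partial>lborel) = ennreal N * (\<integral>\<^sup>+s. ennreal ((cmod (g s))\<^sup>2) \<partial>lborel)"
proof -
  have [measurable]: "g \<in> borel_measurable borel" using g by (simp add: sqint_def)
  define h where "h x = ennreal ((cmod (ft (gP g (fst x)) (\<alpha> *\<^sub>R snd x)))\<^sup>2 * exp (- (fst x \<bullet> fst x)))" for x :: "'v \<times> 'v"
  have hm[measurable]: "h \<in> borel_measurable borel"
    unfolding h_def[abs_def] ft_def gP_def borel_prod[symmetric] by measurable
  have eq: "ennreal ((cmod (S g z))\<^sup>2 * wgt z) = h (Pm z, Rm z)" for z
  proof -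
    have "(cmod (S g z))\<^sup>2 * wgt z = (exp (- (\<alpha>\<^sup>2 / 2) * (fst z \<bullet> fst z - snd z \<bullet> snd z)))\<^sup>2 * (cmod (ft (gP g (Pm z)) (\<alpha> *\<^sub>R Rm z)))\<^sup>2 * wgt z"
      unfolding S_eq_ft by (simp add: norm_mult power_mult_distrib)
    also have "(exp (- (\<alpha>\<^sup>2 / 2) * (fst z \<bullet> fst z - snd z \<bullet> snd z)))\<^sup>2 = exp (- (\<alpha>\<^sup>2 * (fst z \<bullet> fst z - snd z \<bullet> snd z)))"
      unfolding exp_double[symmetric] by simp
    also have "exp (- (\<alpha>\<^sup>2 * (fst z \<bullet> fst z - snd z \<bullet> snd z))) * (cmod (ft (gP g (Pm z)) (\<alpha> *\<^sub>R Rm z)))\<^sup>2 * wgt z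
      = (cmod (ft (gP g (Pm z)) (\<alpha> *\<^sub>R Rm z)))\<^sup>2 * (exp (- (\<alpha>\<^sup>2 * (fst z \<bullet> fst z - snd z \<bullet> snd z))) * wgt z)" by simp
    also have "exp (- (\<alpha>\<^sup>2 * (fst z \<bullet> fst z - snd z \<bullet> snd z))) * wgt z = exp (- (Pm z \<bullet> Pm z))"
      unfolding wgt_def exp_add[symmetric] by simp
    finally show ?thesis by (simp add: h_def)
  qed
  \<comment> \<open>The exponent is the negative squared distance of \<open>\<rho>\<close> from
    \<open>\<alpha> *\<^sub>R s\<close>, so the integral over \<open>\<rho>\<close> does not depend
    on \<open>s\<close>. This is what makes \<open>S\<close> a multiple of an isometry.\<close>
  have gg: "(\<integral>\<^sup>+\<rho>. ennreal (exp (2 * \<alpha> * (\<rho> \<bullet> s) - (\<alpha>\<^sup>2) * (s \<bullet> s) - \<rho> \<bullet> \<rho>)) \<partial>lborel) = ennreal (sqrt pi ^ DIM('v))" for s :: 'v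
  proof -
    have "has_bochner_integral lborel (\<lambda>\<rho>. exp (((2 * \<alpha>) *\<^sub>R s) \<bullet> \<rho> - 1 * (\<rho> \<bullet> \<rho>)) * exp (- (\<alpha>\<^sup>2) * (s \<bullet> s)))
      (sqrt (pi / 1) ^ DIM('v) * exp ((((2 * \<alpha>) *\<^sub>R s) \<bullet> ((2 * \<alpha>) *\<^sub>R s)) / (4 * 1)) * exp (- (\<alpha>\<^sup>2) * (s \<bullet> s)))"
      by (intro has_bochner_integral_mult_left gauss_real) auto
    also have "sqrt (pi / 1) ^ DIM('v) * exp ((((2 * \<alpha>) *\<^sub>R s) \<bullet> ((2 * \<alpha>) *\<^sub>R s)) / (4 * 1)) * exp (- (\<alpha>\<^sup>2) * (s \<bullet> s)) = sqrt pi ^ DIM('v)"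
      by (simp add: mult.assoc exp_add[symmetric] power2_eq_square)
    also have "(\<lambda>\<rho>. exp (((2 * \<alpha>) *\<^sub>R s) \<bullet> \<rho> - 1 * (\<rho> \<bullet> \<rho>)) * exp (- (\<alpha>\<^sup>2) * (s \<bullet> s))) = (\<lambda>\<rho>. exp (2 * \<alpha> * (\<rho> \<bullet> s) - (\<alpha>\<^sup>2) * (s \<bullet> s) - \<rho> \<bullet> \<rho>))"
      by (auto simp: exp_add[symmetric] inner_commute algebra_simps)
    finally show ?thesis
      by (subst nn_integral_eq_integral) (auto simp: has_bochner_integral_iff)
  qed
  have inner: "ennreal (\<alpha> ^ DIM('v)) * (\<integral>\<^sup>+r. h (\<rho>, r) \<partial>lborel) =
     ennreal ((2 * pi) ^ DIM('v)) * (\<integral>\<^sup>+s. ennreal ((cmod (g s))\<^sup>2) * ennreal (exp (2 * \<alpha> * (\<rho> \<bullet> s) - (\<alpha>\<^sup>2) * (s \<bullet> s) - \<rho> \<bullet> \<rho>)) \<partial>lborel)" for \<rho>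
  proof -
    note p = gP_props[OF g, of \<rho>]
    have [measurable]: "gP g \<rho> \<in> borel_measurable borel" using p(1) by auto
    have "ennreal (\<alpha> ^ DIM('v)) * (\<integral>\<^sup>+r. h (\<rho>, r) \<partial>lborel) =
      ennreal (exp (- (\<rho> \<bullet> \<rho>))) * (ennreal (\<bar>\<alpha>\<bar> ^ DIM('v)) * (\<integral>\<^sup>+r. ennreal ((cmod (ft (gP g \<rho>) (0 + \<alpha> *\<^sub>R r)))\<^sup>2) \<partial>lborel))"
      using \<alpha>_pos by (simp add: h_def ennreal_mult nn_integral_multc mult_ac nn_integral_cmult)
    also have "ennreal (\<bar>\<alpha>\<bar> ^ DIM('v)) * (\<integral>\<^sup>+r. ennreal ((cmod (ft (gP g \<rho>) (0 + \<alpha> *\<^sub>R r)))\<^sup>2) \<partial>lborel) = (\<integral>\<^sup>+r. ennreal ((cmod (ft (gP g \<rho>) r))\<^sup>2) \<partial>lborel)"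
      using \<alpha>_pos by (intro lborel_nn_integral_affine[symmetric]) auto
    also have "\<dots> = ennreal ((2 * pi) ^ DIM('v)) * (\<integral>\<^sup>+s. ennreal ((cmod (gP g \<rho> s))\<^sup>2) \<partial>lborel)"
      by (rule plancherel[OF p])
    also have "ennreal (exp (- (\<rho> \<bullet> \<rho>))) * \<dots> = ennreal ((2 * pi) ^ DIM('v)) * (\<integral>\<^sup>+s. ennreal (exp (- (\<rho> \<bullet> \<rho>))) * ennreal ((cmod (gP g \<rho> s))\<^sup>2) \<partial>lborel)"
      by (subst nn_integral_cmult) (auto simp: mult_ac)
    also have "(\<integral>\<^sup>+s. ennreal (exp (- (\<rho> \<bullet> \<rho>))) * ennreal ((cmod (gP g \<rho> s))\<^sup>2) \<partial>lborel) =
      (\<integral>\<^sup>+s. ennreal ((cmod (g s))\<^sup>2) * ennreal (exp (2 * \<alpha> * (\<rho> \<bullet> s) - (\<alpha>\<^sup>2) * (s \<bullet> s) - \<rho> \<bullet> \<rho>)) \<partial>lborel)"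
    proof (rule nn_integral_cong)
      fix s
      have "exp (- (\<rho> \<bullet> \<rho>)) * (cmod (gP g \<rho> s))\<^sup>2 = (cmod (g s))\<^sup>2 * (exp (- (\<rho> \<bullet> \<rho>)) * (exp (\<alpha> * (\<rho> \<bullet> s) - (\<alpha>\<^sup>2 / 2) * (s \<bullet> s)))\<^sup>2)"
        by (simp add: gP_def norm_mult power_mult_distrib)
      also have "exp (- (\<rho> \<bullet> \<rho>)) * (exp (\<alpha> * (\<rho> \<bullet> s) - (\<alpha>\<^sup>2 / 2) * (s \<bullet> s)))\<^sup>2 = exp (2 * \<alpha> * (\<rho> \<bullet> s) - (\<alpha>\<^sup>2) * (s \<bullet> s) - \<rho> \<bullet> \<rho>)"
        unfolding exp_double[symmetric] exp_add[symmetric] by (simp add: algebra_simps)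
      finally show "ennreal (exp (- (\<rho> \<bullet> \<rho>))) * ennreal ((cmod (gP g \<rho> s))\<^sup>2) = ennreal ((cmod (g s))\<^sup>2) * ennreal (exp (2 * \<alpha> * (\<rho> \<bullet> s) - (\<alpha>\<^sup>2) * (s \<bullet> s) - \<rho> \<bullet> \<rho>))"
        by (simp add: ennreal_mult[symmetric])
    qed
    finally show ?thesis .
  qed
  have [measurable]: "h \<in> borel_measurable (borel \<Otimes>\<^sub>M borel)" by (simp add: borel_prod)
  have "ennreal (\<alpha> ^ DIM('v)) * (\<integral>\<^sup>+x. h x \<partial>lborel) = (\<integral>\<^sup>+\<rho>. ennreal (\<alpha> ^ DIM('v)) * (\<integral>\<^sup>+r. h (\<rho>, r) \<partial>lborel) \<partial>lborel)"
    by (subst nn_integral_lborel_pair(1)) (auto simp: nn_integral_cmult)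
  also have "\<dots> = ennreal ((2 * pi) ^ DIM('v)) * (\<integral>\<^sup>+\<rho>. \<integral>\<^sup>+s. ennreal ((cmod (g s))\<^sup>2) * ennreal (exp (2 * \<alpha> * (\<rho> \<bullet> s) - (\<alpha>\<^sup>2) * (s \<bullet> s) - \<rho> \<bullet> \<rho>)) \<partial>lborel \<partial>lborel)"
    unfolding inner by (rule nn_integral_cmult) measurable
  also have "(\<integral>\<^sup>+\<rho>. \<integral>\<^sup>+s. ennreal ((cmod (g s))\<^sup>2) * ennreal (exp (2 * \<alpha> * (\<rho> \<bullet> s) - (\<alpha>\<^sup>2) * (s \<bullet> s) - \<rho> \<bullet> \<rho>)) \<partial>lborel \<partial>lborel)
    = (\<integral>\<^sup>+s. \<integral>\<^sup>+\<rho>. ennreal ((cmod (g s))\<^sup>2) * ennreal (exp (2 * \<alpha> * (\<rho> \<bullet> s) - (\<alpha>\<^sup>2) * (s \<bullet> s) - \<rho> \<bullet> \<rho>)) \<partial>lborel \<partial>lborel)"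
    by (rule lborel_pair.Fubini') measurable
  also have "\<dots> = (\<integral>\<^sup>+s. ennreal ((cmod (g s))\<^sup>2) * ennreal (sqrt pi ^ DIM('v)) \<partial>lborel)"
    by (rule nn_integral_cong) (subst nn_integral_cmult, auto simp: gg)
  also have "\<dots> = (\<integral>\<^sup>+s. ennreal ((cmod (g s))\<^sup>2) \<partial>lborel) * ennreal (sqrt pi ^ DIM('v))"
    by (rule nn_integral_multc) measurable
  finally have 1: "ennreal (\<alpha> ^ DIM('v)) * (\<integral>\<^sup>+x. h x \<partial>lborel) = ennreal ((2 * pi) ^ DIM('v)) * ((\<integral>\<^sup>+s. ennreal ((cmod (g s))\<^sup>2) \<partial>lborel) * ennreal (sqrt pi ^ DIM('v)))" .
  define X where "X = (\<integral>\<^sup>+z. h (Pm z, Rm z) \<partial>lborel)"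
  define c where "c = \<alpha> ^ DIM('v) * (\<alpha>\<^sup>2 - \<gamma>\<^sup>2) ^ DIM('v)"
  have c: "c > 0" using \<alpha>_pos \<gamma>_less by (simp add: c_def)
  have "ennreal c * X = ennreal (\<alpha> ^ DIM('v)) * (ennreal ((\<alpha>\<^sup>2 - \<gamma>\<^sup>2) ^ DIM('v)) * X)"
    using \<alpha>_pos \<gamma>_less by (simp add: c_def ennreal_mult mult.assoc)
  also have "\<dots> = ennreal (c * N) * (\<integral>\<^sup>+s. ennreal ((cmod (g s))\<^sup>2) \<partial>lborel)"
    unfolding X_def nn_integral_RP[OF hm] 1 using c by (simp add: N_def c_def[symmetric] ennreal_mult mult_ac)
  also have "\<dots> = ennreal c * (ennreal N * (\<integral>\<^sup>+s. ennreal ((cmod (g s))\<^sup>2) \<partial>lborel))"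
    using c N_pos by (simp add: ennreal_mult mult.assoc)
  finally have "X = ennreal N * (\<integral>\<^sup>+s. ennreal ((cmod (g s))\<^sup>2) \<partial>lborel)"
    using c by (simp add: ennreal_mult_cancel_left)
  then show ?thesis unfolding eq X_def .
qed

lemma mu_sets [measurable_cong, simp]: "sets mu = sets borel" "space mu = UNIV"
  by (simp_all add: mu_def)

lemma sqint_mu_iff: "sqint mu E \<longleftrightarrow> E \<in> borel_measurable borel \<and> (\<integral>\<^sup>+z. ennreal ((cmod (E z))\<^sup>2 * wgt z) \<partial>lborel) < \<infinity>"
proof -
  have "(\<integral>\<^sup>+z. ennreal ((cmod (E z))\<^sup>2) \<partial>mu) = (\<integral>\<^sup>+z. ennreal ((cmod (E z))\<^sup>2 * wgt z) \<partial>lborel)" if "E \<in> borel_measurable borel"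
    unfolding mu_def using that wgt_pos by (subst nn_integral_density) (auto simp: ennreal_mult[symmetric] less_imp_le mult.commute)
  then show ?thesis unfolding sqint_iff_nn by (auto simp: measurable_cong_sets[OF mu_sets(1) refl])
qed

lemma nn_mu: "E \<in> borel_measurable borel \<Longrightarrow> (\<integral>\<^sup>+z. ennreal ((cmod (E z))\<^sup>2) \<partial>mu) = (\<integral>\<^sup>+z. ennreal ((cmod (E z))\<^sup>2 * wgt z) \<partial>lborel)"
  unfolding mu_def using wgt_pos by (subst nn_integral_density) (auto simp: ennreal_mult[symmetric] less_imp_le mult.commute)

lemma S_isometry:
  assumes g: "sqint lborel g"
  shows "sqint mu (S g)" "l2n mu (S g) = sqrt N * l2n lborel g"
proof -
  have [measurable]: "g \<in> borel_measurable borel" using g by (simp add: sqint_def)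
  show 1: "sqint mu (S g)"
    unfolding sqint_mu_iff S_nn_norm[OF g] using g[unfolded sqint_iff_nn] by (auto simp: ennreal_mult_less_top)
  have "ennreal ((l2n mu (S g))\<^sup>2) = ennreal (N * (l2n lborel g)\<^sup>2)"
    using sqint_nn_eq[OF 1] unfolding nn_mu[OF S_measurable[OF \<open>g \<in> borel_measurable borel\<close>]] S_nn_norm[OF g] sqint_nn_eq[OF g] using N_pos by (simp add: ennreal_mult)
  then have "(l2n mu (S g))\<^sup>2 = N * (l2n lborel g)\<^sup>2" using N_pos by simp
  then have "sqrt ((l2n mu (S g))\<^sup>2) = sqrt (N * (l2n lborel g)\<^sup>2)" by simp
  then show "l2n mu (S g) = sqrt N * l2n lborel g"
    by (simp add: real_sqrt_mult l2n_nonneg)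
qed

lemma mu_integrable_iff:
  fixes f :: "'v \<times> 'v \<Rightarrow> complex"
  assumes "f \<in> borel_measurable borel"
  shows "integrable mu f \<longleftrightarrow> integrable lborel (\<lambda>z. complex_of_real (wgt z) * f z)"
  unfolding mu_def using assms wgt_pos by (subst integrable_density) (auto simp: less_imp_le scaleR_conv_of_real)

lemma mu_integral:
  fixes f :: "'v \<times> 'v \<Rightarrow> complex"
  assumes "f \<in> borel_measurable borel"
  shows "integral\<^sup>L mu f = (LINT z|lborel. complex_of_real (wgt z) * f z)"
  unfolding mu_def using assms wgt_pos by (subst integral_density) (auto simp: less_imp_le scaleR_conv_of_real)

end

section \<open>Reproducing kernel and mean value property\<close>

context skew
begin

text \<open>The order of the components matters: R + iP equals (\<gamma> J + i \<alpha>) applied to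
  x + iy, hence is complex linear, and a phase rotation of \<open>z\<close> only rotates
  \<open>om z\<close>.\<close>

definition om :: "'v \<times> 'v \<Rightarrow> 'v \<times> 'v" where "om z = (Rm z, Pm z)"

lemma om_csc: "om (csc c z) = csc c (om z)"
  by (simp add: om_def csc_def Rm_def Pm_def J_simps scaleR_diff_right scaleR_add_right mult.commute algebra_simps)

lemma Pm_add: "Pm (z + z') = Pm z + Pm z'" and Rm_add: "Rm (z + z') = Rm z + Rm z'"
  by (simp_all add: Pm_def Rm_def J_simps algebra_simps)

text \<open>The integral kernel of \<open>S\<close> composed with its adjoint with respect to
  \<open>mu\<close>; divided by \<open>N\<close> it is the reproducing kernel.\<close>

definition Kr :: "'v \<times> 'v \<Rightarrow> 'v \<times> 'v \<Rightarrow> complex" where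
  "Kr z0 z = (LINT s|lborel. kern z0 s * cnj (kern z s))"

lemma Kr_eq: "Kr z0 z = complex_of_real (sqrt (pi / \<alpha>\<^sup>2) ^ DIM('v)) *
    exp (complex_of_real (- (\<alpha>\<^sup>2 / 2) * (fst z0 \<bullet> fst z0 - snd z0 \<bullet> snd z0) - (\<alpha>\<^sup>2 / 2) * (fst z \<bullet> fst z - snd z \<bullet> snd z)
          + ((Pm z0 + Pm z) \<bullet> (Pm z0 + Pm z) - (Rm z - Rm z0) \<bullet> (Rm z - Rm z0)) / 4)
       + \<i> * complex_of_real (- (\<alpha>\<^sup>2) * (fst z0 \<bullet> snd z0) + \<alpha>\<^sup>2 * (fst z \<bullet> snd z) + ((Pm z0 + Pm z) \<bullet> (Rm z - Rm z0)) / 2))"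
proof -
  define a where "a = - (\<alpha>\<^sup>2 / 2) * (fst z0 \<bullet> fst z0 - snd z0 \<bullet> snd z0) - (\<alpha>\<^sup>2 / 2) * (fst z \<bullet> fst z - snd z \<bullet> snd z)"
  define b where "b = - (\<alpha>\<^sup>2) * (fst z0 \<bullet> snd z0) + \<alpha>\<^sup>2 * (fst z \<bullet> snd z)"
  define x where "x = \<alpha> *\<^sub>R (Pm z0 + Pm z)"
  define y where "y = \<alpha> *\<^sub>R (Rm z - Rm z0)"
  have 1: "kern z0 s * cnj (kern z s) = exp (complex_of_real a + \<i> * complex_of_real b) *
      exp (complex_of_real (x \<bullet> s - \<alpha>\<^sup>2 * (s \<bullet> s)) + \<i> * complex_of_real (y \<bullet> s))" for s
  proof -
    have "kA z0 s + kA z s = a + (x \<bullet> s - \<alpha>\<^sup>2 * (s \<bullet> s))"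
      unfolding kA_def a_def x_def by (simp add: inner_simps algebra_simps)
    moreover have "kB z0 s - kB z s = b + y \<bullet> s"
      unfolding kB_def b_def y_def by (simp add: inner_simps algebra_simps)
    moreover have "kern z0 s * cnj (kern z s) = exp (complex_of_real (kA z0 s + kA z s) + \<i> * complex_of_real (kB z0 s - kB z s))"
      unfolding kern_def exp_cnj exp_add[symmetric] by (simp add: algebra_simps)
    ultimately have "kern z0 s * cnj (kern z s) = exp (complex_of_real (a + (x \<bullet> s - \<alpha>\<^sup>2 * (s \<bullet> s))) + \<i> * complex_of_real (b + y \<bullet> s))"
      by presburger
    then show ?thesis unfolding exp_add[symmetric] by (simp add: algebra_simps)
  qed
  have "has_bochner_integral lborel (\<lambda>s. exp (complex_of_real (x \<bullet> s - \<alpha>\<^sup>2 * (s \<bullet> s)) + \<i> * complex_of_real (y \<bullet> s)))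
     (complex_of_real (sqrt (pi / \<alpha>\<^sup>2) ^ DIM('v)) *
        exp (complex_of_real ((x \<bullet> x - y \<bullet> y) / (4 * \<alpha>\<^sup>2)) + \<i> * complex_of_real ((x \<bullet> y) / (2 * \<alpha>\<^sup>2))))"
    by (rule gauss_fourier) (use \<alpha>_pos in simp)
  then have "Kr z0 z = exp (complex_of_real a + \<i> * complex_of_real b) * (complex_of_real (sqrt (pi / \<alpha>\<^sup>2) ^ DIM('v)) *
        exp (complex_of_real ((x \<bullet> x - y \<bullet> y) / (4 * \<alpha>\<^sup>2)) + \<i> * complex_of_real ((x \<bullet> y) / (2 * \<alpha>\<^sup>2))))"
    unfolding Kr_def 1 by (simp only: integral_mult_right_zero has_bochner_integral_integral_eq)
  moreover have "(x \<bullet> x - y \<bullet> y) / (4 * \<alpha>\<^sup>2) = ((Pm z0 + Pm z) \<bullet> (Pm z0 + Pm z) - (Rm z - Rm z0) \<bullet> (Rm z - Rm z0)) / 4"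
  proof -
    have "x \<bullet> x - y \<bullet> y = \<alpha>\<^sup>2 * ((Pm z0 + Pm z) \<bullet> (Pm z0 + Pm z) - (Rm z - Rm z0) \<bullet> (Rm z - Rm z0))"
      unfolding x_def y_def by (simp add: power2_eq_square right_diff_distrib)
    then show ?thesis using \<alpha>_pos by simp
  qed
  moreover have "(x \<bullet> y) / (2 * \<alpha>\<^sup>2) = ((Pm z0 + Pm z) \<bullet> (Rm z - Rm z0)) / 2"
  proof -
    have "x \<bullet> y = \<alpha>\<^sup>2 * ((Pm z0 + Pm z) \<bullet> (Rm z - Rm z0))"
      unfolding x_def y_def by (simp add: power2_eq_square)
    then show ?thesis using \<alpha>_pos by simp
  qed
  ultimately have "Kr z0 z = complex_of_real (sqrt (pi / \<alpha>\<^sup>2) ^ DIM('v)) * (exp (complex_of_real a + \<i> * complex_of_real b) *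
     exp (complex_of_real (((Pm z0 + Pm z) \<bullet> (Pm z0 + Pm z) - (Rm z - Rm z0) \<bullet> (Rm z - Rm z0)) / 4) + \<i> * complex_of_real (((Pm z0 + Pm z) \<bullet> (Rm z - Rm z0)) / 2)))"
    by (simp only: mult_ac)
  then show ?thesis unfolding exp_add[symmetric] a_def[symmetric] b_def[symmetric]
    by (simp only: of_real_add distrib_left add_ac)
qed

definition hol :: "'v \<times> 'v \<Rightarrow> 'v \<times> 'v \<Rightarrow> complex" where
  "hol z0 \<eta> = complex_of_real (\<alpha>\<^sup>2) * bil z0 \<eta> + complex_of_real (\<alpha>\<^sup>2 / 2) * bil \<eta> \<eta>
     + complex_of_real (1/4) * bil (om \<eta>) (om \<eta>) + \<i> * bil (Pm z0, 0) (om \<eta>)"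

text \<open>After recentring at \<open>z0\<close> the reproducing kernel times the weight is a function of \<open>|om \<eta>|\<close>
  times the exponential of a holomorphic polynomial in \<open>\<eta>\<close>.\<close>
lemma Kr_wgt: "Kr z0 (z0 + \<eta>) * complex_of_real (wgt (z0 + \<eta>)) =
   complex_of_real (sqrt (pi / \<alpha>\<^sup>2) ^ DIM('v)) * (exp (hol z0 \<eta>) * complex_of_real (exp (- (om \<eta> \<bullet> om \<eta>) / 2)))"
proof -
  let ?A = "- (\<alpha>\<^sup>2 / 2) * (fst z0 \<bullet> fst z0 - snd z0 \<bullet> snd z0) - (\<alpha>\<^sup>2 / 2) * (fst (z0 + \<eta>) \<bullet> fst (z0 + \<eta>) - snd (z0 + \<eta>) \<bullet> snd (z0 + \<eta>))
          + ((Pm z0 + Pm (z0 + \<eta>)) \<bullet> (Pm z0 + Pm (z0 + \<eta>)) - (Rm (z0 + \<eta>) - Rm z0) \<bullet> (Rm (z0 + \<eta>) - Rm z0)) / 4"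
  let ?B = "- (\<alpha>\<^sup>2) * (fst z0 \<bullet> snd z0) + \<alpha>\<^sup>2 * (fst (z0 + \<eta>) \<bullet> snd (z0 + \<eta>)) + ((Pm z0 + Pm (z0 + \<eta>)) \<bullet> (Rm (z0 + \<eta>) - Rm z0)) / 2"
  let ?W = "\<alpha>\<^sup>2 * (fst (z0 + \<eta>) \<bullet> fst (z0 + \<eta>) - snd (z0 + \<eta>) \<bullet> snd (z0 + \<eta>)) - Pm (z0 + \<eta>) \<bullet> Pm (z0 + \<eta>)"
  have "complex_of_real ?A + \<i> * complex_of_real ?B + complex_of_real ?W = hol z0 \<eta> + complex_of_real (- (om \<eta> \<bullet> om \<eta>) / 2)"
    by (simp add: complex_eq_iff hol_def bil_def om_def Pm_add Rm_add inner_simps inner_commute inner_prod_def)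
       (simp add: field_simps)
  then have "exp (complex_of_real ?A + \<i> * complex_of_real ?B) * exp (complex_of_real ?W) = exp (hol z0 \<eta>) * exp (complex_of_real (- (om \<eta> \<bullet> om \<eta>) / 2))"
    unfolding exp_add[symmetric] by simp
  then show ?thesis unfolding Kr_eq wgt_def exp_of_real[symmetric] mult.assoc by presburger
qed

text \<open>Up to conjugation the kernel function at \<open>z0\<close> is \<open>S\<close> of a
  square-integrable function, so the isometry yields its square integrability for \<open>mu\<close>
  without estimates on the explicit formula.\<close>

lemma Kr_eq_S: "Kr z0 z = cnj (S (\<lambda>s. cnj (kern z0 s)) z)"
proof -
  have "S (\<lambda>s. cnj (kern z0 s)) z = (LINT s|lborel. cnj (kern z0 s * cnj (kern z s)))"
    unfolding S_def by (simp add: mult.commute)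
  also have "\<dots> = cnj (Kr z0 z)"
    unfolding Kr_def by (rule integral_bounded_linear[OF bounded_linear_cnj sqint_mult[OF kern_sqint sqint_cnj[OF kern_sqint]]])
  finally show ?thesis by simp
qed

lemma Kr_sqint: "sqint mu (Kr z0)"
proof -
  have "sqint mu (\<lambda>z. cnj (S (\<lambda>s. cnj (kern z0 s)) z))"
    by (intro sqint_cnj S_isometry kern_sqint)
  then show ?thesis unfolding Kr_eq_S[symmetric] .
qed

lemma gauss_om:
  "integrable lborel (\<lambda>\<eta>. exp (- (om \<eta> \<bullet> om \<eta>) / 2))"
  "(LINT \<eta>|lborel. exp (- (om \<eta> \<bullet> om \<eta>) / 2)) = (2 * pi) ^ DIM('v) / (\<alpha>\<^sup>2 - \<gamma>\<^sup>2) ^ DIM('v)"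
proof -
  define h where "h x = ennreal (exp (- (x \<bullet> x) / 2))" for x :: "'v \<times> 'v"
  have [measurable]: "h \<in> borel_measurable borel" unfolding h_def by measurable
  have h: "h (Pm \<eta>, Rm \<eta>) = ennreal (exp (- (om \<eta> \<bullet> om \<eta>) / 2))" for \<eta>
    by (simp add: h_def om_def add.commute)
  have "has_bochner_integral lborel (\<lambda>x::'v\<times>'v. exp (0 \<bullet> x - (1/2) * (x \<bullet> x))) (sqrt (pi / (1/2)) ^ DIM('v\<times>'v) * exp ((0 \<bullet> (0::'v\<times>'v)) / (4 * (1/2))))"
    by (rule gauss_real) simp
  moreover have "sqrt (pi / (1/2)) ^ DIM('v\<times>'v) = (2 * pi) ^ DIM('v)"
  proof -
    have "sqrt (pi / (1/2)) ^ DIM('v\<times>'v) = (sqrt (2 * pi) * sqrt (2 * pi)) ^ DIM('v)"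
      unfolding power_mult_distrib by (simp add: power_add mult.commute)
    then show ?thesis by simp
  qed
  ultimately have "has_bochner_integral lborel (\<lambda>x::'v\<times>'v. exp (- (x \<bullet> x) / 2)) ((2 * pi) ^ DIM('v))" by simp
  then have "(\<integral>\<^sup>+x. h x \<partial>lborel) = ennreal ((2 * pi) ^ DIM('v))"
    unfolding h_def by (subst nn_integral_eq_integral) (auto simp: has_bochner_integral_iff)
  with nn_integral_RP[of h] have e: "ennreal ((\<alpha>\<^sup>2 - \<gamma>\<^sup>2) ^ DIM('v)) * (\<integral>\<^sup>+\<eta>. ennreal (exp (- (om \<eta> \<bullet> om \<eta>) / 2)) \<partial>lborel) = ennreal ((2 * pi) ^ DIM('v))"
    by (simp add: h)
  define c where "c = (\<alpha>\<^sup>2 - \<gamma>\<^sup>2) ^ DIM('v)"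
  have c: "c > 0" using \<gamma>_less by (simp add: c_def)
  have "ennreal c * ennreal ((2 * pi) ^ DIM('v) / c) = ennreal ((2 * pi) ^ DIM('v))"
    using c by (simp add: ennreal_mult[symmetric])
  then have "ennreal c * (\<integral>\<^sup>+\<eta>. ennreal (exp (- (om \<eta> \<bullet> om \<eta>) / 2)) \<partial>lborel) = ennreal c * ennreal ((2 * pi) ^ DIM('v) / c)"
    using e[folded c_def] by metis
  then have e2: "(\<integral>\<^sup>+\<eta>. ennreal (exp (- (om \<eta> \<bullet> om \<eta>) / 2)) \<partial>lborel) = ennreal ((2 * pi) ^ DIM('v) / c)"
    by (subst (asm) ennreal_mult_cancel_left) (use c in auto)
  have m: "(\<lambda>\<eta>. exp (- (om \<eta> \<bullet> om \<eta>) / 2)) \<in> borel_measurable lborel"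
    unfolding om_def by (auto intro!: borel_measurable_continuous_onI continuous_intros)
  have "has_bochner_integral lborel (\<lambda>\<eta>. exp (- (om \<eta> \<bullet> om \<eta>) / 2)) ((2 * pi) ^ DIM('v) / c)"
    by (rule has_bochner_integral_nn_integral[OF m]) (use e2 c in auto)
  then show "integrable lborel (\<lambda>\<eta>. exp (- (om \<eta> \<bullet> om \<eta>) / 2))"
    "(LINT \<eta>|lborel. exp (- (om \<eta> \<bullet> om \<eta>) / 2)) = (2 * pi) ^ DIM('v) / (\<alpha>\<^sup>2 - \<gamma>\<^sup>2) ^ DIM('v)"
    by (auto simp: has_bochner_integral_iff c_def)
qed

text \<open>The phase rotations preserve Lebesgue measure and, by complex linearity of
  \<open>om\<close>, the Gaussian factor. Averaging the integral over them replaces \<open>F\<close>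
  by its mean on each circle, which is \<open>F 0\<close>. Integrability of the product is all that
  Fubini needs here, so no growth estimate on \<open>F\<close> enters.\<close>

lemma gaussian_mean_value:
  fixes F :: "'v \<times> 'v \<Rightarrow> complex"
  assumes [measurable]: "F \<in> borel_measurable borel"
    and hF: "\<And>\<eta>. (\<lambda>c. F (csc c \<eta>)) holomorphic_on UNIV"
    and int: "integrable lborel (\<lambda>\<eta>. F \<eta> * complex_of_real (exp (- (om \<eta> \<bullet> om \<eta>) / 2)))"
  shows "(LINT \<eta>|lborel. F \<eta> * complex_of_real (exp (- (om \<eta> \<bullet> om \<eta>) / 2)))
     = complex_of_real ((2 * pi) ^ DIM('v) / (\<alpha>\<^sup>2 - \<gamma>\<^sup>2) ^ DIM('v)) * F 0"
proof -
  define r where "r \<eta> = exp (- (om \<eta> \<bullet> om \<eta>) / 2)" for \<eta>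
  define \<Psi> where "\<Psi> \<eta> = F \<eta> * complex_of_real (r \<eta>)" for \<eta>
  have \<Psi>i: "integrable lborel \<Psi>" using int by (simp add: \<Psi>_def[abs_def] r_def)
  have [measurable]: "\<Psi> \<in> borel_measurable borel" using \<Psi>i by auto
  have r_rot: "r (csc (cis x) \<eta>) = r \<eta>" for x \<eta> by (simp add: r_def om_csc csc_inner)
  define f where "f x \<eta> = indicator {0..1} x *\<^sub>R \<Psi> (csc (cis (2 * pi * x)) \<eta>)" for x :: real and \<eta> :: "'v \<times> 'v"
  have [measurable]: "(\<lambda>p::real\<times>'v\<times>'v. csc (cis (2 * pi * fst p)) (snd p)) \<in> borel \<rightarrow>\<^sub>M borel"
    unfolding csc_def by (intro borel_measurable_continuous_onI continuous_intros)
  then have [measurable]: "(\<lambda>p::real\<times>'v\<times>'v. csc (cis (2 * pi * fst p)) (snd p)) \<in> lborel \<Otimes>\<^sub>M lborel \<rightarrow>\<^sub>M borel"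
    by (simp add: lborel_prod)
  have rm[measurable]: "(csc c :: 'v\<times>'v \<Rightarrow> _) \<in> borel \<rightarrow>\<^sub>M borel" for c
    unfolding csc_def by (intro borel_measurable_continuous_onI continuous_intros)
  have fm: "(\<lambda>p. f (fst p) (snd p)) \<in> borel_measurable (lborel \<Otimes>\<^sub>M lborel)"
    unfolding f_def by measurable
  \<comment> \<open>The angles excluded in \<open>lborel_rotate\<close> are countably many, hence
    null.\<close>
  have good: "AE x in lborel. cos (2 * pi * x) \<noteq> 0"
  proof -
    have "{x. cos (2 * pi * x) = 0} \<subseteq> range (\<lambda>i::int. real_of_int i / 4)"
    proof
      fix x assume "x \<in> {x. cos (2 * pi * x) = 0}"
      then obtain i where "2 * pi * x = real_of_int i * (pi / 2)" by (auto simp: cos_zero_iff_int)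
      then have "x = real_of_int i / 4" by (simp add: field_simps)
      then show "x \<in> range (\<lambda>i::int. real_of_int i / 4)" by blast
    qed
    then have "countable {x. cos (2 * pi * x) = 0}" by (rule countable_subset) auto
    from AE_not_in[OF countable_imp_null_set_lborel[OF this]] show ?thesis by simp
  qed
  have rot: "integrable lborel (\<lambda>\<eta>. \<Psi> (csc (cis (2 * pi * x)) \<eta>))" "(LINT \<eta>|lborel. \<Psi> (csc (cis (2 * pi * x)) \<eta>)) = integral\<^sup>L lborel \<Psi>"
    "(LINT \<eta>|lborel. cmod (\<Psi> (csc (cis (2 * pi * x)) \<eta>))) = (LINT \<eta>|lborel. cmod (\<Psi> \<eta>))" if "cos (2 * pi * x) \<noteq> 0" for x
  proof -
    note d = lborel_rotate[OF that, where 'v='v]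
    have "integrable (distr lborel borel (csc (cis (2 * pi * x)))) \<Psi>" using \<Psi>i d by simp
    then show "integrable lborel (\<lambda>\<eta>. \<Psi> (csc (cis (2 * pi * x)) \<eta>))" by (subst (asm) integrable_distr_eq) auto
    have "integral\<^sup>L lborel \<Psi> = integral\<^sup>L (distr lborel borel (csc (cis (2 * pi * x)))) \<Psi>" using d by simp
    then show "(LINT \<eta>|lborel. \<Psi> (csc (cis (2 * pi * x)) \<eta>)) = integral\<^sup>L lborel \<Psi>" by (simp add: integral_distr)
    have "(LINT \<eta>|lborel. cmod (\<Psi> \<eta>)) = (LINT \<eta>|distr lborel borel (csc (cis (2 * pi * x))). cmod (\<Psi> \<eta>))" using d by simp
    then show "(LINT \<eta>|lborel. cmod (\<Psi> (csc (cis (2 * pi * x)) \<eta>))) = (LINT \<eta>|lborel. cmod (\<Psi> \<eta>))" by (simp add: integral_distr)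
  qed
  have "integrable (lborel \<Otimes>\<^sub>M lborel) (\<lambda>p. f (fst p) (snd p))"
  proof (rule lborel_pair.Fubini_integrable[OF fm])
    show "AE x in lborel. integrable lborel (\<lambda>\<eta>. f (fst (x, \<eta>)) (snd (x, \<eta>)))"
      using good by eventually_elim (simp add: f_def rot)
    have "integrable lborel (\<lambda>x::real. indicator {0..1} x * (LINT \<eta>|lborel. cmod (\<Psi> \<eta>)))"
      by (intro integrable_mult_left integrable_real_indicator) auto
    moreover have "AE x in lborel. (LINT \<eta>|lborel. norm (f (fst (x, \<eta>)) (snd (x, \<eta>)))) = indicator {0..1} x * (LINT \<eta>|lborel. cmod (\<Psi> \<eta>))"
      using good by eventually_elim (simp add: f_def rot)
    moreover have "(\<lambda>x. LINT \<eta>|lborel. norm (f (fst (x, \<eta>)) (snd (x, \<eta>)))) \<in> borel_measurable lborel"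
      using fm by measurable
    ultimately show "integrable lborel (\<lambda>x. LINT \<eta>|lborel. norm (f (fst (x, \<eta>)) (snd (x, \<eta>))))"
      by (subst integrable_cong_AE) auto
  qed
  then have fi: "integrable (lborel \<Otimes>\<^sub>M lborel) (\<lambda>(x, \<eta>). f x \<eta>)" by (simp add: case_prod_unfold)
  have "(LINT x|lborel. (LINT \<eta>|lborel. f x \<eta>)) = (LINT x::real|lborel. indicator {0..1} x *\<^sub>R integral\<^sup>L lborel \<Psi>)"
  proof (rule integral_cong_AE)
    show "(\<lambda>x. LINT \<eta>|lborel. f x \<eta>) \<in> borel_measurable lborel"
      using lborel_pair.integrable_fst[OF fi] by auto
    show "AE x in lborel. (LINT \<eta>|lborel. f x \<eta>) = indicator {0..1} x *\<^sub>R integral\<^sup>L lborel \<Psi>"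
      using good by eventually_elim (simp add: f_def rot)
  qed auto
  also have "\<dots> = integral\<^sup>L lborel \<Psi>" by simp
  finally have 1: "(LINT x|lborel. (LINT \<eta>|lborel. f x \<eta>)) = integral\<^sup>L lborel \<Psi>" .
  have "(LINT x|lborel. f x \<eta>) = F 0 * complex_of_real (r \<eta>)" for \<eta>
  proof -
    have "(LINT x|lborel. f x \<eta>) = (LINT x|lborel. (indicator {0..1} x *\<^sub>R F (csc (cis (2 * pi * x)) \<eta>)) * complex_of_real (r \<eta>))"
      unfolding f_def \<Psi>_def r_rot by (simp add: scaleR_conv_of_real mult_ac)
    also have "\<dots> = (LINT x|lborel. indicator {0..1} x *\<^sub>R F (csc (cis (2 * pi * x)) \<eta>)) * complex_of_real (r \<eta>)"
      by (rule integral_mult_left_zero)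
    also have "\<dots> = F (csc 0 \<eta>) * complex_of_real (r \<eta>)"
      using circle_mean_value[OF hF] by simp
    finally show ?thesis by (simp add: csc_def zero_prod_def)
  qed
  then have "(LINT \<eta>|lborel. (LINT x|lborel. f x \<eta>)) = F 0 * complex_of_real (LINT \<eta>|lborel. r \<eta>)"
    by (simp add: integral_complex_of_real)
  with lborel_pair.Fubini_integral[OF fi] 1 have "integral\<^sup>L lborel \<Psi> = F 0 * complex_of_real (LINT \<eta>|lborel. r \<eta>)" by simp
  then show ?thesis unfolding \<Psi>_def r_def gauss_om(2) by (simp add: mult.commute)
qed

text \<open>Translating \<open>z0\<close> to the origin turns kernel times weight into the
  exponential of a holomorphic polynomial times the Gaussian of \<open>om\<close>, and the mean
  value property applies to the product of \<open>E\<close> with that exponential. Holomorphy enters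
  only along complex lines.\<close>

theorem reproducing:
  assumes E: "sqint mu E" and hE: "\<And>z \<eta>. (\<lambda>c. E (z + csc c \<eta>)) holomorphic_on UNIV"
  shows "integrable mu (\<lambda>z. E z * Kr z0 z)" "(LINT z|mu. E z * Kr z0 z) = complex_of_real N * E z0"
proof -
  show i: "integrable mu (\<lambda>z. E z * Kr z0 z)" by (rule sqint_mult[OF E Kr_sqint])
  have [measurable]: "E \<in> borel_measurable borel" "Kr z0 \<in> borel_measurable borel"
    using E Kr_sqint[of z0] by (auto simp: sqint_mu_iff)
  define C1 where "C1 = sqrt (pi / \<alpha>\<^sup>2) ^ DIM('v)"
  have C1: "C1 > 0" using \<alpha>_pos by (simp add: C1_def)
  define F where "F \<eta> = E (z0 + \<eta>) * exp (hol z0 \<eta>)" for \<eta>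
  have cont: "continuous_on UNIV (hol z0)"
    unfolding hol_def bil_def om_def Complex_eq by (intro continuous_intros)
  then have [measurable]: "hol z0 \<in> borel_measurable borel" by (rule borel_measurable_continuous_onI)
  have Fm: "F \<in> borel_measurable borel" unfolding F_def by measurable
  have eq: "complex_of_real (wgt (\<eta> + z0)) * (E (\<eta> + z0) * Kr z0 (\<eta> + z0)) = complex_of_real C1 * (F \<eta> * complex_of_real (exp (- (om \<eta> \<bullet> om \<eta>) / 2)))" for \<eta>
    using Kr_wgt[of z0 \<eta>] unfolding F_def C1_def[symmetric] by (simp add: add.commute mult_ac)
  have il: "integrable lborel (\<lambda>z. complex_of_real (wgt z) * (E z * Kr z0 z))"
    using i by (subst (asm) mu_integrable_iff) auto
  from integrable_translate[OF this, of z0]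
  have "integrable lborel (\<lambda>\<eta>. complex_of_real C1 * (F \<eta> * complex_of_real (exp (- (om \<eta> \<bullet> om \<eta>) / 2))))"
    unfolding eq .
  from integrable_mult_right[OF this, of "complex_of_real (1 / C1)"]
  have Fi: "integrable lborel (\<lambda>\<eta>. F \<eta> * complex_of_real (exp (- (om \<eta> \<bullet> om \<eta>) / 2)))" using C1 by (simp add: mult.assoc[symmetric])
  have hF: "(\<lambda>c. F (csc c \<eta>)) holomorphic_on UNIV" for \<eta>
  proof -
    have "hol z0 (csc c \<eta>) = c * (complex_of_real (\<alpha>\<^sup>2) * bil z0 \<eta> + \<i> * bil (Pm z0, 0) (om \<eta>))
        + c\<^sup>2 * (complex_of_real (\<alpha>\<^sup>2 / 2) * bil \<eta> \<eta> + complex_of_real (1/4) * bil (om \<eta>) (om \<eta>))" for c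
      unfolding hol_def om_csc bil_csc by (simp add: algebra_simps power2_eq_square)
    then show ?thesis unfolding F_def by (simp only:) (intro holomorphic_intros hE)
  qed
  have "(LINT z|mu. E z * Kr z0 z) = (LINT z|lborel. complex_of_real (wgt z) * (E z * Kr z0 z))"
    by (rule mu_integral) simp
  also have "\<dots> = (LINT \<eta>|lborel. complex_of_real (wgt (\<eta> + z0)) * (E (\<eta> + z0) * Kr z0 (\<eta> + z0)))"
    by (rule integral_translate[symmetric]) simp
  also have "\<dots> = complex_of_real C1 * (LINT \<eta>|lborel. F \<eta> * complex_of_real (exp (- (om \<eta> \<bullet> om \<eta>) / 2)))"
    unfolding eq by (rule integral_mult_right_zero)
  also have "\<dots> = complex_of_real C1 * (complex_of_real ((2 * pi) ^ DIM('v) / (\<alpha>\<^sup>2 - \<gamma>\<^sup>2) ^ DIM('v)) * F 0)"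
    unfolding gaussian_mean_value[OF Fm hF Fi] ..
  \<comment> \<open>The polynomial \<open>hol z0\<close> has no constant term.\<close>
  also have "F 0 = E z0" by (simp add: F_def hol_def bil_def om_def Pm_def Rm_def J_simps linear_0[OF bounded_linear.linear[OF J_linear]] zero_complex.code[symmetric])
  also have "complex_of_real C1 * (complex_of_real ((2 * pi) ^ DIM('v) / (\<alpha>\<^sup>2 - \<gamma>\<^sup>2) ^ DIM('v)) * E z0) = complex_of_real (C1 * ((2 * pi) ^ DIM('v) / (\<alpha>\<^sup>2 - \<gamma>\<^sup>2) ^ DIM('v))) * E z0"
    by simp
  \<comment> \<open>The value of the kernel's Gaussian prefactor times the total mass of the
    Gaussian in \<open>om\<close> is the squared norm of \<open>S\<close>.\<close>
  also have "C1 * ((2 * pi) ^ DIM('v) / (\<alpha>\<^sup>2 - \<gamma>\<^sup>2) ^ DIM('v)) = N"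
    unfolding C1_def N_def using \<alpha>_pos by (simp add: real_sqrt_divide power_divide)
  finally show "(LINT z|mu. E z * Kr z0 z) = complex_of_real N * E z0" .
qed

section \<open>The adjoint on bounded functions of bounded support\<close>

lemma cball_finite: "emeasure lborel (cball (0::'v\<times>'v) k) < top"
  using emeasure_bounded_finite[OF bounded_cball, of "0::'v\<times>'v" k] by simp

lemma wgt_bounded:
  obtains W where "\<And>z. norm z \<le> k \<Longrightarrow> wgt z \<le> W"
proof -
  have "compact (wgt ` cball 0 k)" by (intro compact_continuous_image continuous_on_subset[OF cont_wgt]) auto
  from compact_imp_bounded[OF this] obtain W where W: "\<forall>x\<in>wgt ` cball 0 k. norm x \<le> W" unfolding bounded_iff by blast
  have "wgt z \<le> W" if "norm z \<le> k" for z
  proof -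
    have "norm (wgt z) \<le> W" using W that by simp
    then show ?thesis using wgt_pos[of z] by simp
  qed
  then show ?thesis using that by blast
qed

text \<open>The adjoint of \<open>S\<close> from the weighted space, with the weight written out so
  that the integral is over Lebesgue measure. It is studied for bounded \<open>u\<close> vanishing
  outside a ball, where kernel and weight are bounded by a Gaussian in \<open>s\<close> and every
  exchange of integrals is absolutely convergent.\<close>

definition Adj :: "('v \<times> 'v \<Rightarrow> complex) \<Rightarrow> 'v \<Rightarrow> complex" where
  "Adj u s = (LINT z|lborel. complex_of_real (wgt z) * (u z * cnj (kern z s)))"

context
  fixes u :: "'v \<times> 'v \<Rightarrow> complex" and B k :: real
  assumes u_meas [measurable]: "u \<in> borel_measurable borel" and u_bound: "\<And>z. cmod (u z) \<le> B"
    and u_supp: "\<And>z. norm z > k \<Longrightarrow> u z = 0"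
begin

lemma wu_bound:
  obtains C where "\<And>z s. cmod (complex_of_real (wgt z) * (u z * cnj (kern z s))) \<le> (C * indicator (cball 0 k) z) * exp (- (\<alpha>\<^sup>2 / 4) * (s \<bullet> s))"
    "C \<ge> 0"
proof -
  obtain D where D: "\<And>z s. norm z \<le> k \<Longrightarrow> cmod (kern z s) \<le> D * exp (- (\<alpha>\<^sup>2 / 4) * (s \<bullet> s))" "D > 0"
    using kern_bound by blast
  obtain W where W: "\<And>z. norm z \<le> k \<Longrightarrow> wgt z \<le> W" using wgt_bounded by blast
  have B0: "B \<ge> 0" using u_bound[of 0] norm_ge_zero[of "u 0"] by linarith
  show ?thesis
  proof (rule that[of "\<bar>W\<bar> * B * D"])
    fix z s
    show "cmod (complex_of_real (wgt z) * (u z * cnj (kern z s))) \<le> (\<bar>W\<bar> * B * D * indicator (cball 0 k) z) * exp (- (\<alpha>\<^sup>2 / 4) * (s \<bullet> s))"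
    proof (cases "norm z \<le> k")
      case True
      have "cmod (complex_of_real (wgt z) * (u z * cnj (kern z s))) = wgt z * (cmod (u z) * cmod (kern z s))"
        using wgt_pos[of z] by (simp add: norm_mult)
      also have "\<dots> \<le> \<bar>W\<bar> * (B * (D * exp (- (\<alpha>\<^sup>2 / 4) * (s \<bullet> s))))"
        using W[OF True] D(1)[OF True, of s] u_bound[of z] B0 D(2) by (intro mult_mono) auto
      finally show ?thesis using True by (simp add: mult_ac)
    next
      case False
      then show ?thesis using u_supp[of z] by simp
    qed
  qed (use B0 D in simp)
qed

lemma adj_pair_integrable:
  assumes v[measurable]: "v \<in> borel_measurable borel" and vb: "\<And>s. cmod (v s) \<le> Bv"
  shows "integrable (lborel \<Otimes>\<^sub>M lborel) (\<lambda>(z, s). complex_of_real (wgt z) * (u z * cnj (kern z s)) * v s)"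
proof -
  obtain C where C: "\<And>z s. cmod (complex_of_real (wgt z) * (u z * cnj (kern z s))) \<le> (C * indicator (cball 0 k) z) * exp (- (\<alpha>\<^sup>2 / 4) * (s \<bullet> s))" "C \<ge> 0"
    using wu_bound by blast
  have i1: "integrable lborel (\<lambda>z::'v\<times>'v. complex_of_real (C * indicator (cball 0 k) z * Bv))"
    by (intro integrable_of_real integrable_mult_left integrable_mult_right integrable_real_indicator) (auto simp: cball_finite)
  have i2: "integrable lborel (\<lambda>s::'v. complex_of_real (exp (- (\<alpha>\<^sup>2 / 4) * (s \<bullet> s))))"
    using gauss_int by (intro integrable_of_real)
  show ?thesis
  proof (rule Bochner_Integration.integrable_bound[OF integrable_pair_mult[OF sigma_finite_lborel sigma_finite_lborel i1 i2]])
    show "AE p in lborel \<Otimes>\<^sub>M lborel. norm (case p of (z, s) \<Rightarrow> complex_of_real (wgt z) * (u z * cnj (kern z s)) * v s)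
      \<le> norm (complex_of_real (C * indicator (cball 0 k) (fst p) * Bv) * complex_of_real (exp (- (\<alpha>\<^sup>2 / 4) * (snd p \<bullet> snd p))))"
    proof (rule AE_I2, clarsimp simp only: split: prod.split)
      fix z :: "'v \<times> 'v" and s :: 'v
      have Bv: "Bv \<ge> 0" using vb[of 0] norm_ge_zero[of "v 0"] by linarith
      have "cmod (complex_of_real (wgt z) * (u z * cnj (kern z s)) * v s) \<le> ((C * indicator (cball 0 k) z) * exp (- (\<alpha>\<^sup>2 / 4) * (s \<bullet> s))) * Bv"
        unfolding norm_mult[of _ "v s"] by (intro mult_mono C vb) (use C(2) in auto)
      also have "\<dots> = norm (complex_of_real (C * indicator (cball 0 k) z * Bv) * complex_of_real (exp (- (\<alpha>\<^sup>2 / 4) * (s \<bullet> s))))"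
        using Bv C(2) by (simp add: norm_mult indicator_def mult_ac)
      finally show "norm (complex_of_real (wgt z) * (u z * cnj (kern z s)) * v s) \<le> norm (complex_of_real (C * indicator (cball 0 k) (fst (z, s)) * Bv) * complex_of_real (exp (- (\<alpha>\<^sup>2 / 4) * (snd (z, s) \<bullet> snd (z, s)))))"
        by simp
    qed
  qed measurable
qed

lemma Adj_measurable: "Adj u \<in> borel_measurable borel"
  unfolding Adj_def[abs_def] by measurable

lemma Adj_bound:
  obtains C where "\<And>s. cmod (Adj u s) \<le> C * exp (- (\<alpha>\<^sup>2 / 4) * (s \<bullet> s))" "C \<ge> 0"
proof -
  obtain C where C: "\<And>z s. cmod (complex_of_real (wgt z) * (u z * cnj (kern z s))) \<le> (C * indicator (cball 0 k) z) * exp (- (\<alpha>\<^sup>2 / 4) * (s \<bullet> s))" "C \<ge> 0"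
    using wu_bound by blast
  have i: "integrable lborel (\<lambda>z::'v\<times>'v. (C * indicator (cball 0 k) z) * exp (- (\<alpha>\<^sup>2 / 4) * (s \<bullet> s)))" for s :: 'v
    by (intro integrable_mult_left integrable_mult_right integrable_real_indicator) (auto simp: cball_finite)
  show ?thesis
  proof (rule that[of "C * measure lborel (cball (0::'v\<times>'v) k)"])
    fix s
    have "cmod (Adj u s) \<le> (LINT z::'v\<times>'v|lborel. (C * indicator (cball 0 k) z) * exp (- (\<alpha>\<^sup>2 / 4) * (s \<bullet> s)))"
      unfolding Adj_def
    proof (rule Bochner_Integration.integral_norm_bound_integral[OF _ i])
      show "integrable lborel (\<lambda>z. complex_of_real (wgt z) * (u z * cnj (kern z s)))"
        by (rule Bochner_Integration.integrable_bound[OF i[of s]])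
           (use C in \<open>auto intro!: AE_I2 order_trans[OF C(1)]\<close>)
    qed (use C in auto)
    then show "cmod (Adj u s) \<le> C * measure lborel (cball (0::'v\<times>'v) k) * exp (- (\<alpha>\<^sup>2 / 4) * (s \<bullet> s))" by simp
  qed (use C in simp)
qed

lemma Adj_sqint: "sqint lborel (Adj u)"
proof -
  obtain C where C: "\<And>s. cmod (Adj u s) \<le> C * exp (- (\<alpha>\<^sup>2 / 4) * (s \<bullet> s))" "C \<ge> 0" using Adj_bound by blast
  show ?thesis
    by (rule sqint_bound[OF sqint_cmult[OF gauss_sqint, of "complex_of_real C"]])
       (use C Adj_measurable in \<open>auto simp: norm_mult simp del: of_real_exp\<close>)
qed

lemma Adj_fubini:
  assumes v[measurable]: "v \<in> borel_measurable borel" and vb: "\<And>s. cmod (v s) \<le> Bv"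
  shows "(LINT s|lborel. Adj u s * v s) = (LINT z|mu. u z * (LINT s|lborel. cnj (kern z s) * v s))"
proof -
  note I = adj_pair_integrable[OF v vb]
  have "(LINT s|lborel. Adj u s * v s) = (LINT s|lborel. (LINT z|lborel. complex_of_real (wgt z) * (u z * cnj (kern z s)) * v s))"
    unfolding Adj_def by simp
  also have "\<dots> = (LINT z|lborel. (LINT s|lborel. complex_of_real (wgt z) * (u z * cnj (kern z s)) * v s))"
    by (rule lborel_pair.Fubini_integral[OF I])
  also have "\<dots> = (LINT z|lborel. complex_of_real (wgt z) * (u z * (LINT s|lborel. cnj (kern z s) * v s)))"
    by (simp add: mult.assoc)
  also have "\<dots> = (LINT z|mu. u z * (LINT s|lborel. cnj (kern z s) * v s))"
    by (rule mu_integral[symmetric]) measurable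
  finally show ?thesis .
qed

lemma u_sqint: "sqint mu u"
proof -
  obtain W where W: "\<And>z. norm z \<le> k \<Longrightarrow> wgt z \<le> W" using wgt_bounded by blast
  have "(\<integral>\<^sup>+z. ennreal ((cmod (u z))\<^sup>2 * wgt z) \<partial>lborel) \<le> (\<integral>\<^sup>+z. ennreal (B\<^sup>2 * \<bar>W\<bar>) * indicator (cball (0::'v\<times>'v) k) z \<partial>lborel)"
  proof (rule nn_integral_mono)
    fix z
    show "ennreal ((cmod (u z))\<^sup>2 * wgt z) \<le> ennreal (B\<^sup>2 * \<bar>W\<bar>) * indicator (cball 0 k) z"
    proof (cases "norm z \<le> k")
      case True
      have "(cmod (u z))\<^sup>2 * wgt z \<le> B\<^sup>2 * \<bar>W\<bar>"
        using u_bound[of z] W[OF True] wgt_pos[of z] by (intro mult_mono power_mono) auto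
      then show ?thesis using True by (simp add: ennreal_leI)
    qed (simp add: u_supp)
  qed
  also have "\<dots> = ennreal (B\<^sup>2 * \<bar>W\<bar>) * emeasure lborel (cball (0::'v\<times>'v) k)"
    by (rule nn_integral_cmult_indicator) simp
  also have "\<dots> < \<infinity>" by (simp add: ennreal_mult_less_top cball_finite)
  finally show ?thesis unfolding sqint_mu_iff using u_meas by simp
qed

lemma S_Adj: "S (Adj u) z0 = (LINT z|mu. u z * Kr z0 z)"
proof -
  obtain D where D: "\<And>z s. norm z \<le> norm z0 \<Longrightarrow> cmod (kern z s) \<le> D * exp (- (\<alpha>\<^sup>2 / 4) * (s \<bullet> s))" "D > 0"
    using kern_bound by blast
  have "cmod (kern z0 s) \<le> D" for s
  proof -
    have "D * exp (- (\<alpha>\<^sup>2 / 4) * (s \<bullet> s)) \<le> D * 1" by (intro mult_left_mono) (use D in auto)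
    then show ?thesis using D(1)[of z0 s] by simp
  qed
  from Adj_fubini[of "kern z0", OF _ this] show ?thesis
    unfolding S_def Kr_def by (simp add: mult.commute)
qed

text \<open>The squared norm of \<open>Adj u\<close> is the inner product of \<open>u\<close> with
  \<open>S (Adj u)\<close>; Cauchy-Schwarz and the isometry bound it by \<open>sqrt N\<close> times
  both norms, and one factor cancels.\<close>

lemma Adj_norm: "l2n lborel (Adj u) \<le> sqrt N * l2n mu u"
proof -
  obtain C where C: "\<And>s. cmod (Adj u s) \<le> C * exp (- (\<alpha>\<^sup>2 / 4) * (s \<bullet> s))" "C \<ge> 0" using Adj_bound by blast
  have b: "cmod (cnj (Adj u s)) \<le> C" for s
  proof -
    have "C * exp (- (\<alpha>\<^sup>2 / 4) * (s \<bullet> s)) \<le> C * 1" by (intro mult_left_mono) (use C in auto)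
    then show ?thesis using C(1)[of s] by simp
  qed
  have [measurable]: "Adj u \<in> borel_measurable borel" by (rule Adj_measurable)
  have "complex_of_real ((l2n lborel (Adj u))\<^sup>2) = (LINT s|lborel. Adj u s * cnj (Adj u s))"
    unfolding l2n_square integral_complex_of_real[symmetric] by (simp only: complex_norm_square)
  also have "\<dots> = (LINT z|mu. u z * (LINT s|lborel. cnj (kern z s) * cnj (Adj u s)))"
    by (rule Adj_fubini[OF _ b]) measurable
  also have "\<dots> = (LINT z|mu. u z * cnj (S (Adj u) z))"
  proof -
    have "(LINT s|lborel. cnj (kern z s) * cnj (Adj u s)) = cnj (S (Adj u) z)" for z
      unfolding S_def using integral_bounded_linear[OF bounded_linear_cnj S_integrable[OF Adj_sqint, of z]] by simp
    then show ?thesis by simp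
  qed
  finally have "(l2n lborel (Adj u))\<^sup>2 = cmod (LINT z|mu. u z * cnj (S (Adj u) z))"
    by (metis abs_of_nonneg norm_of_real zero_le_power2)
  also have "\<dots> \<le> l2n mu u * l2n mu (\<lambda>z. cnj (S (Adj u) z))"
    by (intro l2_Cauchy_Schwarz u_sqint sqint_cnj S_isometry Adj_sqint)
  also have "\<dots> = (sqrt N * l2n mu u) * l2n lborel (Adj u)"
    unfolding l2n_cnj S_isometry(2)[OF Adj_sqint] by simp
  finally have "l2n lborel (Adj u) * l2n lborel (Adj u) \<le> (sqrt N * l2n mu u) * l2n lborel (Adj u)" by (simp add: power2_eq_square)
  then show ?thesis
    using l2n_nonneg[of lborel "Adj u"] N_pos l2n_nonneg[of mu u] mult_le_cancel_right[of "l2n lborel (Adj u)" "l2n lborel (Adj u)" "sqrt N * l2n mu u"]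
    by (cases "l2n lborel (Adj u) = 0") auto
qed

end

end

section \<open>The heat kernel at a fixed frequency\<close>

lemma cdot_eq: "cdot z w = Complex (vRe z \<bullet> vRe w - vIm z \<bullet> vIm w) (vRe z \<bullet> vIm w + vIm z \<bullet> vRe w)"
  by (simp add: cdot_def vRe_def vIm_def inner_vec_def complex_eq_iff sum.distrib sum_subtractf)

lemma vRe_simps [simp]: "vRe (z + w) = vRe z + vRe w" "vRe (z - w) = vRe z - vRe w" "vRe (vof_real x) = x"
    "vIm (z + w) = vIm z + vIm w" "vIm (z - w) = vIm z - vIm w" "vIm (vof_real x) = 0"
  by (auto simp: vRe_def vIm_def vof_real_def vec_eq_iff)

lemma cdot_bilinear:
  "cdot (z + z') w = cdot z w + cdot z' w" "cdot z (w + w') = cdot z w + cdot z w'"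
  "cdot (z - z') w = cdot z w - cdot z' w" "cdot z (w - w') = cdot z w - cdot z w'"
  "cdot (c *s z) w = c * cdot z w" "cdot z (c *s w) = c * cdot z w"
  by (simp_all add: cdot_def algebra_simps sum.distrib sum_subtractf sum_distrib_left)

lemma cdot_commute: "cdot z w = cdot w z"
  by (simp add: cdot_def mult.commute)

lemma vof_real_simps: "vof_real (x + y) = vof_real x + vof_real y" "vof_real (x - y) = vof_real x - vof_real y" "vof_real (- x) = - vof_real x"
  by (auto simp: vof_real_def vec_eq_iff)

lemma cdot_continuous [continuous_intros]:
  "continuous_on S f \<Longrightarrow> continuous_on S g \<Longrightarrow> continuous_on S (\<lambda>x. cdot (f x) (g x))"
  unfolding cdot_def by (intro continuous_intros)

lemma vof_real_continuous [continuous_intros]: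
  "continuous_on S f \<Longrightarrow> continuous_on S (\<lambda>x. vof_real (f x))"
  unfolding vof_real_def by (intro continuous_intros)

lemma vRe_continuous [continuous_intros]:
  "continuous_on S f \<Longrightarrow> continuous_on S (\<lambda>x. vRe (f x))" "continuous_on S f \<Longrightarrow> continuous_on S (\<lambda>x. vIm (f x))"
  unfolding vRe_def vIm_def by (auto intro!: continuous_intros)

definition cx :: "(real^'n) \<times> (real^'n) \<Rightarrow> complex^'n" where
  "cx p = (\<chi> i. Complex (fst p $ i) (snd p $ i))"

lemma cx_inv: "vRe (cx p) = fst p" "vIm (cx p) = snd p" "cx (vRe z, vIm z) = z"
  by (auto simp: cx_def vRe_def vIm_def vec_eq_iff)

lemma cx_measurable [measurable]: "(cx :: (real^'n::finite) \<times> (real^'n) \<Rightarrow> _) \<in> borel \<rightarrow>\<^sub>M borel"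
  unfolding cx_def Complex_eq by (intro borel_measurable_continuous_onI continuous_intros)

lemma prod_Basis_vec:
  fixes f :: "'a::euclidean_space^'n \<Rightarrow> 'b::comm_monoid_mult"
  shows "(\<Prod>b\<in>Basis. f b) = (\<Prod>i\<in>UNIV. \<Prod>u\<in>Basis. f (axis i u))"
proof -
  have B: "(Basis :: ('a^'n) set) = (\<lambda>p. axis (fst p) (snd p)) ` (UNIV \<times> Basis)"
    by (force simp: Basis_vec_def)
  have "inj_on (\<lambda>p. axis (fst p) (snd p) :: 'a^'n) (UNIV \<times> Basis)"
    by (auto simp: inj_on_def axis_eq_axis)
  from prod.reindex[OF this, of f] show ?thesis
    unfolding B[symmetric] by (simp add: prod.cartesian_product case_prod_unfold)
qed

text \<open>Lebesgue measure is determined by boxes. The preimage of a complex box is a real box,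
  whose side lengths are the same numbers multiplied in another order.\<close>

lemma lborel_cx: "distr lborel borel cx = (lborel :: (complex^'n::finite) measure)"
proof (rule lborel_eqI[symmetric])
  fix l u :: "complex^'n"
  assume le: "\<And>b. b \<in> Basis \<Longrightarrow> l \<bullet> b \<le> u \<bullet> b"
  have le': "Re (l $ i) \<le> Re (u $ i)" "Im (l $ i) \<le> Im (u $ i)" for i
    using le[of "axis i 1"] le[of "axis i \<i>"] by (auto simp: inner_axis Basis_complex_def Basis_vec_def)
  have vi: "cx -` box l u = box (vRe l, vIm l) (vRe u, vIm u)"
  proof -
    have "p \<in> cx -` box l u \<longleftrightarrow> (\<forall>i. Re (l $ i) < fst p $ i \<and> fst p $ i < Re (u $ i) \<and> Im (l $ i) < snd p $ i \<and> snd p $ i < Im (u $ i))" for p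
      by (auto simp: mem_box Basis_vec_def Basis_complex_def inner_axis cx_def)
    moreover have "p \<in> box (vRe l, vIm l) (vRe u, vIm u) \<longleftrightarrow> (\<forall>i. Re (l $ i) < fst p $ i \<and> fst p $ i < Re (u $ i) \<and> Im (l $ i) < snd p $ i \<and> snd p $ i < Im (u $ i))" for p
      by (cases p) (auto simp: mem_box Basis_prod_def ball_Un Basis_vec_def inner_axis vRe_def vIm_def)
    ultimately show ?thesis by blast
  qed
  have "emeasure (distr lborel borel cx) (box l u) = emeasure lborel (cx -` box l u)"
    by (subst emeasure_distr) auto
  also have "\<dots> = ennreal (\<Prod>b\<in>Basis. ((vRe u, vIm u) - (vRe l, vIm l)) \<bullet> b)"
    unfolding vi
  proof (rule emeasure_lborel_box)
    fix b :: "(real^'n) \<times> (real^'n)" assume "b \<in> Basis"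
    then show "(vRe l, vIm l) \<bullet> b \<le> (vRe u, vIm u) \<bullet> b"
      using le' by (auto simp: Basis_prod_def Basis_vec_def inner_axis vRe_def vIm_def)
  qed
  also have "(\<Prod>b\<in>Basis. ((vRe u, vIm u) - (vRe l, vIm l)) \<bullet> b) = (\<Prod>b\<in>Basis. (vRe u - vRe l) \<bullet> b) * (\<Prod>b\<in>Basis. (vIm u - vIm l) \<bullet> b)"
  proof -
    have [simp]: "inj_on (\<lambda>u::real^'n. (u, 0::real^'n)) Basis" "inj_on (\<lambda>u. (0::real^'n, u::real^'n)) Basis"
      "(\<lambda>u::real^'n. (u, 0::real^'n)) ` Basis \<inter> (\<lambda>u. (0, u)) ` Basis = {}"
      by (auto intro!: inj_onI)
    show ?thesis
      by (simp add: Basis_prod_def prod.union_disjoint prod.reindex)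
  qed
  also have "\<dots> = (\<Prod>b\<in>Basis. (u - l) \<bullet> b)"
    unfolding prod_Basis_vec by (simp add: Basis_complex_def inner_axis vRe_def vIm_def prod.distrib)
  finally show "emeasure (distr lborel borel cx) (box l u) = ennreal (\<Prod>b\<in>Basis. (u - l) \<bullet> b)" .
qed simp

type_synonym 'n vv = "(real^'n) \<times> (real^'n)"

text \<open>The four real blocks of (z, w) regrouped: all real parts in the first component and all
  imaginary parts in the second, so that scalar multiplication becomes \<open>csc\<close>.\<close>

definition enc :: "'n::finite vv \<times> 'n vv \<Rightarrow> 'n cpair" where
  "enc z = (cx (fst (fst z), fst (snd z)), cx (snd (fst z), snd (snd z)))"

definition dec :: "'n::finite cpair \<Rightarrow> 'n vv \<times> 'n vv" where
  "dec p = ((vRe (fst p), vRe (snd p)), (vIm (fst p), vIm (snd p)))"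

lemma enc_dec [simp]: "enc (dec p) = p" "dec (enc z) = z"
  by (auto simp: enc_def dec_def cx_inv)

lemma dec_continuous: "continuous_on UNIV (dec :: 'n::finite cpair \<Rightarrow> _)"
  unfolding dec_def by (intro continuous_intros)

lemma enc_continuous: "continuous_on UNIV (enc :: 'n::finite vv \<times> 'n vv \<Rightarrow> _)"
  unfolding enc_def cx_def Complex_eq by (intro continuous_intros)

lemma enc_measurable [measurable]: "(enc :: 'n::finite vv \<times> 'n vv \<Rightarrow> _) \<in> borel \<rightarrow>\<^sub>M borel"
  by (intro borel_measurable_continuous_onI enc_continuous)

lemma dec_measurable [measurable]: "(dec :: 'n::finite cpair \<Rightarrow> _) \<in> borel \<rightarrow>\<^sub>M borel"
  by (intro borel_measurable_continuous_onI dec_continuous)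

text \<open>After splitting off real and imaginary parts, only the two middle of the four real
  integrals have to be exchanged.\<close>

lemma nn_integral_enc:
  fixes h :: "'n::finite cpair \<Rightarrow> ennreal"
  assumes [measurable]: "h \<in> borel_measurable borel"
  shows "(\<integral>\<^sup>+p. h p \<partial>lborel) = (\<integral>\<^sup>+z. h (enc z) \<partial>lborel)"
proof -
  have h2[measurable]: "h \<in> borel_measurable (borel \<Otimes>\<^sub>M borel)" by (simp add: borel_prod)
  have cxm: "(\<lambda>p. cx (fst p, snd p) :: complex^'n) \<in> borel \<Otimes>\<^sub>M borel \<rightarrow>\<^sub>M borel"
    using cx_measurable unfolding borel_prod by simp
  have [measurable (raw)]: "(\<lambda>x. cx (f x, g x) :: complex^'n) \<in> M \<rightarrow>\<^sub>M borel" if [measurable]: "f \<in> M \<rightarrow>\<^sub>M borel" "g \<in> M \<rightarrow>\<^sub>M borel" for f g and M :: "'z measure"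
  proof -
    have "(\<lambda>x. (f x, g x)) \<in> M \<rightarrow>\<^sub>M borel \<Otimes>\<^sub>M borel" by measurable
    from measurable_compose[OF this cxm] show ?thesis by simp
  qed
  have cxi: "(\<integral>\<^sup>+z. k z \<partial>lborel) = (\<integral>\<^sup>+x. \<integral>\<^sup>+y. k (cx (x, y)) \<partial>lborel \<partial>lborel)" if [measurable]: "k \<in> borel_measurable borel" for k :: "complex^'n \<Rightarrow> ennreal"
  proof -
    have "(\<integral>\<^sup>+z. k z \<partial>lborel) = (\<integral>\<^sup>+p. k (cx p) \<partial>lborel)"
      by (subst lborel_cx[symmetric], subst nn_integral_distr) auto
    then show ?thesis by (subst (asm) nn_integral_lborel_pair(1)) auto
  qed
  have "(\<integral>\<^sup>+p. h p \<partial>lborel) = (\<integral>\<^sup>+z. \<integral>\<^sup>+w. h (z, w) \<partial>lborel \<partial>lborel)"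
    by (rule nn_integral_lborel_pair) simp
  also have "\<dots> = (\<integral>\<^sup>+x. \<integral>\<^sup>+y. \<integral>\<^sup>+u. \<integral>\<^sup>+v. h (cx (x, y), cx (u, v)) \<partial>lborel \<partial>lborel \<partial>lborel \<partial>lborel)"
    by (subst cxi, measurable, intro nn_integral_cong, subst cxi) measurable
  also have "\<dots> = (\<integral>\<^sup>+x. \<integral>\<^sup>+u. \<integral>\<^sup>+y. \<integral>\<^sup>+v. h (cx (x, y), cx (u, v)) \<partial>lborel \<partial>lborel \<partial>lborel \<partial>lborel)"
    by (rule nn_integral_cong, rule lborel_pair.Fubini') measurable
  also have "\<dots> = (\<integral>\<^sup>+x. \<integral>\<^sup>+u. \<integral>\<^sup>+q. h (enc ((x, u), q)) \<partial>lborel \<partial>lborel \<partial>lborel)"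
  proof -
    have m: "(\<lambda>q. h (enc ((x, u), q))) \<in> borel_measurable borel" for x u
      by (rule measurable_compose[of "\<lambda>q. enc ((x, u), q)"], rule borel_measurable_continuous_onI)
         (auto intro!: continuous_on_compose2[OF enc_continuous] continuous_intros)
    show ?thesis
      by (subst nn_integral_lborel_pair(1)[OF m]) (simp add: enc_def)
  qed
  also have "\<dots> = (\<integral>\<^sup>+p. \<integral>\<^sup>+q. h (enc (p, q)) \<partial>lborel \<partial>lborel)"
  proof -
    have "(\<lambda>z. h (enc z)) \<in> borel_measurable (borel :: ('n vv \<times> 'n vv) measure)" by measurable
    then have [measurable]: "(\<lambda>z. h (enc z)) \<in> borel_measurable ((borel :: 'n vv measure) \<Otimes>\<^sub>M (borel :: 'n vv measure))" by (simp add: borel_prod)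
    show ?thesis
      by (subst nn_integral_lborel_pair(1)) measurable
  qed
  also have "\<dots> = (\<integral>\<^sup>+z. h (enc z) \<partial>lborel)"
    by (rule nn_integral_lborel_pair(1)[symmetric]) measurable
  finally show ?thesis .
qed

section \<open>Identification with the abstract kernel and weight\<close>

definition J0 :: "'n::finite vv \<Rightarrow> 'n vv" where "J0 p = (snd p, - fst p)"

text \<open>The value of \<alpha>, chosen so that \<open>(aa t l)\<^sup>2 / 2\<close> is the
  Gaussian rate \<open>l / 4 * coth (t * l)\<close> of the kernel. The matching \<gamma> is
  \<open>l / (2 * aa t l)\<close>.\<close>

definition aa :: "real \<Rightarrow> real \<Rightarrow> real" where "aa t l = sqrt (l / 2 * coth (t * l))"

lemma l_div_sinh_pos: "t > 0 \<Longrightarrow> l \<noteq> 0 \<Longrightarrow> l / sinh (t * l) > (0::real)"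
  by (cases "l > 0") (auto simp: zero_less_divide_iff mult_pos_neg)

text \<open>Double-argument formulas for sinh and cosh. The difference of the squares is the ratio
  occurring in the weight constant, the sum is the Gaussian rate of the weight; positivity also
  covers negative \<open>l\<close>, because \<open>l / sinh (t * l)\<close> is even.\<close>

lemma aa_facts:
  assumes "t > 0" "l \<noteq> 0"
  shows "(aa t l)\<^sup>2 = l / 2 * coth (t * l)" "aa t l > 0"
    "(l / (2 * aa t l))\<^sup>2 = l * sinh (t * l) / (2 * cosh (t * l))"
    "(aa t l)\<^sup>2 - (l / (2 * aa t l))\<^sup>2 = l / sinh (2 * t * l)"
    "(aa t l)\<^sup>2 + (l / (2 * aa t l))\<^sup>2 = l * coth (2 * t * l)"
proof -
  define sh where "sh = sinh (t * l)"
  define ch where "ch = cosh (t * l)"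
  have sh: "sh \<noteq> 0" "l / sh > 0" using assms l_div_sinh_pos[OF assms] by (auto simp: sh_def)
  have ch: "ch > 0" by (simp add: ch_def cosh_real_pos)
  have cs: "ch\<^sup>2 - sh\<^sup>2 = 1" by (simp add: ch_def sh_def hyperbolic_pythagoras)
  have e: "l / 2 * coth (t * l) = (l / sh) * ch / 2" by (simp add: coth_def sh_def ch_def)
  have p: "l / 2 * coth (t * l) > 0" unfolding e using mult_pos_pos[OF sh(2) ch] by (rule half_gt_zero)
  show 1: "(aa t l)\<^sup>2 = l / 2 * coth (t * l)" unfolding aa_def using p by simp
  show 2: "aa t l > 0" unfolding aa_def using p by simp
  have a2: "(aa t l)\<^sup>2 = l * ch / (2 * sh)" unfolding 1 e by simp
  show 3: "(l / (2 * aa t l))\<^sup>2 = l * sinh (t * l) / (2 * cosh (t * l))"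
  proof -
    have "(l / (2 * aa t l))\<^sup>2 = l\<^sup>2 / (4 * (aa t l)\<^sup>2)" by (simp add: power_divide power_mult_distrib)
    also have "\<dots> = l * sh / (2 * ch)" unfolding a2 using assms(2) sh(1) ch by (simp add: power2_eq_square)
    finally show ?thesis by (simp add: sh_def ch_def)
  qed
  have s2: "sinh (2 * t * l) = 2 * sh * ch" using sinh_double[of "t * l"] by (simp add: sh_def ch_def mult.assoc)
  have c2: "cosh (2 * t * l) = ch\<^sup>2 + sh\<^sup>2" using cosh_double[of "t * l"] by (simp add: sh_def ch_def mult.assoc)
  show "(aa t l)\<^sup>2 - (l / (2 * aa t l))\<^sup>2 = l / sinh (2 * t * l)"
  proof -
    have "l * ch / (2 * sh) - l * sh / (2 * ch) = l * (ch\<^sup>2 - sh\<^sup>2) / (2 * sh * ch)"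
      using sh(1) ch by (simp add: divide_simps) (simp add: power2_eq_square algebra_simps)
    then show ?thesis unfolding 3 a2 s2 sh_def[symmetric] ch_def[symmetric] cs by simp
  qed
  show "(aa t l)\<^sup>2 + (l / (2 * aa t l))\<^sup>2 = l * coth (2 * t * l)"
    unfolding 3 a2 coth_def s2 c2 sh_def[symmetric] ch_def[symmetric] using sh(1) ch
    by (simp add: divide_simps) (simp add: power2_eq_square algebra_simps)
qed

lemma skew_J0:
  assumes "t > 0" "l \<noteq> 0"
  shows "skew (J0 :: 'n::finite vv \<Rightarrow> _) (aa t l) (l / (2 * aa t l))"
proof (rule skew.intro)
  show "bounded_linear (J0 :: 'n vv \<Rightarrow> _)"
    unfolding J0_def by (intro bounded_linear_Pair bounded_linear_snd bounded_linear_minus bounded_linear_fst)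
  show "p \<bullet> J0 q = - (J0 p \<bullet> q)" for p q :: "'n vv"
    by (simp add: J0_def inner_prod_def inner_commute)
  show "J0 (J0 p) = - p" for p :: "'n vv" by (simp add: J0_def prod_eq_iff)
  show "aa t l > 0" by (rule aa_facts[OF assms])
  have "l / sinh (2 * t * l) > 0" using l_div_sinh_pos[of "2 * t" l] assms by simp
  then show "(l / (2 * aa t l))\<^sup>2 < (aa t l)\<^sup>2" using aa_facts(4)[OF assms] by simp
qed

definition pref :: "'n itself \<Rightarrow> real \<Rightarrow> real \<Rightarrow> real" where
  "pref TYPE('n) t l = inverse ((4 * pi) ^ CARD('n)) * (l / sinh (t * l)) ^ CARD('n)"

text \<open>The twisted translate of the holomorphic kernel at frequency \<open>l\<close>: the phase
  is what the central component of the group law contributes when the real point \<open>s\<close> is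
  moved to the origin.\<close>

definition hk :: "real \<Rightarrow> real \<Rightarrow> 'n::finite cpair \<Rightarrow> 'n vv \<Rightarrow> complex" where
  "hk t l p s = complex_of_real (pref TYPE('n) t l) *
     exp (\<i> * complex_of_real (l / 2) * (cdot (vof_real (snd s)) (fst p) - cdot (vof_real (fst s)) (snd p))
        - complex_of_real (l / 4 * coth (t * l)) * (cdot (fst p - vof_real (fst s)) (fst p - vof_real (fst s))
            + cdot (snd p - vof_real (snd s)) (snd p - vof_real (snd s))))"

text \<open>The choice of \<gamma> makes \<alpha> \<gamma> equal to \<open>l / 2\<close>, so the
  skew term of \<open>kern\<close> is exactly the symplectic phase, and the quadratic terms agree by
  the choice of \<alpha>.\<close>

lemma hk_eq_kern:
  assumes "t > 0" "l \<noteq> 0"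
  shows "hk t l p (s :: 'n::finite vv) = complex_of_real (pref TYPE('n) t l) * skew.kern J0 (aa t l) (l / (2 * aa t l)) (dec p) s"
proof -
  interpret skew "J0 :: 'n vv \<Rightarrow> _" "aa t l" "l / (2 * aa t l)" by (rule skew_J0[OF assms])
  define al where "al = aa t l"
  have al: "al > 0" "l / 4 * coth (t * l) = al\<^sup>2 / 2" using aa_facts(1,2)[OF assms] by (auto simp: al_def)
  have P: "al * (Pm (dec p) \<bullet> s) = al\<^sup>2 * (fst (dec p) \<bullet> s) + (l / 2) * (J0 (snd (dec p)) \<bullet> s)"
    unfolding Pm_def unfolding al_def[symmetric] using al(1) by (simp add: inner_simps power2_eq_square field_simps)
  have R: "al * (Rm (dec p) \<bullet> s) = (l / 2) * (J0 (fst (dec p)) \<bullet> s) - al\<^sup>2 * (snd (dec p) \<bullet> s)"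
    unfolding Rm_def unfolding al_def[symmetric] using al(1) by (simp add: inner_simps power2_eq_square field_simps)
  have "\<i> * complex_of_real (l / 2) * (cdot (vof_real (snd s)) (fst p) - cdot (vof_real (fst s)) (snd p))
        - complex_of_real (l / 4 * coth (t * l)) * (cdot (fst p - vof_real (fst s)) (fst p - vof_real (fst s))
            + cdot (snd p - vof_real (snd s)) (snd p - vof_real (snd s)))
     = complex_of_real (kA (dec p) s) + \<i> * complex_of_real (kB (dec p) s)"
    unfolding kA_def kB_def unfolding P[unfolded al_def] R[unfolded al_def] unfolding al_def[symmetric] al(2) cdot_eq
    by (simp add: complex_eq_iff dec_def J0_def inner_prod_def inner_simps inner_commute) (simp add: field_simps)
  then show ?thesis unfolding hk_def kern_def by simp
qed

definition cW :: "'n itself \<Rightarrow> real \<Rightarrow> real \<Rightarrow> real" where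
  "cW TYPE('n) t l = 4 ^ CARD('n) * (inverse ((4 * pi) ^ CARD('n)) * (l / sinh (2 * t * l)) ^ CARD('n))"

text \<open>In the exponent of \<open>wgt\<close> the terms in the real parts alone cancel. The
  mixed term has coefficient 2 \<alpha> \<gamma> = \<open>l\<close>, and the quadratic term in the
  imaginary parts has coefficient \<alpha>^2 + \<gamma>^2 =
  \<open>l * coth (2 * t * l)\<close>.\<close>

lemma Wt_eq_wgt:
  assumes "t > 0" "l \<noteq> 0"
  shows "Wt t l (p :: 'n::finite cpair) = cW TYPE('n) t l * skew.wgt J0 (aa t l) (l / (2 * aa t l)) (dec p)"
proof -
  interpret skew "J0 :: 'n vv \<Rightarrow> _" "aa t l" "l / (2 * aa t l)" by (rule skew_J0[OF assms])
  define al where "al = aa t l"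
  define ga where "ga = l / (2 * al)"
  have al: "al > 0" using aa_facts(1,2)[OF assms] by (auto simp: al_def)
  have l: "2 * al * ga = l" using al by (simp add: ga_def)
  have sum: "al\<^sup>2 + ga\<^sup>2 = l * coth (2 * t * l)" using aa_facts(5)[OF assms] by (simp add: al_def ga_def)
  obtain z w where p: "p = (z, w)" by (cases p)
  have "l * (vRe w \<bullet> vIm z - vIm w \<bullet> vRe z) + - (l / 4) * coth (2 * t * l) * ((2 *\<^sub>R vIm z) \<bullet> (2 *\<^sub>R vIm z) + (2 *\<^sub>R vIm w) \<bullet> (2 *\<^sub>R vIm w))
    = al\<^sup>2 * (fst (dec p) \<bullet> fst (dec p) - snd (dec p) \<bullet> snd (dec p)) - Pm (dec p) \<bullet> Pm (dec p)"
  proof -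
    have "Pm (dec p) \<bullet> Pm (dec p) = al\<^sup>2 * (fst (dec p) \<bullet> fst (dec p)) + 2 * al * ga * (fst (dec p) \<bullet> J0 (snd (dec p))) + ga\<^sup>2 * (snd (dec p) \<bullet> snd (dec p))"
      unfolding Pm_def unfolding al_def[symmetric] unfolding ga_def[symmetric]
      by (simp add: inner_simps inner_commute power2_eq_square algebra_simps J0_def inner_prod_def)
    then have "al\<^sup>2 * (fst (dec p) \<bullet> fst (dec p) - snd (dec p) \<bullet> snd (dec p)) - Pm (dec p) \<bullet> Pm (dec p)
      = - (al\<^sup>2 + ga\<^sup>2) * (snd (dec p) \<bullet> snd (dec p)) - l * (fst (dec p) \<bullet> J0 (snd (dec p)))"
      unfolding l by (simp add: algebra_simps)
    then show ?thesis unfolding sum p by (simp add: dec_def J0_def inner_prod_def inner_commute algebra_simps)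
  qed
  then have e: "exp (l * (vRe w \<bullet> vIm z - vIm w \<bullet> vRe z)) * exp (- (l / 4) * coth (2 * t * l) * ((2 *\<^sub>R vIm z) \<bullet> (2 *\<^sub>R vIm z) + (2 *\<^sub>R vIm w) \<bullet> (2 *\<^sub>R vIm w))) = wgt (dec p)"
    unfolding wgt_def unfolding exp_add[symmetric] by (simp add: al_def)
  show ?thesis
    unfolding e[symmetric] unfolding Wt_def p cW_def pker_def by simp
qed

text \<open>Since the real dimension is \<open>2 * CARD('n)\<close>, every factor is an n-th power
  of a scalar, and one identity between hyperbolic functions remains. It says that the
  normalisations of kernel and weight make the fibre transform exactly isometric.\<close>

lemma const_identity:
  assumes "t > 0" "l \<noteq> 0"
  shows "(pref TYPE('n::finite) t l)\<^sup>2 * cW TYPE('n) t l * skew.N TYPE('n vv) (aa t l) (l / (2 * aa t l)) = 1"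
proof -
  interpret skew "J0 :: 'n vv \<Rightarrow> _" "aa t l" "l / (2 * aa t l)" by (rule skew_J0[OF assms])
  define sh where "sh = sinh (t * l)"
  define ch where "ch = cosh (t * l)"
  have sh: "sh \<noteq> 0" using assms by (auto simp: sh_def)
  have ch: "ch > 0" by (simp add: ch_def cosh_real_pos)
  have s2: "sinh (2 * t * l) = 2 * sh * ch" using sinh_double[of "t * l"] by (simp add: sh_def ch_def mult.assoc)
  have a2: "(aa t l)\<^sup>2 = l * ch / (2 * sh)" using aa_facts(1)[OF assms] by (simp add: coth_def sh_def ch_def)
  have d: "(aa t l)\<^sup>2 - (l / (2 * aa t l))\<^sup>2 = l / (2 * sh * ch)" using aa_facts(4)[OF assms] unfolding s2 .
  have dim: "DIM('n vv) = 2 * CARD('n)" by simp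
  have N: "N = ((2 * pi)\<^sup>2 * pi / ((l * ch / (2 * sh)) * (l / (2 * sh * ch))\<^sup>2)) ^ CARD('n)"
    unfolding N_def d unfolding dim power_mult a2 by (simp add: power_mult_distrib power_divide) (simp flip: power_mult_distrib)
  have "(pref TYPE('n) t l)\<^sup>2 * cW TYPE('n) t l * N =
    ((inverse (4 * pi) * (l / sh))\<^sup>2 * (4 * (inverse (4 * pi) * (l / (2 * sh * ch)))) * ((2 * pi)\<^sup>2 * pi / ((l * ch / (2 * sh)) * (l / (2 * sh * ch))\<^sup>2))) ^ CARD('n)"
    unfolding N pref_def cW_def s2 sh_def[symmetric] power_mult_distrib power_inverse power_mult[symmetric] mult.commute[of _ 2] by simp
  also have "(inverse (4 * pi) * (l / sh))\<^sup>2 * (4 * (inverse (4 * pi) * (l / (2 * sh * ch)))) * ((2 * pi)\<^sup>2 * pi / ((l * ch / (2 * sh)) * (l / (2 * sh * ch))\<^sup>2)) = 1"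
    using sh ch assms(2) by (simp add: field_simps power2_eq_square)
  finally show ?thesis by simp
qed

section \<open>Holomorphy of the fibre transform\<close>

lemma norm_cdot_le: "cmod (cdot z (w :: complex^'n::finite)) \<le> real CARD('n) * (norm z * norm w)"
proof -
  have "cmod (cdot z w) \<le> (\<Sum>i\<in>UNIV. cmod (z $ i * w $ i))" unfolding cdot_def by (rule norm_sum)
  also have "\<dots> \<le> (\<Sum>i\<in>(UNIV::'n set). norm z * norm w)"
    by (intro sum_mono) (auto simp: norm_mult intro!: mult_mono Finite_Cartesian_Product.norm_nth_le)
  finally show ?thesis by simp
qed

lemma norm_vof_real: "norm (vof_real x) = norm x"
  by (simp add: vof_real_def norm_vec_def)

text \<open>The part of the exponent of \<open>hk\<close> that is complex linear in
  \<open>p\<close>. The part quadratic in \<open>p\<close> leaves the integral over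
  \<open>s\<close>, so only this one has to be differentiated under the integral sign.\<close>

definition Lam :: "real \<Rightarrow> real \<Rightarrow> 'n::finite cpair \<Rightarrow> 'n vv \<Rightarrow> complex" where
  "Lam a l p s = \<i> * complex_of_real (l / 2) * (cdot (vof_real (snd s)) (fst p) - cdot (vof_real (fst s)) (snd p))
     + complex_of_real (2 * a) * (cdot (vof_real (fst s)) (fst p) + cdot (vof_real (snd s)) (snd p))"

lemma Lam_add: "Lam a l (p + q) s = Lam a l p s + Lam a l q s"
  by (simp add: Lam_def cdot_bilinear algebra_simps)

lemma Lam_cscale: "Lam a l (c *s z, c *s w) s = c * Lam a l (z, w) s"
  by (simp add: Lam_def cdot_bilinear algebra_simps)

lemma scaleR_eq_cscale: "r *\<^sub>R (z :: complex^'n) = complex_of_real r *s z"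
  by (simp add: vec_eq_iff complex_eq_iff)

lemma Lam_scaleR: "Lam a l (r *\<^sub>R p) s = r *\<^sub>R Lam a l p s"
  using Lam_cscale[of a l "complex_of_real r" "fst p" "snd p" s]
  by (simp add: scaleR_eq_cscale[symmetric] scaleR_prod_def scaleR_conv_of_real)

lemma Lam_bound:
  obtains K where "\<And>p s. cmod (Lam a l p (s :: 'n::finite vv)) \<le> K * (norm p * norm s)" "K \<ge> 0"
proof -
  define n where "n = real CARD('n)"
  have c: "cmod (cdot (vof_real x) z) \<le> n * (norm p * norm s)" if "norm x \<le> norm s" "norm z \<le> norm p"
    for x :: "real^'n" and z :: "complex^'n" and p :: "'n cpair" and s :: "'n vv"
  proof -
    have "cmod (cdot (vof_real x) z) \<le> n * (norm x * norm z)"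
      using norm_cdot_le[of "vof_real x" z] by (simp add: n_def norm_vof_real)
    also have "\<dots> \<le> n * (norm s * norm p)" by (intro mult_left_mono mult_mono that) (auto simp: n_def)
    finally show ?thesis by (simp add: mult.commute)
  qed
  have nf: "norm (fst p) \<le> norm p" "norm (snd p) \<le> norm p" for p :: "'x::real_normed_vector \<times> 'y::real_normed_vector"
    using norm_fst_le[of "fst p" "snd p"] norm_snd_le[of "snd p" "fst p"] by auto
  show ?thesis
  proof (rule that[of "2 * (\<bar>l\<bar> / 2 + \<bar>2 * a\<bar>) * n"])
    fix p :: "'n cpair" and s :: "'n vv"
    let ?X = "n * (norm p * norm s)"
    have "cmod (Lam a l p s) \<le> \<bar>l\<bar> / 2 * (cmod (cdot (vof_real (snd s)) (fst p)) + cmod (cdot (vof_real (fst s)) (snd p)))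
       + \<bar>2 * a\<bar> * (cmod (cdot (vof_real (fst s)) (fst p)) + cmod (cdot (vof_real (snd s)) (snd p)))"
      unfolding Lam_def
      by (rule order_trans[OF norm_triangle_ineq], intro add_mono)
         (auto simp: norm_mult abs_mult intro!: mult_left_mono norm_triangle_ineq norm_triangle_ineq4 divide_right_mono)
    also have "\<dots> \<le> \<bar>l\<bar> / 2 * (?X + ?X) + \<bar>2 * a\<bar> * (?X + ?X)"
      by (intro add_mono mult_left_mono c nf) auto
    finally show "cmod (Lam a l p s) \<le> 2 * (\<bar>l\<bar> / 2 + \<bar>2 * a\<bar>) * n * (norm p * norm s)" by (simp add: algebra_simps)
  qed (simp add: n_def)
qed

lemma hk_eq_Lam:
  "hk t l (p :: 'n::finite cpair) s = complex_of_real (pref TYPE('n) t l) *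
     exp (- complex_of_real (l / 4 * coth (t * l)) * (cdot (fst p) (fst p) + cdot (snd p) (snd p))) *
     (exp (Lam (l / 4 * coth (t * l)) l p s) * complex_of_real (exp (- (l / 4 * coth (t * l)) * (s \<bullet> s))))"
proof -
  have ss: "cdot (vof_real x) (vof_real x) = complex_of_real (x \<bullet> x)" for x :: "real^'n"
    by (simp add: cdot_eq complex_eq_iff)
  define a where "a = l / 4 * coth (t * l)"
  have "\<i> * complex_of_real (l / 2) * (cdot (vof_real (snd s)) (fst p) - cdot (vof_real (fst s)) (snd p))
        - complex_of_real a * (cdot (fst p - vof_real (fst s)) (fst p - vof_real (fst s))
            + cdot (snd p - vof_real (snd s)) (snd p - vof_real (snd s)))
     = - complex_of_real a * (cdot (fst p) (fst p) + cdot (snd p) (snd p)) + (Lam a l p s + complex_of_real (- a * (s \<bullet> s)))"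
    unfolding Lam_def cdot_bilinear cdot_commute[of "fst p" "vof_real (fst s)"] cdot_commute[of "snd p" "vof_real (snd s)"] ss
    by (simp add: inner_prod_def algebra_simps)
  then show ?thesis unfolding hk_def a_def[symmetric] exp_of_real[symmetric] by (simp only: exp_add mult.assoc)
qed

lemma entireC_mult:
  assumes "entireC F" "entireC G"
  shows "entireC (\<lambda>p. F p * G p)"
  unfolding entireC_def
proof
  fix p
  obtain L M where L: "(F has_derivative L) (at p)" "\<forall>c z w. L (c *s z, c *s w) = c * L (z, w)"
    and M: "(G has_derivative M) (at p)" "\<forall>c z w. M (c *s z, c *s w) = c * M (z, w)"
    using assms unfolding entireC_def by meson
  show "\<exists>L. ((\<lambda>p. F p * G p) has_derivative L) (at p) \<and> (\<forall>c z w. L (c *s z, c *s w) = c * L (z, w))"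
  proof (intro exI[of _ "\<lambda>h. F p * M h + L h * G p"] conjI)
    show "((\<lambda>p. F p * G p) has_derivative (\<lambda>h. F p * M h + L h * G p)) (at p)"
      by (rule has_derivative_mult[OF L(1) M(1)])
    show "\<forall>c z w. F p * M (c *s z, c *s w) + L (c *s z, c *s w) * G p = c * (F p * M (z, w) + L (z, w) * G p)"
      using L(2) M(2) by (simp add: algebra_simps)
  qed
qed

lemma entireC_exp_quadratic: "entireC (\<lambda>p :: 'n::finite cpair. C * exp (c * (cdot (fst p) (fst p) + cdot (snd p) (snd p))))"
  unfolding entireC_def
proof
  fix p :: "'n cpair"
  have d: "((\<lambda>p :: 'n cpair. cdot (fst p) (fst p) + cdot (snd p) (snd p)) has_derivative
     (\<lambda>h. 2 * cdot (fst p) (fst h) + 2 * cdot (snd p) (snd h))) (at p)"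
  proof -
    have "((\<lambda>p :: 'n cpair. cdot (fst p) (fst p) + cdot (snd p) (snd p)) has_derivative
     (\<lambda>h. (\<Sum>i\<in>UNIV. fst p $ i * fst h $ i + fst h $ i * fst p $ i) + (\<Sum>i\<in>UNIV. snd p $ i * snd h $ i + snd h $ i * snd p $ i))) (at p)"
      unfolding cdot_def by (auto intro!: derivative_eq_intros bounded_linear.has_derivative[OF bounded_linear_vec_nth])
    then show ?thesis unfolding cdot_def by (simp add: sum.distrib sum_distrib_left mult.commute)
  qed
  show "\<exists>L. ((\<lambda>p. C * exp (c * (cdot (fst p) (fst p) + cdot (snd p) (snd p)))) has_derivative L) (at p) \<and> (\<forall>c z w. L (c *s z, c *s w) = c * L (z, w))"
  proof (intro exI conjI)
    have e: "(exp has_derivative (\<lambda>h. h * exp x)) (at x)" for x :: complex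
      using DERIV_exp[of x] by (simp add: has_field_derivative_def mult_commute_abs)
    show "((\<lambda>p. C * exp (c * (cdot (fst p) (fst p) + cdot (snd p) (snd p)))) has_derivative
      (\<lambda>h. C * ((c * (2 * cdot (fst p) (fst h) + 2 * cdot (snd p) (snd h))) * exp (c * (cdot (fst p) (fst p) + cdot (snd p) (snd p)))))) (at p)"
      by (intro has_derivative_mult_right has_derivative_compose[OF has_derivative_mult_right[OF d] e])
    show "\<forall>d z w. C * ((c * (2 * cdot (fst p) (fst (d *s z, d *s w)) + 2 * cdot (snd p) (snd (d *s z, d *s w)))) * exp (c * (cdot (fst p) (fst p) + cdot (snd p) (snd p))))
       = d * (C * ((c * (2 * cdot (fst p) (fst (z, w)) + 2 * cdot (snd p) (snd (z, w)))) * exp (c * (cdot (fst p) (fst p) + cdot (snd p) (snd p)))))"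
      by (simp add: cdot_bilinear algebra_simps)
  qed
qed

lemma Lam_measurable [measurable]: "Lam a l p \<in> borel_measurable borel"
  unfolding Lam_def by (intro borel_measurable_continuous_onI continuous_intros)

text \<open>Differentiation under the integral sign with an explicit remainder:
  \<open>exp h - 1 - h\<close> is bounded by \<open>exp \<bar>Re h\<bar>\<close> times the square of
  \<open>cmod h\<close>, and the exponential moments of \<open>m\<close> make the resulting bound
  integrable. The derivative inherits complex linearity from \<open>Lam\<close>.\<close>

lemma entireC_Lam_integral:
  fixes m :: "'n::finite vv \<Rightarrow> complex"
  assumes [measurable]: "m \<in> borel_measurable borel" and mi: "\<And>C. integrable lborel (\<lambda>s. exp (C * norm s) * cmod (m s))"
  shows "entireC (\<lambda>p. LINT s|lborel. exp (Lam a l p s) * m s)"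
  unfolding entireC_def
proof
  fix p :: "'n cpair"
  obtain K where K: "\<And>p s. cmod (Lam a l p (s :: 'n vv)) \<le> K * (norm p * norm s)" "K \<ge> 0" using Lam_bound by blast
  have I1: "integrable lborel (\<lambda>s. exp (Lam a l q s) * m s)" for q
  proof (rule Bochner_Integration.integrable_bound[OF mi[of "K * norm q"]])
    show "AE s in lborel. norm (exp (Lam a l q s) * m s) \<le> norm (exp (K * norm q * norm s) * cmod (m s))"
    proof (rule AE_I2)
      fix s
      have "Re (Lam a l q s) \<le> K * norm q * norm s"
        using complex_Re_le_cmod[of "Lam a l q s"] K(1)[of q s] by (simp add: mult.assoc)
      then show "norm (exp (Lam a l q s) * m s) \<le> norm (exp (K * norm q * norm s) * cmod (m s))"
        by (simp add: norm_mult mult_right_mono)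
    qed
  qed measurable
  define D where "D h = (LINT s|lborel. Lam a l h s * (exp (Lam a l p s) * m s))" for h
  have I2b: "cmod (Lam a l h s * (exp (Lam a l p s) * m s)) \<le> norm h * (K * (exp ((K * norm p + 1) * norm s) * cmod (m s)))" for h s
  proof -
    have "Re (Lam a l p s) \<le> K * norm p * norm s"
      using complex_Re_le_cmod[of "Lam a l p s"] K(1)[of p s] by (simp add: mult.assoc)
    moreover have "norm s \<le> exp (norm s)" using exp_ge_add_one_self[of "norm s"] by linarith
    ultimately have "norm s * exp (Re (Lam a l p s)) \<le> exp (norm s) * exp (K * norm p * norm s)"
      by (intro mult_mono) auto
    also have "\<dots> = exp ((K * norm p + 1) * norm s)" by (simp add: exp_add[symmetric] algebra_simps)
    finally have 1: "norm s * exp (Re (Lam a l p s)) \<le> exp ((K * norm p + 1) * norm s)" .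
    have "cmod (Lam a l h s * (exp (Lam a l p s) * m s)) = cmod (Lam a l h s) * (exp (Re (Lam a l p s)) * cmod (m s))"
      by (simp add: norm_mult)
    also have "\<dots> \<le> (K * (norm h * norm s)) * (exp (Re (Lam a l p s)) * cmod (m s))"
      by (intro mult_right_mono K) auto
    also have "\<dots> = norm h * (K * ((norm s * exp (Re (Lam a l p s))) * cmod (m s)))" by (simp add: mult_ac)
    also have "\<dots> \<le> norm h * (K * (exp ((K * norm p + 1) * norm s) * cmod (m s)))"
      by (intro mult_left_mono mult_right_mono 1 K) auto
    finally show ?thesis .
  qed
  have I2: "integrable lborel (\<lambda>s. Lam a l h s * (exp (Lam a l p s) * m s))" for h
  proof (rule Bochner_Integration.integrable_bound)
    show "integrable lborel (\<lambda>s. norm h * (K * (exp ((K * norm p + 1) * norm s) * cmod (m s))))"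
      by (intro integrable_mult_right mi)
    show "AE s in lborel. norm (Lam a l h s * (exp (Lam a l p s) * m s)) \<le> norm (norm h * (K * (exp ((K * norm p + 1) * norm s) * cmod (m s))))"
      using I2b K(2) by (intro AE_I2) simp
  qed measurable
  have D_lin: "bounded_linear D"
  proof (rule bounded_linear_intro)
    show "D (x + y) = D x + D y" for x y
      unfolding D_def Lam_add distrib_right by (rule Bochner_Integration.integral_add[OF I2 I2])
    show "D (r *\<^sub>R x) = r *\<^sub>R D x" for r x
      unfolding D_def Lam_scaleR scaleR_left_commute by simp
    show "norm (D x) \<le> norm x * (LINT s|lborel. K * (exp ((K * norm p + 1) * norm s) * cmod (m s)))" for x
    proof -
      have "norm (D x) \<le> (LINT s|lborel. norm x * (K * (exp ((K * norm p + 1) * norm s) * cmod (m s))))"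
        unfolding D_def by (rule Bochner_Integration.integral_norm_bound_integral[OF I2])
          (auto intro!: integrable_mult_right mi I2b)
      then show ?thesis using mi by simp
    qed
  qed
  \<comment> \<open>In the exponent, \<open>K * norm p\<close> bounds the exponential at
    \<open>p\<close> and \<open>K\<close> the one of an increment of norm at most 1. The summand 1
    and the factor 2 come from \<open>(norm s)\<^sup>2 \<le> 2 * exp (norm s)\<close>, and
    \<open>K\<^sup>2\<close> from the squared increment.\<close>
  define M where "M = (LINT s|lborel. K\<^sup>2 * (2 * (exp ((K * norm p + K + 1) * norm s) * cmod (m s))))"
  have rem: "cmod ((LINT s|lborel. exp (Lam a l (p + h) s) * m s) - (LINT s|lborel. exp (Lam a l p s) * m s) - D h) \<le> (norm h)\<^sup>2 * M"
    if h: "norm h \<le> 1" for h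
  proof -
    have "(LINT s|lborel. exp (Lam a l (p + h) s) * m s) - (LINT s|lborel. exp (Lam a l p s) * m s) - D h
      = (LINT s|lborel. exp (Lam a l (p + h) s) * m s - exp (Lam a l p s) * m s - Lam a l h s * (exp (Lam a l p s) * m s))"
      unfolding D_def using I1 I2 by simp
    also have "cmod \<dots> \<le> (LINT s|lborel. (norm h)\<^sup>2 * (K\<^sup>2 * (2 * (exp ((K * norm p + K + 1) * norm s) * cmod (m s)))))"
    proof (rule Bochner_Integration.integral_norm_bound_integral)
      show "integrable lborel (\<lambda>s. exp (Lam a l (p + h) s) * m s - exp (Lam a l p s) * m s - Lam a l h s * (exp (Lam a l p s) * m s))"
        using I1 I2 by simp
      show "integrable lborel (\<lambda>s. (norm h)\<^sup>2 * (K\<^sup>2 * (2 * (exp ((K * norm p + K + 1) * norm s) * cmod (m s)))))"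
        by (intro integrable_mult_right mi)
      fix s
      let ?h = "Lam a l h s" and ?p = "Lam a l p s"
      have hb: "cmod ?h \<le> K * norm h * norm s" using K(1)[of h s] by (simp add: mult.assoc)
      also have "\<dots> \<le> K * 1 * norm s" using h K(2) by (intro mult_right_mono mult_left_mono) auto
      finally have hb1: "cmod ?h \<le> K * norm s" by simp
      have "cmod (exp ?h - (\<Sum>k\<le>1. ?h ^ k / fact k)) \<le> exp \<bar>Re ?h\<bar> * cmod ?h ^ Suc 1 / fact 1"
        by (rule Taylor_exp)
      then have 1: "cmod (exp ?h - 1 - ?h) \<le> exp \<bar>Re ?h\<bar> * (cmod ?h)\<^sup>2" by (simp add: numeral_2_eq_2 algebra_simps)
      have s2: "(norm s)\<^sup>2 \<le> 2 * exp (norm s)"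
        using exp_lower_Taylor_quadratic[OF norm_ge_zero[of s]] norm_ge_zero[of s] by linarith
      have "\<bar>Re ?h\<bar> \<le> K * norm s" using abs_Re_le_cmod[of ?h] hb1 by linarith
      moreover have "(cmod ?h)\<^sup>2 \<le> (K * norm h * norm s)\<^sup>2" using hb by (rule power_mono) simp
      ultimately have "exp \<bar>Re ?h\<bar> * (cmod ?h)\<^sup>2 \<le> exp (K * norm s) * (K * norm h * norm s)\<^sup>2"
        by (intro mult_mono) auto
      also have "\<dots> = (norm h)\<^sup>2 * (K\<^sup>2 * (exp (K * norm s) * (norm s)\<^sup>2))" by (simp add: power_mult_distrib mult_ac)
      also have "\<dots> \<le> (norm h)\<^sup>2 * (K\<^sup>2 * (exp (K * norm s) * (2 * exp (norm s))))"
        by (intro mult_left_mono s2) auto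
      finally have 2: "cmod (exp ?h - 1 - ?h) \<le> (norm h)\<^sup>2 * (K\<^sup>2 * (exp (K * norm s) * (2 * exp (norm s))))" using 1 by linarith
      have pb: "cmod (exp ?p) \<le> exp (K * norm p * norm s)"
        using complex_Re_le_cmod[of ?p] K(1)[of p s] by (simp add: mult.assoc)
      have "exp (Lam a l (p + h) s) * m s - exp ?p * m s - ?h * (exp ?p * m s) = exp ?p * (exp ?h - 1 - ?h) * m s"
        unfolding Lam_add exp_add by (simp add: algebra_simps)
      also have "cmod \<dots> \<le> exp (K * norm p * norm s) * ((norm h)\<^sup>2 * (K\<^sup>2 * (exp (K * norm s) * (2 * exp (norm s))))) * cmod (m s)"
        unfolding norm_mult[of _ "m s"] norm_mult[of "exp ?p"] by (intro mult_right_mono mult_mono pb 2) auto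
      also have "\<dots> = (norm h)\<^sup>2 * (K\<^sup>2 * (2 * ((exp (K * norm p * norm s) * (exp (K * norm s) * exp (norm s))) * cmod (m s))))"
        by (simp add: mult_ac)
      also have "exp (K * norm p * norm s) * (exp (K * norm s) * exp (norm s)) = exp ((K * norm p + K + 1) * norm s)"
        unfolding exp_add[symmetric] by (simp add: algebra_simps)
      finally show "norm (exp (Lam a l (p + h) s) * m s - exp ?p * m s - ?h * (exp ?p * m s)) \<le> (norm h)\<^sup>2 * (K\<^sup>2 * (2 * (exp ((K * norm p + K + 1) * norm s) * cmod (m s))))" .
    qed
    also have "\<dots> = (norm h)\<^sup>2 * M" unfolding M_def by simp
    finally show ?thesis .
  qed
  show "\<exists>L. ((\<lambda>p. LINT s|lborel. exp (Lam a l p s) * m s) has_derivative L) (at p) \<and> (\<forall>c z w. L (c *s z, c *s w) = c * L (z, w))"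
  proof (intro exI[of _ D] conjI allI)
    show "((\<lambda>p. LINT s|lborel. exp (Lam a l p s) * m s) has_derivative D) (at p)"
    proof (rule has_derivativeI_sandwich[where e=1 and H="\<lambda>y. norm (y - p) * M"])
      show "((\<lambda>y. norm (y - p) * M) \<longlongrightarrow> 0) (at p)"
        by (auto intro!: tendsto_eq_intros)
      fix y assume y: "y \<noteq> p" "dist y p < 1"
      have "cmod ((LINT s|lborel. exp (Lam a l y s) * m s) - (LINT s|lborel. exp (Lam a l p s) * m s) - D (y - p)) \<le> (norm (y - p))\<^sup>2 * M"
        using rem[of "y - p"] y by (simp add: dist_norm)
      then show "norm ((LINT s|lborel. exp (Lam a l y s) * m s) - (LINT s|lborel. exp (Lam a l p s) * m s) - D (y - p)) / norm (y - p) \<le> norm (y - p) * M"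
        using y by (simp add: divide_le_eq power2_eq_square mult_ac)
    qed (use D_lin in auto)
    show "D (c *s z, c *s w) = c * D (z, w)" for c z w
      unfolding D_def Lam_cscale mult.assoc by simp
  qed
qed

lemma entireC_continuous: "entireC F \<Longrightarrow> continuous_on UNIV F"
  unfolding entireC_def continuous_on_eq_continuous_within by (metis has_derivative_continuous)

lemma enc_csc: "enc (z + csc c \<eta>) = (fst (enc z) + c *s fst (enc \<eta>), snd (enc z) + c *s snd (enc \<eta>))"
  by (simp add: enc_def csc_def cx_def vec_eq_iff complex_eq_iff algebra_simps)

text \<open>The chain rule: along a complex line a complex linear derivative becomes multiplication
  by a number. This is the form of holomorphy that the reproducing property asks for.\<close>

lemma entireC_line:
  fixes E :: "'n::finite cpair \<Rightarrow> complex"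
  assumes "entireC E"
  shows "(\<lambda>c. E (enc (z + csc c \<eta>))) holomorphic_on UNIV"
  unfolding holomorphic_on_def
proof
  fix c0 :: complex
  define \<phi> where "\<phi> c = enc (z + csc c \<eta>)" for c
  obtain L where L: "(E has_derivative L) (at (\<phi> c0))" "\<And>c z w. L (c *s z, c *s w) = c * L (z, w)"
    using assms unfolding entireC_def by metis
  have bl: "bounded_linear (\<lambda>c. c *s v)" for v :: "complex^'n"
  proof -
    have "linear (\<lambda>c. c *s v)" by (rule linearI) (auto simp: vec_eq_iff algebra_simps complex_eq_iff)
    then show ?thesis by (rule linear_conv_bounded_linear[THEN iffD1])
  qed
  have ad: "((\<lambda>c. u + c *s v) has_derivative (\<lambda>h. h *s v)) (at c0)" for u v :: "complex^'n"
    using has_derivative_add[OF has_derivative_const[of u] bounded_linear_imp_has_derivative[OF bl[of v]]] by simp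
  have "(\<phi> has_derivative (\<lambda>h. (h *s fst (enc \<eta>), h *s snd (enc \<eta>)))) (at c0)"
    unfolding \<phi>_def enc_csc by (intro has_derivative_Pair ad)
  from has_derivative_compose[OF this L(1)]
  have "((\<lambda>c. E (\<phi> c)) has_derivative (\<lambda>h. L (h *s fst (enc \<eta>), h *s snd (enc \<eta>)))) (at c0)" .
  then have "((\<lambda>c. E (\<phi> c)) has_field_derivative L (fst (enc \<eta>), snd (enc \<eta>))) (at c0)"
    unfolding has_field_derivative_def L(2) by (simp add: mult_commute_abs)
  then show "(\<lambda>c. E (enc (z + csc c \<eta>))) field_differentiable at c0 within UNIV"
    unfolding \<phi>_def field_differentiable_def by auto
qed

definition hT :: "real \<Rightarrow> real \<Rightarrow> ('n::finite vv \<Rightarrow> complex) \<Rightarrow> 'n cpair \<Rightarrow> complex" where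
  "hT t l g p = (LINT s|lborel. hk t l p s * g s)"

section \<open>Isometry at a fixed frequency\<close>

context
  fixes t l :: real
  assumes t: "t > 0" and l: "l \<noteq> 0"
begin

lemma hT_eq_S: "hT t l g (p :: 'n::finite cpair) = complex_of_real (pref TYPE('n) t l) * skew.S J0 (aa t l) (l / (2 * aa t l)) g (dec p)"
proof -
  interpret skew "J0 :: 'n vv \<Rightarrow> _" "aa t l" "l / (2 * aa t l)" by (rule skew_J0[OF t l])
  show ?thesis unfolding hT_def S_def hk_eq_kern[OF t l] by (simp add: mult.assoc)
qed

lemma pref_pos: "pref TYPE('n::finite) t l > 0"
  unfolding pref_def using l_div_sinh_pos[OF t l] by simp

lemma cW_pos: "cW TYPE('n::finite) t l > 0"
  unfolding cW_def using l_div_sinh_pos[of "2 * t" l] t l by simp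

lemma hk_sqint: "sqint lborel (hk t l (p :: 'n::finite cpair))"
proof -
  interpret skew "J0 :: 'n vv \<Rightarrow> _" "aa t l" "l / (2 * aa t l)" by (rule skew_J0[OF t l])
  have "hk t l p = (\<lambda>s. complex_of_real (pref TYPE('n) t l) * kern (dec p) s)" using hk_eq_kern[OF t l, of p] by auto
  then show ?thesis by (simp add: sqint_cmult kern_sqint)
qed

lemma hT_integrable: "sqint lborel g \<Longrightarrow> integrable lborel (\<lambda>s. hk t l p s * g s)"
  by (rule sqint_mult[OF hk_sqint])

lemma bnorm2_eq:
  fixes E :: "'n::finite cpair \<Rightarrow> complex"
  assumes [measurable]: "E \<in> borel_measurable borel"
  shows "bnorm2 t l E = ennreal (cW TYPE('n) t l) * (\<integral>\<^sup>+z. ennreal ((cmod (E (enc z)))\<^sup>2 * skew.wgt J0 (aa t l) (l / (2 * aa t l)) z) \<partial>lborel)"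
proof -
  interpret skew "J0 :: 'n vv \<Rightarrow> _" "aa t l" "l / (2 * aa t l)" by (rule skew_J0[OF t l])
  have "bnorm2 t l E = (\<integral>\<^sup>+p. ennreal (cW TYPE('n) t l) * ennreal ((cmod (E p))\<^sup>2 * wgt (dec p)) \<partial>lborel)"
    unfolding bnorm2_def Wt_eq_wgt[OF t l] using cW_pos[where 'n='n] wgt_pos
    by (intro nn_integral_cong) (simp add: ennreal_mult[symmetric] less_imp_le mult_ac)
  also have "\<dots> = ennreal (cW TYPE('n) t l) * (\<integral>\<^sup>+p. ennreal ((cmod (E p))\<^sup>2 * wgt (dec p)) \<partial>lborel)"
    by (rule nn_integral_cmult) measurable
  also have "(\<integral>\<^sup>+p. ennreal ((cmod (E p))\<^sup>2 * wgt (dec p)) \<partial>lborel) = (\<integral>\<^sup>+z. ennreal ((cmod (E (enc z)))\<^sup>2 * wgt (dec (enc z))) \<partial>lborel)"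
    by (rule nn_integral_enc) measurable
  finally show ?thesis by simp
qed

text \<open>The factor quadratic in \<open>p\<close> is pulled out; what remains is a
  \<open>Lam\<close> integral against \<open>g\<close> times a Gaussian. That product has all
  exponential moments, by Cauchy-Schwarz and completing a square.\<close>

lemma entireC_hT:
  fixes g :: "'n::finite vv \<Rightarrow> complex"
  assumes g: "sqint lborel g"
  shows "entireC (hT t l g)"
proof -
  define a where "a = l / 4 * coth (t * l)"
  have "a = (aa t l)\<^sup>2 / 2" using aa_facts(1)[OF t l] by (simp add: a_def)
  then have a: "a > 0" using zero_less_power[OF aa_facts(2)[OF t l], of 2] by linarith
  have [measurable]: "g \<in> borel_measurable borel" using g by (simp add: sqint_def)
  define m where "m s = complex_of_real (exp (- a * (s \<bullet> s))) * g s" for s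
  have [measurable]: "m \<in> borel_measurable borel" unfolding m_def by measurable
  have mi: "integrable lborel (\<lambda>s. exp (C * norm s) * cmod (m s))" for C
  proof -
    have "sqint lborel (\<lambda>s::'n vv. complex_of_real (exp (C * norm s) * exp (- a * (s \<bullet> s))))"
    proof (rule sqint_bound)
      have "(\<lambda>s::'n vv. (cmod (complex_of_real (exp (- (a/2) * (s \<bullet> s)))))\<^sup>2) = (\<lambda>s. exp (0 \<bullet> s - a * (s \<bullet> s)))"
        by (auto simp: exp_double[symmetric])
      then have "sqint lborel (\<lambda>s::'n vv. complex_of_real (exp (- (a/2) * (s \<bullet> s))))"
        unfolding sqint_def using gauss_real[OF a, of "0::'n vv"] by (simp add: has_bochner_integral_iff)
      then show "sqint lborel (\<lambda>s::'n vv. complex_of_real (exp (C\<^sup>2 / (2 * a))) * complex_of_real (exp (- (a/2) * (s \<bullet> s))))"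
        by (rule sqint_cmult)
      fix s :: "'n vv"
      have "0 \<le> (a * norm s - C)\<^sup>2" by simp
      then have "2 * a * (C * norm s) \<le> C\<^sup>2 + a\<^sup>2 * (norm s)\<^sup>2" by (simp add: power2_diff power_mult_distrib mult_ac)
      then have "C * norm s \<le> C\<^sup>2 / (2 * a) + a / 2 * (s \<bullet> s)"
        using a unfolding power2_norm_eq_inner by (simp add: field_simps power2_eq_square)
      then have "C * norm s + - a * (s \<bullet> s) \<le> C\<^sup>2 / (2 * a) + - (a / 2) * (s \<bullet> s)" by simp
      then have "exp (C * norm s) * exp (- a * (s \<bullet> s)) \<le> exp (C\<^sup>2 / (2 * a)) * exp (- (a / 2) * (s \<bullet> s))"
        unfolding exp_add[symmetric] by simp
      then show "cmod (complex_of_real (exp (C * norm s) * exp (- a * (s \<bullet> s)))) \<le> cmod (complex_of_real (exp (C\<^sup>2 / (2 * a))) * complex_of_real (exp (- (a/2) * (s \<bullet> s))))"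
        unfolding of_real_mult[symmetric] norm_of_real by simp
    qed measurable
    from integrable_norm[OF sqint_mult[OF this g]] show ?thesis
      by (simp add: m_def norm_mult mult_ac)
  qed
  have "hT t l g = (\<lambda>p. (complex_of_real (pref TYPE('n) t l) * exp (- complex_of_real a * (cdot (fst p) (fst p) + cdot (snd p) (snd p)))) * (LINT s|lborel. exp (Lam a l p s) * m s))"
  proof
    fix p :: "'n cpair"
    have "hk t l p s * g s = (complex_of_real (pref TYPE('n) t l) * exp (- complex_of_real a * (cdot (fst p) (fst p) + cdot (snd p) (snd p)))) * (exp (Lam a l p s) * m s)" for s
      unfolding hk_eq_Lam m_def a_def[symmetric] by (simp only: mult.assoc)
    then show "hT t l g p = (complex_of_real (pref TYPE('n) t l) * exp (- complex_of_real a * (cdot (fst p) (fst p) + cdot (snd p) (snd p)))) * (LINT s|lborel. exp (Lam a l p s) * m s)"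
      unfolding hT_def by simp
  qed
  then show ?thesis
    using entireC_mult[OF entireC_exp_quadratic[of "complex_of_real (pref TYPE('n) t l)" "- complex_of_real a"] entireC_Lam_integral[of m a l, OF _ mi]]
    by simp
qed

lemma bnorm2_hT:
  fixes g :: "'n::finite vv \<Rightarrow> complex"
  assumes g: "sqint lborel g"
  shows "bnorm2 t l (hT t l g) = (\<integral>\<^sup>+s. ennreal ((cmod (g s))\<^sup>2) \<partial>lborel)"
proof -
  interpret skew "J0 :: 'n vv \<Rightarrow> _" "aa t l" "l / (2 * aa t l)" by (rule skew_J0[OF t l])
  have [measurable]: "g \<in> borel_measurable borel" using g by (simp add: sqint_def)
  let ?c = "pref TYPE('n) t l"
  have "bnorm2 t l (hT t l g) = ennreal (cW TYPE('n) t l) * (\<integral>\<^sup>+z. ennreal ((cmod (hT t l g (enc z)))\<^sup>2 * wgt z) \<partial>lborel)"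
    by (intro bnorm2_eq borel_measurable_continuous_onI entireC_continuous entireC_hT g)
  also have "(\<integral>\<^sup>+z. ennreal ((cmod (hT t l g (enc z)))\<^sup>2 * wgt z) \<partial>lborel) = (\<integral>\<^sup>+z. ennreal (?c\<^sup>2) * ennreal ((cmod (S g z))\<^sup>2 * wgt z) \<partial>lborel)"
    unfolding hT_eq_S using pref_pos[where 'n='n] wgt_pos
    by (intro nn_integral_cong) (simp add: norm_mult power_mult_distrib ennreal_mult[symmetric] less_imp_le mult_ac)
  also have "\<dots> = ennreal (?c\<^sup>2) * (ennreal N * (\<integral>\<^sup>+s. ennreal ((cmod (g s))\<^sup>2) \<partial>lborel))"
    unfolding S_nn_norm[OF g, symmetric] by (rule nn_integral_cmult) measurable
  also have "ennreal (cW TYPE('n) t l) * \<dots> = ennreal (?c\<^sup>2 * cW TYPE('n) t l * N) * (\<integral>\<^sup>+s. ennreal ((cmod (g s))\<^sup>2) \<partial>lborel)"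
    using cW_pos[where 'n='n] N_pos by (simp add: ennreal_mult[symmetric] mult.assoc[symmetric] less_imp_le) (simp add: mult_ac)
  finally show ?thesis unfolding const_identity[OF t l] by simp
qed

end

section \<open>Inversion of the fibre transforms\<close>

lemma floor_scaled_tendsto: "(\<lambda>n. real_of_int \<lfloor>real (Suc n) * x\<rfloor> / real (Suc n)) \<longlonglongrightarrow> x"
proof -
  have "(\<lambda>n. real_of_int \<lfloor>real (Suc n) * x\<rfloor> / real (Suc n) - x) \<longlonglongrightarrow> 0"
  proof (rule Lim_null_comparison[OF always_eventually])
    show "\<forall>n. norm (real_of_int \<lfloor>real (Suc n) * x\<rfloor> / real (Suc n) - x) \<le> 1 / real (Suc n)"
    proof
      fix n
      let ?m = "real (Suc n)"
      have "real_of_int \<lfloor>?m * x\<rfloor> / ?m - x = (real_of_int \<lfloor>?m * x\<rfloor> - ?m * x) / ?m" by (simp add: field_simps)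
      moreover have "\<bar>real_of_int \<lfloor>?m * x\<rfloor> - ?m * x\<bar> \<le> 1" by linarith
      ultimately show "norm (real_of_int \<lfloor>?m * x\<rfloor> / ?m - x) \<le> 1 / ?m" by (simp add: divide_right_mono)
    qed
    show "(\<lambda>n. 1 / real (Suc n)) \<longlonglongrightarrow> 0" by real_asymp
  qed
  then show ?thesis by (simp add: LIM_zero_iff)
qed

text \<open>The second variable is rounded down to a grid of mesh \<open>1 / real (Suc n)\<close>,
  so that only countably many of the functions measurable in \<open>l\<close> are involved;
  continuity recovers the original as a pointwise limit. This gives joint measurability of families
  that are measurable in the frequency and entire in the point.\<close>

lemma caratheodory_measurable:
  fixes f :: "real \<Rightarrow> 'a::euclidean_space \<Rightarrow> complex"
  assumes m: "\<And>p. (\<lambda>l. f l p) \<in> borel_measurable borel" and c: "\<And>l. continuous_on UNIV (f l)"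
  shows "(\<lambda>x. f (fst x) (snd x)) \<in> borel_measurable (borel \<Otimes>\<^sub>M borel)"
proof -
  define d where "d n p = (\<Sum>b\<in>Basis. (real_of_int \<lfloor>real (Suc n) * (p \<bullet> b)\<rfloor> / real (Suc n)) *\<^sub>R b)" for n and p :: 'a
  have dm[measurable]: "d n \<in> borel \<rightarrow>\<^sub>M borel" for n unfolding d_def by measurable
  have dlim: "(\<lambda>n. d n p) \<longlonglongrightarrow> p" for p
  proof -
    have "(\<lambda>n. d n p) \<longlonglongrightarrow> (\<Sum>b\<in>Basis. (p \<bullet> b) *\<^sub>R b)"
      unfolding d_def by (intro tendsto_sum tendsto_scaleR floor_scaled_tendsto tendsto_const)
    then show ?thesis by (simp add: euclidean_representation)
  qed
  have dc: "countable (range (d n))" for n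
  proof (rule countable_subset)
    show "range (d n) \<subseteq> (\<lambda>g. \<Sum>b\<in>Basis. (real_of_int (g b) / real (Suc n)) *\<^sub>R b) ` (PiE Basis (\<lambda>_. UNIV :: int set))"
    proof
      fix y assume "y \<in> range (d n)"
      then obtain p where y: "y = d n p" by blast
      show "y \<in> (\<lambda>g. \<Sum>b\<in>Basis. (real_of_int (g b) / real (Suc n)) *\<^sub>R b) ` (PiE Basis (\<lambda>_. UNIV :: int set))"
        by (rule image_eqI[of _ _ "restrict (\<lambda>b. \<lfloor>real (Suc n) * (p \<bullet> b)\<rfloor>) Basis"]) (auto simp: y d_def)
    qed
    show "countable ((\<lambda>g. \<Sum>b\<in>Basis. (real_of_int (g b) / real (Suc n)) *\<^sub>R b) ` (PiE (Basis :: 'a set) (\<lambda>_. UNIV :: int set)))"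
      by (intro countable_image countable_PiE) auto
  qed
  have "(\<lambda>x. f (fst x) (d n (snd x))) \<in> borel_measurable (borel \<Otimes>\<^sub>M borel)" for n
  proof (rule measurable_compose_countable'[where f="\<lambda>i x. f (fst x) i" and g="\<lambda>x. d n (snd x)", OF _ _ dc])
    show "(\<lambda>x. f (fst x) i) \<in> borel_measurable (borel \<Otimes>\<^sub>M borel)" for i
      by (rule measurable_compose[OF measurable_fst m])
    show "(\<lambda>x. d n (snd x)) \<in> borel \<Otimes>\<^sub>M borel \<rightarrow>\<^sub>M count_space (range (d n))"
      unfolding measurable_count_space_eq_countable[OF dc]
    proof (intro conjI ballI)
      show "(\<lambda>x. d n (snd x)) \<in> space (borel \<Otimes>\<^sub>M borel) \<rightarrow> range (d n)" by auto
      fix a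
      have "(\<lambda>x. d n (snd x)) -` {a} \<inter> space (borel \<Otimes>\<^sub>M borel) = {x \<in> space (borel \<Otimes>\<^sub>M borel). d n (snd x) = a}" by auto
      also have "\<dots> \<in> sets (borel \<Otimes>\<^sub>M borel)" by measurable
      finally show "(\<lambda>x. d n (snd x)) -` {a} \<inter> space (borel \<Otimes>\<^sub>M borel) \<in> sets (borel \<Otimes>\<^sub>M borel)" .
    qed
  qed
  then show ?thesis
  proof (rule borel_measurable_LIMSEQ_metric)
    fix x :: "real \<times> 'a"
    have "isCont (f (fst x)) (snd x)" using c[of "fst x"] by (simp add: continuous_on_eq_continuous_at)
    then show "(\<lambda>n. f (fst x) (d n (snd x))) \<longlonglongrightarrow> f (fst x) (snd x)"
      by (rule isCont_tendsto_compose[OF _ dlim])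
  qed
qed

text \<open>The adjoint of the fibre transform in the weighted space, applied to \<open>F\<close>
  restricted to the ball of radius \<open>k\<close>. It is written as one explicit integral so that
  its measurability in the frequency and the point together can be read off.\<close>

definition gk :: "real \<Rightarrow> real \<Rightarrow> nat \<Rightarrow> ('n::finite cpair \<Rightarrow> complex) \<Rightarrow> 'n vv \<Rightarrow> complex" where
  "gk t l k F s = (LINT z|lborel. complex_of_real (Wt t l (enc z)) * (F (enc z) * indicator (cball 0 (real k)) z * cnj (hk t l (enc z) s)))"

context
  fixes t l :: real and F :: "'n::finite cpair \<Rightarrow> complex"
  assumes t: "t > 0" and l: "l \<noteq> 0" and F: "entireC F" and Fb: "bnorm2 t l F < \<infinity>"
begin

interpretation skew "J0 :: 'n vv \<Rightarrow> _" "aa t l" "l / (2 * aa t l)" by (rule skew_J0[OF t l])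

abbreviation "uu k z \<equiv> F (enc z) * indicator (cball 0 (real k)) z"

lemma const_pos: "pref TYPE('n) t l > 0" "cW TYPE('n) t l > 0" "pref TYPE('n) t l * cW TYPE('n) t l = 1 / (N * pref TYPE('n) t l)" "(pref TYPE('n) t l)\<^sup>2 * cW TYPE('n) t l * N = 1"
proof -
  show 1: "pref TYPE('n) t l > 0" "cW TYPE('n) t l > 0" by (rule pref_pos[OF t l], rule cW_pos[OF t l])
  show 2: "(pref TYPE('n) t l)\<^sup>2 * cW TYPE('n) t l * N = 1" by (rule const_identity[OF t l])
  then show "pref TYPE('n) t l * cW TYPE('n) t l = 1 / (N * pref TYPE('n) t l)" using 1 N_pos by (simp add: field_simps power2_eq_square)
qed

lemma Fe_cont: "continuous_on UNIV (\<lambda>z. F (enc z))"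
  by (intro continuous_on_compose2[OF entireC_continuous[OF F] enc_continuous]) auto

lemma Fe_measurable [measurable]: "(\<lambda>z. F (enc z)) \<in> borel_measurable borel"
  by (intro borel_measurable_continuous_onI Fe_cont)

lemma E_sqint: "sqint mu (\<lambda>z. F (enc z))"
proof -
  have Fm: "F \<in> borel_measurable borel" by (intro borel_measurable_continuous_onI entireC_continuous F)
  have "ennreal (cW TYPE('n) t l) * (\<integral>\<^sup>+z. ennreal ((cmod (F (enc z)))\<^sup>2 * wgt z) \<partial>lborel) < \<infinity>"
    using Fb unfolding bnorm2_eq[OF t l Fm] .
  then have "(\<integral>\<^sup>+z. ennreal ((cmod (F (enc z)))\<^sup>2 * wgt z) \<partial>lborel) < \<infinity>"
    using const_pos(2) by (auto simp: ennreal_mult_less_top)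
  then show ?thesis unfolding sqint_mu_iff by simp
qed

lemma uu_props:
  obtains B where "\<And>z. cmod (uu k z) \<le> B" "\<And>z. norm z > real k \<Longrightarrow> uu k z = 0"
proof -
  have "compact ((\<lambda>z. F (enc z)) ` cball 0 (real k))" by (intro compact_continuous_image continuous_on_subset[OF Fe_cont]) auto
  from compact_imp_bounded[OF this] obtain B where B: "\<forall>x\<in>(\<lambda>z. F (enc z)) ` cball 0 (real k). norm x \<le> B" unfolding bounded_iff by blast
  show ?thesis
  proof (rule that[of "\<bar>B\<bar>"])
    fix z
    show "cmod (uu k z) \<le> \<bar>B\<bar>"
    proof (cases "norm z \<le> real k")
      case True
      then have "cmod (F (enc z)) \<le> B" using B by simp
      then show ?thesis using True by simp
    qed simp
  qed simp
qed

lemma uu_measurable [measurable]: "uu k \<in> borel_measurable borel"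
  by (intro borel_measurable_times Fe_measurable borel_measurable_indicator) auto

lemma gk_eq: "gk t l k F s = complex_of_real (1 / (N * pref TYPE('n) t l)) * Adj (uu k) s"
proof -
  have "complex_of_real (Wt t l (enc z)) * (F (enc z) * indicator (cball 0 (real k)) z * cnj (hk t l (enc z) s))
    = complex_of_real (pref TYPE('n) t l * cW TYPE('n) t l) * (complex_of_real (wgt z) * (uu k z * cnj (kern z s)))" for z
    unfolding Wt_eq_wgt[OF t l] hk_eq_kern[OF t l] by simp
  then show ?thesis unfolding gk_def Adj_def const_pos(3) by simp
qed

lemma gk_sqint: "sqint lborel (gk t l k F)"
proof -
  obtain B where "\<And>z. cmod (uu k z) \<le> B" "\<And>z. norm z > real k \<Longrightarrow> uu k z = 0" using uu_props by blast
  from Adj_sqint[OF uu_measurable this] have "sqint lborel (\<lambda>s. complex_of_real (1 / (N * pref TYPE('n) t l)) * Adj (uu k) s)" by (rule sqint_cmult)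
  then show ?thesis unfolding gk_eq[symmetric] .
qed

lemma Adj_integrable: "integrable lborel (\<lambda>z. complex_of_real (wgt z) * (uu k z * cnj (kern z s)))"
proof -
  have "continuous_on (cball 0 (real k)) (\<lambda>z. kern z s)"
    by (rule continuous_on_compose2[OF cont_kern, of _ "\<lambda>z. (z, s)", simplified]) (auto intro!: continuous_intros)
  then have "continuous_on (cball 0 (real k)) (\<lambda>z. complex_of_real (wgt z) * (F (enc z) * cnj (kern z s)))"
    by (intro continuous_intros continuous_on_subset[OF cont_wgt] continuous_on_subset[OF Fe_cont]) auto
  from borel_integrable_compact[OF compact_cball this] show ?thesis
    by (rule Bochner_Integration.integrable_cong[THEN iffD1, rotated 2]) (auto simp: indicator_def)
qed

text \<open>The adjoint does not increase norms, and the two truncations of \<open>F\<close> differ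
  only outside the smaller ball. The bound depends on \<open>j\<close> alone, which is what later
  makes the sequence Cauchy.\<close>

lemma gk_diff:
  assumes "j \<le> k"
  shows "(\<integral>\<^sup>+s. ennreal ((cmod (gk t l k F s - gk t l j F s))\<^sup>2) \<partial>lborel) \<le>
    (\<integral>\<^sup>+z. ennreal ((cmod (F (enc z)))\<^sup>2 * Wt t l (enc z)) * indicator (- cball 0 (real j)) z \<partial>lborel)"
proof -
  define u where "u z = uu k z - uu j z" for z
  have [measurable]: "u \<in> borel_measurable borel" unfolding u_def by measurable
  obtain B1 B2 where B: "\<And>z. cmod (uu k z) \<le> B1" "\<And>z. norm z > real k \<Longrightarrow> uu k z = 0"
    "\<And>z. cmod (uu j z) \<le> B2" "\<And>z. norm z > real j \<Longrightarrow> uu j z = 0"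
    using uu_props[of k] uu_props[of j] by metis
  have ub: "cmod (u z) \<le> B1 + B2" for z
    unfolding u_def using norm_triangle_ineq4[of "uu k z" "uu j z"] B(1)[of z] B(3)[of z] by linarith
  have us: "u z = 0" if "norm z > real k" for z
    unfolding u_def using B(2)[OF that] B(4)[of z] that assms by simp
  have um: "u \<in> borel_measurable borel" by measurable
  have eq: "gk t l k F s - gk t l j F s = complex_of_real (1 / (N * pref TYPE('n) t l)) * Adj u s" for s
  proof -
    have "Adj u s = Adj (uu k) s - Adj (uu j) s"
      unfolding Adj_def using Adj_integrable[of k s] Adj_integrable[of j s]
      by (subst Bochner_Integration.integral_diff[symmetric]) (auto simp: u_def algebra_simps intro!: Bochner_Integration.integral_cong)
    then show ?thesis unfolding gk_eq by (simp add: right_diff_distrib)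
  qed
  have s1: "sqint lborel (Adj u)" by (rule Adj_sqint[OF um ub us])
  have s2: "sqint lborel (\<lambda>s. gk t l k F s - gk t l j F s)" unfolding eq by (rule sqint_cmult[OF s1])
  have s3: "sqint mu u" by (rule u_sqint[OF um ub us])
  have "l2n lborel (\<lambda>s. gk t l k F s - gk t l j F s) = 1 / (N * pref TYPE('n) t l) * l2n lborel (Adj u)"
    unfolding eq l2n_cmult norm_of_real using N_pos const_pos(1) by simp
  also have "\<dots> \<le> 1 / (N * pref TYPE('n) t l) * (sqrt N * l2n mu u)"
    using N_pos const_pos(1) by (intro mult_left_mono Adj_norm[OF um ub us]) auto
  finally have "(l2n lborel (\<lambda>s. gk t l k F s - gk t l j F s))\<^sup>2 \<le> (1 / (N * pref TYPE('n) t l) * (sqrt N * l2n mu u))\<^sup>2"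
    by (intro power_mono l2n_nonneg)
  also have "\<dots> = cW TYPE('n) t l * (l2n mu u)\<^sup>2"
  proof -
    have "(1 / (N * pref TYPE('n) t l) * (sqrt N * l2n mu u))\<^sup>2 = (1 / (N * pref TYPE('n) t l))\<^sup>2 * N * (l2n mu u)\<^sup>2"
      using N_pos by (simp add: power_mult_distrib power_divide)
    also have "(1 / (N * pref TYPE('n) t l))\<^sup>2 * N = cW TYPE('n) t l"
    proof -
      have "(1 / (N * pref TYPE('n) t l))\<^sup>2 * N = (pref TYPE('n) t l * cW TYPE('n) t l) * (pref TYPE('n) t l * cW TYPE('n) t l) * N" unfolding const_pos(3)[symmetric] by (simp add: power2_eq_square)
      also have "\<dots> = cW TYPE('n) t l * ((pref TYPE('n) t l)\<^sup>2 * cW TYPE('n) t l * N)" by (simp add: power2_eq_square)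
      finally show ?thesis unfolding const_pos(4) by simp
    qed
    finally show ?thesis .
  qed
  finally have "(\<integral>\<^sup>+s. ennreal ((cmod (gk t l k F s - gk t l j F s))\<^sup>2) \<partial>lborel) \<le> ennreal (cW TYPE('n) t l * (l2n mu u)\<^sup>2)"
    unfolding sqint_nn_eq[OF s2] by (rule ennreal_leI)
  also have "\<dots> = ennreal (cW TYPE('n) t l) * (\<integral>\<^sup>+z. ennreal ((cmod (u z))\<^sup>2 * wgt z) \<partial>lborel)"
    unfolding nn_mu[OF um, symmetric] sqint_nn_eq[OF s3] using const_pos(2) by (simp add: ennreal_mult)
  also have "\<dots> = (\<integral>\<^sup>+z. ennreal (cW TYPE('n) t l) * ennreal ((cmod (u z))\<^sup>2 * wgt z) \<partial>lborel)"
    by (rule nn_integral_cmult[symmetric]) measurable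
  also have "\<dots> \<le> (\<integral>\<^sup>+z. ennreal ((cmod (F (enc z)))\<^sup>2 * Wt t l (enc z)) * indicator (- cball 0 (real j)) z \<partial>lborel)"
  proof (rule nn_integral_mono)
    fix z
    have "(cmod (u z))\<^sup>2 \<le> (cmod (F (enc z)))\<^sup>2 * indicator (- cball 0 (real j)) z"
      using assms by (auto simp: u_def indicator_def)
    then have "cW TYPE('n) t l * ((cmod (u z))\<^sup>2 * wgt z) \<le> cW TYPE('n) t l * (((cmod (F (enc z)))\<^sup>2 * indicator (- cball 0 (real j)) z) * wgt z)"
      using const_pos(2) wgt_pos[of z] by (intro mult_left_mono mult_right_mono) auto
    also have "\<dots> = (cmod (F (enc z)))\<^sup>2 * Wt t l (enc z) * indicator (- cball 0 (real j)) z"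
      unfolding Wt_eq_wgt[OF t l] by simp
    finally have "ennreal (cW TYPE('n) t l * ((cmod (u z))\<^sup>2 * wgt z)) \<le> ennreal ((cmod (F (enc z)))\<^sup>2 * Wt t l (enc z) * indicator (- cball 0 (real j)) z)"
      by (rule ennreal_leI)
    then show "ennreal (cW TYPE('n) t l) * ennreal ((cmod (u z))\<^sup>2 * wgt z) \<le> ennreal ((cmod (F (enc z)))\<^sup>2 * Wt t l (enc z)) * indicator (- cball 0 (real j)) z"
      using const_pos(2) wgt_pos[of z] by (cases "z \<in> cball 0 (real j)") (auto simp: ennreal_mult[symmetric])
  qed
  finally show ?thesis .
qed

text \<open>Applying the transform to the truncated adjoint gives, up to the constant, the integral
  of the truncated \<open>F\<close> against the kernel at \<open>p\<close>. Since \<open>F\<close>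
  times the kernel is integrable, the truncation can be removed by dominated convergence, and the
  reproducing property identifies the limit.\<close>

lemma hT_gk_tendsto: "(\<lambda>k. hT t l (gk t l k F) p) \<longlonglongrightarrow> F p"
proof -
  have eq: "hT t l (gk t l k F) p = complex_of_real (1 / N) * (LINT z|mu. uu k z * Kr (dec p) z)" for k
  proof -
    obtain B where B: "\<And>z. cmod (uu k z) \<le> B" "\<And>z. norm z > real k \<Longrightarrow> uu k z = 0" using uu_props by blast
    have "S (gk t l k F) (dec p) = complex_of_real (1 / (N * pref TYPE('n) t l)) * S (Adj (uu k)) (dec p)"
      unfolding S_def gk_eq by (subst integral_mult_right_zero[symmetric]) (simp add: mult_ac)
    then have "hT t l (gk t l k F) p = complex_of_real (pref TYPE('n) t l * (1 / (N * pref TYPE('n) t l))) * S (Adj (uu k)) (dec p)"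
      unfolding hT_eq_S[OF t l] by simp
    also have "pref TYPE('n) t l * (1 / (N * pref TYPE('n) t l)) = 1 / N" using const_pos(1) by simp
    also have "S (Adj (uu k)) (dec p) = (LINT z|mu. uu k z * Kr (dec p) z)" by (rule S_Adj[OF uu_measurable B])
    finally show ?thesis .
  qed
  note rep = reproducing[OF E_sqint entireC_line[OF F], of "dec p"]
  have [measurable]: "Kr (dec p) \<in> borel_measurable borel" using Kr_sqint[of "dec p"] by (auto simp: sqint_mu_iff)
  have "(\<lambda>k. LINT z|mu. uu k z * Kr (dec p) z) \<longlonglongrightarrow> (LINT z|mu. F (enc z) * Kr (dec p) z)"
  proof (rule integral_dominated_convergence)
    show "integrable mu (\<lambda>z. cmod (F (enc z) * Kr (dec p) z))" using rep(1) by (rule integrable_norm)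
    show "AE z in mu. (\<lambda>k. uu k z * Kr (dec p) z) \<longlonglongrightarrow> F (enc z) * Kr (dec p) z"
    proof (rule AE_I2)
      fix z :: "'n vv \<times> 'n vv"
      obtain k0 where k0: "norm z \<le> real k0" using real_arch_simple by blast
      have "\<forall>\<^sub>F k in sequentially. uu k z * Kr (dec p) z = F (enc z) * Kr (dec p) z"
        by (intro eventually_sequentiallyI[of k0]) (use k0 in \<open>auto simp: indicator_def\<close>)
      then show "(\<lambda>k. uu k z * Kr (dec p) z) \<longlonglongrightarrow> F (enc z) * Kr (dec p) z" by (rule tendsto_eventually)
    qed
    show "AE z in mu. norm (uu k z * Kr (dec p) z) \<le> cmod (F (enc z) * Kr (dec p) z)" for k
      by (intro AE_I2) (auto simp: norm_mult indicator_def)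
  qed measurable
  from tendsto_mult_left[OF this, of "complex_of_real (1 / N)"] show ?thesis
    unfolding eq rep(2) using N_pos by simp
qed

end

section \<open>The heat kernel as a function of the frequency\<close>

lemma ft_shift:
  fixes K :: "real \<Rightarrow> complex"
  assumes [measurable]: "K \<in> borel_measurable borel"
  shows "ft (\<lambda>l. K (l + d)) \<xi> = exp (\<i> * complex_of_real (d * \<xi>)) * ft K \<xi>"
proof -
  have "ft (\<lambda>l. K (l + d)) \<xi> = (LINT l|lborel. exp (\<i> * complex_of_real (d * \<xi>)) * (exp (- (\<i> * complex_of_real (\<xi> \<bullet> (l + d)))) * K (l + d)))"
    unfolding ft_def
  proof (intro Bochner_Integration.integral_cong refl)
    fix l :: real
    have "exp (- (\<i> * complex_of_real (\<xi> \<bullet> l))) = exp (\<i> * complex_of_real (d * \<xi>)) * exp (- (\<i> * complex_of_real (\<xi> \<bullet> (l + d))))"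
      unfolding exp_add[symmetric] by (simp add: algebra_simps)
    then show "exp (- (\<i> * complex_of_real (\<xi> \<bullet> l))) * K (l + d) = exp (\<i> * complex_of_real (d * \<xi>)) * (exp (- (\<i> * complex_of_real (\<xi> \<bullet> (l + d)))) * K (l + d))"
      by simp
  qed
  also have "\<dots> = exp (\<i> * complex_of_real (d * \<xi>)) * (LINT l|lborel. exp (- (\<i> * complex_of_real (\<xi> \<bullet> (l + d)))) * K (l + d))"
    by (rule integral_mult_right_zero)
  also have "(LINT l|lborel. exp (- (\<i> * complex_of_real (\<xi> \<bullet> (l + d)))) * K (l + d)) = ft K \<xi>"
    unfolding ft_def by (rule integral_translate[of "\<lambda>l. exp (- (\<i> * complex_of_real (\<xi> \<bullet> l))) * K l" d]) simp
  finally show ?thesis .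
qed

lemma nn_integral_cauchy_density: "(\<integral>\<^sup>+x. ennreal (inverse (1 + x\<^sup>2)) \<partial>lborel) = ennreal pi"
proof -
  have i: "integrable lborel (\<lambda>x::real. inverse (1 + x\<^sup>2))"
    using integrable_inverse_1_plus_square by (simp add: set_integrable_def)
  have "(LINT x|lborel. inverse (1 + x\<^sup>2)) = pi"
    using LBINT_inverse_1_plus_square by (simp add: interval_lebesgue_integral_def set_lebesgue_integral_def)
  then show ?thesis by (subst nn_integral_eq_integral[OF i]) (auto simp: add_nonneg_nonneg)
qed

text \<open>The one-dimensional Sobolev argument with difference quotients in place of a derivative.
  Plancherel bounds the norm of (exp(i e \<xi>) - 1)/e times the transform, Fatou turns this into a
  bound for \<xi> times the transform, and Cauchy-Schwarz against 1/(1 + \<xi>^2) gives the square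
  root of (4 pi B^2) pi.\<close>

lemma ft_L1_bound:
  fixes K :: "real \<Rightarrow> complex"
  assumes Ki: "integrable lborel K" and K2: "sqint lborel K" and B: "B \<ge> 0"
    and b0: "(\<integral>\<^sup>+l. ennreal ((cmod (K l))\<^sup>2) \<partial>lborel) \<le> ennreal (B\<^sup>2)"
    and b1: "\<And>d. 0 < d \<Longrightarrow> d \<le> 1 \<Longrightarrow> (\<integral>\<^sup>+l. ennreal ((cmod (K (l + d) - K l))\<^sup>2) \<partial>lborel) \<le> ennreal ((d * B)\<^sup>2)"
  shows "(\<integral>\<^sup>+\<xi>. ennreal (cmod (ft K \<xi>)) \<partial>lborel) \<le> ennreal (2 * pi * B)"
proof -
  have [measurable]: "K \<in> borel_measurable borel" using Ki by auto
  define e where "e n = 1 / real (Suc n)" for n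
  have e: "e \<longlonglongrightarrow> 0" "\<And>n. e n > 0" "\<And>n. e n \<le> 1" unfolding e_def by (real_asymp, auto)
  define D where "D n \<xi> = (cmod ((exp (\<i> * complex_of_real (e n * \<xi>)) - 1) * ft K \<xi>))\<^sup>2 / (e n)\<^sup>2" for n \<xi>
  have [measurable]: "D n \<in> borel_measurable borel" for n unfolding D_def by measurable
  have Dn: "(\<integral>\<^sup>+\<xi>. ennreal (D n \<xi>) \<partial>lborel) \<le> ennreal (2 * pi * B\<^sup>2)" for n
  proof -
    have i: "integrable lborel (\<lambda>l. K (l + e n) - K l)" by (intro Bochner_Integration.integrable_diff integrable_translate Ki)
    have s: "sqint lborel (\<lambda>l. K (l + e n) - K l)" by (intro sqint_diff sqint_translate K2)
    have "ft (\<lambda>l. K (l + e n) - K l) \<xi> = (exp (\<i> * complex_of_real (e n * \<xi>)) - 1) * ft K \<xi>" for \<xi>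
    proof -
      have "ft (\<lambda>l. K (l + e n) - K l) \<xi> = ft (\<lambda>l. K (l + e n)) \<xi> - ft K \<xi>"
        unfolding ft_def right_diff_distrib
        by (rule Bochner_Integration.integral_diff[OF ft_integrand_integrable[OF integrable_translate[OF Ki]] ft_integrand_integrable[OF Ki]])
      then show ?thesis unfolding ft_shift[OF \<open>K \<in> borel_measurable borel\<close>] by (simp add: left_diff_distrib)
    qed
    then have "(\<integral>\<^sup>+\<xi>. ennreal ((cmod ((exp (\<i> * complex_of_real (e n * \<xi>)) - 1) * ft K \<xi>))\<^sup>2) \<partial>lborel) = ennreal (2 * pi) * (\<integral>\<^sup>+l. ennreal ((cmod (K (l + e n) - K l))\<^sup>2) \<partial>lborel)"
      using plancherel[OF i s] by simp
    also have "\<dots> \<le> ennreal (2 * pi) * ennreal ((e n * B)\<^sup>2)"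
      by (intro mult_left_mono b1 e) simp
    finally have 1: "(\<integral>\<^sup>+\<xi>. ennreal ((cmod ((exp (\<i> * complex_of_real (e n * \<xi>)) - 1) * ft K \<xi>))\<^sup>2) \<partial>lborel) \<le> ennreal (2 * pi * (e n * B)\<^sup>2)"
      by (simp add: ennreal_mult)
    have "(\<integral>\<^sup>+\<xi>. ennreal (D n \<xi>) \<partial>lborel) = (\<integral>\<^sup>+\<xi>. ennreal (1 / (e n)\<^sup>2) * ennreal ((cmod ((exp (\<i> * complex_of_real (e n * \<xi>)) - 1) * ft K \<xi>))\<^sup>2) \<partial>lborel)"
      unfolding D_def by (intro nn_integral_cong) (simp add: ennreal_mult[symmetric] del: of_real_mult)
    also have "\<dots> = ennreal (1 / (e n)\<^sup>2) * (\<integral>\<^sup>+\<xi>. ennreal ((cmod ((exp (\<i> * complex_of_real (e n * \<xi>)) - 1) * ft K \<xi>))\<^sup>2) \<partial>lborel)"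
      by (rule nn_integral_cmult) measurable
    also have "\<dots> \<le> ennreal (1 / (e n)\<^sup>2) * ennreal (2 * pi * (e n * B)\<^sup>2)" by (intro mult_left_mono 1) simp
    also have "\<dots> = ennreal (2 * pi * B\<^sup>2)" using e(2)[of n] by (simp add: ennreal_mult[symmetric] power_mult_distrib)
    finally show ?thesis .
  qed
  have lim: "(\<lambda>n. ennreal (D n \<xi>)) \<longlonglongrightarrow> ennreal (\<xi>\<^sup>2 * (cmod (ft K \<xi>))\<^sup>2)" for \<xi>
  proof -
    have "((\<lambda>x. exp (\<i> * complex_of_real \<xi> * x)) has_field_derivative (\<i> * complex_of_real \<xi>)) (at 0)"
      by (auto intro!: derivative_eq_intros)
    then have "((\<lambda>h. (exp (\<i> * complex_of_real \<xi> * h) - 1) / h) \<longlongrightarrow> \<i> * complex_of_real \<xi>) (at 0)"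
      by (simp add: has_field_derivative_iff)
    moreover have "filterlim (\<lambda>n. complex_of_real (e n)) (at 0) sequentially"
      using tendsto_of_real[OF e(1), where 'a=complex] e(2) by (auto simp: filterlim_at less_imp_neq[symmetric] intro!: always_eventually)
    ultimately have "(\<lambda>n. (exp (\<i> * complex_of_real \<xi> * complex_of_real (e n)) - 1) / complex_of_real (e n)) \<longlonglongrightarrow> \<i> * complex_of_real \<xi>"
      by (rule filterlim_compose)
    then have "(\<lambda>n. (cmod ((exp (\<i> * complex_of_real \<xi> * complex_of_real (e n)) - 1) / complex_of_real (e n) * ft K \<xi>))\<^sup>2) \<longlonglongrightarrow> (cmod (\<i> * complex_of_real \<xi> * ft K \<xi>))\<^sup>2"
      by (intro tendsto_intros)
    moreover have "(cmod ((exp (\<i> * complex_of_real \<xi> * complex_of_real (e n)) - 1) / complex_of_real (e n) * ft K \<xi>))\<^sup>2 = D n \<xi>" for n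
      unfolding D_def using e(2)[of n] by (simp add: norm_mult norm_divide power_mult_distrib power_divide mult_ac)
    ultimately show ?thesis by (intro tendsto_ennrealI) (simp add: norm_mult power_mult_distrib)
  qed
  have "(\<integral>\<^sup>+\<xi>. ennreal (\<xi>\<^sup>2 * (cmod (ft K \<xi>))\<^sup>2) \<partial>lborel) = (\<integral>\<^sup>+\<xi>. liminf (\<lambda>n. ennreal (D n \<xi>)) \<partial>lborel)"
    by (intro nn_integral_cong lim_imp_Liminf[symmetric] lim) simp
  also have "\<dots> \<le> liminf (\<lambda>n. \<integral>\<^sup>+\<xi>. ennreal (D n \<xi>) \<partial>lborel)"
    by (rule nn_integral_liminf) measurable
  also have "\<dots> \<le> liminf (\<lambda>n::nat. ennreal (2 * pi * B\<^sup>2))"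
    by (intro Liminf_mono always_eventually allI Dn)
  finally have x2: "(\<integral>\<^sup>+\<xi>. ennreal (\<xi>\<^sup>2 * (cmod (ft K \<xi>))\<^sup>2) \<partial>lborel) \<le> ennreal (2 * pi * B\<^sup>2)" by (simp add: Liminf_const)
  have x0: "(\<integral>\<^sup>+\<xi>. ennreal ((cmod (ft K \<xi>))\<^sup>2) \<partial>lborel) \<le> ennreal (2 * pi * B\<^sup>2)"
  proof -
    have "(\<integral>\<^sup>+\<xi>. ennreal ((cmod (ft K \<xi>))\<^sup>2) \<partial>lborel) = ennreal (2 * pi) * (\<integral>\<^sup>+l. ennreal ((cmod (K l))\<^sup>2) \<partial>lborel)"
      using plancherel[OF Ki K2] by simp
    also have "\<dots> \<le> ennreal (2 * pi) * ennreal (B\<^sup>2)" by (intro mult_left_mono b0) simp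
    finally show ?thesis by (simp add: ennreal_mult)
  qed
  have x12: "(\<integral>\<^sup>+\<xi>. (ennreal (sqrt (1 + \<xi>\<^sup>2) * cmod (ft K \<xi>)))\<^sup>2 \<partial>lborel) \<le> ennreal (4 * pi * B\<^sup>2)"
  proof -
    have "(\<integral>\<^sup>+\<xi>. (ennreal (sqrt (1 + \<xi>\<^sup>2) * cmod (ft K \<xi>)))\<^sup>2 \<partial>lborel) = (\<integral>\<^sup>+\<xi>. ennreal ((cmod (ft K \<xi>))\<^sup>2) + ennreal (\<xi>\<^sup>2 * (cmod (ft K \<xi>))\<^sup>2) \<partial>lborel)"
      by (intro nn_integral_cong) (simp add: ennreal_power power_mult_distrib ennreal_plus[symmetric] distrib_right del: ennreal_plus)
    also have "\<dots> = (\<integral>\<^sup>+\<xi>. ennreal ((cmod (ft K \<xi>))\<^sup>2) \<partial>lborel) + (\<integral>\<^sup>+\<xi>. ennreal (\<xi>\<^sup>2 * (cmod (ft K \<xi>))\<^sup>2) \<partial>lborel)"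
      by (rule nn_integral_add) measurable
    also have "\<dots> \<le> ennreal (2 * pi * B\<^sup>2) + ennreal (2 * pi * B\<^sup>2)" by (intro add_mono x0 x2)
    finally show ?thesis by (simp add: ennreal_plus[symmetric] mult.assoc del: ennreal_plus)
  qed
  have "(\<integral>\<^sup>+\<xi>. ennreal (sqrt (1 + \<xi>\<^sup>2) * cmod (ft K \<xi>)) * ennreal (inverse (sqrt (1 + \<xi>\<^sup>2))) \<partial>lborel)\<^sup>2
     \<le> (\<integral>\<^sup>+\<xi>. (ennreal (sqrt (1 + \<xi>\<^sup>2) * cmod (ft K \<xi>)))\<^sup>2 \<partial>lborel) * (\<integral>\<^sup>+\<xi>. (ennreal (inverse (sqrt (1 + \<xi>\<^sup>2))))\<^sup>2 \<partial>lborel)"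
    by (rule Cauchy_Schwarz_nn_integral) measurable
  also have "(\<integral>\<^sup>+\<xi>. (ennreal (inverse (sqrt (1 + \<xi>\<^sup>2))))\<^sup>2 \<partial>lborel) = ennreal pi"
    unfolding nn_integral_cauchy_density[symmetric]
    by (intro nn_integral_cong) (simp add: ennreal_power power_inverse)
  also have "(\<integral>\<^sup>+\<xi>. (ennreal (sqrt (1 + \<xi>\<^sup>2) * cmod (ft K \<xi>)))\<^sup>2 \<partial>lborel) * ennreal pi \<le> ennreal (4 * pi * B\<^sup>2) * ennreal pi"
    by (intro mult_right_mono x12) simp
  also have "\<dots> = (ennreal (2 * pi * B))\<^sup>2"
    using B by (simp add: ennreal_power ennreal_mult[symmetric] power_mult_distrib power2_eq_square mult_ac)
  finally have sq: "(\<integral>\<^sup>+\<xi>. ennreal (sqrt (1 + \<xi>\<^sup>2) * cmod (ft K \<xi>)) * ennreal (inverse (sqrt (1 + \<xi>\<^sup>2))) \<partial>lborel)\<^sup>2 \<le> (ennreal (2 * pi * B))\<^sup>2" .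
  have "(\<integral>\<^sup>+\<xi>. ennreal (sqrt (1 + \<xi>\<^sup>2) * cmod (ft K \<xi>)) * ennreal (inverse (sqrt (1 + \<xi>\<^sup>2))) \<partial>lborel) = (\<integral>\<^sup>+\<xi>. ennreal (cmod (ft K \<xi>)) \<partial>lborel)"
  proof (intro nn_integral_cong)
    fix \<xi> :: real
    have "1 + \<xi>\<^sup>2 > 0" by (simp add: add_pos_nonneg)
    then have "sqrt (1 + \<xi>\<^sup>2) \<noteq> 0" by simp
    then show "ennreal (sqrt (1 + \<xi>\<^sup>2) * cmod (ft K \<xi>)) * ennreal (inverse (sqrt (1 + \<xi>\<^sup>2))) = ennreal (cmod (ft K \<xi>))"
      by (simp add: ennreal_mult[symmetric] field_simps)
  qed
  with sq have "(\<integral>\<^sup>+\<xi>. ennreal (cmod (ft K \<xi>)) \<partial>lborel)\<^sup>2 \<le> (ennreal (2 * pi * B))\<^sup>2" by simp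
  then show ?thesis
    by (cases "\<integral>\<^sup>+\<xi>. ennreal (cmod (ft K \<xi>)) \<partial>lborel")
       (use B in \<open>auto simp: ennreal_power ennreal_le_iff top_unique intro!: ennreal_leI power2_le_imp_le\<close>)
qed

section \<open>Hyperbolic inequalities and the factor l / sinh (t l)\<close>

lemma sinh_ge_self: "x \<ge> 0 \<Longrightarrow> x \<le> sinh (x::real)"
proof -
  assume x: "x \<ge> 0"
  have "sinh 0 - 0 \<le> sinh x - x"
  proof (rule DERIV_nonneg_imp_nondecreasing[OF x])
    fix y :: real
    show "\<exists>D. ((\<lambda>x. sinh x - x) has_real_derivative D) (at y) \<and> 0 \<le> D"
      by (rule exI[of _ "cosh y - 1"]) (auto intro!: derivative_eq_intros cosh_real_ge_1)
  qed
  then show ?thesis by simp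
qed

lemma sinh_le_mult_cosh: "x \<ge> 0 \<Longrightarrow> sinh x \<le> x * cosh (x::real)"
proof -
  assume x: "x \<ge> 0"
  have "0 * cosh 0 - sinh 0 \<le> x * cosh x - sinh x"
  proof (rule DERIV_nonneg_imp_nondecreasing[OF x])
    fix y :: real assume "0 \<le> y"
    then show "\<exists>D. ((\<lambda>x. x * cosh x - sinh x) has_real_derivative D) (at y) \<and> 0 \<le> D"
      by (intro exI[of _ "y * sinh y"]) (auto intro!: derivative_eq_intros)
  qed
  then show ?thesis by simp
qed

text \<open>With \<open>exp (- x) = cosh x - sinh x\<close> this is
  \<open>x * exp (- x) \<le> sinh x\<close>. It is the upper half of 1 \<le> x coth x \<le> 1 +
  x.\<close>

lemma mult_cosh_le: "x \<ge> 0 \<Longrightarrow> x * cosh x \<le> (1 + x) * sinh (x::real)"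
proof -
  assume x: "x \<ge> 0"
  have "x * exp (- x) \<le> sinh x"
  proof -
    have "1 + 2 * x \<le> exp (2 * x)" by (rule exp_ge_add_one_self)
    then have "(1 + 2 * x) * exp (- x) \<le> exp (2 * x) * exp (- x)" by (intro mult_right_mono) auto
    also have "\<dots> = exp x" unfolding exp_add[symmetric] by simp
    finally show ?thesis by (simp add: sinh_field_def field_simps)
  qed
  moreover have "exp (- x) = cosh x - sinh x" by (simp add: cosh_minus_sinh)
  ultimately show ?thesis by (simp add: algebra_simps)
qed

text \<open>With \<open>exp (- x) = cosh x - sinh x\<close> this is
  \<open>sinh x * exp (- x) \<le> x\<close>. It bounds the derivative of x coth x by 1.\<close>

lemma sinh_cosh_minus_le: "x \<ge> 0 \<Longrightarrow> sinh x * cosh x - x \<le> (sinh (x::real))\<^sup>2"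
proof -
  assume x: "x \<ge> 0"
  have "sinh x * exp (- x) \<le> x"
  proof -
    have "1 + (- 2 * x) \<le> exp (- 2 * x)" by (rule exp_ge_add_one_self)
    moreover have "sinh x * exp (- x) = (1 - exp (- 2 * x)) / 2"
      by (simp add: sinh_field_def left_diff_distrib exp_add[symmetric])
    ultimately show ?thesis by simp
  qed
  moreover have "exp (- x) = cosh x - sinh x" by (simp add: cosh_minus_sinh)
  ultimately show ?thesis by (simp add: algebra_simps power2_eq_square)
qed

text \<open>The removable singularity at 0 is filled with its limit, so that the kernel becomes
  continuous in the frequency; plain division would give the value 0 there.\<close>

definition phi :: "real \<Rightarrow> real \<Rightarrow> real" where
  "phi t l = (if l = 0 then 1 / t else l / sinh (t * l))"

lemma phi_even: "phi t (- l) = phi t l"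
  by (simp add: phi_def)

context
  fixes t :: real
  assumes t: "t > 0"
begin

lemma phi_pos: "phi t l > 0"
  using t l_div_sinh_pos[OF t, of l] by (cases "l = 0") (simp_all add: phi_def)

lemma phi_abs: "phi t l = phi t \<bar>l\<bar>"
  using phi_even[of t l] by (cases "l \<ge> 0") auto

lemma phi_le: "phi t l \<le> 1 / t"
proof -
  have "phi t \<bar>l\<bar> \<le> 1 / t"
  proof (cases "l = 0")
    case False
    then have p: "t * \<bar>l\<bar> > 0" using t by simp
    then have s: "sinh (t * \<bar>l\<bar>) > 0" by simp
    have "t * \<bar>l\<bar> \<le> sinh (t * \<bar>l\<bar>)" using sinh_ge_self[of "t * \<bar>l\<bar>"] p by linarith
    then show ?thesis using False s t by (simp add: phi_def field_simps)
  qed (simp add: phi_def)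
  then show ?thesis using phi_abs by simp
qed

lemma phi_cosh_bounds: "\<bar>l\<bar> \<le> phi t l * cosh (t * l)" "phi t l * cosh (t * l) \<le> \<bar>l\<bar> + 1 / t"
proof -
  have c: "cosh (t * l) = cosh (t * \<bar>l\<bar>)" by (cases "l \<ge> 0") auto
  have "\<bar>l\<bar> \<le> phi t \<bar>l\<bar> * cosh (t * \<bar>l\<bar>) \<and> phi t \<bar>l\<bar> * cosh (t * \<bar>l\<bar>) \<le> \<bar>l\<bar> + 1 / t"
  proof (cases "l = 0")
    case False
    then have p: "t * \<bar>l\<bar> > 0" using t by simp
    then have s: "sinh (t * \<bar>l\<bar>) > 0" by simp
    have e: "phi t \<bar>l\<bar> * cosh (t * \<bar>l\<bar>) = \<bar>l\<bar> * cosh (t * \<bar>l\<bar>) / sinh (t * \<bar>l\<bar>)" using False by (simp add: phi_def)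
    have "\<bar>l\<bar> * sinh (t * \<bar>l\<bar>) \<le> \<bar>l\<bar> * cosh (t * \<bar>l\<bar>)"
      using sinh_less_cosh_real[of "t * \<bar>l\<bar>"] by (intro mult_left_mono) auto
    then have 1: "\<bar>l\<bar> \<le> \<bar>l\<bar> * cosh (t * \<bar>l\<bar>) / sinh (t * \<bar>l\<bar>)" using s by (simp add: pos_le_divide_eq)
    have "t * (\<bar>l\<bar> * cosh (t * \<bar>l\<bar>)) \<le> t * ((\<bar>l\<bar> + 1 / t) * sinh (t * \<bar>l\<bar>))"
      using mult_cosh_le[of "t * \<bar>l\<bar>"] p t by (simp add: algebra_simps)
    then have "\<bar>l\<bar> * cosh (t * \<bar>l\<bar>) \<le> (\<bar>l\<bar> + 1 / t) * sinh (t * \<bar>l\<bar>)" using t by (simp only: mult_le_cancel_left_pos)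
    then have "\<bar>l\<bar> * cosh (t * \<bar>l\<bar>) / sinh (t * \<bar>l\<bar>) \<le> \<bar>l\<bar> + 1 / t" using s by (simp add: pos_divide_le_eq)
    with 1 show ?thesis unfolding e by simp
  qed (use t in \<open>simp add: phi_def\<close>)
  then show "\<bar>l\<bar> \<le> phi t l * cosh (t * l)" "phi t l * cosh (t * l) \<le> \<bar>l\<bar> + 1 / t"
    unfolding c phi_abs[of l] by auto
qed

lemma phi_cont: "continuous_on UNIV (phi t)"
  unfolding continuous_on_eq_continuous_at[OF open_UNIV]
proof
  fix l :: real
  show "isCont (phi t) l"
  proof (cases "l = 0")
    case True
    have "((\<lambda>l. sinh (t * l)) has_real_derivative t) (at 0)" by (auto intro!: derivative_eq_intros)
    then have "((\<lambda>h. sinh (t * h) / h) \<longlongrightarrow> t) (at 0)" by (simp add: has_field_derivative_iff)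
    then have "((\<lambda>h. inverse (sinh (t * h) / h)) \<longlongrightarrow> inverse t) (at 0)" using t by (intro tendsto_inverse) auto
    then have "((\<lambda>h. phi t h) \<longlongrightarrow> phi t 0) (at 0)"
      by (rule Lim_transform_eventually[OF tendsto_eq_rhs]) (auto simp: phi_def eventually_at_filter inverse_eq_divide)
    then show ?thesis using True by (simp add: isCont_def)
  next
    case False
    have "isCont (\<lambda>l. l / sinh (t * l)) l" using False t by (intro continuous_intros) auto
    moreover have "\<forall>\<^sub>F x in nhds l. phi t x = x / sinh (t * x)"
      using False by (intro eventually_mono[OF t1_space_nhds[of l 0]]) (auto simp: phi_def)
    ultimately show ?thesis using isCont_cong[of "phi t" "\<lambda>l. l / sinh (t * l)" l] by simp
  qed
qed

lemma phi_eventually: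
  assumes l: "l \<noteq> 0"
  shows "\<forall>\<^sub>F x in nhds l. phi t x = x / sinh (t * x)" "\<forall>\<^sub>F x in nhds l. phi t x * cosh (t * x) = x * cosh (t * x) / sinh (t * x)"
  using eventually_mono[OF t1_space_nhds[OF l]] by (auto simp: phi_def elim!: eventually_mono)

text \<open>The logarithmic derivative is 1/l - t coth(t l), and 1 \<le> x coth x \<le> 1 + x at x =
  t |l| bounds it by \<open>t\<close>.\<close>

lemma phi_deriv:
  assumes l: "l \<noteq> 0"
  obtains eta where "(phi t has_real_derivative phi t l * eta) (at l)" "\<bar>eta\<bar> \<le> t"
proof -
  have s: "sinh (t * l) \<noteq> 0" using l t by simp
  define eta where "eta = 1 / l - t * (cosh (t * l) / sinh (t * l))"
  have "((\<lambda>l. l / sinh (t * l)) has_real_derivative (l / sinh (t * l)) * eta) (at l)"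
    using s l by (auto intro!: derivative_eq_intros simp: eta_def field_simps power2_eq_square)
  then have d: "(phi t has_real_derivative phi t l * eta) (at l)"
  proof -
    have "phi t l = l / sinh (t * l)" using l by (simp add: phi_def)
    then show ?thesis using DERIV_cong_ev[OF refl phi_eventually(1)[OF l] refl] \<open>((\<lambda>l. l / sinh (t * l)) has_real_derivative (l / sinh (t * l)) * eta) (at l)\<close> by simp
  qed
  have "\<bar>l\<bar> * \<bar>eta\<bar> \<le> \<bar>l\<bar> * t"
  proof -
    let ?x = "t * \<bar>l\<bar>"
    have p: "?x > 0" using l t by simp
    then have sp: "sinh ?x > 0" by simp
    have q: "l * (cosh (t * l) / sinh (t * l)) = \<bar>l\<bar> * cosh ?x / sinh ?x" by (cases "l > 0") auto
    have "\<bar>l\<bar> * \<bar>eta\<bar> = \<bar>1 - t * (l * (cosh (t * l) / sinh (t * l)))\<bar>" unfolding abs_mult[symmetric] eta_def using l by (simp add: right_diff_distrib mult_ac)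
    also have "\<dots> = \<bar>1 - ?x * cosh ?x / sinh ?x\<bar>" unfolding q by (simp add: mult.assoc)
    also have "\<dots> \<le> ?x"
    proof -
      have "1 \<le> ?x * cosh ?x / sinh ?x" using sinh_le_mult_cosh[of ?x] p sp by (simp add: pos_le_divide_eq)
      moreover have "?x * cosh ?x / sinh ?x \<le> 1 + ?x" using mult_cosh_le[of ?x] p sp by (simp add: pos_divide_le_eq)
      ultimately show ?thesis by simp
    qed
    finally show ?thesis by (simp add: mult.commute)
  qed
  then have "\<bar>eta\<bar> \<le> t" using l by (rule_tac mult_left_le_imp_le[of "\<bar>l\<bar>"]) auto
  then show ?thesis using that d by blast
qed

text \<open>The derivative is (sinh x cosh x - x) / (sinh x)^2 at x = t l. For positive x the
  numerator lies between 0 and (sinh x)^2, and for negative x only its sign changes.\<close>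

lemma phi_cosh_deriv:
  assumes l: "l \<noteq> 0"
  obtains D where "((\<lambda>l. phi t l * cosh (t * l)) has_real_derivative D) (at l)" "\<bar>D\<bar> \<le> 1"
proof -
  have s: "sinh (t * l) \<noteq> 0" using l t by simp
  define D where "D = (sinh (t * l) * cosh (t * l) - t * l) / (sinh (t * l))\<^sup>2"
  have "((\<lambda>l. l * cosh (t * l) / sinh (t * l)) has_real_derivative D) (at l)"
  proof -
    have "((\<lambda>l. l * cosh (t * l) / sinh (t * l)) has_real_derivative
      ((cosh (t * l) + l * (t * sinh (t * l))) * sinh (t * l) - l * cosh (t * l) * (t * cosh (t * l))) / (sinh (t * l))\<^sup>2) (at l)"
      using s l by (auto intro!: derivative_eq_intros simp: power2_eq_square mult_ac)
    moreover have "(cosh (t * l) + l * (t * sinh (t * l))) * sinh (t * l) - l * cosh (t * l) * (t * cosh (t * l)) = sinh (t * l) * cosh (t * l) - t * l * ((cosh (t * l))\<^sup>2 - (sinh (t * l))\<^sup>2)"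
      by (simp add: algebra_simps power2_eq_square)
    ultimately show ?thesis unfolding D_def by (simp add: hyperbolic_pythagoras)
  qed
  then have d: "((\<lambda>l. phi t l * cosh (t * l)) has_real_derivative D) (at l)"
    using DERIV_cong_ev[OF refl phi_eventually(2)[OF l] refl] by simp
  have "\<bar>D\<bar> \<le> 1"
  proof -
    let ?x = "t * \<bar>l\<bar>"
    have p: "?x > 0" using l t by simp
    then have sp: "sinh ?x > 0" by simp
    have "\<bar>D\<bar> = \<bar>sinh ?x * cosh ?x - ?x\<bar> / (sinh ?x)\<^sup>2"
      unfolding D_def abs_divide by (cases "l > 0") (auto simp: abs_minus_commute)
    also have "\<bar>sinh ?x * cosh ?x - ?x\<bar> \<le> (sinh ?x)\<^sup>2"
    proof -
      have "?x * 1 \<le> sinh ?x * cosh ?x" using sinh_ge_self[of ?x] p by (intro mult_mono cosh_real_ge_1) auto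
      then show ?thesis using sinh_cosh_minus_le[of ?x] p by simp
    qed
    finally show ?thesis using sp by (auto simp: divide_right_mono split: if_splits)
  qed
  then show ?thesis using that d by blast
qed

end

section \<open>Estimates for the kernel in the frequency variable\<close>

definition qA :: "'n::finite cpair \<Rightarrow> 'n vv \<Rightarrow> complex" where
  "qA p s = cdot (vof_real (snd s)) (fst p) - cdot (vof_real (fst s)) (snd p)"

definition qq :: "'n::finite cpair \<Rightarrow> 'n vv \<Rightarrow> complex" where
  "qq p s = cdot (fst p - vof_real (fst s)) (fst p - vof_real (fst s)) + cdot (snd p - vof_real (snd s)) (snd p - vof_real (snd s))"

text \<open>The damped kernel at frequency \<open>l\<close>, extended continuously to
  \<open>l = 0\<close>. \<open>qA\<close> and \<open>qq\<close> carry its dependence on the points,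
  and \<open>phi\<close> its dependence on the frequency. Its Fourier transform in \<open>l\<close>
  is \<open>2 * pi\<close> times the heat kernel along the central direction.\<close>

definition KK :: "real \<Rightarrow> 'n::finite cpair \<Rightarrow> 'n vv \<Rightarrow> real \<Rightarrow> complex" where
  "KK t p s l = complex_of_real (inverse ((4 * pi) ^ CARD('n)) * phi t l ^ CARD('n)) *
     exp (complex_of_real (- t * l\<^sup>2) + \<i> * complex_of_real (l / 2) * qA p s - complex_of_real (phi t l * cosh (t * l) / 4) * qq p s)"

lemma KK_eq_hk:
  assumes "l \<noteq> 0"
  shows "KK t p s l = complex_of_real (exp (- t * l\<^sup>2)) * hk t l p s"
proof -
  have "phi t l * cosh (t * l) / 4 = l / 4 * coth (t * l)" using assms by (simp add: phi_def coth_def)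
  moreover have "phi t l = l / sinh (t * l)" using assms by (simp add: phi_def)
  ultimately show ?thesis
    unfolding KK_def hk_def pref_def qA_def[symmetric] qq_def[symmetric] exp_of_real[symmetric]
    by (simp only: exp_add add_diff_eq[symmetric] mult_ac)
qed

lemma KK_continuous: "t > 0 \<Longrightarrow> continuous_on UNIV (KK t p s)"
  unfolding KK_def by (intro continuous_intros continuous_on_subset[OF phi_cont]) auto

lemma norm_J0: "norm (J0 s) = norm s"
  by (simp add: J0_def norm_prod_def add.commute)

lemma qA_Im: "Im (qA p s) = J0 s \<bullet> snd (dec p)"
  by (simp add: qA_def cdot_eq J0_def dec_def inner_prod_def)

lemma qq_Re: "Re (qq p s) = (norm (fst (dec p) - s))\<^sup>2 - (norm (snd (dec p)))\<^sup>2"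
  unfolding power2_norm_eq_inner by (simp add: qq_def cdot_eq dec_def inner_prod_def)

lemma qA_bound: "cmod (qA p (s :: 'n::finite vv)) \<le> 2 * real CARD('n) * (norm s * norm p)"
proof -
  have c: "cmod (cdot (vof_real x) z) \<le> real CARD('n) * (norm s * norm p)" if "norm x \<le> norm s" "norm z \<le> norm p"
    for x :: "real^'n" and z :: "complex^'n"
  proof -
    have "cmod (cdot (vof_real x) z) \<le> real CARD('n) * (norm x * norm z)"
      using norm_cdot_le[of "vof_real x" z] by (simp add: norm_vof_real)
    also have "\<dots> \<le> real CARD('n) * (norm s * norm p)" by (intro mult_left_mono mult_mono that) auto
    finally show ?thesis .
  qed
  have "cmod (qA p s) \<le> cmod (cdot (vof_real (snd s)) (fst p)) + cmod (cdot (vof_real (fst s)) (snd p))"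
    unfolding qA_def by (rule norm_triangle_ineq4)
  also have "\<dots> \<le> real CARD('n) * (norm s * norm p) + real CARD('n) * (norm s * norm p)"
    using norm_fst_le[of "fst s" "snd s"] norm_snd_le[of "snd s" "fst s"] norm_fst_le[of "fst p" "snd p"] norm_snd_le[of "snd p" "fst p"]
    by (intro add_mono c) auto
  finally show ?thesis by (simp add: algebra_simps)
qed

lemma qq_bound: "cmod (qq p (s :: 'n::finite vv)) \<le> 2 * real CARD('n) * (norm p + norm s)\<^sup>2"
proof -
  have c: "cmod (cdot (z - vof_real x) (z - vof_real x)) \<le> real CARD('n) * (norm p + norm s)\<^sup>2" if "norm x \<le> norm s" "norm z \<le> norm p"
    for x :: "real^'n" and z :: "complex^'n"
  proof -
    have "norm (z - vof_real x) \<le> norm p + norm s"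
      using norm_triangle_ineq4[of z "vof_real x"] that by (simp add: norm_vof_real)
    then have "norm (z - vof_real x) * norm (z - vof_real x) \<le> (norm p + norm s)\<^sup>2"
      unfolding power2_eq_square by (intro mult_mono) auto
    then have "real CARD('n) * (norm (z - vof_real x) * norm (z - vof_real x)) \<le> real CARD('n) * (norm p + norm s)\<^sup>2"
      by (intro mult_left_mono) auto
    then show ?thesis using norm_cdot_le[of "z - vof_real x" "z - vof_real x"] by linarith
  qed
  have "cmod (qq p s) \<le> cmod (cdot (fst p - vof_real (fst s)) (fst p - vof_real (fst s))) + cmod (cdot (snd p - vof_real (snd s)) (snd p - vof_real (snd s)))"
    unfolding qq_def by (rule norm_triangle_ineq)
  also have "\<dots> \<le> real CARD('n) * (norm p + norm s)\<^sup>2 + real CARD('n) * (norm p + norm s)\<^sup>2"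
    using norm_fst_le[of "fst s" "snd s"] norm_snd_le[of "snd s" "fst s"] norm_fst_le[of "fst p" "snd p"] norm_snd_le[of "snd p" "fst p"]
    by (intro add_mono c) auto
  finally show ?thesis by (simp add: algebra_simps)
qed

text \<open>The lower bound \<open>\<bar>l\<bar> \<le> l coth (t l)\<close> makes the quadratic term dominate the linear one in \<open>s\<close>,
  uniformly in \<open>l\<close>.\<close>
lemma KK_norm_bound:
  fixes p :: "'n::finite cpair"
  assumes t: "t > 0"
  obtains A C where "\<And>s l. cmod (KK t p s l) \<le> A * exp (- t * l\<^sup>2 + C * \<bar>l\<bar>)" "A \<ge> 0" "C \<ge> 0"
proof -
  define P where "P = norm (fst (dec p))"
  define Q where "Q = norm (snd (dec p))"
  define n where "n = CARD('n)"
  have ex: "- t * l\<^sup>2 - (l / 2) * Im (qA p s) - (phi t l * cosh (t * l) / 4) * Re (qq p s) \<le> - t * l\<^sup>2 + (Q\<^sup>2 / 2 + P * Q / 2) * \<bar>l\<bar> + Q\<^sup>2 / (4 * t)" for s l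
  proof -
    let ?d = "norm (fst (dec p) - s)"
    let ?c = "phi t l * cosh (t * l)"
    have s: "norm s \<le> ?d + P" unfolding P_def using norm_triangle_sub[of s "fst (dec p)"] by (simp add: norm_minus_commute)
    have "\<bar>Im (qA p s)\<bar> \<le> norm s * Q"
      unfolding qA_Im Q_def using Cauchy_Schwarz_ineq2[of "J0 s" "snd (dec p)"] by (simp add: norm_J0)
    also have "\<dots> \<le> (?d + P) * Q" by (intro mult_right_mono s) (simp add: Q_def)
    also have "\<dots> \<le> (?d\<^sup>2 + Q\<^sup>2) / 2 + P * Q" using sum_squares_bound[of ?d Q] by (simp add: algebra_simps)
    finally have "\<bar>l\<bar> / 2 * \<bar>Im (qA p s)\<bar> \<le> \<bar>l\<bar> / 2 * ((?d\<^sup>2 + Q\<^sup>2) / 2 + P * Q)" by (intro mult_left_mono) auto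
    moreover have "- (l / 2) * Im (qA p s) \<le> \<bar>l\<bar> / 2 * \<bar>Im (qA p s)\<bar>"
      using abs_ge_self[of "- (l / 2) * Im (qA p s)"] by (simp add: abs_mult)
    ultimately have 1: "- (l / 2) * Im (qA p s) \<le> \<bar>l\<bar> / 2 * ((?d\<^sup>2 + Q\<^sup>2) / 2 + P * Q)" by linarith
    have "\<bar>l\<bar> * ?d\<^sup>2 \<le> ?c * ?d\<^sup>2" by (intro mult_right_mono phi_cosh_bounds[OF t]) auto
    moreover have "?c * Q\<^sup>2 \<le> (\<bar>l\<bar> + 1 / t) * Q\<^sup>2" by (intro mult_right_mono phi_cosh_bounds[OF t]) auto
    ultimately have 2: "- (?c / 4) * Re (qq p s) \<le> - (\<bar>l\<bar> / 4) * ?d\<^sup>2 + (\<bar>l\<bar> + 1 / t) / 4 * Q\<^sup>2"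
      unfolding qq_Re Q_def[symmetric] by (simp add: algebra_simps)
    \<comment> \<open>The squared distance enters with \<open>\<bar>l\<bar> / 4\<close> from the
      phase and with the opposite coefficient from the Gaussian; it cancels exactly, so nothing
      depending on \<open>s\<close> is left.\<close>
    have "\<bar>l\<bar> / 2 * ((?d\<^sup>2 + Q\<^sup>2) / 2 + P * Q) + (- (\<bar>l\<bar> / 4) * ?d\<^sup>2 + (\<bar>l\<bar> + 1 / t) / 4 * Q\<^sup>2) = (Q\<^sup>2 / 2 + P * Q / 2) * \<bar>l\<bar> + Q\<^sup>2 / (4 * t)"
      by (simp add: field_simps)
    then show ?thesis using 1 2 by linarith
  qed
  show ?thesis
  proof (rule that[of "inverse ((4 * pi) ^ n) * (1 / t) ^ n * exp (Q\<^sup>2 / (4 * t))" "Q\<^sup>2 / 2 + P * Q / 2"])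
    fix s l
    have "cmod (KK t p s l) = inverse ((4 * pi) ^ n) * phi t l ^ n * exp (- t * l\<^sup>2 - (l / 2) * Im (qA p s) - (phi t l * cosh (t * l) / 4) * Re (qq p s))"
    proof -
      have nn: "0 \<le> inverse ((4 * pi) ^ n) * phi t l ^ n" using phi_pos[OF t, of l] by simp
      have "Re (complex_of_real (- t * l\<^sup>2) + \<i> * complex_of_real (l / 2) * qA p s - complex_of_real (phi t l * cosh (t * l) / 4) * qq p s)
        = - t * l\<^sup>2 - (l / 2) * Im (qA p s) - (phi t l * cosh (t * l) / 4) * Re (qq p s)" by simp
      then show ?thesis
        unfolding KK_def n_def[symmetric]
        unfolding norm_mult[of "complex_of_real (inverse ((4 * pi) ^ n) * phi t l ^ n)"] norm_exp_eq_Re norm_of_real abs_of_nonneg[OF nn]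
        by presburger
    qed
    also have "\<dots> \<le> inverse ((4 * pi) ^ n) * (1 / t) ^ n * exp (- t * l\<^sup>2 + (Q\<^sup>2 / 2 + P * Q / 2) * \<bar>l\<bar> + Q\<^sup>2 / (4 * t))"
      using ex[of l s] phi_le[OF t, of l] phi_pos[OF t, of l] t
      by (intro mult_mono power_mono) (auto simp: less_imp_le)
    also have "\<dots> = inverse ((4 * pi) ^ n) * (1 / t) ^ n * exp (Q\<^sup>2 / (4 * t)) * exp (- t * l\<^sup>2 + (Q\<^sup>2 / 2 + P * Q / 2) * \<bar>l\<bar>)"
      by (simp only: exp_add mult_ac)
    finally show "cmod (KK t p s l) \<le> inverse ((4 * pi) ^ n) * (1 / t) ^ n * exp (Q\<^sup>2 / (4 * t)) * exp (- t * l\<^sup>2 + (Q\<^sup>2 / 2 + P * Q / 2) * \<bar>l\<bar>)" .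
  qed (use t in \<open>auto simp: P_def Q_def\<close>)
qed

lemma exp_quadratic_le:
  fixes t c l :: real
  assumes "t > 0"
  shows "exp (- t * l\<^sup>2 + c * \<bar>l\<bar>) \<le> exp (c\<^sup>2 / (2 * t)) * exp (- (t / 2) * l\<^sup>2)"
proof -
  have "0 \<le> (t * \<bar>l\<bar> - c)\<^sup>2" by simp
  then have "2 * t * (c * \<bar>l\<bar>) \<le> c\<^sup>2 + t\<^sup>2 * l\<^sup>2" by (simp add: power2_diff power_mult_distrib mult_ac)
  then have "c * \<bar>l\<bar> \<le> c\<^sup>2 / (2 * t) + t / 2 * l\<^sup>2" using assms by (simp add: field_simps power2_eq_square)
  then show ?thesis unfolding exp_add[symmetric] by simp
qed

lemma KK_deriv:
  fixes p :: "'n::finite cpair"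
  assumes t: "t > 0" and l: "l \<noteq> 0"
  obtains D where "(KK t p s has_vector_derivative D) (at l)"
    "cmod D \<le> cmod (KK t p s l) * (real CARD('n) * t + 2 * t * \<bar>l\<bar> + cmod (qA p s) / 2 + cmod (qq p s) / 4)"
proof -
  obtain eta where eta: "(phi t has_real_derivative phi t l * eta) (at l)" "\<bar>eta\<bar> \<le> t" using phi_deriv[OF t l] .
  obtain X where X: "((\<lambda>l. phi t l * cosh (t * l)) has_real_derivative X) (at l)" "\<bar>X\<bar> \<le> 1" using phi_cosh_deriv[OF t l] .
  define n where "n = CARD('n)"
  define c0 where "c0 = inverse ((4 * pi) ^ n)"
  have n1: "n = Suc (n - 1)" unfolding n_def by simp
  have d1: "((\<lambda>l. c0 * phi t l ^ n) has_real_derivative (c0 * phi t l ^ n) * (real n * eta)) (at l)"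
  proof -
    have "phi t l * (phi t l ^ (n - Suc 0)) = phi t l ^ n" using n1 by (metis One_nat_def power_Suc)
    then show ?thesis by (auto intro!: derivative_eq_intros eta(1) simp: mult_ac)
  qed
  define F where "F = complex_of_real (real n * eta - 2 * t * l) + \<i> / 2 * qA p s - complex_of_real (X / 4) * qq p s"
  have e: "((\<lambda>l. complex_of_real (- t * l\<^sup>2) + \<i> * complex_of_real (l / 2) * qA p s - complex_of_real (phi t l * cosh (t * l) / 4) * qq p s)
     has_vector_derivative (complex_of_real (- 2 * t * l) + \<i> / 2 * qA p s - complex_of_real (X / 4) * qq p s)) (at l)"
  proof -
    have a: "((\<lambda>l. complex_of_real (- t * l\<^sup>2)) has_vector_derivative complex_of_real (- 2 * t * l)) (at l)"
      by (rule has_vector_derivative_of_real) (auto intro!: derivative_eq_intros)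
    have b: "((\<lambda>l. complex_of_real (l / 2)) has_vector_derivative complex_of_real (1 / 2)) (at l)"
      by (rule has_vector_derivative_of_real) (auto intro!: derivative_eq_intros)
    have c: "((\<lambda>l. complex_of_real (phi t l * cosh (t * l) / 4)) has_vector_derivative complex_of_real (X / 4)) (at l)"
      by (rule has_vector_derivative_of_real) (rule DERIV_cdivide[OF X(1)])
    have b': "((\<lambda>l. \<i> * complex_of_real (l / 2) * qA p s) has_vector_derivative \<i> * complex_of_real (1 / 2) * qA p s) (at l)"
      by (rule has_vector_derivative_mult_left[OF has_vector_derivative_mult_right[OF b]])
    have c': "((\<lambda>l. complex_of_real (phi t l * cosh (t * l) / 4) * qq p s) has_vector_derivative complex_of_real (X / 4) * qq p s) (at l)"
      by (rule has_vector_derivative_mult_left[OF c])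
    from has_vector_derivative_diff[OF has_vector_derivative_add[OF a b'] c'] show ?thesis by simp
  qed
  define E where "E l = exp (complex_of_real (- t * l\<^sup>2) + \<i> * complex_of_real (l / 2) * qA p s - complex_of_real (phi t l * cosh (t * l) / 4) * qq p s)" for l
  have dE: "(E has_vector_derivative (complex_of_real (- 2 * t * l) + \<i> / 2 * qA p s - complex_of_real (X / 4) * qq p s) * E l) (at l)"
    using field_vector_diff_chain_at[OF e DERIV_exp] unfolding E_def comp_def by simp
  have dc: "((\<lambda>l. complex_of_real (c0 * phi t l ^ n)) has_vector_derivative complex_of_real ((c0 * phi t l ^ n) * (real n * eta))) (at l)"
    by (rule has_vector_derivative_of_real[OF d1])
  have KKe: "KK t p s = (\<lambda>l. complex_of_real (c0 * phi t l ^ n) * E l)"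
    unfolding KK_def E_def c0_def n_def by simp
  have "(KK t p s has_vector_derivative KK t p s l * F) (at l)"
    unfolding KKe using has_vector_derivative_mult[OF dc dE]
    by (rule has_vector_derivative_eq_rhs) (simp add: F_def algebra_simps)
  moreover have "cmod (KK t p s l * F) \<le> cmod (KK t p s l) * (real n * t + 2 * t * \<bar>l\<bar> + cmod (qA p s) / 2 + cmod (qq p s) / 4)"
    unfolding norm_mult
  proof (rule mult_left_mono)
    have "cmod F \<le> cmod (complex_of_real (real n * eta - 2 * t * l)) + cmod (\<i> / 2 * qA p s) + cmod (complex_of_real (X / 4) * qq p s)"
      unfolding F_def by (rule order_trans[OF norm_triangle_ineq4]) (intro add_right_mono norm_triangle_ineq)
    moreover have "cmod (complex_of_real (real n * eta - 2 * t * l)) \<le> real n * t + 2 * t * \<bar>l\<bar>"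
    proof -
      have "\<bar>real n * eta - 2 * t * l\<bar> \<le> \<bar>real n * eta\<bar> + \<bar>2 * t * l\<bar>" by (rule abs_triangle_ineq4)
      also have "\<bar>real n * eta\<bar> \<le> real n * t" unfolding abs_mult using eta(2) by (simp add: mult_left_mono)
      finally show ?thesis unfolding norm_of_real using t by (simp add: abs_mult)
    qed
    moreover have "cmod (complex_of_real (X / 4) * qq p s) \<le> cmod (qq p s) / 4"
      using mult_right_mono[OF X(2), of "cmod (qq p s)"] by (simp add: norm_mult)
    moreover have "cmod (\<i> / 2 * qA p s) = cmod (qA p s) / 2" by (simp add: norm_mult norm_divide)
    ultimately show "cmod F \<le> real n * t + 2 * t * \<bar>l\<bar> + cmod (qA p s) / 2 + cmod (qq p s) / 4" by linarith
  qed simp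
  ultimately show ?thesis using that unfolding n_def by blast
qed

text \<open>The Gaussian in \<open>l\<close> is split: half of it survives, the other half absorbs
  the exponential growth in \<open>\<bar>l\<bar>\<close> and the linear factor of the logarithmic
  derivative. The quadratic growth in \<open>s\<close> comes from \<open>qq\<close>.\<close>

lemma KK_bounds:
  fixes p :: "'n::finite cpair"
  assumes t: "t > 0"
  obtains C where "C \<ge> 0" "\<And>s l. cmod (KK t p s l) \<le> C * exp (- (t / 2) * l\<^sup>2)"
    "\<And>s l. l \<noteq> 0 \<Longrightarrow> \<exists>D. (KK t p s has_vector_derivative D) (at l) \<and> cmod D \<le> C * (1 + norm s)\<^sup>2 * exp (- (t / 2) * l\<^sup>2)"
proof -
  obtain A c where Ac: "\<And>s l. cmod (KK t p s l) \<le> A * exp (- t * l\<^sup>2 + c * \<bar>l\<bar>)" "A \<ge> 0" "c \<ge> 0"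
    using KK_norm_bound[OF t] by blast
  define n where "n = real CARD('n)"
  define F where "F = n * t + 2 * t + n * norm p + n / 2 * (1 + norm p)\<^sup>2"
  have n0: "n \<ge> 0" by (simp add: n_def)
  have F0: "F \<ge> 0" using t n0 by (simp add: F_def)
  \<comment> \<open>The exponent \<open>c + 1\<close> in the second summand accounts for
    \<open>1 + \<bar>l\<bar> \<le> exp \<bar>l\<bar>\<close> in the derivative bound.\<close>
  define C where "C = A * exp (c\<^sup>2 / (2 * t)) + A * F * exp ((c + 1)\<^sup>2 / (2 * t))"
  show ?thesis
  proof (rule that[of C])
    show "C \<ge> 0" unfolding C_def using Ac F0 by simp
    fix s :: "'n vv" and l :: real
    have "cmod (KK t p s l) \<le> A * (exp (c\<^sup>2 / (2 * t)) * exp (- (t / 2) * l\<^sup>2))"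
      using Ac(1)[of s l] mult_left_mono[OF exp_quadratic_le[OF t, of l c] Ac(2)] by linarith
    also have "\<dots> \<le> C * exp (- (t / 2) * l\<^sup>2)"
      unfolding C_def mult.assoc[symmetric] using Ac F0 by (intro mult_right_mono) auto
    finally show "cmod (KK t p s l) \<le> C * exp (- (t / 2) * l\<^sup>2)" .
    assume l: "l \<noteq> 0"
    obtain D where D: "(KK t p s has_vector_derivative D) (at l)"
      "cmod D \<le> cmod (KK t p s l) * (n * t + 2 * t * \<bar>l\<bar> + cmod (qA p s) / 2 + cmod (qq p s) / 4)"
      using KK_deriv[OF t l, of p s] unfolding n_def by blast
    let ?S = "(1 + norm s)\<^sup>2"
    have S1: "1 \<le> ?S" "norm s \<le> ?S" by (auto simp: power2_eq_square algebra_simps)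
    have "n * t + 2 * t * \<bar>l\<bar> + cmod (qA p s) / 2 + cmod (qq p s) / 4 \<le> F * ((1 + \<bar>l\<bar>) * ?S)"
    proof -
      have LS: "?S \<le> (1 + \<bar>l\<bar>) * ?S" "\<bar>l\<bar> \<le> (1 + \<bar>l\<bar>) * ?S"
        using mult_right_mono[of 1 "1 + \<bar>l\<bar>" ?S] mult_mono[of "\<bar>l\<bar>" "1 + \<bar>l\<bar>" 1 ?S] S1 by auto
      have "1 \<le> (1 + \<bar>l\<bar>) * ?S" using S1(1) LS(1) by linarith
      from mult_left_mono[OF this, of "n * t"] have "n * t \<le> n * t * ((1 + \<bar>l\<bar>) * ?S)" using n0 t by simp
      moreover have "2 * t * \<bar>l\<bar> \<le> 2 * t * ((1 + \<bar>l\<bar>) * ?S)" using LS(2) t by (intro mult_left_mono) auto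
      moreover have "cmod (qA p s) / 2 \<le> n * norm p * ((1 + \<bar>l\<bar>) * ?S)"
      proof -
        have "cmod (qA p s) / 2 \<le> n * norm p * norm s" using qA_bound[of p s] by (simp add: n_def mult_ac)
        also have "\<dots> \<le> n * norm p * ((1 + \<bar>l\<bar>) * ?S)" using S1(2) LS(1) n0 by (intro mult_left_mono) auto
        finally show ?thesis .
      qed
      moreover have "cmod (qq p s) / 4 \<le> n / 2 * (1 + norm p)\<^sup>2 * ((1 + \<bar>l\<bar>) * ?S)"
      proof -
        have "norm p + norm s \<le> (1 + norm p) * (1 + norm s)" by (simp add: algebra_simps)
        then have "(norm p + norm s)\<^sup>2 \<le> ((1 + norm p) * (1 + norm s))\<^sup>2" by (intro power_mono) auto
        then have "n / 2 * (norm p + norm s)\<^sup>2 \<le> n / 2 * ((1 + norm p)\<^sup>2 * ?S)" using n0 by (intro mult_left_mono) (auto simp: power_mult_distrib)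
        moreover have "n / 2 * (1 + norm p)\<^sup>2 * ?S \<le> n / 2 * (1 + norm p)\<^sup>2 * ((1 + \<bar>l\<bar>) * ?S)" using LS(1) n0 by (intro mult_left_mono) auto
        moreover have "cmod (qq p s) / 4 \<le> n / 2 * (norm p + norm s)\<^sup>2" using qq_bound[of p s] by (simp add: n_def)
        ultimately show ?thesis by (simp add: mult.assoc)
      qed
      ultimately show ?thesis unfolding F_def by (simp add: distrib_right)
    qed
    then have "cmod D \<le> cmod (KK t p s l) * (F * ((1 + \<bar>l\<bar>) * ?S))"
      by (rule order_trans[OF D(2) mult_left_mono]) simp
    also have "\<dots> \<le> (A * exp (- t * l\<^sup>2 + c * \<bar>l\<bar>)) * (F * (exp \<bar>l\<bar> * ?S))"
      using F0 exp_ge_add_one_self[of "\<bar>l\<bar>"] by (intro mult_mono Ac(1)) (auto intro!: mult_nonneg_nonneg Ac)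
    also have "\<dots> = A * F * ?S * exp (- t * l\<^sup>2 + (c + 1) * \<bar>l\<bar>)"
    proof -
      have "exp (- t * l\<^sup>2 + c * \<bar>l\<bar>) * exp \<bar>l\<bar> = exp (- t * l\<^sup>2 + (c + 1) * \<bar>l\<bar>)" unfolding exp_add[symmetric] by (simp add: algebra_simps)
      then show ?thesis by (simp add: mult_ac)
    qed
    also have "\<dots> \<le> A * F * ?S * (exp ((c + 1)\<^sup>2 / (2 * t)) * exp (- (t / 2) * l\<^sup>2))"
      using Ac F0 by (intro mult_left_mono exp_quadratic_le[OF t]) auto
    also have "\<dots> \<le> C * ?S * exp (- (t / 2) * l\<^sup>2)"
    proof -
      have "A * F * exp ((c + 1)\<^sup>2 / (2 * t)) \<le> C" unfolding C_def using Ac by simp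
      then have "A * F * exp ((c + 1)\<^sup>2 / (2 * t)) * (?S * exp (- (t / 2) * l\<^sup>2)) \<le> C * (?S * exp (- (t / 2) * l\<^sup>2))" by (intro mult_right_mono) auto
      then show ?thesis by (simp add: mult_ac)
    qed
    finally show "\<exists>D. (KK t p s has_vector_derivative D) (at l) \<and> cmod D \<le> C * (1 + norm s)\<^sup>2 * exp (- (t / 2) * l\<^sup>2)"
      using D(1) by blast
  qed
qed

text \<open>The derivative bounds are available only away from the origin. An interval containing 0
  is split there, continuity covers the missing point, and the mean value inequality holds on either
  side with the same constant.\<close>

lemma lipschitz_except_0:
  fixes f :: "real \<Rightarrow> complex"
  assumes cont: "continuous_on {a..b} f" and ab: "a \<le> b"
    and d: "\<And>x. a < x \<Longrightarrow> x < b \<Longrightarrow> x \<noteq> 0 \<Longrightarrow> \<exists>D. (f has_vector_derivative D) (at x) \<and> cmod D \<le> M"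
  shows "cmod (f b - f a) \<le> M * (b - a)"
proof -
  have *: "cmod (f v - f u) \<le> M * (v - u)" if uv: "u \<le> v" "a \<le> u" "v \<le> b" "0 \<notin> {u<..<v}" for u v
  proof (cases "u = v")
    case False
    then have "u < v" using uv by simp
    obtain D where D: "\<And>x. u < x \<Longrightarrow> x < v \<Longrightarrow> (f has_vector_derivative D x) (at x) \<and> cmod (D x) \<le> M"
    proof -
      have "\<forall>x\<in>{u<..<v}. \<exists>D. (f has_vector_derivative D) (at x) \<and> cmod D \<le> M"
      proof
        fix x assume x: "x \<in> {u<..<v}"
        then have "x \<noteq> 0" using uv(4) by auto
        then show "\<exists>D. (f has_vector_derivative D) (at x) \<and> cmod D \<le> M" using d[of x] x uv by auto
      qed
      then show ?thesis using that by (metis greaterThanLessThan_iff)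
    qed
    have "continuous_on {u..v} f" by (rule continuous_on_subset[OF cont]) (use uv in auto)
    from mvt_general[OF \<open>u < v\<close> this, of "\<lambda>x h. h *\<^sub>R D x"] D
    obtain x where x: "x \<in> {u<..<v}" "cmod (f v - f u) \<le> cmod ((v - u) *\<^sub>R D x)"
      by (auto simp: has_vector_derivative_def)
    have "cmod ((v - u) *\<^sub>R D x) = (v - u) * cmod (D x)" using \<open>u < v\<close> by simp
    also have "\<dots> \<le> (v - u) * M" using D[of x] x \<open>u < v\<close> by (intro mult_left_mono) auto
    finally show ?thesis using x(2) by (simp add: mult.commute)
  qed simp
  show ?thesis
  proof (cases "a < 0 \<and> 0 < b")
    case True
    have "cmod (f b - f a) \<le> cmod (f b - f 0) + cmod (f 0 - f a)"
      using norm_triangle_ineq[of "f b - f 0" "f 0 - f a"] by simp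
    also have "\<dots> \<le> M * (b - 0) + M * (0 - a)" using True by (intro add_mono *) auto
    finally show ?thesis by (simp add: algebra_simps)
  next
    case False
    then show ?thesis using ab by (intro *) auto
  qed
qed

text \<open>The derivative bound gives square-integrable difference quotients with constant
  proportional to \<open>(1 + norm s)\<^sup>2\<close>, which the Sobolev argument turns into a bound
  on the integral of the transform. Together with continuity this makes Fourier inversion in the
  frequency legitimate at every point.\<close>

lemma KK_fourier:
  fixes p :: "'n::finite cpair"
  assumes t: "t > 0"
  obtains C where "C \<ge> 0" "\<And>s. integrable lborel (KK t p s)" "\<And>s l. cmod (KK t p s l) \<le> C"
    "\<And>s. (\<integral>\<^sup>+\<xi>. ennreal (cmod (ft (KK t p s) \<xi>)) \<partial>lborel) \<le> ennreal (C * (1 + norm s)\<^sup>2)"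
proof -
  obtain C where C: "C \<ge> 0" "\<And>s l. cmod (KK t p s l) \<le> C * exp (- (t / 2) * l\<^sup>2)"
    "\<And>s l. l \<noteq> 0 \<Longrightarrow> \<exists>D. (KK t p s has_vector_derivative D) (at l) \<and> cmod D \<le> C * (1 + norm s)\<^sup>2 * exp (- (t / 2) * l\<^sup>2)"
    using KK_bounds[OF t] by blast
  have m: "KK t p s \<in> borel_measurable borel" for s
    by (intro borel_measurable_continuous_onI KK_continuous[OF t])
  \<comment> \<open>The integral over \<open>l\<close> of the square of
    \<open>exp (t / 2) * exp (- (t / 4) * l\<^sup>2)\<close>, the profile that dominates both the
    kernel and its difference quotients.\<close>
  define q where "q = exp t * sqrt (2 * pi / t)"
  have q: "q > 0" using t by (simp add: q_def)
  define Q where "Q = sqrt q"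
  have Q: "Q \<ge> 0" "Q\<^sup>2 = q" using q by (auto simp: Q_def)
  have g: "(\<integral>\<^sup>+l. ennreal ((X * exp (t / 2) * exp (- (t / 4) * l\<^sup>2))\<^sup>2) \<partial>lborel) = ennreal ((X * Q)\<^sup>2)" for X :: real
  proof -
    have "has_bochner_integral lborel (\<lambda>l::real. X\<^sup>2 * exp t * exp (0 \<bullet> l - (t / 2) * (l \<bullet> l))) (X\<^sup>2 * exp t * (sqrt (pi / (t / 2)) ^ DIM(real) * exp ((0 \<bullet> (0::real)) / (4 * (t / 2)))))"
      by (intro has_bochner_integral_mult_right gauss_real) (use t in auto)
    moreover have "X\<^sup>2 * exp t * (sqrt (pi / (t / 2)) ^ DIM(real) * exp ((0 \<bullet> (0::real)) / (4 * (t / 2)))) = (X * Q)\<^sup>2"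
      unfolding power_mult_distrib Q(2) q_def by (simp add: mult_ac)
    moreover have "X\<^sup>2 * exp t * exp (0 \<bullet> l - (t / 2) * (l \<bullet> l)) = (X * exp (t / 2) * exp (- (t / 4) * l\<^sup>2))\<^sup>2" for l :: real
      unfolding power_mult_distrib exp_double[symmetric] by (simp add: power2_eq_square)
    ultimately have "has_bochner_integral lborel (\<lambda>l. (X * exp (t / 2) * exp (- (t / 4) * l\<^sup>2))\<^sup>2) ((X * Q)\<^sup>2)" by simp
    then show ?thesis by (subst nn_integral_eq_integral) (auto simp: has_bochner_integral_iff)
  qed
  have i: "integrable lborel (KK t p s)" for s
  proof (rule Bochner_Integration.integrable_bound)
    show "integrable lborel (\<lambda>l::real. C * exp (- (t / 2) * l\<^sup>2))"
      using integrable_gauss_norm[of "t / 2", where 'a=real] t by (intro integrable_mult_right) simp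
  qed (use C m in auto)
  have k2: "(\<integral>\<^sup>+l. ennreal ((cmod (KK t p s l))\<^sup>2) \<partial>lborel) \<le> ennreal ((C * (1 + norm s)\<^sup>2 * Q)\<^sup>2)" for s
  proof -
    have "(\<integral>\<^sup>+l. ennreal ((cmod (KK t p s l))\<^sup>2) \<partial>lborel) \<le> (\<integral>\<^sup>+l. ennreal ((C * (1 + norm s)\<^sup>2 * exp (t / 2) * exp (- (t / 4) * l\<^sup>2))\<^sup>2) \<partial>lborel)"
    proof (intro nn_integral_mono ennreal_leI power_mono)
      fix l :: real
      have "C * exp (- (t / 2) * l\<^sup>2) \<le> C * ((1 + norm s)\<^sup>2 * exp (t / 2) * exp (- (t / 4) * l\<^sup>2))"
      proof (rule mult_left_mono[OF _ C(1)])
        have "1 * 1 \<le> (1 + norm s)\<^sup>2 * exp (t / 2)" using t by (intro mult_mono) auto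
        moreover have "exp (- (t / 2) * l\<^sup>2) \<le> exp (- (t / 4) * l\<^sup>2)" using t by (simp add: mult_right_mono)
        ultimately have "1 * exp (- (t / 2) * l\<^sup>2) \<le> ((1 + norm s)\<^sup>2 * exp (t / 2)) * exp (- (t / 4) * l\<^sup>2)" by (intro mult_mono) auto
        then show "exp (- (t / 2) * l\<^sup>2) \<le> (1 + norm s)\<^sup>2 * exp (t / 2) * exp (- (t / 4) * l\<^sup>2)" by simp
      qed
      then show "cmod (KK t p s l) \<le> C * (1 + norm s)\<^sup>2 * exp (t / 2) * exp (- (t / 4) * l\<^sup>2)" using C(2)[of s l] by (simp add: mult.assoc)
    qed simp
    then show ?thesis unfolding g .
  qed
  have K2: "sqint lborel (KK t p s)" for s
    unfolding sqint_iff_nn using m k2[of s] by (auto intro: le_less_trans)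
  have b1: "(\<integral>\<^sup>+l. ennreal ((cmod (KK t p s (l + d) - KK t p s l))\<^sup>2) \<partial>lborel) \<le> ennreal ((d * (C * (1 + norm s)\<^sup>2 * Q))\<^sup>2)" if d: "0 < d" "d \<le> 1" for d s
  proof -
    have "(\<integral>\<^sup>+l. ennreal ((cmod (KK t p s (l + d) - KK t p s l))\<^sup>2) \<partial>lborel) \<le> (\<integral>\<^sup>+l. ennreal ((d * (C * (1 + norm s)\<^sup>2) * exp (t / 2) * exp (- (t / 4) * l\<^sup>2))\<^sup>2) \<partial>lborel)"
    proof (intro nn_integral_mono ennreal_leI power_mono)
      fix l :: real
      have "cmod (KK t p s (l + d) - KK t p s l) \<le> (C * (1 + norm s)\<^sup>2 * (exp (t / 2) * exp (- (t / 4) * l\<^sup>2))) * (l + d - l)"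
      proof (rule lipschitz_except_0)
        show "continuous_on {l..l + d} (KK t p s)" by (rule continuous_on_subset[OF KK_continuous[OF t]]) auto
        fix x assume x: "l < x" "x < l + d" "x \<noteq> 0"
        obtain D where D: "(KK t p s has_vector_derivative D) (at x)" "cmod D \<le> C * (1 + norm s)\<^sup>2 * exp (- (t / 2) * x\<^sup>2)"
          using C(3)[OF x(3)] by blast
        \<comment> \<open>The derivative is taken at \<open>x\<close>, at distance less than 1 from
          \<open>l\<close>, while the bound has to be a function of \<open>l\<close>. The rate falls
          from \<open>t / 2\<close> to \<open>t / 4\<close> and a factor \<open>exp (t / 2)\<close>
          appears.\<close>
        have "l\<^sup>2 \<le> 2 * x\<^sup>2 + 2"
        proof -
          have "(l - x)\<^sup>2 \<le> 1" using x d by (simp add: abs_square_le_1)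
          moreover have "0 \<le> (2 * x - l)\<^sup>2" by simp
          ultimately show ?thesis by (simp add: power2_eq_square algebra_simps)
        qed
        then have "(t / 4) * l\<^sup>2 \<le> (t / 4) * (2 * x\<^sup>2 + 2)" using t by (intro mult_left_mono) auto
        then have "- (t / 2) * x\<^sup>2 \<le> t / 2 + - (t / 4) * l\<^sup>2" by (simp add: algebra_simps)
        then have "exp (- (t / 2) * x\<^sup>2) \<le> exp (t / 2) * exp (- (t / 4) * l\<^sup>2)" unfolding exp_add[symmetric] by simp
        then have "C * (1 + norm s)\<^sup>2 * exp (- (t / 2) * x\<^sup>2) \<le> C * (1 + norm s)\<^sup>2 * (exp (t / 2) * exp (- (t / 4) * l\<^sup>2))"
          using C(1) by (intro mult_left_mono) auto
        then show "\<exists>D. (KK t p s has_vector_derivative D) (at x) \<and> cmod D \<le> C * (1 + norm s)\<^sup>2 * (exp (t / 2) * exp (- (t / 4) * l\<^sup>2))"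
          using D by (intro exI[of _ D]) auto
      qed (use d in auto)
      then show "cmod (KK t p s (l + d) - KK t p s l) \<le> d * (C * (1 + norm s)\<^sup>2) * exp (t / 2) * exp (- (t / 4) * l\<^sup>2)" by (simp add: mult_ac)
    qed simp
    also have "\<dots> = ennreal ((d * (C * (1 + norm s)\<^sup>2) * Q)\<^sup>2)" unfolding g ..
    finally show ?thesis by (simp add: mult.assoc)
  qed
  show ?thesis
  proof (rule that[of "C + 2 * pi * C * Q"])
    show "C + 2 * pi * C * Q \<ge> 0" using C(1) Q by simp
    show "integrable lborel (KK t p s)" for s by (rule i)
    show "cmod (KK t p s l) \<le> C + 2 * pi * C * Q" for s l
    proof -
      have "C * exp (- (t / 2) * l\<^sup>2) \<le> C * 1" using C(1) t by (intro mult_left_mono) auto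
      moreover have "0 \<le> 2 * pi * C * Q" using C(1) Q by simp
      ultimately show ?thesis using C(2)[of s l] by linarith
    qed
    fix s
    have "(\<integral>\<^sup>+\<xi>. ennreal (cmod (ft (KK t p s) \<xi>)) \<partial>lborel) \<le> ennreal (2 * pi * (C * (1 + norm s)\<^sup>2 * Q))"
      by (rule ft_L1_bound[OF i K2 _ k2 b1]) (use C(1) Q in auto)
    also have "\<dots> \<le> ennreal ((C + 2 * pi * C * Q) * (1 + norm s)\<^sup>2)"
      using C(1) by (intro ennreal_leI) (simp add: algebra_simps)
    finally show "(\<integral>\<^sup>+\<xi>. ennreal (cmod (ft (KK t p s) \<xi>)) \<partial>lborel) \<le> ennreal ((C + 2 * pi * C * Q) * (1 + norm s)\<^sup>2)" .
  qed
qed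

section \<open>The heat kernel transform of rapidly decreasing functions\<close>

definition unasc :: "'n::finite vv \<times> real \<Rightarrow> 'n heis" where
  "unasc y = (fst (fst y), snd (fst y), snd y)"

definition asc :: "'n::finite heis \<Rightarrow> 'n vv \<times> real" where
  "asc h = ((fst h, fst (snd h)), snd (snd h))"

lemma asc_unasc [simp]: "asc (unasc y) = y" "unasc (asc h) = h"
  by (simp_all add: asc_def unasc_def)

lemma unasc_continuous: "continuous_on UNIV (unasc :: 'n::finite vv \<times> real \<Rightarrow> _)"
  unfolding unasc_def by (intro continuous_intros)

lemma asc_continuous: "continuous_on UNIV (asc :: 'n::finite heis \<Rightarrow> _)"
  unfolding asc_def by (intro continuous_intros)

lemma unasc_measurable [measurable]: "(unasc :: 'n::finite vv \<times> real \<Rightarrow> _) \<in> borel \<rightarrow>\<^sub>M borel"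
  by (intro borel_measurable_continuous_onI unasc_continuous)

lemma asc_measurable [measurable]: "(asc :: 'n::finite heis \<Rightarrow> _) \<in> borel \<rightarrow>\<^sub>M borel"
  by (intro borel_measurable_continuous_onI asc_continuous)

lemma norm_unasc: "norm (unasc y) = norm y"
  by (simp add: unasc_def norm_prod_def power2_eq_square[symmetric])

lemma nn_integral_unasc:
  fixes h :: "'n::finite heis \<Rightarrow> ennreal"
  assumes [measurable]: "h \<in> borel_measurable borel"
  shows "(\<integral>\<^sup>+x. h x \<partial>lborel) = (\<integral>\<^sup>+y. h (unasc y) \<partial>lborel)"
proof -
  have "(\<integral>\<^sup>+x. h x \<partial>lborel) = (\<integral>\<^sup>+x. \<integral>\<^sup>+r. h (x, r) \<partial>lborel \<partial>lborel)"
    by (rule nn_integral_lborel_pair) simp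
  also have "\<dots> = (\<integral>\<^sup>+x. \<integral>\<^sup>+u. \<integral>\<^sup>+\<xi>. h (x, u, \<xi>) \<partial>lborel \<partial>lborel \<partial>lborel)"
  proof (rule nn_integral_cong)
    fix x :: "real^'n"
    have "(\<lambda>r::(real^'n)\<times>real. (x, r)) \<in> borel \<rightarrow>\<^sub>M borel" by (intro borel_measurable_continuous_onI continuous_intros)
    from measurable_compose[OF this assms] show "(\<integral>\<^sup>+r. h (x, r) \<partial>lborel) = (\<integral>\<^sup>+u. \<integral>\<^sup>+\<xi>. h (x, u, \<xi>) \<partial>lborel \<partial>lborel)"
      by (rule nn_integral_lborel_pair)
  qed
  also have "\<dots> = (\<integral>\<^sup>+v. \<integral>\<^sup>+\<xi>. h (unasc (v, \<xi>)) \<partial>lborel \<partial>lborel)"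
  proof -
    have "(\<lambda>y. h (unasc y)) \<in> borel_measurable (borel :: ('n vv \<times> real) measure)" by measurable
    then have [measurable]: "(\<lambda>y. h (unasc y)) \<in> borel_measurable ((borel :: 'n vv measure) \<Otimes>\<^sub>M (borel :: real measure))" by (simp add: borel_prod)
    show ?thesis by (subst nn_integral_lborel_pair(1)) (measurable, simp add: unasc_def)
  qed
  also have "\<dots> = (\<integral>\<^sup>+y. h (unasc y) \<partial>lborel)"
    by (rule nn_integral_lborel_pair(1)[symmetric]) measurable
  finally show ?thesis .
qed

lemma lborel_unasc: "distr lborel borel unasc = (lborel :: 'n::finite heis measure)"
proof (rule measure_eqI)
  fix A :: "'n heis set" assume "A \<in> sets (distr lborel borel unasc)"
  then have A: "A \<in> sets borel" by simp
  have "emeasure (distr lborel borel unasc) A = (\<integral>\<^sup>+x. indicator A x \<partial>(distr lborel borel unasc))" using A by simp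
  also have "\<dots> = (\<integral>\<^sup>+y. indicator A (unasc y) \<partial>lborel)" using A by (subst nn_integral_distr) auto
  also have "\<dots> = (\<integral>\<^sup>+x. indicator A x \<partial>lborel)" using A by (intro nn_integral_unasc[symmetric]) auto
  finally show "emeasure (distr lborel borel unasc) A = emeasure lborel A" using A by simp
qed simp

lemma integral_unasc:
  fixes f :: "'n::finite heis \<Rightarrow> complex"
  assumes [measurable]: "f \<in> borel_measurable borel"
  shows "(LINT h|lborel. f h) = (LINT y|lborel. f (unasc y))"
  by (subst lborel_unasc[symmetric], subst integral_distr) auto

lemma L2_iff: "L2 f \<longleftrightarrow> sqint lborel (\<lambda>y. f (unasc y))"
  and L2norm2_eq: "L2 f \<Longrightarrow> L2norm2 f = (\<integral>\<^sup>+y. ennreal ((cmod (f (unasc y)))\<^sup>2) \<partial>lborel)"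
  for f :: "'n::finite heis \<Rightarrow> complex"
proof -
  have e: "(\<integral>\<^sup>+x. ennreal ((cmod (f x))\<^sup>2) \<partial>lborel) = (\<integral>\<^sup>+y. ennreal ((cmod (f (unasc y)))\<^sup>2) \<partial>lborel)" if "f \<in> borel_measurable borel"
    using that by (intro nn_integral_unasc) measurable
  have m: "f \<in> borel_measurable borel \<longleftrightarrow> (\<lambda>y. f (unasc y)) \<in> borel_measurable borel"
    using measurable_compose[OF unasc_measurable, of f borel] measurable_compose[OF asc_measurable, of "\<lambda>y. f (unasc y)" borel]
    by (simp only: asc_unasc) blast
  show "L2 f \<longleftrightarrow> sqint lborel (\<lambda>y. f (unasc y))" unfolding L2_def sqint_iff_nn using e m by auto
  show "L2 f \<Longrightarrow> L2norm2 f = (\<integral>\<^sup>+y. ennreal ((cmod (f (unasc y)))\<^sup>2) \<partial>lborel)"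
    unfolding L2_def L2norm2_def using e by simp
qed

section \<open>Rapidly decreasing functions\<close>

definition rapid :: "('a::euclidean_space \<Rightarrow> complex) \<Rightarrow> bool" where
  "rapid g \<longleftrightarrow> continuous_on UNIV g \<and> (\<forall>k::nat. \<exists>C. \<forall>x. cmod (g x) * (1 + norm x) ^ k \<le> C)"

lemma schwartz_rapid:
  fixes f :: "'n::finite heis \<Rightarrow> complex"
  assumes "schwartz f"
  shows "rapid (\<lambda>y. f (unasc y))"
  unfolding rapid_def
proof
  have "iter_pd [] f differentiable_on UNIV"
    using assms unfolding schwartz_def by (elim conjE allE[of _ "[]"]) simp
  then have "continuous_on UNIV f" by (simp add: differentiable_imp_continuous_on)
  then show "continuous_on UNIV (\<lambda>y. f (unasc y))"
    by (rule continuous_on_compose2[OF _ unasc_continuous]) auto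
  show "\<forall>k::nat. \<exists>C. \<forall>x. cmod (f (unasc x)) * (1 + norm x) ^ k \<le> C"
  proof
    fix k :: nat
    have "bounded (range (\<lambda>x. (1 + norm x) ^ k * norm (iter_pd [] f x)))"
      using assms unfolding schwartz_def by (elim conjE allE[of _ k] allE[of _ "[]"]) simp
    then obtain C where C: "\<And>x. norm ((1 + norm x) ^ k * norm (f x)) \<le> C" by (auto simp: bounded_iff)
    have "cmod (f (unasc x)) * (1 + norm x) ^ k \<le> C" for x
      using C[of "unasc x"] by (simp add: norm_unasc mult.commute abs_mult)
    then show "\<exists>C. \<forall>x. cmod (f (unasc x)) * (1 + norm x) ^ k \<le> C" by blast
  qed
qed

text \<open>Each \<open>1 + (x \<bullet> b)\<^sup>2\<close> is at most
  \<open>(1 + norm x)\<^sup>2\<close>, so the function is dominated by a product of Cauchy profiles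
  over \<open>Basis\<close>, each of integral \<open>pi\<close>.\<close>

lemma integrable_poly_decay:
  "integrable lborel (\<lambda>x::'a::euclidean_space. 1 / (1 + norm x) ^ (2 * DIM('a)))"
proof (rule integrableI_nonneg)
  have "(\<integral>\<^sup>+x. ennreal (1 / (1 + norm x) ^ (2 * DIM('a))) \<partial>(lborel :: 'a measure)) \<le> (\<integral>\<^sup>+x. (\<Prod>b\<in>Basis. ennreal (inverse (1 + (x \<bullet> b)\<^sup>2))) \<partial>(lborel :: 'a measure))"
  proof (rule nn_integral_mono)
    fix x :: 'a
    have "(\<Prod>b\<in>(Basis::'a set). 1 + (x \<bullet> b)\<^sup>2) \<le> (\<Prod>b\<in>(Basis::'a set). (1 + norm x)\<^sup>2)"
    proof (rule prod_mono, rule conjI)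
      fix b :: 'a assume b: "b \<in> Basis"
      have "(x \<bullet> b)\<^sup>2 \<le> (norm x)\<^sup>2" using Basis_le_norm[OF b, of x] by (metis abs_le_square_iff abs_norm_cancel)
      then show "1 + (x \<bullet> b)\<^sup>2 \<le> (1 + norm x)\<^sup>2" using norm_ge_zero[of x] unfolding power2_sum power_one by linarith
    qed (simp add: add_nonneg_nonneg)
    also have "\<dots> = (1 + norm x) ^ (2 * DIM('a))" by (simp add: power_mult)
    finally have "1 / (1 + norm x) ^ (2 * DIM('a)) \<le> 1 / (\<Prod>b\<in>Basis. 1 + (x \<bullet> b)\<^sup>2)"
    proof (rule divide_left_mono)
      have "0 < (1 + norm x) ^ (2 * DIM('a))" by (intro zero_less_power add_pos_nonneg) auto
      moreover have "0 < (\<Prod>b\<in>(Basis::'a set). 1 + (x \<bullet> b)\<^sup>2)" by (intro prod_pos ballI add_pos_nonneg) auto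
      ultimately show "0 < (1 + norm x) ^ (2 * DIM('a)) * (\<Prod>b\<in>Basis. 1 + (x \<bullet> b)\<^sup>2)" by (rule mult_pos_pos)
    qed simp
    also have "\<dots> = (\<Prod>b\<in>Basis. inverse (1 + (x \<bullet> b)\<^sup>2))" by (simp add: prod_dividef inverse_eq_divide)
    finally show "ennreal (1 / (1 + norm x) ^ (2 * DIM('a))) \<le> (\<Prod>b\<in>Basis. ennreal (inverse (1 + (x \<bullet> b)\<^sup>2)))"
      by (subst prod_ennreal) (auto intro!: ennreal_leI add_nonneg_nonneg)
  qed
  also have "\<dots> = (\<Prod>b\<in>(Basis::'a set). \<integral>\<^sup>+x. ennreal (inverse (1 + x\<^sup>2)) \<partial>lborel)"
    by (rule nn_integral_lborel_prod) auto
  also have "\<dots> = ennreal (\<Prod>b\<in>(Basis::'a set). pi)"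
    unfolding nn_integral_cauchy_density by (rule prod_ennreal) simp
  also have "\<dots> < \<infinity>" by simp
  finally show "(\<integral>\<^sup>+x. ennreal (1 / (1 + norm x) ^ (2 * DIM('a))) \<partial>(lborel :: 'a measure)) < \<infinity>" .
qed (auto intro!: AE_I2)

lemma rapid_bound:
  fixes g :: "'a::euclidean_space \<Rightarrow> complex"
  assumes "rapid g"
  obtains C where "C \<ge> 0" "\<And>x. cmod (g x) \<le> C * (1 / (1 + norm x) ^ k)"
proof -
  obtain C where C: "\<And>x. cmod (g x) * (1 + norm x) ^ k \<le> C" using assms unfolding rapid_def by blast
  have "0 \<le> C" using order_trans[OF _ C[of 0]] by simp
  moreover have "cmod (g x) \<le> C * (1 / (1 + norm x) ^ k)" for x
    using C[of x] by (simp add: pos_le_divide_eq add_pos_nonneg)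
  ultimately show ?thesis using that by blast
qed

lemma rapid_measurable: "rapid g \<Longrightarrow> g \<in> borel_measurable borel"
  by (auto simp: rapid_def intro: borel_measurable_continuous_onI)

text \<open>The weight is the growth in \<open>s\<close> permitted by \<open>KK_fourier\<close>.
  Decay of order \<open>2 * DIM('v\<times>real) + 2\<close> pays for it and leaves an integrable
  remainder.\<close>

lemma rapid_integrable_weight:
  fixes g :: "'v::euclidean_space \<times> real \<Rightarrow> complex"
  assumes "rapid g"
  shows "integrable lborel (\<lambda>y. cmod (g y) * (1 + norm (fst y))\<^sup>2)" "integrable lborel g" "sqint lborel g"
proof -
  have [measurable]: "g \<in> borel_measurable borel" by (rule rapid_measurable[OF assms])
  obtain C where C: "C \<ge> 0" "\<And>x. cmod (g x) \<le> C * (1 / (1 + norm x) ^ (2 * DIM('v\<times>real) + 2))" using rapid_bound[OF assms] by blast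
  have b: "cmod (g y) * (1 + norm (fst y))\<^sup>2 \<le> C * (1 / (1 + norm y) ^ (2 * DIM('v\<times>real)))" for y
  proof -
    have "norm (fst y) \<le> norm y" using norm_fst_le[of "fst y" "snd y"] by simp
    then have "cmod (g y) * (1 + norm (fst y))\<^sup>2 \<le> (C * (1 / (1 + norm y) ^ (2 * DIM('v\<times>real) + 2))) * (1 + norm y)\<^sup>2"
      using C by (intro mult_mono power_mono) auto
    also have "\<dots> = C * (1 / (1 + norm y) ^ (2 * DIM('v\<times>real)))"
    proof -
      have "1 + norm y > 0" by (simp add: add_pos_nonneg)
      then have "(1 + norm y)\<^sup>2 \<noteq> 0" by simp
      then show ?thesis unfolding power_add by (simp del: power_eq_0_iff)
    qed
    finally show ?thesis .
  qed
  have I: "integrable lborel (\<lambda>y::'v\<times>real. C * (1 / (1 + norm y) ^ (2 * DIM('v\<times>real))))"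
    by (rule integrable_mult_right[OF integrable_poly_decay])
  show 1: "integrable lborel (\<lambda>y. cmod (g y) * (1 + norm (fst y))\<^sup>2)"
  proof (rule Bochner_Integration.integrable_bound[OF I])
    have "(\<lambda>y::'v\<times>real. fst y) \<in> borel_measurable borel" by (intro borel_measurable_continuous_onI continuous_intros)
    then show "(\<lambda>y. cmod (g y) * (1 + norm (fst y))\<^sup>2) \<in> borel_measurable lborel" by measurable
    show "AE y in lborel. norm (cmod (g y) * (1 + norm (fst y))\<^sup>2) \<le> norm (C * (1 / (1 + norm y) ^ (2 * DIM('v\<times>real))))"
      using b C(1) by (intro AE_I2) simp
  qed
  show 2: "integrable lborel g"
  proof (rule Bochner_Integration.integrable_bound[OF 1])
    show "AE y in lborel. norm (g y) \<le> norm (cmod (g y) * (1 + norm (fst y))\<^sup>2)"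
    proof (rule AE_I2)
      fix y :: "'v \<times> real"
      have "1 \<le> (1 + norm (fst y))\<^sup>2" by simp
      from mult_left_mono[OF this, of "cmod (g y)"] show "norm (g y) \<le> norm (cmod (g y) * (1 + norm (fst y))\<^sup>2)" by simp
    qed
  qed simp
  obtain C0 where C0: "C0 \<ge> 0" "\<And>x. cmod (g x) \<le> C0 * (1 / (1 + norm x) ^ 0)" using rapid_bound[OF assms] by blast
  show "sqint lborel g"
    unfolding sqint_def
  proof
    show "integrable lborel (\<lambda>x. (cmod (g x))\<^sup>2)"
    proof (rule Bochner_Integration.integrable_bound)
      show "integrable lborel (\<lambda>x. C0 * cmod (g x))" using 2 by simp
      show "AE x in lborel. norm ((cmod (g x))\<^sup>2) \<le> norm (C0 * cmod (g x))"
        using C0 by (intro AE_I2) (auto simp: power2_eq_square intro!: mult_right_mono)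
    qed simp
  qed simp
qed

text \<open>The decay is split between the two variables: order 2 in the central one makes every
  fibre integrable, and the rest makes the transform square integrable at every frequency.
  Membership in the direct integral asks for every frequency, not almost every one.\<close>

lemma rapid_fibre:
  fixes g :: "'v::euclidean_space \<times> real \<Rightarrow> complex"
  assumes "rapid g"
  shows "integrable lborel (\<lambda>\<xi>. g (v, \<xi>))" "sqint lborel (\<lambda>v. pft \<sigma> g (v, l))"
proof -
  have gm[measurable]: "g \<in> borel_measurable borel" by (rule rapid_measurable[OF assms])
  define m where "m = 2 * DIM('v)"
  obtain C where C: "C \<ge> 0" "\<And>x. cmod (g x) \<le> C * (1 / (1 + norm x) ^ (m + 2))" using rapid_bound[OF assms] by blast
  have b: "cmod (g (v, \<xi>)) \<le> C * (1 / (1 + norm v) ^ m) * (1 / (1 + norm \<xi>) ^ 2)" for v \<xi>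
  proof -
    have "norm v \<le> norm (v, \<xi>)" "norm \<xi> \<le> norm (v, \<xi>)" by (rule norm_fst_le, rule norm_snd_le)
    then have "(1 + norm v) ^ m * (1 + norm \<xi>) ^ 2 \<le> (1 + norm (v, \<xi>)) ^ m * (1 + norm (v, \<xi>)) ^ 2"
      by (intro mult_mono power_mono) auto
    then have "(1 + norm v) ^ m * (1 + norm \<xi>) ^ 2 \<le> (1 + norm (v, \<xi>)) ^ (m + 2)" by (simp only: power_add)
    then have "1 / (1 + norm (v, \<xi>)) ^ (m + 2) \<le> 1 / ((1 + norm v) ^ m * (1 + norm \<xi>) ^ 2)"
      by (intro divide_left_mono) (auto intro!: mult_pos_pos zero_less_power add_pos_nonneg simp del: power_add)
    from mult_left_mono[OF this C(1)] show ?thesis using C(2)[of "(v, \<xi>)"] by simp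
  qed
  have i1: "integrable lborel (\<lambda>\<xi>::real. 1 / (1 + norm \<xi>) ^ 2)" using integrable_poly_decay[where 'a=real] by simp
  have [measurable]: "(\<lambda>\<xi>. g (v, \<xi>)) \<in> borel_measurable borel" for v
    by (rule measurable_compose[OF _ gm]) (intro borel_measurable_continuous_onI continuous_intros)
  show i: "integrable lborel (\<lambda>\<xi>. g (v, \<xi>))" for v
    by (rule Bochner_Integration.integrable_bound[OF integrable_mult_right[OF i1, of "C * (1 / (1 + norm v) ^ m)"]])
       (use b[of v] C(1) in \<open>auto intro!: AE_I2\<close>)
  define I where "I = (LINT \<xi>::real|lborel. 1 / (1 + norm \<xi>) ^ 2)"
  have pb: "cmod (pft \<sigma> g (v, l)) \<le> C * I * (1 / (1 + norm v) ^ m)" for v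
  proof -
    have "cmod (pft \<sigma> g (v, l)) \<le> (LINT \<xi>::real|lborel. C * (1 / (1 + norm v) ^ m) * (1 / (1 + norm \<xi>) ^ 2))"
      unfolding pft_def fst_conv snd_conv
    proof (rule Bochner_Integration.integral_norm_bound_integral)
      show "integrable lborel (\<lambda>\<xi>. exp (\<i> * complex_of_real (\<sigma> * l * \<xi>)) * g (v, \<xi>))"
        by (rule Bochner_Integration.integrable_bound[OF integrable_norm[OF i[of v]]]) (auto simp: norm_mult intro!: AE_I2)
      show "integrable lborel (\<lambda>\<xi>::real. C * (1 / (1 + norm v) ^ m) * (1 / (1 + norm \<xi>) ^ 2))"
        by (rule integrable_mult_right[OF i1])
      show "cmod (exp (\<i> * complex_of_real (\<sigma> * l * \<xi>)) * g (v, \<xi>)) \<le> C * (1 / (1 + norm v) ^ m) * (1 / (1 + norm \<xi>) ^ 2)" for \<xi>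
        using b[of v \<xi>] by (simp add: norm_mult)
    qed
    also have "\<dots> = C * (1 / (1 + norm v) ^ m) * I" unfolding I_def by (rule integral_mult_right_zero)
    finally show ?thesis by (simp add: mult_ac)
  qed
  have I0: "I \<ge> 0" unfolding I_def by (rule Bochner_Integration.integral_nonneg) simp
  show "sqint lborel (\<lambda>v. pft \<sigma> g (v, l))"
  proof (rule sqint_bound)
    show "sqint lborel (\<lambda>v::'v. complex_of_real (C * I) * complex_of_real (1 / (1 + norm v) ^ m))"
    proof (rule sqint_cmult)
      show "sqint lborel (\<lambda>v::'v. complex_of_real (1 / (1 + norm v) ^ m))"
        unfolding sqint_def
      proof
        show "integrable lborel (\<lambda>v::'v. (cmod (complex_of_real (1 / (1 + norm v) ^ m)))\<^sup>2)"
        proof (rule Bochner_Integration.integrable_bound[OF integrable_poly_decay])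
          show "AE v::'v in lborel. norm ((cmod (complex_of_real (1 / (1 + norm v) ^ m)))\<^sup>2) \<le> norm (1 / (1 + norm v) ^ (2 * DIM('v)))"
          proof (rule AE_I2)
            fix v :: 'v
            have "0 \<le> 1 / (1 + norm v) ^ m" "1 / (1 + norm v) ^ m \<le> 1" by (auto simp: divide_le_eq_1 add_pos_nonneg)
            then have "(1 / (1 + norm v) ^ m)\<^sup>2 \<le> 1 / (1 + norm v) ^ m"
              unfolding power2_eq_square by (intro mult_left_le)
            then show "norm ((cmod (complex_of_real (1 / (1 + norm v) ^ m)))\<^sup>2) \<le> norm (1 / (1 + norm v) ^ (2 * DIM('v)))"
              unfolding m_def norm_of_real by simp
          qed
        qed measurable
      qed measurable
    qed
    show "(\<lambda>v. pft \<sigma> g (v, l)) \<in> borel_measurable lborel"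
      using measurable_compose[OF _ pft_measurable[OF gm], of "\<lambda>v. (v, l)" borel \<sigma>]
      by (simp add: borel_measurable_continuous_onI continuous_intros)
    show "cmod (pft \<sigma> g (v, l)) \<le> cmod (complex_of_real (C * I) * complex_of_real (1 / (1 + norm v) ^ m))" for v
      using pb[of v] C(1) I0 unfolding of_real_mult[symmetric] norm_of_real by simp
  qed
qed

section \<open>The integral formula on Schwartz functions\<close>

lemma KK_continuous_joint: "t > 0 \<Longrightarrow> continuous_on UNIV (\<lambda>x. KK t (fst x) (fst (snd x)) (snd (snd x)))"
  unfolding KK_def qA_def qq_def
  by (intro continuous_intros continuous_on_compose2[OF phi_cont]) auto

lemma KK_measurable_raw [measurable (raw)]:
  assumes t: "t > 0" and [measurable]: "p \<in> M \<rightarrow>\<^sub>M borel" "f \<in> M \<rightarrow>\<^sub>M borel" "g \<in> M \<rightarrow>\<^sub>M borel"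
  shows "(\<lambda>x. KK t (p x) (f x) (g x)) \<in> borel_measurable M"
proof -
  have "(\<lambda>x. (p x, f x, g x)) \<in> M \<rightarrow>\<^sub>M borel \<Otimes>\<^sub>M (borel \<Otimes>\<^sub>M borel)" by measurable
  then have "(\<lambda>x. (p x, f x, g x)) \<in> M \<rightarrow>\<^sub>M borel" by (simp only: borel_prod)
  from measurable_compose[OF this borel_measurable_continuous_onI[OF KK_continuous_joint[OF t]]] show ?thesis by simp
qed

text \<open>The central component of the product is \<xi> - \<open>snd y\<close> plus half a
  symplectic form in (z, w) and \<open>fst y\<close>. That second part supplies the phase of
  \<open>KK\<close>, and the first one is the Fourier variable.\<close>

lemma heat_kernel_eq:
  fixes z w :: "complex^'n::finite"
  assumes t: "t > 0"
  shows "heat_kernelC t (hmulC (hembed (hinv (unasc y))) (z, w, complex_of_real \<xi>)) =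
    complex_of_real (1 / (2 * pi)) * ft (KK t (z, w) (fst y)) (\<xi> - snd y)"
proof -
  obtain x u \<xi>' where y: "y = ((x, u), \<xi>')" by (metis surj_pair)
  define \<zeta> where "\<zeta> = complex_of_real (- \<xi>') + complex_of_real \<xi> + (1/2) * (cdot (vof_real (- u)) z - cdot (vof_real (- x)) w)"
  define c0 where "c0 = inverse ((4 * pi) ^ CARD('n))"
  have "heat_kernelC t (hmulC (hembed (hinv (unasc y))) (z, w, complex_of_real \<xi>)) =
    complex_of_real (inverse (2*pi) * c0) *
     (LINT l|lborel. exp (- \<i> * complex_of_real l * \<zeta>) * complex_of_real (exp (- t * l^2))
        * complex_of_real ((l / sinh (t * l)) ^ CARD('n))
        * exp (- complex_of_real (l / 4 * coth (t * l)) * (cdot (vof_real (- x) + z) (vof_real (- x) + z) + cdot (vof_real (- u) + w) (vof_real (- u) + w))))"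
    unfolding y unasc_def hinv_def hembed_def hmulC_def heat_kernelC_def c0_def \<zeta>_def by simp
  also have "\<dots> = complex_of_real (inverse (2*pi)) * (LINT l|lborel. complex_of_real c0 * (exp (- \<i> * complex_of_real l * \<zeta>) * complex_of_real (exp (- t * l^2))
        * complex_of_real ((l / sinh (t * l)) ^ CARD('n))
        * exp (- complex_of_real (l / 4 * coth (t * l)) * (cdot (vof_real (- x) + z) (vof_real (- x) + z) + cdot (vof_real (- u) + w) (vof_real (- u) + w)))))"
    by (subst integral_mult_right_zero) simp
  also have "(LINT l|lborel. complex_of_real c0 * (exp (- \<i> * complex_of_real l * \<zeta>) * complex_of_real (exp (- t * l^2))
        * complex_of_real ((l / sinh (t * l)) ^ CARD('n))
        * exp (- complex_of_real (l / 4 * coth (t * l)) * (cdot (vof_real (- x) + z) (vof_real (- x) + z) + cdot (vof_real (- u) + w) (vof_real (- u) + w)))))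
     = ft (KK t (z, w) (x, u)) (\<xi> - \<xi>')"
    unfolding ft_def
  proof (rule integral_cong_AE)
    have K: "KK t (z, w) (x, u) \<in> borel_measurable borel" by (intro borel_measurable_continuous_onI KK_continuous[OF t])
    then show "(\<lambda>l. exp (- (\<i> * complex_of_real ((\<xi> - \<xi>') \<bullet> l))) * KK t (z, w) (x, u) l) \<in> borel_measurable lborel" by measurable
    have [measurable]: "(\<lambda>l::real. sinh (t * l)) \<in> borel_measurable borel" "(\<lambda>l::real. cosh (t * l)) \<in> borel_measurable borel"
      by (intro borel_measurable_continuous_onI continuous_intros)+
    show "(\<lambda>l. complex_of_real c0 * (exp (- \<i> * complex_of_real l * \<zeta>) * complex_of_real (exp (- t * l^2))
        * complex_of_real ((l / sinh (t * l)) ^ CARD('n))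
        * exp (- complex_of_real (l / 4 * coth (t * l)) * (cdot (vof_real (- x) + z) (vof_real (- x) + z) + cdot (vof_real (- u) + w) (vof_real (- u) + w))))) \<in> borel_measurable lborel"
      unfolding coth_def by measurable
    \<comment> \<open>At \<open>l = 0\<close> the integrands differ: division by zero makes the
      stated one vanish, while \<open>phi\<close> takes its limit \<open>1 / t\<close>.\<close>
    have "AE l::real in lborel. l \<noteq> 0" by (rule AE_lborel_singleton)
    then show "AE l in lborel. complex_of_real c0 * (exp (- \<i> * complex_of_real l * \<zeta>) * complex_of_real (exp (- t * l^2))
        * complex_of_real ((l / sinh (t * l)) ^ CARD('n))
        * exp (- complex_of_real (l / 4 * coth (t * l)) * (cdot (vof_real (- x) + z) (vof_real (- x) + z) + cdot (vof_real (- u) + w) (vof_real (- u) + w))))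
       = exp (- (\<i> * complex_of_real ((\<xi> - \<xi>') \<bullet> l))) * KK t (z, w) (x, u) l"
    proof eventually_elim
      case (elim l)
      have ph: "phi t l = l / sinh (t * l)" "phi t l * cosh (t * l) / 4 = l / 4 * coth (t * l)" using elim by (simp_all add: phi_def coth_def)
      have q: "cdot (vof_real (- x) + z) (vof_real (- x) + z) + cdot (vof_real (- u) + w) (vof_real (- u) + w) = qq (z, w) (x, u)"
        unfolding qq_def vof_real_simps by simp
      have e: "- \<i> * complex_of_real l * \<zeta> = - (\<i> * complex_of_real ((\<xi> - \<xi>') \<bullet> l)) + \<i> * complex_of_real (l / 2) * qA (z, w) (x, u)"
        unfolding \<zeta>_def qA_def vof_real_simps by (simp add: cdot_def sum_negf algebra_simps)
      have ex: "exp (- X + Y) * complex_of_real (exp (- t * l\<^sup>2)) * R * exp (- A * q) =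
        exp (- X) * (R * exp (complex_of_real (- t * l\<^sup>2) + Y - A * q))" for X Y A R q
        unfolding exp_of_real[symmetric] exp_add exp_diff by (simp add: exp_minus divide_inverse mult_ac)
      show ?case unfolding q e KK_def ph(2) unfolding ph(1) c0_def[symmetric] of_real_mult[of c0] ex by (simp only: mult_ac)
    qed
  qed
  finally show ?thesis unfolding y by (simp add: inverse_eq_divide)
qed

text \<open>Fubini moves the integral over \<xi> innermost. There it is, after translation by the
  central coordinate of \<open>y\<close>, the Fourier inversion integral of \<open>KK\<close>, whose
  factor \<open>2 * pi\<close> cancels the one in the kernel; the translation leaves the phase that
  \<open>pft\<close> integrates. Absolute integrability holds because the quadratic growth from
  \<open>KK_fourier\<close> meets a rapidly decreasing function.\<close>

theorem Jt_formula:
  fixes f :: "'n::finite heis \<Rightarrow> complex"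
  assumes t: "t > 0" and l: "l \<noteq> 0" and f: "rapid (\<lambda>y. f (unasc y))"
  shows "Jt t f l p = complex_of_real (exp (- t * l\<^sup>2)) * hT t l (\<lambda>s. pft 1 (\<lambda>y. f (unasc y)) (s, l)) p"
proof -
  obtain z w where p: "p = (z, w)" by (cases p)
  define g where "g y = f (unasc y)" for y
  have rg: "rapid g" using f by (simp add: g_def[abs_def])
  have gm[measurable]: "g \<in> borel_measurable borel" by (rule rapid_measurable[OF rg])
  have gm2[measurable]: "g \<in> borel_measurable (borel \<Otimes>\<^sub>M borel)" by (simp add: borel_prod)
  obtain C where C: "C \<ge> 0" "\<And>s. integrable lborel (KK t p s)" "\<And>s l. cmod (KK t p s l) \<le> C"
    "\<And>s. (\<integral>\<^sup>+\<xi>. ennreal (cmod (ft (KK t p s) \<xi>)) \<partial>lborel) \<le> ennreal (C * (1 + norm s)\<^sup>2)"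
    using KK_fourier[OF t, of p] by blast
  have fm: "(\<lambda>x. ft (KK t p (fst x)) (snd x)) \<in> borel_measurable (borel \<Otimes>\<^sub>M borel)"
    unfolding ft_def using t by measurable
  have fti: "integrable lborel (ft (KK t p s))" for s
  proof (rule integrableI_bounded)
    have "(\<integral>\<^sup>+\<xi>. ennreal (norm (ft (KK t p s) \<xi>)) \<partial>lborel) \<le> ennreal (C * (1 + norm s)\<^sup>2)" using C(4) by simp
    also have "\<dots> < \<infinity>" by simp
    finally show "(\<integral>\<^sup>+\<xi>. ennreal (norm (ft (KK t p s) \<xi>)) \<partial>lborel) < \<infinity>" .
    show "ft (KK t p s) \<in> borel_measurable lborel" using borel_measurable_integrable[OF C(2)[of s]] by measurable
  qed
  define I where "I y \<xi> = exp (\<i> * complex_of_real (l * \<xi>)) * (g y * (complex_of_real (1 / (2 * pi)) * ft (KK t p (fst y)) (\<xi> - snd y)))" for y \<xi>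
  have Fm: "(\<lambda>y. ft (KK t p (fst y)) (\<xi> - snd y)) \<in> borel_measurable borel" for \<xi>
  proof -
    have "(\<lambda>y::'n vv\<times>real. (fst y, \<xi> - snd y)) \<in> borel \<Otimes>\<^sub>M borel \<rightarrow>\<^sub>M borel \<Otimes>\<^sub>M borel" by measurable
    from measurable_compose[OF this fm] show ?thesis by (simp add: borel_prod)
  qed
  have ht: "heat_transform t f (z, w, complex_of_real \<xi>) = (LINT y|lborel. g y * (complex_of_real (1 / (2 * pi)) * ft (KK t p (fst y)) (\<xi> - snd y)))" for \<xi>
  proof -
    define H where "H y = g y * (complex_of_real (1 / (2 * pi)) * ft (KK t p (fst y)) (\<xi> - snd y))" for y
    have Hm: "H \<in> borel_measurable borel" unfolding H_def using gm Fm by measurable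
    have "f h * heat_kernelC t (hmulC (hembed (hinv h)) (z, w, complex_of_real \<xi>)) = H (asc h)" for h
      using heat_kernel_eq[OF t, of "asc h" z w \<xi>] unfolding H_def g_def p by simp
    then have "heat_transform t f (z, w, complex_of_real \<xi>) = (LINT h|lborel. H (asc h))" unfolding heat_transform_def by simp
    also have "\<dots> = (LINT y|lborel. H (asc (unasc y)))"
      by (rule integral_unasc[OF measurable_compose[OF asc_measurable Hm]])
    finally show ?thesis by (simp add: H_def)
  qed
  have Im: "(\<lambda>x. I (fst x) (snd x)) \<in> borel_measurable (lborel \<Otimes>\<^sub>M lborel)"
  proof -
    have "(\<lambda>x::('n vv\<times>real)\<times>real. (fst (fst x), snd x - snd (fst x))) \<in> borel \<rightarrow>\<^sub>M borel"
      by (intro borel_measurable_continuous_onI continuous_intros)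
    then have 1: "(\<lambda>x::('n vv\<times>real)\<times>real. (fst (fst x), snd x - snd (fst x))) \<in> (lborel \<Otimes>\<^sub>M lborel) \<rightarrow>\<^sub>M borel"
      by (simp add: lborel_prod)
    have 2: "(\<lambda>x. ft (KK t p (fst x)) (snd x)) \<in> borel_measurable borel" using fm by (simp add: borel_prod)
    have [measurable]: "(\<lambda>x::('n vv\<times>real)\<times>real. ft (KK t p (fst (fst x))) (snd x - snd (fst x))) \<in> borel_measurable (lborel \<Otimes>\<^sub>M lborel)"
      using measurable_compose[OF 1 2] by simp
    have [measurable]: "(\<lambda>x::('n vv\<times>real)\<times>real. g (fst x)) \<in> borel_measurable (lborel \<Otimes>\<^sub>M lborel)"
      by (rule measurable_compose[OF measurable_fst]) (simp add: gm)
    show ?thesis unfolding I_def by measurable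
  qed
  have Iy: "integrable lborel (I y)" for y
  proof (rule Bochner_Integration.integrable_bound)
    show "integrable lborel (\<lambda>\<xi>. cmod (g y) * (1 / (2 * pi)) * cmod (ft (KK t p (fst y)) (\<xi> + - snd y)))"
      by (intro integrable_mult_right integrable_norm integrable_translate fti)
    show "I y \<in> borel_measurable lborel" using measurable_compose[OF _ Im, of "\<lambda>\<xi>. (y, \<xi>)"] by simp
    show "AE \<xi> in lborel. norm (I y \<xi>) \<le> norm (cmod (g y) * (1 / (2 * pi)) * cmod (ft (KK t p (fst y)) (\<xi> + - snd y)))"
      by (intro AE_I2) (simp add: I_def norm_mult norm_divide)
  qed
  have "integrable (lborel \<Otimes>\<^sub>M lborel) (\<lambda>x. I (fst x) (snd x))"
  proof (rule lborel_pair.Fubini_integrable[OF Im])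
    show "AE y in lborel. integrable lborel (\<lambda>\<xi>. I (fst (y, \<xi>)) (snd (y, \<xi>)))" using Iy by simp
    show "integrable lborel (\<lambda>y. LINT \<xi>|lborel. norm (I (fst (y, \<xi>)) (snd (y, \<xi>))))"
    proof (rule Bochner_Integration.integrable_bound)
      show "integrable lborel (\<lambda>y. C * (cmod (g y) * (1 + norm (fst y))\<^sup>2))" by (intro integrable_mult_right rapid_integrable_weight rg)
      show "(\<lambda>y. LINT \<xi>|lborel. norm (I (fst (y, \<xi>)) (snd (y, \<xi>)))) \<in> borel_measurable lborel"
        using Im by measurable
      show "AE y in lborel. norm (LINT \<xi>|lborel. norm (I (fst (y, \<xi>)) (snd (y, \<xi>)))) \<le> norm (C * (cmod (g y) * (1 + norm (fst y))\<^sup>2))"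
      proof (rule AE_I2)
        fix y :: "'n vv \<times> real"
        have nn: "(LINT \<xi>|lborel. cmod (ft (KK t p (fst y)) \<xi>)) \<le> C * (1 + norm (fst y))\<^sup>2"
        proof -
          have "ennreal (LINT \<xi>|lborel. cmod (ft (KK t p (fst y)) \<xi>)) \<le> ennreal (C * (1 + norm (fst y))\<^sup>2)"
            using C(4)[of "fst y"] by (subst nn_integral_eq_integral[symmetric]) (auto intro: integrable_norm[OF fti])
          then show ?thesis using C(1) by (subst (asm) ennreal_le_iff) auto
        qed
        have ftm: "ft (KK t p (fst y)) \<in> borel_measurable borel" using fti[of "fst y"] by auto
        have "(LINT \<xi>|lborel. norm (I y \<xi>)) = cmod (g y) * (1 / (2 * pi)) * (LINT \<xi>|lborel. cmod (ft (KK t p (fst y)) (\<xi> + - snd y)))"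
          by (simp add: I_def norm_mult norm_divide)
        also have "(LINT \<xi>|lborel. cmod (ft (KK t p (fst y)) (\<xi> + - snd y))) = (LINT \<xi>|lborel. cmod (ft (KK t p (fst y)) \<xi>))"
          by (rule integral_translate[of "\<lambda>\<xi>. cmod (ft (KK t p (fst y)) \<xi>)"]) (use ftm in measurable)
        also have "cmod (g y) * (1 / (2 * pi)) * \<dots> \<le> cmod (g y) * 1 * (C * (1 + norm (fst y))\<^sup>2)"
        proof -
          have "1 / (2 * pi) \<le> 1" using pi_ge_two by simp
          then show ?thesis using nn C(1) by (intro mult_mono) (auto intro!: Bochner_Integration.integral_nonneg)
        qed
        finally have "(LINT \<xi>|lborel. norm (I y \<xi>)) \<le> C * (cmod (g y) * (1 + norm (fst y))\<^sup>2)" by (simp add: mult_ac)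
        moreover have "0 \<le> (LINT \<xi>|lborel. norm (I y \<xi>))" by (rule Bochner_Integration.integral_nonneg) simp
        ultimately show "norm (LINT \<xi>|lborel. norm (I (fst (y, \<xi>)) (snd (y, \<xi>)))) \<le> norm (C * (cmod (g y) * (1 + norm (fst y))\<^sup>2))"
          using C(1) by simp
      qed
    qed
  qed
  then have Ii: "integrable (lborel \<Otimes>\<^sub>M lborel) (\<lambda>(y, \<xi>). I y \<xi>)" by (simp add: case_prod_unfold)
  have inner: "(LINT \<xi>|lborel. I y \<xi>) = exp (\<i> * complex_of_real (1 * l * snd y)) * g y * KK t p (fst y) l" for y
  proof -
    have ftm: "ft (KK t p (fst y)) \<in> borel_measurable borel" using fti[of "fst y"] by auto
    have "(LINT \<xi>|lborel. I y \<xi>) = (LINT \<xi>|lborel. (exp (\<i> * complex_of_real (l * snd y)) * (g y * complex_of_real (1 / (2 * pi)))) * (exp (\<i> * complex_of_real ((\<xi> + - snd y) \<bullet> l)) * ft (KK t p (fst y)) (\<xi> + - snd y)))"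
    proof (intro Bochner_Integration.integral_cong refl)
      fix \<xi>
      have "exp (\<i> * complex_of_real (l * \<xi>)) = exp (\<i> * complex_of_real (l * snd y)) * exp (\<i> * complex_of_real ((\<xi> + - snd y) \<bullet> l))"
        unfolding exp_add[symmetric] by (simp add: algebra_simps)
      then show "I y \<xi> = (exp (\<i> * complex_of_real (l * snd y)) * (g y * complex_of_real (1 / (2 * pi)))) * (exp (\<i> * complex_of_real ((\<xi> + - snd y) \<bullet> l)) * ft (KK t p (fst y)) (\<xi> + - snd y))"
        unfolding I_def by (simp add: mult_ac)
    qed
    also have "\<dots> = (exp (\<i> * complex_of_real (l * snd y)) * (g y * complex_of_real (1 / (2 * pi)))) * (LINT \<xi>|lborel. exp (\<i> * complex_of_real ((\<xi> + - snd y) \<bullet> l)) * ft (KK t p (fst y)) (\<xi> + - snd y))"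
      by (rule integral_mult_right_zero)
    also have "(LINT \<xi>|lborel. exp (\<i> * complex_of_real ((\<xi> + - snd y) \<bullet> l)) * ft (KK t p (fst y)) (\<xi> + - snd y)) = (LINT \<xi>|lborel. exp (\<i> * complex_of_real (\<xi> \<bullet> l)) * ft (KK t p (fst y)) \<xi>)"
      by (rule integral_translate[of "\<lambda>\<xi>. exp (\<i> * complex_of_real (\<xi> \<bullet> l)) * ft (KK t p (fst y)) \<xi>"]) (use ftm in measurable)
    also have "\<dots> = complex_of_real ((2 * pi) ^ DIM(real)) * KK t p (fst y) l"
      using KK_continuous[OF t, of p "fst y"]
      by (intro fourier_inversion[where B=C] C fti) (simp add: continuous_on_eq_continuous_at)
    finally show ?thesis by (simp add: mult_ac)
  qed
  have "Jt t f l p = (LINT \<xi>|lborel. (LINT y|lborel. I y \<xi>))"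
    unfolding Jt_def p ht I_def prod.case unfolding p[symmetric] by simp
  also have "\<dots> = (LINT y|lborel. (LINT \<xi>|lborel. I y \<xi>))"
    by (rule lborel_pair.Fubini_integral[OF Ii])
  also have "\<dots> = (LINT y|lborel. exp (\<i> * complex_of_real (1 * l * snd y)) * g y * KK t p (fst y) l)"
    unfolding inner ..
  also have "\<dots> = (LINT s|lborel. (LINT \<xi>|lborel. exp (\<i> * complex_of_real (1 * l * \<xi>)) * g (s, \<xi>) * KK t p s l))"
  proof -
    have "integrable lborel (\<lambda>y. exp (\<i> * complex_of_real (1 * l * snd y)) * g y * KK t p (fst y) l)"
    proof (rule Bochner_Integration.integrable_bound)
      show "integrable lborel (\<lambda>y. C * cmod (g y))" using rapid_integrable_weight(2)[OF rg] by simp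
      have "(\<lambda>y::'n vv\<times>real. fst y) \<in> borel_measurable borel" "(\<lambda>y::'n vv\<times>real. snd y) \<in> borel_measurable borel"
        by (intro borel_measurable_continuous_onI continuous_intros)+
      then show "(\<lambda>y. exp (\<i> * complex_of_real (1 * l * snd y)) * g y * KK t p (fst y) l) \<in> borel_measurable lborel"
        using t by measurable
      show "AE y in lborel. norm (exp (\<i> * complex_of_real (1 * l * snd y)) * g y * KK t p (fst y) l) \<le> norm (C * cmod (g y))"
        using C(1,3) by (intro AE_I2) (auto simp: norm_mult mult.commute[of C] intro!: mult_left_mono)
    qed
    from integral_lborel_pair(1)[OF this] show ?thesis by simp
  qed
  also have "\<dots> = (LINT s|lborel. complex_of_real (exp (- t * l\<^sup>2)) * (hk t l p s * pft 1 g (s, l)))"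
  proof (intro Bochner_Integration.integral_cong refl)
    fix s :: "'n vv"
    have "(LINT \<xi>|lborel. exp (\<i> * complex_of_real (1 * l * \<xi>)) * g (s, \<xi>) * KK t p s l) = pft 1 g (s, l) * KK t p s l"
      unfolding pft_def fst_conv snd_conv by (rule integral_mult_left_zero)
    then show "(LINT \<xi>|lborel. exp (\<i> * complex_of_real (1 * l * \<xi>)) * g (s, \<xi>) * KK t p s l) = complex_of_real (exp (- t * l\<^sup>2)) * (hk t l p s * pft 1 g (s, l))"
      unfolding KK_eq_hk[OF l] by (simp add: mult_ac)
  qed
  also have "\<dots> = complex_of_real (exp (- t * l\<^sup>2)) * hT t l (\<lambda>s. pft 1 g (s, l)) p"
    unfolding hT_def by (rule integral_mult_right_zero)
  finally show ?thesis unfolding g_def[abs_def] .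
qed

section \<open>The unitary operator\<close>

lemma slice_measurable:
  assumes "h \<in> borel_measurable (borel :: ('a::euclidean_space \<times> 'b::euclidean_space) measure)"
  shows "(\<lambda>x. h (x, y)) \<in> borel_measurable borel"
  by (rule measurable_compose[OF _ assms]) (intro borel_measurable_continuous_onI continuous_intros)

lemma nn_slice_measurable:
  fixes h :: "'a::euclidean_space \<times> 'b::euclidean_space \<Rightarrow> ennreal"
  assumes "h \<in> borel_measurable borel"
  shows "(\<lambda>y. \<integral>\<^sup>+x. h (x, y) \<partial>lborel) \<in> borel_measurable borel"
proof -
  have [measurable]: "h \<in> borel_measurable (borel \<Otimes>\<^sub>M borel)" using assms by (simp add: borel_prod)
  show ?thesis by measurable
qed

lemma AE_lborel_sndI:
  fixes P :: "'b::euclidean_space \<Rightarrow> bool"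
  assumes "AE x in lborel. P x"
  shows "AE p in (lborel :: ('a::euclidean_space \<times> 'b) measure). P (snd p)"
proof -
  obtain N where N: "{x. \<not> P x} \<subseteq> N" "emeasure lborel N = 0" "N \<in> sets lborel"
    using assms by (elim AE_E) auto
  show ?thesis
  proof (rule AE_I)
    show "{p \<in> space lborel. \<not> P (snd p)} \<subseteq> UNIV \<times> N" using N by auto
    show "UNIV \<times> N \<in> sets (lborel :: ('a \<times> 'b) measure)"
      unfolding lborel_prod[symmetric] using N by (intro pair_measureI) auto
    show "emeasure (lborel :: ('a \<times> 'b) measure) (UNIV \<times> N) = 0"
      unfolding lborel_prod[symmetric] using N by (subst lborel.emeasure_pair_measure_Times) auto
  qed
qed

lemma AE_lborel_pairD:
  fixes P :: "'a::euclidean_space \<times> 'b::euclidean_space \<Rightarrow> bool"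
  assumes "AE p in lborel. P p"
  shows "AE y in lborel. AE x in lborel. P (x, y)"
proof -
  obtain N where N: "{p. \<not> P p} \<subseteq> N" "emeasure lborel N = 0" "N \<in> sets lborel"
    using assms by (elim AE_E) auto
  have m: "(indicator N :: _ \<Rightarrow> ennreal) \<in> borel_measurable borel" using N(3) by simp
  have "(\<integral>\<^sup>+y. \<integral>\<^sup>+x. indicator N (x, y) \<partial>lborel \<partial>lborel) = 0"
    using nn_integral_lborel_pair(2)[OF m] N by simp
  then have "AE y in lborel. (\<integral>\<^sup>+x. indicator N (x, y) \<partial>lborel) = 0"
    using nn_slice_measurable[OF m] by (subst (asm) nn_integral_0_iff_AE) auto
  then show ?thesis
  proof eventually_elim
    case (elim y)
    have "AE x in lborel. indicator N (x, y) = (0::ennreal)"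
      using elim slice_measurable[OF m, of y] by (subst (asm) nn_integral_0_iff_AE) auto
    then show ?case by eventually_elim (use N(1) in \<open>auto simp: indicator_def split: if_splits\<close>)
  qed
qed

text \<open>This transfers joint measurability from the continuous \<open>KK\<close> to
  \<open>hk\<close>. At \<open>l = 0\<close> the prefactor of \<open>hk\<close> is a positive power
  of \<open>0 / 0\<close>, that is 0.\<close>

lemma hk_eq_KK: "hk t l p s = (if l = 0 then 0 else complex_of_real (exp (t * l\<^sup>2)) * KK t p s l)"
proof (cases "l = 0")
  case True
  then show ?thesis by (simp add: hk_def pref_def power_0_left)
next
  case False
  have "complex_of_real (exp (t * l\<^sup>2)) * complex_of_real (exp (- t * l\<^sup>2)) = 1"
    unfolding of_real_mult[symmetric] exp_add[symmetric] by simp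
  then show ?thesis using False unfolding KK_eq_hk[OF False] by (simp add: mult.assoc[symmetric])
qed

lemma hk_measurable_raw [measurable (raw)]:
  assumes "t > 0" and [measurable]: "f \<in> M \<rightarrow>\<^sub>M borel" "p \<in> M \<rightarrow>\<^sub>M borel" "g \<in> M \<rightarrow>\<^sub>M borel"
  shows "(\<lambda>x. hk t (f x) (p x) (g x)) \<in> borel_measurable M"
  unfolding hk_eq_KK using assms(1) by measurable

lemma Wt_measurable_raw [measurable (raw)]:
  assumes [measurable]: "f \<in> M \<rightarrow>\<^sub>M borel" "p \<in> M \<rightarrow>\<^sub>M borel"
  shows "(\<lambda>x. Wt t (f x) (p x :: 'n::finite cpair)) \<in> borel_measurable M"
proof -
  have 1: "(\<lambda>q::'n cpair. vRe (snd q) \<bullet> vIm (fst q) - vIm (snd q) \<bullet> vRe (fst q)) \<in> borel_measurable borel"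
    "(\<lambda>q::'n cpair. (2 *\<^sub>R vIm (fst q)) \<bullet> (2 *\<^sub>R vIm (fst q)) + (2 *\<^sub>R vIm (snd q)) \<bullet> (2 *\<^sub>R vIm (snd q))) \<in> borel_measurable borel"
    by (intro borel_measurable_continuous_onI continuous_intros)+
  note [measurable] = measurable_compose[OF assms(2) 1(1)] measurable_compose[OF assms(2) 1(2)]
  have 2: "(\<lambda>l. sinh (2 * t * l)) \<in> borel_measurable borel" "(\<lambda>l. cosh (2 * t * l)) \<in> borel_measurable borel"
    by (intro borel_measurable_continuous_onI continuous_intros)+
  note [measurable] = measurable_compose[OF assms(1) 2(1)] measurable_compose[OF assms(1) 2(2)]
  show ?thesis unfolding Wt_def pker_def coth_def case_prod_unfold by measurable
qed

section \<open>The fibrewise operator and its norm\<close>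

definition Vt :: "real \<Rightarrow> ('n::finite vv \<times> real \<Rightarrow> complex) \<Rightarrow> real \<Rightarrow> 'n cpair \<Rightarrow> complex" where
  "Vt t G l p = complex_of_real (exp (- t * l\<^sup>2)) * hT t l (\<lambda>s. G (s, l)) p"

lemma hT_cmult: "hT t l (\<lambda>s. c * g s) p = c * hT t l g p"
  unfolding hT_def by (subst integral_mult_right_zero[symmetric]) (simp add: mult_ac)

lemma hT_add:
  assumes "t > 0" "l \<noteq> 0" "sqint lborel g" "sqint lborel h"
  shows "hT t l (\<lambda>s. g s + h s) p = hT t l g p + hT t l h p"
  unfolding hT_def distrib_left
  by (rule Bochner_Integration.integral_add) (intro hT_integrable assms)+

lemma Vt_measurable:
  assumes "t > 0" "G \<in> borel_measurable borel"
  shows "(\<lambda>l. Vt t G l p) \<in> borel_measurable borel"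
proof -
  have [measurable]: "G \<in> borel_measurable (borel \<Otimes>\<^sub>M borel)" using assms(2) by (simp add: borel_prod)
  show ?thesis unfolding Vt_def hT_def using assms(1) by measurable
qed

lemma Vt_fibre:
  fixes G :: "'n::finite vv \<times> real \<Rightarrow> complex"
  assumes t: "t > 0" and l: "l \<noteq> 0" and g: "sqint lborel (\<lambda>s. G (s, l))"
  shows "entireC (Vt t G l)"
    "bnorm2 t l (Vt t G l) = ennreal ((exp (- t * l\<^sup>2))\<^sup>2) * (\<integral>\<^sup>+s. ennreal ((cmod (G (s, l)))\<^sup>2) \<partial>lborel)"
proof -
  have e: "Vt t G l = hT t l (\<lambda>s. complex_of_real (exp (- t * l\<^sup>2)) * G (s, l))"
    by (rule ext) (simp add: Vt_def hT_cmult)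
  note s = sqint_cmult[OF g, of "complex_of_real (exp (- t * l\<^sup>2))"]
  show "entireC (Vt t G l)" unfolding e by (rule entireC_hT[OF t l s])
  have [measurable]: "(\<lambda>s. G (s, l)) \<in> borel_measurable lborel" using g by (simp add: sqint_def)
  show "bnorm2 t l (Vt t G l) = ennreal ((exp (- t * l\<^sup>2))\<^sup>2) * (\<integral>\<^sup>+s. ennreal ((cmod (G (s, l)))\<^sup>2) \<partial>lborel)"
    unfolding e bnorm2_hT[OF t l s] norm_mult power_mult_distrib norm_of_real power2_abs
    by (simp only: ennreal_mult' zero_le_power2, subst nn_integral_cmult) auto
qed

text \<open>The squared damping factor cancels the density \<open>exp (2 * t * l\<^sup>2)\<close> of
  the direct integral. The remaining \<open>1 / (2 * pi)\<close> is the reciprocal of the Plancherel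
  constant of the partial Fourier transform.\<close>

lemma Bnorm2_Vt:
  fixes G :: "'n::finite vv \<times> real \<Rightarrow> complex"
  assumes t: "t > 0" and G: "sqint lborel G"
  shows "Bnorm2 t (Vt t G) = ennreal (1 / (2 * pi)) * (\<integral>\<^sup>+p. ennreal ((cmod (G p))\<^sup>2) \<partial>lborel)"
proof -
  have [measurable]: "G \<in> borel_measurable borel" using G by (simp add: sqint_def)
  have m: "(\<lambda>p. ennreal ((cmod (G p))\<^sup>2)) \<in> borel_measurable borel" by measurable
  have "Bnorm2 t (Vt t G) = (\<integral>\<^sup>+l. ennreal (1 / (2 * pi)) * (\<integral>\<^sup>+s. ennreal ((cmod (G (s, l)))\<^sup>2) \<partial>lborel) \<partial>lborel)"
    unfolding Bnorm2_def
  proof (rule nn_integral_cong_AE)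
    have "AE l::real in lborel. l \<noteq> 0" by (rule AE_lborel_singleton)
    with sqint_fibre(2)[OF G]
    show "AE l in lborel. indicator (- {0}) l * ennreal (1 / (2*pi)) * bnorm2 t l (Vt t G l) * ennreal (exp (2 * t * l^2))
      = ennreal (1 / (2 * pi)) * (\<integral>\<^sup>+s. ennreal ((cmod (G (s, l)))\<^sup>2) \<partial>lborel)"
    proof eventually_elim
      case (elim l)
      have "ennreal ((exp (- t * l\<^sup>2))\<^sup>2) * ennreal (exp (2 * t * l^2)) = 1"
        unfolding power2_eq_square[of "exp _"] exp_add[symmetric]
        by (simp add: ennreal_mult'[symmetric] exp_add[symmetric])
      moreover have "A * (B * I) * D = A * I" if "B * D = 1" for A B D I :: ennreal
      proof -
        have "A * (B * I) * D = A * I * (B * D)" by (simp only: mult_ac)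
        then show ?thesis using that by simp
      qed
      ultimately show ?case using elim unfolding Vt_fibre(2)[OF t elim(2,1)] by simp
    qed
  qed
  also have "\<dots> = ennreal (1 / (2 * pi)) * (\<integral>\<^sup>+l. (\<integral>\<^sup>+s. ennreal ((cmod (G (s, l)))\<^sup>2) \<partial>lborel) \<partial>lborel)"
    by (rule nn_integral_cmult) (simp add: nn_slice_measurable[OF m])
  also have "(\<integral>\<^sup>+l. (\<integral>\<^sup>+s. ennreal ((cmod (G (s, l)))\<^sup>2) \<partial>lborel) \<partial>lborel) = (\<integral>\<^sup>+p. ennreal ((cmod (G p))\<^sup>2) \<partial>lborel)"
    by (rule nn_integral_lborel_pair(2)[OF m, symmetric])
  finally show ?thesis .
qed

lemma Bt_Vt:
  fixes G :: "'n::finite vv \<times> real \<Rightarrow> complex"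
  assumes t: "t > 0" and G: "sqint lborel G" and g: "\<And>l. sqint lborel (\<lambda>s. G (s, l))"
  shows "Bt t (Vt t G)"
  unfolding Bt_def
proof (intro conjI allI impI)
  fix l :: real assume l: "l \<noteq> 0"
  show "entireC (Vt t G l)" by (rule Vt_fibre(1)[OF t l g])
  show "bnorm2 t l (Vt t G l) < \<infinity>"
    unfolding Vt_fibre(2)[OF t l g] using g[of l] by (auto simp: sqint_iff_nn ennreal_mult_less_top)
next
  show "(\<lambda>l. Vt t G l p) \<in> borel_measurable lborel" for p
    using Vt_measurable[OF t, of G p] G by (simp add: sqint_def)
  show "Bnorm2 t (Vt t G) < \<infinity>"
    unfolding Bnorm2_Vt[OF t G] using G by (auto simp: sqint_iff_nn ennreal_mult_less_top)
qed

lemma B_equiv_AE: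
  assumes "AE l in lborel. l \<noteq> 0 \<longrightarrow> (\<forall>p. s l p = s' l p)"
  shows "B_equiv t s s'"
proof -
  have "Bnorm2 t (\<lambda>l p. s l p - s' l p) = (\<integral>\<^sup>+l. 0 \<partial>(lborel :: real measure))"
    unfolding Bnorm2_def
  proof (rule nn_integral_cong_AE, use assms in eventually_elim)
    case (elim l)
    then have "l \<noteq> 0 \<Longrightarrow> (\<lambda>p. s l p - s' l p) = (\<lambda>p. 0)" by auto
    then show ?case by (cases "l = 0") (simp_all add: bnorm2_def)
  qed
  then show ?thesis by (simp add: B_equiv_def)
qed

text \<open>The families compared are known to agree only off frequency 0; changing a measurable
  function at one point keeps it measurable.\<close>

lemma Bt_cong:
  assumes s: "Bt t s" and eq: "\<And>l p. l \<noteq> 0 \<Longrightarrow> s' l p = s l p"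
  shows "Bt t s'"
proof -
  have e: "s' l = s l" if "l \<noteq> 0" for l using eq[OF that] by (rule ext)
  have "Bnorm2 t s' = Bnorm2 t s"
    unfolding Bnorm2_def by (rule nn_integral_cong) (auto simp: e indicator_def)
  moreover have "(\<lambda>l. s' l p) \<in> borel_measurable lborel" for p
  proof -
    have [measurable]: "(\<lambda>l. s l p) \<in> borel_measurable borel" using s unfolding Bt_def measurable_lborel2 by blast
    have "(\<lambda>l. s' l p) = (\<lambda>l. if l = 0 then s' 0 p else s l p)" by (rule ext) (simp add: eq)
    then show ?thesis by simp
  qed
  ultimately show ?thesis using s by (simp add: Bt_def e)
qed

lemma Vt_cong_AE:
  fixes G :: "'n::finite vv \<times> real \<Rightarrow> complex"
  assumes t: "t > 0" and [measurable]: "G \<in> borel_measurable borel" "H \<in> borel_measurable borel" and "AE p in lborel. G p = H p"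
  shows "AE l in lborel. \<forall>p. Vt t G l p = Vt t H l p"
  using AE_lborel_pairD[OF assms(4)]
proof eventually_elim
  case (elim l)
  have [measurable]: "(\<lambda>s. G (s, l)) \<in> borel_measurable borel" "(\<lambda>s. H (s, l)) \<in> borel_measurable borel"
    by (intro slice_measurable assms)+
  show ?case
  proof
    fix p
    have "hT t l (\<lambda>s. G (s, l)) p = hT t l (\<lambda>s. H (s, l)) p"
      unfolding hT_def by (rule integral_cong_AE) (use t elim in \<open>auto elim: eventually_mono\<close>)
    then show "Vt t G l p = Vt t H l p" by (simp add: Vt_def)
  qed
qed

text \<open>Membership in the direct integral constrains every fibre, not just almost every one, so the
  partial Fourier transform has to be modified on a null set of frequencies.\<close>

definition isG :: "('n::finite heis \<Rightarrow> complex) \<Rightarrow> ('n vv \<times> real \<Rightarrow> complex) \<Rightarrow> bool" where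
  "isG f G \<longleftrightarrow> isft 1 (\<lambda>y. f (unasc y)) G \<and> (\<forall>l. sqint lborel (\<lambda>s. G (s, l)))"

lemma isG_exists:
  assumes "L2 f"
  shows "\<exists>G. isG f G"
proof -
  obtain G0 where G0: "isft 1 (\<lambda>y. f (unasc y)) G0" using isft_exists assms unfolding L2_iff by blast
  then have s0: "sqint lborel G0" by (simp add: isft_def)
  then have [measurable]: "G0 \<in> borel_measurable borel" by (simp add: sqint_def)
  have m: "(\<lambda>p. ennreal ((cmod (G0 p))\<^sup>2)) \<in> borel_measurable borel" by measurable
  \<comment> \<open>The frequencies with square-integrable fibre: a measurable set by Tonelli, of
    full measure. Off it the new representative has fibre 0.\<close>
  define A where "A = {l. (\<integral>\<^sup>+s. ennreal ((cmod (G0 (s, l)))\<^sup>2) \<partial>lborel) < \<infinity>}"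
  have A[measurable]: "A \<in> sets borel"
    using nn_slice_measurable[OF m] unfolding A_def by measurable
  define G where "G p = indicator A (snd p) * G0 p" for p
  have "AE p in lborel. snd p \<in> A"
    by (rule AE_lborel_sndI, use sqint_fibre(2)[OF s0] in eventually_elim) (simp add: A_def sqint_iff_nn)
  then have ae: "AE p in lborel. G0 p = G p" by eventually_elim (simp add: G_def)
  have "(\<lambda>p. indicator A (snd p) * G0 p) \<in> borel_measurable (borel \<Otimes>\<^sub>M borel)"
    unfolding borel_prod[symmetric] by (intro borel_measurable_times) (measurable, simp add: borel_prod)
  then have Gm: "G \<in> borel_measurable borel" unfolding G_def by (simp add: borel_prod)
  have sG: "sqint lborel G"
    by (rule sqint_bound[OF s0]) (use Gm in \<open>auto simp: G_def norm_mult indicator_def\<close>)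
  have "isft 1 (\<lambda>y. f (unasc y)) G" by (rule isft_cong_AE[OF G0 sG ae]) simp
  moreover have "sqint lborel (\<lambda>s. G (s, l))" for l
    unfolding sqint_iff_nn using slice_measurable[OF Gm, of l]
    by (cases "l \<in> A") (auto simp: G_def A_def)
  ultimately show ?thesis unfolding isG_def by blast
qed

text \<open>A representative of the transform is chosen for each function separately, so additivity
  and homogeneity can be expected only modulo \<open>B_equiv\<close>.\<close>

definition Ut :: "real \<Rightarrow> ('n::finite heis \<Rightarrow> complex) \<Rightarrow> real \<Rightarrow> 'n cpair \<Rightarrow> complex" where
  "Ut t f = Vt t (SOME G. isG f G)"

text \<open>The chosen transform may be exchanged for any other: they agree almost everywhere, hence
  on almost every fibre, and there the integrals agree at all points \<open>p\<close> at once. Each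
  algebraic property is then checked on a convenient transform.\<close>

lemma Ut_equiv:
  assumes t: "t > 0" and G: "isft 1 (\<lambda>y. f (unasc y)) G"
  shows "AE l in lborel. \<forall>p. Ut t f l p = Vt t G l p"
proof -
  define H where "H = (SOME G. isG f G)"
  have "L2 f" using G unfolding L2_iff isft_def by blast
  then have H: "isG f H" unfolding H_def using isG_exists someI_ex by metis
  have "AE p in lborel. H p = G p" by (rule isft_unique[OF _ G]) (use H in \<open>auto simp: isG_def\<close>)
  then show ?thesis unfolding Ut_def H_def[symmetric]
    by (intro Vt_cong_AE t) (use G H in \<open>auto simp: isG_def isft_def sqint_def\<close>)
qed

lemma Ut_obtain:
  assumes "L2 f"
  obtains G where "Ut t f = Vt t G" "isft 1 (\<lambda>y. f (unasc y)) G" "sqint lborel G" "\<And>l. sqint lborel (\<lambda>s. G (s, l))"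
proof -
  have "isG f (SOME G. isG f G)" using isG_exists[OF assms] by (rule someI_ex)
  then show ?thesis using that unfolding Ut_def isG_def isft_def by blast
qed

lemma Ut_norm:
  assumes t: "t > 0" and f: "L2 f"
  shows "Bnorm2 t (Ut t f) = L2norm2 f"
proof -
  obtain G where G: "Ut t f = Vt t G" "isft 1 (\<lambda>y. f (unasc y)) G" "sqint lborel G" "\<And>l. sqint lborel (\<lambda>s. G (s, l))"
    using Ut_obtain[OF f] by blast
  have s: "sqint lborel (\<lambda>y. f (unasc y))" using f by (simp add: L2_iff)
  have "(l2n lborel G)\<^sup>2 = 2 * pi * (l2n lborel (\<lambda>y. f (unasc y)))\<^sup>2"
    using isft_norm[OF G(2)] by (simp add: power_mult_distrib)
  then show ?thesis
    unfolding G(1) Bnorm2_Vt[OF t G(3)] L2norm2_eq[OF f] sqint_nn_eq[OF s] sqint_nn_eq[OF G(3)]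
    by (simp add: ennreal_mult'[symmetric])
qed

lemma Vt_add:
  assumes "t > 0" "l \<noteq> 0" "sqint lborel (\<lambda>s. G (s, l))" "sqint lborel (\<lambda>s. H (s, l))"
  shows "Vt t (\<lambda>p. G p + H p) l p = Vt t G l p + Vt t H l p"
  unfolding Vt_def hT_add[OF assms] by (simp add: distrib_left)

lemma Vt_cmult: "Vt t (\<lambda>p. c * G p) l p = c * Vt t G l p"
  unfolding Vt_def hT_cmult by simp

lemma Ut_add:
  assumes t: "t > 0" and f: "L2 f" and g: "L2 g"
  shows "B_equiv t (Ut t (\<lambda>x. f x + g x)) (\<lambda>l p. Ut t f l p + Ut t g l p)"
proof -
  obtain F where F: "Ut t f = Vt t F" "isft 1 (\<lambda>y. f (unasc y)) F" "\<And>l. sqint lborel (\<lambda>s. F (s, l))" using Ut_obtain[OF f] by blast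
  obtain G where G: "Ut t g = Vt t G" "isft 1 (\<lambda>y. g (unasc y)) G" "\<And>l. sqint lborel (\<lambda>s. G (s, l))" using Ut_obtain[OF g] by blast
  have "isft 1 (\<lambda>y. f (unasc y) + g (unasc y)) (\<lambda>p. F p + G p)" by (rule isft_add[OF F(2) G(2)]) simp
  from Ut_equiv[OF t this] show ?thesis
    unfolding F(1) G(1) by (intro B_equiv_AE, eventually_elim) (simp add: Vt_add[OF t _ F(3) G(3)])
qed

lemma Ut_cmult:
  assumes t: "t > 0" and f: "L2 f"
  shows "B_equiv t (Ut t (\<lambda>x. c * f x)) (\<lambda>l p. c * Ut t f l p)"
proof -
  obtain F where F: "Ut t f = Vt t F" "isft 1 (\<lambda>y. f (unasc y)) F" using Ut_obtain[OF f] by blast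
  from Ut_equiv[OF t isft_cmult[OF F(2), of c]] show ?thesis
    unfolding F(1) by (intro B_equiv_AE, eventually_elim) (simp add: Vt_cmult)
qed

lemma Jt_eq_Vt:
  assumes "t > 0" "l \<noteq> 0" "schwartz f"
  shows "Jt t f l p = Vt t (pft 1 (\<lambda>y. f (unasc y))) l p"
  unfolding Vt_def by (rule Jt_formula[OF assms(1,2) schwartz_rapid[OF assms(3)]])

lemma schwartz_isft:
  fixes f :: "'n::finite heis \<Rightarrow> complex"
  assumes "schwartz f"
  shows "isft 1 (\<lambda>y. f (unasc y)) (pft 1 (\<lambda>y. f (unasc y)))"
  using rapid_integrable_weight(3)[OF schwartz_rapid[OF assms]] rapid_fibre(1)[OF schwartz_rapid[OF assms]]
  by (intro isft_pft) (auto simp: fibre_integrable_def)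

lemma Jt_Bt:
  assumes t: "t > 0" and f: "schwartz f"
  shows "Bt t (Jt t f)"
proof (rule Bt_cong)
  show "Bt t (Vt t (pft 1 (\<lambda>y. f (unasc y))))"
    by (rule Bt_Vt[OF t _ rapid_fibre(2)[OF schwartz_rapid[OF f]]]) (use schwartz_isft[OF f] in \<open>simp add: isft_def\<close>)
qed (rule Jt_eq_Vt[OF t _ f])

lemma Ut_Jt:
  assumes t: "t > 0" and f: "schwartz f"
  shows "B_equiv t (Ut t f) (Jt t f)"
  by (rule B_equiv_AE, use Ut_equiv[OF t schwartz_isft[OF f]] in eventually_elim) (simp add: Jt_eq_Vt[OF t _ f])

section \<open>Intertwining with the group actions\<close>

lemma cdot_vof_real: "cdot (vof_real x) (vof_real y) = complex_of_real (x \<bullet> y)"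
  by (simp add: cdot_def vof_real_def inner_vec_def)

text \<open>Moving the real point by \<open>(a, b)\<close> or the complex point by its negative
  gives the same Gaussian. The identity concerns the phases alone, in which the bilinear term
  between \<open>(a, b)\<close> and \<open>s\<close> occurs on both sides.\<close>

lemma hk_shift:
  fixes a b :: "real^'n::finite"
  shows "hk t l (z, w) (s + (a, b)) * exp (\<i> * complex_of_real (l * (c + (b \<bullet> fst (s + (a, b)) - a \<bullet> snd (s + (a, b))) / 2))) =
    exp (\<i> * complex_of_real (l * c)) * exp (- (\<i> * complex_of_real (l / 2)) * (cdot (vof_real a) w - cdot (vof_real b) z))
     * hk t l (z - vof_real a, w - vof_real b) s"
proof -
  obtain x u where s: "s = (x, u)" by (cases s)
  define C where "C = complex_of_real (l / 4 * coth (t * l))"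
  have q: "z - vof_real (x + a) = z - vof_real a - vof_real x" "w - vof_real (u + b) = w - vof_real b - vof_real u"
    by (simp_all add: vof_real_simps)
  have ex: "P * exp A * exp B = exp D * exp E * (P * exp F)" if "A + B = D + E + F" for P A B D E F :: complex
  proof -
    have "exp A * exp B = exp D * exp E * exp F" using that by (simp add: exp_add[symmetric])
    then show ?thesis by (simp add: mult_ac)
  qed
  show ?thesis
    unfolding hk_def s fst_conv snd_conv add_Pair q C_def[symmetric]
    by (rule ex, simp only: vof_real_simps cdot_bilinear cdot_vof_real inner_add_right of_real_mult of_real_add of_real_diff of_real_divide of_real_numeral inner_commute[of b x] inner_commute[of a u] inner_commute[of b a])
       (simp add: field_simps cdot_vof_real inner_commute)
qed

lemma hT_shift:
  fixes a b :: "real^'n::finite"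
  assumes t: "t > 0" and [measurable]: "g \<in> borel_measurable borel"
  shows "hT t l (\<lambda>s. exp (\<i> * complex_of_real (1 * l * (c + (b \<bullet> fst s - a \<bullet> snd s) / 2))) * g (s - (a, b))) (z, w) =
    exp (\<i> * complex_of_real (l * c)) * exp (- (\<i> * complex_of_real (l / 2)) * (cdot (vof_real a) w - cdot (vof_real b) z))
     * hT t l g (z - vof_real a, w - vof_real b)"
proof -
  define H where "H s = hk t l (z, w) s * (exp (\<i> * complex_of_real (1 * l * (c + (b \<bullet> fst s - a \<bullet> snd s) / 2))) * g (s - (a, b)))" for s
  have [measurable]: "(\<lambda>s::'n vv. c + (b \<bullet> fst s - a \<bullet> snd s) / 2) \<in> borel_measurable borel"
    by (intro borel_measurable_continuous_onI continuous_intros) auto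
  have Hm: "H \<in> borel_measurable borel" unfolding H_def using t by measurable
  have "hT t l (\<lambda>s. exp (\<i> * complex_of_real (1 * l * (c + (b \<bullet> fst s - a \<bullet> snd s) / 2))) * g (s - (a, b))) (z, w) = (LINT s|lborel. H (s + (a, b)))"
    unfolding integral_translate[OF Hm] unfolding hT_def H_def ..
  also have "\<dots> = (LINT s|lborel. (exp (\<i> * complex_of_real (l * c)) * exp (- (\<i> * complex_of_real (l / 2)) * (cdot (vof_real a) w - cdot (vof_real b) z)))
     * (hk t l (z - vof_real a, w - vof_real b) s * g s))"
  proof (rule Bochner_Integration.integral_cong[OF refl])
    fix s :: "'n vv"
    have "H (s + (a, b)) = (hk t l (z, w) (s + (a, b)) * exp (\<i> * complex_of_real (l * (c + (b \<bullet> fst (s + (a, b)) - a \<bullet> snd (s + (a, b))) / 2)))) * g s"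
      unfolding H_def by (simp only: mult.assoc mult_1 add_diff_cancel_right')
    then show "H (s + (a, b)) = (exp (\<i> * complex_of_real (l * c)) * exp (- (\<i> * complex_of_real (l / 2)) * (cdot (vof_real a) w - cdot (vof_real b) z)))
     * (hk t l (z - vof_real a, w - vof_real b) s * g s)" unfolding hk_shift by (simp only: mult.assoc)
  qed
  also have "\<dots> = (exp (\<i> * complex_of_real (l * c)) * exp (- (\<i> * complex_of_real (l / 2)) * (cdot (vof_real a) w - cdot (vof_real b) z)))
     * hT t l g (z - vof_real a, w - vof_real b)"
    unfolding hT_def by (rule integral_mult_right_zero)
  finally show ?thesis .
qed

lemma Ut_tau:
  fixes f :: "'n::finite heis \<Rightarrow> complex"
  assumes t: "t > 0" and f: "L2 f"
  shows "B_equiv t (Ut t (tau h f)) (Sigma_act h (Ut t f))"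
proof -
  obtain a b c where h: "h = (a, b, c)" by (metis surj_pair)
  obtain F where F: "Ut t f = Vt t F" "isft 1 (\<lambda>y. f (unasc y)) F" "sqint lborel F" using Ut_obtain[OF f] by blast
  have Fm: "F \<in> borel_measurable borel" using F(3) by (simp add: sqint_def)
  \<comment> \<open>The central component of the inverse of \<open>h\<close> times a point lowers
    the central coordinate by exactly this amount, so left translation is a shear.\<close>
  define \<theta> where "\<theta> v = c + (b \<bullet> fst v - a \<bullet> snd v) / 2" for v :: "'n vv"
  have "\<theta> \<in> borel_measurable borel" unfolding \<theta>_def by (intro borel_measurable_continuous_onI continuous_intros) auto
  from isft_shear[OF F(2) this, of "(a, b)"]
  have S: "isft 1 (\<lambda>p. f (unasc (fst p - (a, b), snd p - \<theta> (fst p)))) (\<lambda>p. exp (\<i> * complex_of_real (1 * snd p * \<theta> (fst p))) * F (fst p - (a, b), snd p))" by simp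
  have e: "f (unasc (fst p - (a, b), snd p - \<theta> (fst p))) = tau h f (unasc p)" for p
    unfolding tau_def h hinv_def hmul_def unasc_def \<theta>_def
    by (simp add: algebra_simps diff_divide_distrib add_divide_distrib)
  have v: "Vt t (\<lambda>p. exp (\<i> * complex_of_real (1 * snd p * \<theta> (fst p))) * F (fst p - (a, b), snd p)) l p = Sigma_act h (Vt t F) l p" for l p
  proof -
    obtain z w where p: "p = (z, w)" by (cases p)
    show ?thesis
      unfolding Vt_def fst_conv snd_conv \<theta>_def p hT_shift[OF t slice_measurable[OF Fm]] unfolding Sigma_act_def h prod.case
      by (simp only: mult_ac)
  qed
  show ?thesis unfolding F(1)
    by (rule B_equiv_AE, use Ut_equiv[OF t S[unfolded e]] in eventually_elim) (simp only: v simp_thms)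
qed

section \<open>Surjectivity\<close>

text \<open>A ball of radius 0 is a null set. This makes index 0 the zero starting point against
  which the later approximants are compared.\<close>

lemma gk_0: "gk t l 0 F (s :: 'n::finite vv) = 0"
proof -
  have "gk t l 0 F s = (LINT z::'n vv \<times> 'n vv|lborel. 0)"
    unfolding gk_def
  proof (rule integral_cong_AE)
    have "AE z in lborel. z \<noteq> (0 :: 'n vv \<times> 'n vv)" by (rule AE_lborel_singleton)
    then show "AE z in lborel. complex_of_real (Wt t l (enc z)) * (F (enc z) * indicator (cball 0 (real 0)) z * cnj (hk t l (enc z) s)) = 0"
      by eventually_elim simp
    have "(\<lambda>z. complex_of_real (Wt t l (enc z)) * (F (enc z) * indicator (cball 0 (real 0)) z * cnj (hk t l (enc z) s)))
       = (\<lambda>z. indicator {0} z * (complex_of_real (Wt t l (enc (0 :: 'n vv \<times> 'n vv))) * (F (enc 0) * cnj (hk t l (enc 0) s))))"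
      by (rule ext) (simp add: indicator_def)
    then show "(\<lambda>z. complex_of_real (Wt t l (enc z)) * (F (enc z) * indicator (cball 0 (real 0)) z * cnj (hk t l (enc z) s))) \<in> borel_measurable lborel"
      by simp
  qed simp
  then show ?thesis by simp
qed

text \<open>If the fibre norms of a sequence tend to zero in mean, Fatou's lemma makes their lower limit
  vanish on almost every fibre; this identifies the fibrewise limits with the global one.\<close>

lemma liminf_fibre:
  fixes D :: "nat \<Rightarrow> 'v::euclidean_space \<times> real \<Rightarrow> complex"
  assumes D: "\<And>k. sqint lborel (D k)" and lim: "(\<lambda>k. l2n lborel (D k)) \<longlonglongrightarrow> 0"
  shows "AE l in lborel. liminf (\<lambda>k. \<integral>\<^sup>+v. ennreal ((cmod (D k (v, l)))\<^sup>2) \<partial>lborel) = 0"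
proof -
  have [measurable]: "D k \<in> borel_measurable borel" for k using D by (simp add: sqint_def)
  have m: "(\<lambda>p. ennreal ((cmod (D k p))\<^sup>2)) \<in> borel_measurable borel" for k by measurable
  note [measurable] = nn_slice_measurable[OF m]
  have "(\<integral>\<^sup>+l. liminf (\<lambda>k. \<integral>\<^sup>+v. ennreal ((cmod (D k (v, l)))\<^sup>2) \<partial>lborel) \<partial>lborel)
     \<le> liminf (\<lambda>k. \<integral>\<^sup>+l. \<integral>\<^sup>+v. ennreal ((cmod (D k (v, l)))\<^sup>2) \<partial>lborel \<partial>lborel)"
    by (rule nn_integral_liminf) measurable
  also have "(\<lambda>k. \<integral>\<^sup>+l. \<integral>\<^sup>+v. ennreal ((cmod (D k (v, l)))\<^sup>2) \<partial>lborel \<partial>lborel) = (\<lambda>k. ennreal ((l2n lborel (D k))\<^sup>2))"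
    unfolding nn_integral_lborel_pair(2)[OF m, symmetric] sqint_nn_eq[OF D] ..
  also have "liminf \<dots> = 0"
  proof -
    have "(\<lambda>k. ennreal ((l2n lborel (D k))\<^sup>2)) \<longlonglongrightarrow> ennreal (0\<^sup>2)" by (intro tendsto_ennrealI tendsto_power lim)
    from lim_imp_Liminf[OF _ this] show ?thesis by simp
  qed
  finally show ?thesis by (subst (asm) le_zero_eq, subst (asm) nn_integral_0_iff_AE) measurable
qed

text \<open>Evaluation of the transform at \<open>p\<close> is a bounded functional, because its
  kernel is square integrable. If the limit were different, the distances would eventually stay
  above a positive number, against a lower limit of 0; no subsequence depending on the fibre has to
  be chosen.\<close>

lemma hT_limit:
  assumes t: "t > 0" and l: "l \<noteq> 0" and G: "\<And>k::nat. sqint lborel (G k)" "sqint lborel g"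
    and lim: "(\<lambda>k. hT t l (G k) p) \<longlonglongrightarrow> c"
    and z: "liminf (\<lambda>k. \<integral>\<^sup>+v. ennreal ((cmod (G k v - g v))\<^sup>2) \<partial>lborel) = 0"
  shows "hT t l g p = c"
proof (rule ccontr)
  assume ne: "hT t l g p \<noteq> c"
  define d where "d = cmod (c - hT t l g p)"
  define N where "N = l2n lborel (hk t l p) + 1"
  have d: "d > 0" using ne by (simp add: d_def)
  have N: "N > 0" unfolding N_def using l2n_nonneg[of lborel "hk t l p"] by simp
  have b: "cmod (hT t l (G k) p - hT t l g p) \<le> N * l2n lborel (\<lambda>v. G k v - g v)" for k
  proof -
    have s: "sqint lborel (\<lambda>v. G k v - g v)" by (intro sqint_diff G)
    have "hT t l (G k) p - hT t l g p = (LINT s|lborel. hk t l p s * (G k s - g s))"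
      unfolding hT_def right_diff_distrib
      by (rule Bochner_Integration.integral_diff[symmetric]) (intro hT_integrable t l G)+
    also have "cmod \<dots> \<le> l2n lborel (hk t l p) * l2n lborel (\<lambda>v. G k v - g v)"
      by (rule l2_Cauchy_Schwarz[OF hk_sqint[OF t l] s])
    also have "\<dots> \<le> N * l2n lborel (\<lambda>v. G k v - g v)" unfolding N_def by (intro mult_right_mono l2n_nonneg) simp
    finally show ?thesis .
  qed
  have "(\<lambda>k. cmod (hT t l (G k) p - hT t l g p)) \<longlonglongrightarrow> d"
    unfolding d_def by (intro tendsto_intros lim)
  then have "eventually (\<lambda>k. d / 2 < cmod (hT t l (G k) p - hT t l g p)) sequentially"
    using d by (intro order_tendstoD(1)) auto
  then have "eventually (\<lambda>k. ennreal ((d / (2 * N))\<^sup>2) \<le> (\<integral>\<^sup>+v. ennreal ((cmod (G k v - g v))\<^sup>2) \<partial>lborel)) sequentially"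
  proof eventually_elim
    case (elim k)
    then have "d / 2 \<le> N * l2n lborel (\<lambda>v. G k v - g v)" using b[of k] by linarith
    then have "d / (2 * N) \<le> l2n lborel (\<lambda>v. G k v - g v)" using N by (simp add: field_simps)
    then show ?case using d N unfolding sqint_nn_eq[OF sqint_diff[OF G(1)[of k] G(2)]]
      by (intro ennreal_leI power_mono) auto
  qed
  from Liminf_bounded[OF this] have "ennreal ((d / (2 * N))\<^sup>2) \<le> 0" unfolding z .
  then show False using d N by simp
qed

text \<open>The errors of the fibrewise approximants add up over the frequencies to the tail of a
  single integrable function, so the approximants converge in the product space, and no preimage is
  selected fibre by fibre. On almost every fibre the global limit must then have the pointwise limit
  as its transform.\<close>

lemma Vt_onto:
  fixes s :: "real \<Rightarrow> 'n::finite cpair \<Rightarrow> complex"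
  assumes t: "t > 0" and s: "Bt t s"
  obtains G where "sqint lborel G" "AE l in lborel. l \<noteq> 0 \<longrightarrow> (\<forall>p. Vt t G l p = s l p)"
proof -
  have ent: "entireC (s l)" and fin: "bnorm2 t l (s l) < \<infinity>" if "l \<noteq> 0" for l
    using s that unfolding Bt_def by blast+
  have sm[measurable]: "(\<lambda>l. s l p) \<in> borel_measurable borel" for p using s unfolding Bt_def measurable_lborel2 by blast
  have Bn: "Bnorm2 t s < \<infinity>" using s unfolding Bt_def by blast
  \<comment> \<open>Undoes the damping in \<open>Vt\<close>. The value 0 at \<open>l = 0\<close>,
    where the given family is unconstrained, makes every fibre continuous, as joint measurability
    requires.\<close>
  define s1 where "s1 l p = (if l = 0 then 0 else complex_of_real (exp (t * l\<^sup>2)) * s l p)" for l p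
  have s1e: "entireC (s1 l)" if "l \<noteq> 0" for l
  proof -
    have "s1 l = (\<lambda>p. complex_of_real (exp (t * l\<^sup>2)) * s l p)" using that by (auto simp: s1_def)
    then show ?thesis using entireC_mult[OF entireC_exp_quadratic[of "complex_of_real (exp (t * l\<^sup>2))" 0] ent[OF that]] by simp
  qed
  have s1c: "continuous_on UNIV (s1 l)" for l
  proof (cases "l = 0")
    case True
    then have "s1 l = (\<lambda>p. 0)" by (auto simp: s1_def)
    then show ?thesis by simp
  qed (rule entireC_continuous[OF s1e])
  have s1m: "(\<lambda>x. s1 (fst x) (snd x)) \<in> borel_measurable (borel \<Otimes>\<^sub>M borel)"
    by (rule caratheodory_measurable[OF _ s1c]) (unfold s1_def, measurable)
  have s1m_raw[measurable (raw)]: "f \<in> M \<rightarrow>\<^sub>M borel \<Longrightarrow> p \<in> M \<rightarrow>\<^sub>M borel \<Longrightarrow> (\<lambda>x. s1 (f x) (p x)) \<in> borel_measurable M" for f p M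
    using measurable_compose[OF measurable_Pair s1m, of f M p] by simp
  \<comment> \<open>The energy density in the point and the frequency together; its integral is
    \<open>2 * pi\<close> times \<open>Bnorm2 t s\<close>.\<close>
  define \<Phi> where "\<Phi> y = (if snd y = 0 then 0 else ennreal ((cmod (s1 (snd y) (enc (fst y))))\<^sup>2 * Wt t (snd y) (enc (fst y))))" for y :: "('n vv \<times> 'n vv) \<times> real"
  have \<Phi>m2[measurable]: "\<Phi> \<in> borel_measurable (borel \<Otimes>\<^sub>M borel)" unfolding \<Phi>_def by measurable
  then have \<Phi>m[measurable]: "\<Phi> \<in> borel_measurable borel" by (simp add: borel_prod)
  have s1b: "bnorm2 t l (s1 l) = bnorm2 t l (s l) * ennreal (exp (2 * t * l\<^sup>2))" if l: "l \<noteq> 0" for l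
  proof -
    have [measurable]: "s l \<in> borel_measurable borel" by (intro borel_measurable_continuous_onI entireC_continuous ent l)
    have "(cmod (s1 l p))\<^sup>2 * Wt t l p = (cmod (s l p))\<^sup>2 * Wt t l p * exp (2 * t * l\<^sup>2)" for p
      using l unfolding s1_def by (simp add: norm_mult power_mult_distrib exp_double[symmetric] mult_ac)
    then have "ennreal ((cmod (s1 l p))\<^sup>2 * Wt t l p) = ennreal ((cmod (s l p))\<^sup>2 * Wt t l p) * ennreal (exp (2 * t * l\<^sup>2))" for p
      by (simp only: ennreal_mult''[OF exp_ge_zero])
    then show ?thesis unfolding bnorm2_def by (simp only:) (rule nn_integral_multc, measurable)
  qed
  have inner: "(\<integral>\<^sup>+z. \<Phi> (z, l) \<partial>lborel) = bnorm2 t l (s1 l)" if l: "l \<noteq> 0" for l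
  proof -
    have [measurable]: "s1 l \<in> borel_measurable borel" by (intro borel_measurable_continuous_onI s1c)
    show ?thesis unfolding bnorm2_def \<Phi>_def using l by (subst nn_integral_enc) auto
  qed
  have "(\<integral>\<^sup>+y. \<Phi> y \<partial>lborel) = (\<integral>\<^sup>+l. \<integral>\<^sup>+z. \<Phi> (z, l) \<partial>lborel \<partial>lborel)" by (rule nn_integral_lborel_pair(2)[OF \<Phi>m])
  also have "\<dots> = (\<integral>\<^sup>+l. ennreal (2 * pi) * (indicator (- {0}) l * ennreal (1 / (2*pi)) * bnorm2 t l (s l) * ennreal (exp (2 * t * l^2))) \<partial>lborel)"
  proof (rule nn_integral_cong)
    fix l :: real
    have "ennreal (2 * pi) * ennreal (1 / (2 * pi)) = 1" by (simp add: ennreal_mult'[symmetric])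
    then show "(\<integral>\<^sup>+z. \<Phi> (z, l) \<partial>lborel) = ennreal (2 * pi) * (indicator (- {0}) l * ennreal (1 / (2*pi)) * bnorm2 t l (s l) * ennreal (exp (2 * t * l^2)))"
      by (cases "l = 0") (simp add: \<Phi>_def, simp add: inner s1b mult.assoc[symmetric])
  qed
  also have "\<dots> = ennreal (2 * pi) * Bnorm2 t s"
  proof -
    \<comment> \<open>Measurability of the fibre norms in \<open>l\<close> is obtained by rewriting
      them as integrals of the jointly measurable \<Phi>.\<close>
    have "(\<lambda>l. indicator (- {0}) l * ennreal (1 / (2*pi)) * bnorm2 t l (s l) * ennreal (exp (2 * t * l^2))) = (\<lambda>l. ennreal (1 / (2*pi)) * (\<integral>\<^sup>+z. \<Phi> (z, l) \<partial>lborel))"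
    proof
      fix l :: real
      show "indicator (- {0}) l * ennreal (1 / (2*pi)) * bnorm2 t l (s l) * ennreal (exp (2 * t * l^2)) = ennreal (1 / (2*pi)) * (\<integral>\<^sup>+z. \<Phi> (z, l) \<partial>lborel)"
        by (cases "l = 0") (simp add: \<Phi>_def, simp add: inner s1b mult.assoc)
    qed
    then have "(\<lambda>l. indicator (- {0}) l * ennreal (1 / (2*pi)) * bnorm2 t l (s l) * ennreal (exp (2 * t * l^2))) \<in> borel_measurable lborel"
      using nn_slice_measurable[OF \<Phi>m] by simp
    then show ?thesis unfolding Bnorm2_def by (rule nn_integral_cmult)
  qed
  finally have \<Phi>fin: "(\<integral>\<^sup>+y. \<Phi> y \<partial>lborel) < \<infinity>" using Bn by (simp add: ennreal_mult_less_top)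
  \<comment> \<open>The energy outside the ball of radius \<open>j\<close>, over all frequencies at
    once. It bounds the error of every later approximant and tends to 0 by dominated
    convergence.\<close>
  define T where "T j = (\<integral>\<^sup>+y. \<Phi> y * indicator (- cball 0 (real j)) (fst y) \<partial>lborel)" for j :: nat
  have \<Phi>Tm: "(\<lambda>y. \<Phi> y * indicator (- cball 0 (real j)) (fst y)) \<in> borel_measurable borel" for j :: nat
  proof -
    have "(\<lambda>y. \<Phi> y * indicator (- cball 0 (real j)) (fst y)) \<in> borel_measurable (borel \<Otimes>\<^sub>M borel)" by measurable
    then show ?thesis by (simp add: borel_prod)
  qed
  have T0: "T \<longlonglongrightarrow> 0"
  proof -
    have "T \<longlonglongrightarrow> (\<integral>\<^sup>+y. 0 \<partial>(lborel :: (('n vv \<times> 'n vv) \<times> real) measure))"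
      unfolding T_def
    proof (rule nn_integral_dominated_convergence[where w=\<Phi>])
      show "AE y in lborel. \<Phi> y * indicator (- cball 0 (real j)) (fst y) \<le> \<Phi> y" for j :: nat
        by (intro AE_I2) (auto simp: indicator_def)
      show "AE y in lborel. (\<lambda>j. \<Phi> y * indicator (- cball 0 (real j)) (fst y)) \<longlonglongrightarrow> 0"
      proof (rule AE_I2)
        fix y :: "('n vv \<times> 'n vv) \<times> real"
        obtain j0 where "norm (fst y) \<le> real j0" using real_arch_simple by blast
        then have "\<Phi> y * indicator (- cball 0 (real j)) (fst y) = 0" if "j \<ge> j0" for j
          using that of_nat_mono[OF that, where 'a=real] by (auto simp: indicator_def)
        then show "(\<lambda>j. \<Phi> y * indicator (- cball 0 (real j)) (fst y)) \<longlonglongrightarrow> 0"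
          by (intro tendsto_eventually eventually_sequentiallyI[of j0]) auto
      qed
    qed (use \<Phi>Tm \<Phi>m \<Phi>fin in auto)
    then show ?thesis by simp
  qed
  define Gk where "Gk k p = gk t (snd p) k (s1 (snd p)) (fst p)" for k :: nat and p :: "'n vv \<times> real"
  have Gm[measurable]: "Gk k \<in> borel_measurable borel" for k
  proof -
    have "(\<lambda>x. hk t (snd (fst x)) (enc (snd x)) (fst (fst x))) \<in> borel_measurable (((borel :: 'n vv measure) \<Otimes>\<^sub>M borel) \<Otimes>\<^sub>M lborel)"
      using t by measurable
    then have [measurable]: "(\<lambda>x. cnj (hk t (snd (fst x)) (enc (snd x)) (fst (fst x)))) \<in> borel_measurable (((borel :: 'n vv measure) \<Otimes>\<^sub>M borel) \<Otimes>\<^sub>M lborel)"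
      by (rule borel_measurable_cnj)
    have [measurable]: "(\<lambda>x. indicator (cball 0 (real k)) (snd x) :: complex) \<in> borel_measurable (((borel :: 'n vv measure) \<Otimes>\<^sub>M (borel :: real measure)) \<Otimes>\<^sub>M (lborel :: ('n vv \<times> 'n vv) measure))"
      by (rule measurable_compose[OF measurable_snd borel_measurable_indicator]) (simp add: borel_closed)
    have "Gk k \<in> borel_measurable (borel \<Otimes>\<^sub>M borel)" unfolding Gk_def gk_def by measurable
    then show ?thesis by (simp add: borel_prod)
  qed
  have Gdiff: "(\<integral>\<^sup>+p. ennreal ((cmod (Gk k p - Gk j p))\<^sup>2) \<partial>lborel) \<le> T j" if "j \<le> k" for j k
  proof -
    have "(\<integral>\<^sup>+p. ennreal ((cmod (Gk k p - Gk j p))\<^sup>2) \<partial>lborel) = (\<integral>\<^sup>+l. \<integral>\<^sup>+v. ennreal ((cmod (Gk k (v, l) - Gk j (v, l)))\<^sup>2) \<partial>lborel \<partial>lborel)"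
      by (rule nn_integral_lborel_pair(2)) measurable
    also have "\<dots> \<le> (\<integral>\<^sup>+l. \<integral>\<^sup>+z. \<Phi> (z, l) * indicator (- cball 0 (real j)) z \<partial>lborel \<partial>lborel)"
    proof (rule nn_integral_mono_AE)
      have "AE l::real in lborel. l \<noteq> 0" by (rule AE_lborel_singleton)
      then show "AE l in lborel. (\<integral>\<^sup>+v. ennreal ((cmod (Gk k (v, l) - Gk j (v, l)))\<^sup>2) \<partial>lborel) \<le> (\<integral>\<^sup>+z. \<Phi> (z, l) * indicator (- cball 0 (real j)) z \<partial>lborel)"
      proof eventually_elim
        case (elim l)
        have "bnorm2 t l (s1 l) < \<infinity>" unfolding s1b[OF elim] using fin[OF elim] by (simp add: ennreal_mult_less_top)
        from gk_diff[OF t elim s1e[OF elim] this that] show ?case using elim by (simp add: Gk_def \<Phi>_def)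
      qed
    qed
    also have "\<dots> = T j" unfolding T_def by (subst nn_integral_lborel_pair(2)[OF \<Phi>Tm]) simp
    finally show ?thesis .
  qed
  have T_fin: "T j < \<infinity>" for j
  proof -
    have "T j \<le> (\<integral>\<^sup>+y. \<Phi> y \<partial>lborel)" unfolding T_def by (rule nn_integral_mono) (auto simp: indicator_def)
    then show ?thesis using \<Phi>fin by simp
  qed
  have Gs: "sqint lborel (Gk k)" for k
  proof -
    \<comment> \<open>\<open>Gk 0\<close> vanishes, so the difference estimate at
      \<open>j = 0\<close> bounds the norm of \<open>Gk k\<close> itself.\<close>
    have "(\<integral>\<^sup>+p. ennreal ((cmod (Gk k p))\<^sup>2) \<partial>lborel) \<le> T 0" using Gdiff[of 0 k] by (simp add: Gk_def gk_0)
    then show ?thesis unfolding sqint_iff_nn using T_fin[of 0] by auto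
  qed
  have Cau: "\<exists>N. \<forall>m\<ge>N. \<forall>n\<ge>N. l2n lborel (\<lambda>x. Gk m x - Gk n x) < e" if "e > 0" for e
  proof -
    have "eventually (\<lambda>j. T j < ennreal (e\<^sup>2)) sequentially" using T0 that by (intro order_tendstoD(2)) auto
    then obtain N where N: "\<And>j. j \<ge> N \<Longrightarrow> T j < ennreal (e\<^sup>2)" by (auto simp: eventually_sequentially)
    have *: "l2n lborel (\<lambda>x. Gk m x - Gk n x) < e" if "n \<ge> N" "m \<ge> n" for m n
    proof -
      have "ennreal ((l2n lborel (\<lambda>x. Gk m x - Gk n x))\<^sup>2) < ennreal (e\<^sup>2)"
        using Gdiff[OF that(2)] N[OF that(1)] unfolding sqint_nn_eq[OF sqint_diff[OF Gs Gs]] by (rule le_less_trans)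
      then have "(l2n lborel (\<lambda>x. Gk m x - Gk n x))\<^sup>2 < e\<^sup>2" by (simp add: ennreal_less_iff)
      then show ?thesis using \<open>e > 0\<close> by (intro power2_less_imp_less[where y=e]) auto
    qed
    show ?thesis
    proof (intro exI allI impI)
      fix m n assume "N \<le> m" "N \<le> n"
      then show "l2n lborel (\<lambda>x. Gk m x - Gk n x) < e"
        using *[of n m] *[of m n] l2n_minus[of lborel "Gk m" "Gk n"] by (cases "n \<le> m") auto
    qed
  qed
  obtain G where G: "sqint lborel G" "(\<lambda>k. l2n lborel (\<lambda>x. Gk k x - G x)) \<longlonglongrightarrow> 0"
    using l2_complete[of lborel Gk, OF Gs Cau] by blast
  have "AE l in lborel. l \<noteq> 0 \<longrightarrow> (\<forall>p. Vt t G l p = s l p)"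
    using liminf_fibre[OF sqint_diff[OF Gs G(1)] G(2)] sqint_fibre(2)[OF G(1)]
  proof eventually_elim
    case (elim l)
    show ?case
    proof (intro impI allI)
      fix p :: "'n cpair" assume l: "l \<noteq> 0"
      have b: "bnorm2 t l (s1 l) < \<infinity>" unfolding s1b[OF l] using fin[OF l] by (simp add: ennreal_mult_less_top)
      have "hT t l (\<lambda>v. G (v, l)) p = s1 l p"
        by (rule hT_limit[OF t l gk_sqint[OF t l s1e[OF l] b] elim(2) hT_gk_tendsto[OF t l s1e[OF l] b]])
           (use elim(1) in \<open>simp add: Gk_def\<close>)
      moreover have "complex_of_real (exp (- t * l\<^sup>2)) * complex_of_real (exp (t * l\<^sup>2)) = 1"
        unfolding of_real_mult[symmetric] exp_add[symmetric] by simp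
      ultimately show "Vt t G l p = s l p" using l by (simp add: Vt_def s1_def mult.assoc[symmetric])
    qed
  qed
  with G(1) show ?thesis using that by blast
qed

lemma Ut_onto:
  fixes s :: "real \<Rightarrow> 'n::finite cpair \<Rightarrow> complex"
  assumes t: "t > 0" and s: "Bt t s"
  shows "\<exists>f. L2 f \<and> B_equiv t (Ut t f) s"
proof -
  obtain G where G: "sqint lborel G" "AE l in lborel. l \<noteq> 0 \<longrightarrow> (\<forall>p. Vt t G l p = s l p)" using Vt_onto[OF assms] .
  obtain f' where f': "isft 1 f' G" using isft_onto[OF G(1), of 1] by auto
  define f where "f h = f' (asc h)" for h
  have f: "isft 1 (\<lambda>y. f (unasc y)) G" using f' by (simp add: f_def)
  then have "L2 f" by (simp add: L2_iff isft_def)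
  moreover have "B_equiv t (Ut t f) s"
    by (rule B_equiv_AE, use G(2) Ut_equiv[OF t f] in eventually_elim) simp
  ultimately show ?thesis by blast
qed

theorem theorem5p1:
  fixes t :: real
  assumes "t > 0"
  shows "(\<forall>f :: 'n::finite heis \<Rightarrow> complex. schwartz f \<longrightarrow> Bt t (Jt t f)) \<and>
    (\<exists>U :: ('n heis \<Rightarrow> complex) \<Rightarrow> (real \<Rightarrow> 'n cpair \<Rightarrow> complex).
       (\<forall>f. L2 f \<longrightarrow> Bt t (U f)) \<and>
       (\<forall>f g. L2 f \<longrightarrow> L2 g \<longrightarrow> B_equiv t (U (\<lambda>x. f x + g x)) (\<lambda>l p. U f l p + U g l p)) \<and>
       (\<forall>c f. L2 f \<longrightarrow> B_equiv t (U (\<lambda>x. c * f x)) (\<lambda>l p. c * U f l p)) \<and>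
       (\<forall>f. L2 f \<longrightarrow> Bnorm2 t (U f) = L2norm2 f) \<and>
       (\<forall>s. Bt t s \<longrightarrow> (\<exists>f. L2 f \<and> B_equiv t (U f) s)) \<and>
       (\<forall>f. schwartz f \<longrightarrow> B_equiv t (U f) (Jt t f)) \<and>
       (\<forall>h f. L2 f \<longrightarrow> B_equiv t (U (tau h f)) (Sigma_act h (U f))))"
proof (rule conjI)
  note t = assms
  show "\<forall>f :: 'n heis \<Rightarrow> complex. schwartz f \<longrightarrow> Bt t (Jt t f)" using Jt_Bt[OF t] by blast
  have "Bt t (Ut t f)" if "L2 f" for f :: "'n heis \<Rightarrow> complex"
    using Ut_obtain[OF that] Bt_Vt[OF t] by metis
  then show "\<exists>U :: ('n heis \<Rightarrow> complex) \<Rightarrow> (real \<Rightarrow> 'n cpair \<Rightarrow> complex).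
       (\<forall>f. L2 f \<longrightarrow> Bt t (U f)) \<and>
       (\<forall>f g. L2 f \<longrightarrow> L2 g \<longrightarrow> B_equiv t (U (\<lambda>x. f x + g x)) (\<lambda>l p. U f l p + U g l p)) \<and>
       (\<forall>c f. L2 f \<longrightarrow> B_equiv t (U (\<lambda>x. c * f x)) (\<lambda>l p. c * U f l p)) \<and>
       (\<forall>f. L2 f \<longrightarrow> Bnorm2 t (U f) = L2norm2 f) \<and>
       (\<forall>s. Bt t s \<longrightarrow> (\<exists>f. L2 f \<and> B_equiv t (U f) s)) \<and>
       (\<forall>f. schwartz f \<longrightarrow> B_equiv t (U f) (Jt t f)) \<and>
       (\<forall>h f. L2 f \<longrightarrow> B_equiv t (U (tau h f)) (Sigma_act h (U f)))"
    using Ut_add[OF t] Ut_cmult[OF t] Ut_norm[OF t] Ut_onto[OF t] Ut_Jt[OF t] Ut_tau[OF t]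
    by (intro exI[of _ "Ut t"] conjI allI impI) blast+
qed

end
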